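(* For any commutative $\mathbb Z[\boldsymbol\upsilon,\boldsymbol\upsilon^{-1}]$-algebra $R$, the set $\{\phi_A\mid A\in M(m|n,r)\}$ forms an $R$-basis for $\mathcal S(m|n,r;R)$. In particular, $\mathcal S(m|n,r;R)\cong\mathcal S(m|n,r)\otimes R$ has rank $$|M(m|n,r)|=\sum_{k=0}^r\binom{m^2+n^2+k-1}{k}\binom{2mn}{r-k}.$$ Moreover, there is an algebra anti-involution $\tau:\mathcal S(m|n,r;R)\to\mathcal S(m|n,r;R)$ satisfying $\tau(\phi_A)=\phi_{A^T}$ for all $A$, where $A^T$ is the transpose of $A$.
   Context: Let $m,n\ge0$ be integers, not both zero, $r\ge1$, $\mathcal Z=\mathbb Z[\boldsymbol\upsilon,\boldsymbol\upsilon^{-1}]$, $\boldsymbol q=\boldsymbol\upsilon^2$. $\mathfrak S_r$ is the symmetric group with simple reflections $S$ and length $l$. $\mathcal H$ is its Hecke algebra over $\mathcal Z$: basis $T_w$, $T_s^2=(\boldsymbol q-1)T_s+\boldsymbol q$ for $s\in S$, $T_yT_w=T_{yw}$ if $l(yw)=l(y)+l(w)$. For a commutative $\mathcal Z$-algebra $R$, $\mathcal H_R=\mathcal H\otimes_{\mathcal Z}R$ and $q$ is the image of $\boldsymbol q$ in $R$. $\Lambda(m|n,r)$ is the set of pairs $\lambda|\mu$, $\lambda\in\mathbb N^m,\mu\in\mathbb N^n$, $|\lambda|+|\mu|=r$, identified with the concatenation $\lambda\vee\mu$. For a composition $\nu$ of $r$, $R^\nu_k=\{\nu_1+\dots+\nu_{k-1}+1,\dots,\nu_1+\dots+\nu_k\}$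 and $\mathfrak S_\nu$ is the Young subgroup stabilizing all $R^\nu_k$. Put $\lambda^*=\lambda\vee(1^{r-|\lambda|})$, ${}^*\mu=(1^{r-|\mu|})\vee\mu$, so $\mathfrak S_{\lambda|\mu}:=\mathfrak S_{\lambda\vee\mu}=\mathfrak S_{\lambda^*}\mathfrak S_{{}^*\mu}$. Put $$x_\lambda=\sum_{w\in\mathfrak S_{\lambda^*}}T_w,\qquad y_\mu=\sum_{w\in\mathfrak S_{{}^*\mu}}(-q)^{-l(w)}T_w.$$ Let $\mathfrak T(m|n,r;R)=\bigoplus_{\lambda|\mu\in\Lambda(m|n,r)}x_\lambda y_\mu\mathcal H_R$ (a right $\mathcal H_R$-module) and $\mathcal S(m|n,r;R)=\mathrm{End}_{\mathcal H_R}(\mathfrak T(m|n,r;R))$, with $\mathbb Z_2$-grading in which $\mathrm{Hom}_{\mathcal H_R}(x_\xi y_\eta\mathcal H_R,x_\lambda y_\mu\mathcal H_R)$ has degree $|\mu|+|\eta|$ mod $2$, and with the supermultiplication $\phi\psi=(-1)^{\hat\phi\hat\psi}\phi\circ\psi$ for homogeneous $\phi,\psi$ of degrees $\hat\phi,\hat\psi$. $\mathcal S(m|n,r)=\mathcal S(m|n,r;\mathcal Z)$. $\hat i=0$ for $i\le m$, $\hat i=1$ for $m<i\le m+n$. $M(m|n,r)$ is the set of $(m+n)\times(m+n)$ matrices $A=(a_{ij})$ over $\mathbb N$ with entry sum $r$ and $a_{ij}\in\{0,1\}$ whenever $\hat i+\hat j=1$. For $A\in M(m|n,r)$ with row sums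 $\lambda|\mu$ and column sums $\xi|\eta$, let $d$ be the shortest element of the double coset $D=\{w\in\mathfrak S_r:|R_i^{\lambda\vee\mu}\cap wR_j^{\xi\vee\eta}|=a_{ij}\ \forall i,j\}\in\mathfrak S_{\lambda|\mu}\backslash\mathfrak S_r/\mathfrak S_{\xi|\eta}$, and define compositions $\alpha,\beta$ by $\mathfrak S_{\alpha^*}=d^{-1}\mathfrak S_{\lambda^*}d\cap\mathfrak S_{\xi^*}$, $\mathfrak S_{{}^*\beta}=d^{-1}\mathfrak S_{{}^*\mu}d\cap\mathfrak S_{{}^*\eta}$. Put $$T_D=\sum_{u,v}(-q)^{-l(v)}x_\lambda y_\mu T_dT_uT_v,$$ the sum over $u\in\mathfrak S_{\xi^*}$, $v\in\mathfrak S_{{}^*\eta}$ such that $u$ (resp. $v$) is of minimal length in $\mathfrak S_{\alpha^*}u$ (resp. $\mathfrak S_{{}^*\beta}v$). Then $\phi_A\in\mathcal S(m|n,r;R)$ is defined by $\phi_A(x_\xi y_\eta h)=T_Dh$ for $h\in\mathcal H_R$ and $\phi_A=0$ on the summands $x_{\xi'}y_{\eta'}\mathcal H_R$ with $\xi'|\eta'\ne\xi|\eta$.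
   Formalization: The English fails if m,n≥1, r≥2 and 1+q is a zero divisor (m=n=1, r=2, q=−1: rank 10, not 8). The basis, base-change and rank claims are stated for m=0, n=0, r=1, or 1+q not a zero divisor in R; R is nonzero. *)

theory Defs
  imports
    "HOL-Algebra.Module"
    "HOL-Algebra.Coset"
    "HOL-Algebra.QuotRing"
    "HOL-Algebra.Generated_Groups"
    "HOL-Algebra.Free_Abelian_Groups"
    "HOL-Combinatorics.Permutations"
    "HOL-Combinatorics.Transposition"
    "HOL-Library.Poly_Mapping"
    "HOL-Library.FuncSet"
    "Jordan_Normal_Form.Matrix"
begin

section \<open>Modules and algebras over a commutative ring\<close>

text \<open>The scalars are the elements of a type of class \<^class>\<open>comm_ring_1\<close>; the module or algebra
  itself is a HOL-Algebra record, of which the fields \<^const>\<open>mult\<close> and \<^const>\<open>one\<close> are irrelevant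
  for the module structure.\<close>

definition is_basis :: "('c, 'a, 'z) module_scheme \<Rightarrow> 'i set \<Rightarrow> ('i \<Rightarrow> 'a) \<Rightarrow> bool" where
  "is_basis A I b \<longleftrightarrow>
     finite I \<and> b \<in> I \<rightarrow> carrier A \<and>
     (\<forall>x \<in> carrier A. \<exists>!c. c \<in> extensional I \<and> x = (\<Oplus>\<^bsub>A\<^esub>i\<in>I. c i \<odot>\<^bsub>A\<^esub> b i))"

definition has_rank :: "('c, 'a, 'z) module_scheme \<Rightarrow> nat \<Rightarrow> bool" where
  "has_rank A k \<longleftrightarrow> (\<exists>b. is_basis A {..<k} b)"

definition algebra_iso :: "('c, 'a, 'y) module_scheme \<Rightarrow> ('c, 'b, 'z) module_scheme \<Rightarrow> ('a \<Rightarrow> 'b) \<Rightarrow> bool" where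
  "algebra_iso A B \<Phi> \<longleftrightarrow>
     \<Phi> \<in> ring_iso A B \<and> (\<forall>c. \<forall>x \<in> carrier A. \<Phi> (c \<odot>\<^bsub>A\<^esub> x) = c \<odot>\<^bsub>B\<^esub> \<Phi> x)"

definition algebra_anti_involution :: "('c, 'a, 'z) module_scheme \<Rightarrow> ('a \<Rightarrow> 'a) \<Rightarrow> bool" where
  "algebra_anti_involution A \<tau> \<longleftrightarrow>
     \<tau> \<in> carrier A \<rightarrow> carrier A \<and>
     (\<forall>x \<in> carrier A. \<forall>y \<in> carrier A. \<tau> (x \<oplus>\<^bsub>A\<^esub> y) = \<tau> x \<oplus>\<^bsub>A\<^esub> \<tau> y) \<and>
     (\<forall>c. \<forall>x \<in> carrier A. \<tau> (c \<odot>\<^bsub>A\<^esub> x) = c \<odot>\<^bsub>A\<^esub> \<tau> x) \<and>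
     (\<forall>x \<in> carrier A. \<forall>y \<in> carrier A. \<tau> (x \<otimes>\<^bsub>A\<^esub> y) = \<tau> y \<otimes>\<^bsub>A\<^esub> \<tau> x) \<and>
     \<tau> \<one>\<^bsub>A\<^esub> = \<one>\<^bsub>A\<^esub> \<and>
     (\<forall>x \<in> carrier A. \<tau> (\<tau> x) = x)"

subsection \<open>Extension of scalars\<close>

text \<open>For a ring homomorphism \<open>f\<close> from \<open>'c\<close> to \<open>'r\<close> and a \<open>'c\<close>-algebra \<open>A\<close>, the \<open>'r\<close>-algebra
  obtained by tensoring \<open>A\<close> with \<open>'r\<close> over \<open>'c\<close>: the free abelian group on all pairs \<open>(x, a)\<close>,
  modulo the subgroup generated by the bilinearity relations. Its elements are cosets.\<close>

definition tensor_free :: "('c, 'a, 'z) module_scheme \<Rightarrow> (('a \<times> 'r) \<Rightarrow>\<^sub>0 int) monoid" where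
  "tensor_free A = free_Abelian_group (carrier A \<times> UNIV)"

definition tensor_rels :: "('c \<Rightarrow> 'r::comm_ring_1) \<Rightarrow> ('c, 'a, 'z) module_scheme \<Rightarrow> (('a \<times> 'r) \<Rightarrow>\<^sub>0 int) set" where
  "tensor_rels f A = generate (tensor_free A)
     ({frag_of (x \<oplus>\<^bsub>A\<^esub> y, a) - frag_of (x, a) - frag_of (y, a) | x y a. x \<in> carrier A \<and> y \<in> carrier A} \<union>
      {frag_of (x, a + b) - frag_of (x, a) - frag_of (x, b) | x a b. x \<in> carrier A} \<union>
      {frag_of (c \<odot>\<^bsub>A\<^esub> x, a) - frag_of (x, f c * a) | c x a. x \<in> carrier A})"

definition tensor_class :: "('c \<Rightarrow> 'r::comm_ring_1) \<Rightarrow> ('c, 'a, 'z) module_scheme \<Rightarrow> (('a \<times> 'r) \<Rightarrow>\<^sub>0 int) \<Rightarrow> (('a \<times> 'r) \<Rightarrow>\<^sub>0 int) set" where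
  "tensor_class f A P = tensor_rels f A #>\<^bsub>tensor_free A\<^esub> P"

definition pure_tensor :: "('c \<Rightarrow> 'r::comm_ring_1) \<Rightarrow> ('c, 'a, 'z) module_scheme \<Rightarrow> 'a \<Rightarrow> 'r \<Rightarrow> (('a \<times> 'r) \<Rightarrow>\<^sub>0 int) set" where
  "pure_tensor f A x a = tensor_class f A (frag_of (x, a))"

text \<open>Product and scalar multiplication are the biadditive, respectively additive, extensions of
  \<open>(x, a) (y, b) = (x y, a b)\<close> and \<open>c (x, a) = (x, c a)\<close>, transported to cosets through
  representatives (the unions are unions of equal cosets).\<close>

definition base_change :: "('c \<Rightarrow> 'r::comm_ring_1) \<Rightarrow> ('c, 'a, 'z) module_scheme \<Rightarrow> ('r, (('a \<times> 'r) \<Rightarrow>\<^sub>0 int) set) module" where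
  "base_change f A = \<lparr>
     partial_object.carrier = carrier (tensor_free A Mod tensor_rels f A),
     monoid.mult = (\<lambda>X Y. \<Union>P\<in>X. \<Union>Q\<in>Y. tensor_class f A
       (frag_extend (\<lambda>(x, a). frag_extend (\<lambda>(y, b). frag_of (x \<otimes>\<^bsub>A\<^esub> y, a * b)) Q) P)),
     monoid.one = pure_tensor f A \<one>\<^bsub>A\<^esub> 1,
     ring.zero = \<one>\<^bsub>tensor_free A Mod tensor_rels f A\<^esub>,
     ring.add = (\<lambda>X Y. X \<otimes>\<^bsub>tensor_free A Mod tensor_rels f A\<^esub> Y),
     module.smult = (\<lambda>c X. \<Union>P\<in>X. tensor_class f A (frag_extend (\<lambda>(x, a). frag_of (x, c * a)) P))\<rparr>"

section \<open>The symmetric group\<close>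

text \<open>The elements are the functions \<open>w\<close> with \<open>w permutes {1..r}\<close>, multiplied by \<open>\<circ>\<close>.\<close>

definition symgrp :: "nat \<Rightarrow> (nat \<Rightarrow> nat) set" where
  "symgrp r = {w. w permutes {1..r}}"

definition simple_refls :: "nat \<Rightarrow> (nat \<Rightarrow> nat) set" where
  "simple_refls r = {Transposition.transpose i (Suc i) | i. 1 \<le> i \<and> i < r}"

definition cox_length :: "nat \<Rightarrow> (nat \<Rightarrow> nat) \<Rightarrow> nat" where
  "cox_length r w = (LEAST k. \<exists>ss. set ss \<subseteq> simple_refls r \<and> length ss = k \<and> w = foldr (\<circ>) ss id)"

text \<open>Parts of compositions are indexed from \<open>0\<close>, positions from \<open>1\<close>.\<close>

definition block :: "nat list \<Rightarrow> nat \<Rightarrow> nat set" where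
  "block \<nu> k = {sum_list (take k \<nu>) <.. sum_list (take (Suc k) \<nu>)}"

definition young :: "nat list \<Rightarrow> (nat \<Rightarrow> nat) set" where
  "young \<nu> = {w \<in> symgrp (sum_list \<nu>). \<forall>k < length \<nu>. w ` block \<nu> k = block \<nu> k}"

definition lstar :: "nat \<Rightarrow> nat list \<Rightarrow> nat list" where
  "lstar r la = la @ replicate (r - sum_list la) 1"

definition rstar :: "nat \<Rightarrow> nat list \<Rightarrow> nat list" where
  "rstar r \<mu> = replicate (r - sum_list \<mu>) 1 @ \<mu>"

definition bicomps :: "nat \<Rightarrow> nat \<Rightarrow> nat \<Rightarrow> (nat list \<times> nat list) set" where
  "bicomps m n r = {(la, \<mu>). length la = m \<and> length \<mu> = n \<and> sum_list la + sum_list \<mu> = r}"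

section \<open>Hecke algebras\<close>

text \<open>Integral Laurent polynomials in \<open>\<upsilon>\<close> are the group ring of the additive group \<^typ>\<open>int\<close>, with
  \<open>single k 1\<close> playing the role of the \<open>k\<close>-th power of \<open>\<upsilon>\<close>. An algebra over them is a commutative
  ring with a ring homomorphism \<open>f\<close> from them; \<open>q_of f\<close> and \<open>qinv_of f\<close> are the images of \<open>\<upsilon>\<close> to
  the powers \<open>2\<close> and \<open>-2\<close>.\<close>

type_synonym laurent = "int \<Rightarrow>\<^sub>0 int"

definition q_of :: "(laurent \<Rightarrow> 'r::comm_ring_1) \<Rightarrow> 'r" where
  "q_of f = f (Poly_Mapping.single 2 1)"

definition qinv_of :: "(laurent \<Rightarrow> 'r::comm_ring_1) \<Rightarrow> 'r" where
  "qinv_of f = f (Poly_Mapping.single (-2) 1)"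

text \<open>An element of the Hecke algebra is identified with its coefficient function with respect to
  the basis \<open>T_elt w\<close>. Extending scalars to \<open>'r\<close> along \<open>f\<close> gives the free module on the same basis whose
  structure constants are the images under \<open>f\<close>, i.e. the Hecke algebra over \<open>'r\<close> with parameter
  \<open>q_of f\<close>.\<close>

type_synonym 'r hecke = "(nat \<Rightarrow> nat) \<Rightarrow> 'r"

definition hecke_carrier :: "nat \<Rightarrow> 'r::comm_ring_1 hecke set" where
  "hecke_carrier r = {h. \<forall>w. h w \<noteq> 0 \<longrightarrow> w \<in> symgrp r}"

definition T_elt :: "(nat \<Rightarrow> nat) \<Rightarrow> 'r::comm_ring_1 hecke" where
  "T_elt w = (\<lambda>u. if u = w then 1 else 0)"

definition is_hecke_product :: "nat \<Rightarrow> 'r::comm_ring_1 \<Rightarrow> ('r hecke \<Rightarrow> 'r hecke \<Rightarrow> 'r hecke) \<Rightarrow> bool" where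
  "is_hecke_product r q mul \<longleftrightarrow>
     (\<forall>a \<in> hecke_carrier r. \<forall>b \<in> hecke_carrier r. mul a b \<in> hecke_carrier r) \<and>
     (\<forall>a \<in> hecke_carrier r. \<forall>b \<in> hecke_carrier r.
        mul a b = (\<lambda>w. \<Sum>y\<in>symgrp r. \<Sum>z\<in>symgrp r. a y * b z * mul (T_elt y) (T_elt z) w)) \<and>
     (\<forall>a \<in> hecke_carrier r. \<forall>b \<in> hecke_carrier r. \<forall>c \<in> hecke_carrier r.
        mul (mul a b) c = mul a (mul b c)) \<and>
     (\<forall>s \<in> simple_refls r. mul (T_elt s) (T_elt s) = (\<lambda>w. (q - 1) * T_elt s w + q * T_elt id w)) \<and>
     (\<forall>y \<in> symgrp r. \<forall>w \<in> symgrp r. cox_length r (y \<circ> w) = cox_length r y + cox_length r w \<longrightarrow> mul (T_elt y) (T_elt w) = T_elt (y \<circ> w))"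

text \<open>On the carrier the product is uniquely determined by these properties; the second one is
  bilinearity.\<close>

definition hmult :: "nat \<Rightarrow> (laurent \<Rightarrow> 'r::comm_ring_1) \<Rightarrow> 'r hecke \<Rightarrow> 'r hecke \<Rightarrow> 'r hecke" where
  "hmult r f = (SOME mul. is_hecke_product r (q_of f) mul)"

definition x_elt :: "nat \<Rightarrow> nat list \<Rightarrow> 'r::comm_ring_1 hecke" where
  "x_elt r la = (\<lambda>u. \<Sum>w\<in>young (lstar r la). T_elt w u)"

definition y_elt :: "nat \<Rightarrow> (laurent \<Rightarrow> 'r::comm_ring_1) \<Rightarrow> nat list \<Rightarrow> 'r hecke" where
  "y_elt r f \<mu> = (\<lambda>u. \<Sum>w\<in>young (rstar r \<mu>). (- qinv_of f) ^ cox_length r w * T_elt w u)"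

definition xy_elt :: "nat \<Rightarrow> (laurent \<Rightarrow> 'r::comm_ring_1) \<Rightarrow> nat list \<times> nat list \<Rightarrow> 'r hecke" where
  "xy_elt r f p = hmult r f (x_elt r (fst p)) (y_elt r f (snd p))"

definition xyH :: "nat \<Rightarrow> (laurent \<Rightarrow> 'r::comm_ring_1) \<Rightarrow> nat list \<times> nat list \<Rightarrow> 'r hecke set" where
  "xyH r f p = {hmult r f (xy_elt r f p) h | h. h \<in> hecke_carrier r}"

section \<open>The tensor space and the quantum Schur superalgebra\<close>

text \<open>An element of the direct sum is the family of its components, extended by \<open>0\<close>.\<close>

type_synonym 'r tspace = "nat list \<times> nat list \<Rightarrow> 'r hecke"

definition tspace :: "nat \<Rightarrow> nat \<Rightarrow> nat \<Rightarrow> (laurent \<Rightarrow> 'r::comm_ring_1) \<Rightarrow> 'r tspace set" where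
  "tspace m n r f =
     {t. (\<forall>p \<in> bicomps m n r. t p \<in> xyH r f p) \<and> (\<forall>p. p \<notin> bicomps m n r \<longrightarrow> t p = (\<lambda>w. 0))}"

definition tadd :: "'r::comm_ring_1 tspace \<Rightarrow> 'r tspace \<Rightarrow> 'r tspace" where
  "tadd s t = (\<lambda>p w. s p w + t p w)"

definition tact :: "nat \<Rightarrow> (laurent \<Rightarrow> 'r::comm_ring_1) \<Rightarrow> 'r tspace \<Rightarrow> 'r hecke \<Rightarrow> 'r tspace" where
  "tact r f t h = (\<lambda>p. hmult r f (t p) h)"

definition tinj :: "nat list \<times> nat list \<Rightarrow> 'r::comm_ring_1 hecke \<Rightarrow> 'r tspace" where
  "tinj p x = (\<lambda>p'. if p' = p then x else (\<lambda>w. 0))"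

text \<open>Compatibility with the Hecke action includes \<open>'r\<close>-linearity, as \<open>'r\<close> acts through the
  multiples of \<open>T_elt id\<close>.\<close>

definition schur_carrier :: "nat \<Rightarrow> nat \<Rightarrow> nat \<Rightarrow> (laurent \<Rightarrow> 'r::comm_ring_1) \<Rightarrow> ('r tspace \<Rightarrow> 'r tspace) set" where
  "schur_carrier m n r f =
     {F \<in> tspace m n r f \<rightarrow>\<^sub>E tspace m n r f.
        (\<forall>s \<in> tspace m n r f. \<forall>t \<in> tspace m n r f. F (tadd s t) = tadd (F s) (F t)) \<and>
        (\<forall>t \<in> tspace m n r f. \<forall>h \<in> hecke_carrier r. F (tact r f t h) = tact r f (F t) h)}"

text \<open>The degree of a homomorphism between the summands indexed by \<open>p'\<close> and \<open>p\<close>.\<close>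

definition hom_degree :: "nat list \<times> nat list \<Rightarrow> nat list \<times> nat list \<Rightarrow> nat" where
  "hom_degree p p' = (sum_list (snd p) + sum_list (snd p')) mod 2"

definition schur_homogeneous :: "nat \<Rightarrow> nat \<Rightarrow> nat \<Rightarrow> (laurent \<Rightarrow> 'r::comm_ring_1) \<Rightarrow> nat \<Rightarrow> ('r tspace \<Rightarrow> 'r tspace) set" where
  "schur_homogeneous m n r f i =
     {F \<in> schur_carrier m n r f.
        \<forall>p \<in> bicomps m n r. \<forall>p' \<in> bicomps m n r. hom_degree p p' \<noteq> i \<longrightarrow>
          (\<forall>x \<in> xyH r f p'. F (tinj p' x) p = (\<lambda>w. 0))}"

text \<open>The homogeneous component of degree \<open>i\<close> of an endomorphism.\<close>

definition schur_component :: "nat \<Rightarrow> nat \<Rightarrow> nat \<Rightarrow> (laurent \<Rightarrow> 'r::comm_ring_1) \<Rightarrow> nat \<Rightarrow> ('r tspace \<Rightarrow> 'r tspace) \<Rightarrow> ('r tspace \<Rightarrow> 'r tspace)" where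
  "schur_component m n r f i F =
     (\<lambda>t \<in> tspace m n r f. \<lambda>p w. \<Sum>p' \<in> {p' \<in> bicomps m n r. hom_degree p p' = i}. F (tinj p' (t p')) p w)"

definition schur_mult :: "nat \<Rightarrow> nat \<Rightarrow> nat \<Rightarrow> (laurent \<Rightarrow> 'r::comm_ring_1) \<Rightarrow> ('r tspace \<Rightarrow> 'r tspace) \<Rightarrow> ('r tspace \<Rightarrow> 'r tspace) \<Rightarrow> ('r tspace \<Rightarrow> 'r tspace)" where
  "schur_mult m n r f F G =
     (\<lambda>t \<in> tspace m n r f. \<lambda>p w. \<Sum>i<2. \<Sum>j<2.
        (-1) ^ (i * j) * schur_component m n r f i F (schur_component m n r f j G t) p w)"

definition schur :: "nat \<Rightarrow> nat \<Rightarrow> nat \<Rightarrow> (laurent \<Rightarrow> 'r::comm_ring_1) \<Rightarrow> ('r, 'r tspace \<Rightarrow> 'r tspace) module" where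
  "schur m n r f = \<lparr>
     partial_object.carrier = schur_carrier m n r f,
     monoid.mult = schur_mult m n r f,
     monoid.one = (\<lambda>t \<in> tspace m n r f. t),
     ring.zero = (\<lambda>t \<in> tspace m n r f. \<lambda>p w. 0),
     ring.add = (\<lambda>F G. \<lambda>t \<in> tspace m n r f. tadd (F t) (G t)),
     module.smult = (\<lambda>c F. \<lambda>t \<in> tspace m n r f. \<lambda>p w. c * F t p w)\<rparr>"

text \<open>Over the Laurent polynomials themselves.\<close>

abbreviation schur_generic :: "nat \<Rightarrow> nat \<Rightarrow> nat \<Rightarrow> (laurent, laurent tspace \<Rightarrow> laurent tspace) module" where
  "schur_generic m n r \<equiv> schur m n r id"

section \<open>The elements indexed by matrices\<close>

definition matrices :: "nat \<Rightarrow> nat \<Rightarrow> nat \<Rightarrow> nat mat set" where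
  "matrices m n r =
     {A \<in> carrier_mat (m + n) (m + n).
        (\<Sum>i<m + n. \<Sum>j<m + n. A $$ (i, j)) = r \<and>
        (\<forall>i < m + n. \<forall>j < m + n. (i < m) \<noteq> (j < m) \<longrightarrow> A $$ (i, j) \<in> {0, 1})}"

definition row_comp :: "nat \<Rightarrow> nat \<Rightarrow> nat mat \<Rightarrow> nat list \<times> nat list" where
  "row_comp m n A = (map (\<lambda>i. \<Sum>j<m + n. A $$ (i, j)) [0..<m],
                     map (\<lambda>i. \<Sum>j<m + n. A $$ (i, j)) [m..<m + n])"

definition col_comp :: "nat \<Rightarrow> nat \<Rightarrow> nat mat \<Rightarrow> nat list \<times> nat list" where
  "col_comp m n A = (map (\<lambda>j. \<Sum>i<m + n. A $$ (i, j)) [0..<m],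
                     map (\<lambda>j. \<Sum>i<m + n. A $$ (i, j)) [m..<m + n])"

definition double_coset :: "nat \<Rightarrow> nat \<Rightarrow> nat \<Rightarrow> nat mat \<Rightarrow> (nat \<Rightarrow> nat) set" where
  "double_coset m n r A =
     (let (la, \<mu>) = row_comp m n A; (\<xi>, \<eta>) = col_comp m n A in
      {w \<in> symgrp r. \<forall>i < m + n. \<forall>j < m + n.
         card (block (la @ \<mu>) i \<inter> w ` block (\<xi> @ \<eta>) j) = A $$ (i, j)})"

definition shortest :: "nat \<Rightarrow> nat \<Rightarrow> nat \<Rightarrow> nat mat \<Rightarrow> (nat \<Rightarrow> nat)" where
  "shortest m n r A = arg_min_on (cox_length r) (double_coset m n r A)"

definition conj_inter :: "(nat \<Rightarrow> nat) \<Rightarrow> (nat \<Rightarrow> nat) set \<Rightarrow> (nat \<Rightarrow> nat) set \<Rightarrow> (nat \<Rightarrow> nat) set" where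
  "conj_inter d U V = {inv_into UNIV d \<circ> w \<circ> d | w. w \<in> U} \<inter> V"

definition min_right_reps :: "nat \<Rightarrow> (nat \<Rightarrow> nat) set \<Rightarrow> (nat \<Rightarrow> nat) set \<Rightarrow> (nat \<Rightarrow> nat) set" where
  "min_right_reps r U V = {u \<in> V. \<forall>w \<in> U. cox_length r u \<le> cox_length r (w \<circ> u)}"

text \<open>The compositions \<open>\<alpha>\<close> and \<open>\<beta>\<close> only enter through their Young subgroups, which are the two
  intersections below.\<close>

definition TD :: "nat \<Rightarrow> nat \<Rightarrow> nat \<Rightarrow> (laurent \<Rightarrow> 'r::comm_ring_1) \<Rightarrow> nat mat \<Rightarrow> 'r hecke" where
  "TD m n r f A =
     (let (la, \<mu>) = row_comp m n A; (\<xi>, \<eta>) = col_comp m n A; d = shortest m n r A;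
          Y\<alpha> = conj_inter d (young (lstar r la)) (young (lstar r \<xi>));
          Y\<beta> = conj_inter d (young (rstar r \<mu>)) (young (rstar r \<eta>))
      in (\<lambda>w. \<Sum>u \<in> min_right_reps r Y\<alpha> (young (lstar r \<xi>)).
              \<Sum>v \<in> min_right_reps r Y\<beta> (young (rstar r \<eta>)).
                (- qinv_of f) ^ cox_length r v *
                hmult r f (hmult r f (hmult r f (xy_elt r f (la, \<mu>)) (T_elt d)) (T_elt u)) (T_elt v) w))"

definition phi :: "nat \<Rightarrow> nat \<Rightarrow> nat \<Rightarrow> (laurent \<Rightarrow> 'r::comm_ring_1) \<Rightarrow> nat mat \<Rightarrow> 'r tspace \<Rightarrow> 'r tspace" where
  "phi m n r f A = (THE F. F \<in> schur_carrier m n r f \<and>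
     (\<forall>h \<in> hecke_carrier r.
        F (tinj (col_comp m n A) (hmult r f (xy_elt r f (col_comp m n A)) h)) =
        tinj (row_comp m n A) (hmult r f (TD m n r f A) h)) \<and>
     (\<forall>p \<in> bicomps m n r. p \<noteq> col_comp m n A \<longrightarrow>
        (\<forall>x \<in> xyH r f p. F (tinj p x) = (\<lambda>p' w. 0))))"

end

theory Submission
  imports Defs
begin

text \<open>The module \<open>x\<^sub>\<lambda> y\<^sub>\<mu> H\<close> is the set of common eigenvectors of left multiplication by the \<open>T\<^sub>s\<close> with \<open>s\<close>
  in the Young subgroup (eigenvalue \<open>q\<close> on even and \<open>-1\<close> on odd blocks). A homomorphism
  \<open>x\<^sub>\<xi> y\<^sub>\<eta> H \<rightarrow> x\<^sub>\<lambda> y\<^sub>\<mu> H\<close> is determined by the image \<open>z\<close> of the generator; since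
  \<open>x\<^sub>\<xi> y\<^sub>\<eta> T\<^sub>s\<close> is a multiple of \<open>x\<^sub>\<xi> y\<^sub>\<eta>\<close>, this \<open>z\<close> is also a right eigenvector, hence of the form \<open>a x\<^sub>\<xi> y\<^sub>\<eta>\<close>,
  so the homomorphism is left multiplication by \<open>a\<close>. Thus an endomorphism of the tensor space is a family of
  two-sided eigenvectors. The coefficients of such a \<open>z\<close> are determined by its values on the shortest
  double coset representatives. On a double coset whose matrix lies in \<open>M(m|n,r)\<close> the value is
  arbitrary, with \<open>T\<^sub>D\<close> as the normalized solution: its coefficient at \<open>w\<close> is \<open>(-q)\<close> to minus the number
  of inversions of \<open>w\<close> inside a common odd row block or a common odd column block. On the other double
  cosets a value \<open>a\<close> satisfies \<open>(1 + q) a = 0\<close>. This description of \<open>T\<^sub>D\<close> is symmetric in rows and columns, so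
  the anti-involution \<open>T\<^sub>w \<mapsto> T\<^bsub>w\<^sup>-\<^sup>1\<^esub>\<close> of \<open>H\<close> induces the required \<open>\<tau>\<close>, over any \<open>R\<close>.\<close>

subsection \<open>Inversions and the length function\<close>

text \<open>The basis statement fails without a condition on 1 + q: for m = n = 1, r = 2 and a
  nonzero a with (1 + q) a = 0, the element a (1 + T_s) has left eigenvalue q and right eigenvalue
  -1. It gives a nonzero homomorphism from y H to x H, although no admissible matrix has row sums
  (2|0) and column sums (0|2). Hence basis, rank and base change carry a regularity condition,
  whereas the anti-involution is built on families of two-sided eigenvectors, which never refer to a
  basis. Eigenvectors are encoded by coefficient recursions along ascents, h(s w) = h(w) or h(s w) =
  - q^-1 h(w), because these are compatible with every ring homomorphism and turn each uniqueness
  question into a descent on length. The product \<open>hmult\<close> is a choice among all products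
  with the Hecke relations, so existence and uniqueness of such a product must precede everything
  else. Both rest on operators that commute with right multiplications, which avoids comparing
  different reduced words of one permutation.\<close>

abbreviation sr :: "nat \<Rightarrow> nat \<Rightarrow> nat" where "sr i \<equiv> Transposition.transpose i (Suc i)"

abbreviation pinv :: "(nat \<Rightarrow> nat) \<Rightarrow> nat \<Rightarrow> nat" where "pinv \<equiv> inv_into UNIV"

definition invset :: "nat \<Rightarrow> (nat \<Rightarrow> nat) \<Rightarrow> (nat \<times> nat) set" where
  "invset r w = {(i, j). 1 \<le> i \<and> i < j \<and> j \<le> r \<and> w j < w i}"

lemma finite_invset [simp]: "finite (invset r w)"
  by (rule finite_subset[of _ "{1..r} \<times> {1..r}"]) (auto simp: invset_def)

lemma symgrp_finite [simp]: "finite (symgrp r)"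
  by (simp add: symgrp_def finite_permutations)

lemma symgrp_id [simp]: "id \<in> symgrp r"
  by (simp add: symgrp_def permutes_id)

lemma symgrp_comp [simp]: "v \<in> symgrp r \<Longrightarrow> w \<in> symgrp r \<Longrightarrow> v \<circ> w \<in> symgrp r"
  by (simp add: symgrp_def permutes_compose)

lemma symgrp_inv [simp]: "w \<in> symgrp r \<Longrightarrow> pinv w \<in> symgrp r"
  by (simp add: symgrp_def permutes_inv)

lemma symgrp_inv_inv [simp]: "w \<in> symgrp r \<Longrightarrow> pinv (pinv w) = w"
  by (simp add: symgrp_def permutes_inv_inv)

lemma symgrp_inv_o [simp]: "w \<in> symgrp r \<Longrightarrow> pinv w \<circ> w = id" "w \<in> symgrp r \<Longrightarrow> w \<circ> pinv w = id"
  by (auto simp: symgrp_def permutes_inv_o)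

lemma symgrp_inv_app [simp]: "w \<in> symgrp r \<Longrightarrow> pinv w (w x) = x" "w \<in> symgrp r \<Longrightarrow> w (pinv w x) = x"
  by (auto simp: symgrp_def permutes_inverses)

lemma symgrp_inv_comp: "v \<in> symgrp r \<Longrightarrow> w \<in> symgrp r \<Longrightarrow> pinv (v \<circ> w) = pinv w \<circ> pinv v"
  by (simp add: symgrp_def permutes_bij o_inv_distrib)

lemma symgrp_range: "w \<in> symgrp r \<Longrightarrow> w x \<in> {1..r} \<longleftrightarrow> x \<in> {1..r}"
  by (simp only: symgrp_def mem_Collect_eq permutes_in_image)

lemma symgrp_bounds: "w \<in> symgrp r \<Longrightarrow> 1 \<le> x \<Longrightarrow> x \<le> r \<Longrightarrow> 1 \<le> w x \<and> w x \<le> r"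
  using symgrp_range[of w r x] by simp

lemma symgrp_inj_iff: "w \<in> symgrp r \<Longrightarrow> w x = w y \<longleftrightarrow> x = y"
  by (metis symgrp_inv_app(1))

lemma symgrp_fix: "w \<in> symgrp r \<Longrightarrow> x \<notin> {1..r} \<Longrightarrow> w x = x"
  unfolding symgrp_def permutes_def by blast

lemma sr_symgrp [simp]: "1 \<le> i \<Longrightarrow> i < r \<Longrightarrow> sr i \<in> symgrp r"
  by (simp add: symgrp_def permutes_swap_id)

lemma sr_sr [simp]: "sr i \<circ> sr i = id" "w \<circ> sr i \<circ> sr i = w" "sr i \<circ> (sr i \<circ> w) = w" "sr i (sr i x) = x"
  by (auto simp: fun_eq_iff)

lemma symgrp_comp_sr_iff: "1 \<le> i \<Longrightarrow> i < r \<Longrightarrow> w \<circ> sr i \<in> symgrp r \<longleftrightarrow> w \<in> symgrp r"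
  by (metis sr_sr(2) sr_symgrp symgrp_comp)

lemma symgrp_sr_comp_iff: "1 \<le> i \<Longrightarrow> i < r \<Longrightarrow> sr i \<circ> w \<in> symgrp r \<longleftrightarrow> w \<in> symgrp r"
  by (metis sr_sr(3) sr_symgrp symgrp_comp)

lemma inv_sr [simp]: "pinv (sr i) = sr i"
  by (simp add: inv_equality)

lemma symgrp_inv_sr_comp: "1 \<le> i \<Longrightarrow> i < r \<Longrightarrow> w \<in> symgrp r \<Longrightarrow> pinv (sr i \<circ> w) = pinv w \<circ> sr i"
  using symgrp_inv_comp[OF sr_symgrp] by simp

lemma symgrp_inv_comp_sr: "1 \<le> i \<Longrightarrow> i < r \<Longrightarrow> w \<in> symgrp r \<Longrightarrow> pinv (w \<circ> sr i) = sr i \<circ> pinv w"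
  using symgrp_inv_comp[OF _ sr_symgrp] by simp

lemma sr_less_iff:
  assumes "a \<noteq> b" "\<not> (a = i \<and> b = Suc i)" "\<not> (a = Suc i \<and> b = i)"
  shows "sr i a < sr i b \<longleftrightarrow> a < b"
  using assms by (auto simp: Transposition.transpose_def)

text \<open>Exchanging the positions i and i + 1 reverses the order of no other pair of positions,
  so away from this one pair the inversions are merely relabelled by \<open>sr i\<close>.\<close>

lemma invset_comp_sr:
  assumes "1 \<le> i" "i < r"
  shows "invset r (w \<circ> sr i) - {(i, Suc i)} = map_prod (sr i) (sr i) ` (invset r w - {(i, Suc i)})"
proof -
  have *: "map_prod (sr i) (sr i) p \<in> invset r (w \<circ> sr i) - {(i, Suc i)}"
    if "p \<in> invset r w - {(i, Suc i)}" for p w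
  proof -
    obtain a b where p: "p = (a, b)" by (cases p)
    have ab: "1 \<le> a" "a < b" "b \<le> r" "w b < w a" "\<not> (a = i \<and> b = Suc i)"
      using that p by (auto simp: invset_def)
    then have "sr i a < sr i b" by (subst sr_less_iff) auto
    moreover have "1 \<le> sr i a" "sr i b \<le> r"
      using ab assms by (auto simp: Transposition.transpose_def)
    moreover have "\<not> (sr i a = i \<and> sr i b = Suc i)"
      using ab by (auto simp: Transposition.transpose_def split: if_splits)
    ultimately show ?thesis using ab(4) by (auto simp: p invset_def)
  qed
  show ?thesis
  proof (intro equalityI subsetI)
    fix p assume p: "p \<in> invset r (w \<circ> sr i) - {(i, Suc i)}"
    have "map_prod (sr i) (sr i) p \<in> invset r (w \<circ> sr i \<circ> sr i) - {(i, Suc i)}"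
      using *[OF p] .
    then have "map_prod (sr i) (sr i) p \<in> invset r w - {(i, Suc i)}"
      by (simp only: sr_sr)
    moreover have "p = map_prod (sr i) (sr i) (map_prod (sr i) (sr i) p)"
      by (cases p) simp
    ultimately show "p \<in> map_prod (sr i) (sr i) ` (invset r w - {(i, Suc i)})" by (rule image_eqI[rotated])
  next
    fix p assume "p \<in> map_prod (sr i) (sr i) ` (invset r w - {(i, Suc i)})"
    then obtain x where "p = map_prod (sr i) (sr i) x" "x \<in> invset r w - {(i, Suc i)}" by (rule imageE)
    then show "p \<in> invset r (w \<circ> sr i) - {(i, Suc i)}" by (simp only: *)
  qed
qed

lemma inj_map_prod_sr: "inj_on (map_prod (sr i) (sr i)) X"
  by (rule inj_on_inverseI[of _ "map_prod (sr i) (sr i)"]) auto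

lemma invset_card_up:
  assumes "1 \<le> i" "i < r" "w i < w (Suc i)"
  shows "card (invset r (w \<circ> sr i)) = Suc (card (invset r w))"
proof -
  have "(i, Suc i) \<in> invset r (w \<circ> sr i)" "(i, Suc i) \<notin> invset r w"
    using assms by (auto simp: invset_def)
  then have "card (invset r (w \<circ> sr i)) = Suc (card (invset r (w \<circ> sr i) - {(i, Suc i)}))"
    by (metis card.remove finite_invset)
  also have "\<dots> = Suc (card (invset r w - {(i, Suc i)}))"
    by (simp only: invset_comp_sr[OF assms(1,2)] card_image[OF inj_map_prod_sr])
  finally show ?thesis using \<open>(i, Suc i) \<notin> invset r w\<close> by simp
qed

lemma invset_card_down:
  assumes "1 \<le> i" "i < r" "w (Suc i) < w i"
  shows "card (invset r w) = Suc (card (invset r (w \<circ> sr i)))"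
proof -
  have "card (invset r (w \<circ> sr i \<circ> sr i)) = Suc (card (invset r (w \<circ> sr i)))"
    using assms by (intro invset_card_up) auto
  then show ?thesis by (simp only: sr_sr)
qed

section \<open>Words in the simple reflections and the Coxeter length\<close>

definition word_prod :: "(nat \<Rightarrow> nat) list \<Rightarrow> nat \<Rightarrow> nat" where
  "word_prod ss = foldr (\<circ>) ss id"

lemma word_prod_simps [simp]: "word_prod [] = id" "word_prod (s # ss) = s \<circ> word_prod ss"
  by (simp_all add: word_prod_def comp_def)

lemma word_prod_snoc: "word_prod (ss @ [s]) = word_prod ss \<circ> s"
  by (induct ss) (simp_all add: comp_assoc)

lemma word_symgrp: "set ss \<subseteq> simple_refls r \<Longrightarrow> word_prod ss \<in> symgrp r"
  by (induct ss) (auto simp: simple_refls_def)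

text \<open>Each further letter changes the number of inversions by exactly one, so a word cannot be
  shorter than the number of inversions of its product.\<close>

lemma card_invset_word:
  "set ss \<subseteq> simple_refls r \<Longrightarrow> card (invset r (word_prod ss)) \<le> length ss"
proof (induct ss rule: rev_induct)
  case Nil
  have "invset r id = {}" by (auto simp: invset_def)
  then show ?case by (simp add: id_def)
next
  case (snoc s ss)
  define w where "w = word_prod ss"
  obtain i where i: "s = sr i" "1 \<le> i" "i < r" using snoc.prems by (auto simp: simple_refls_def)
  have w: "w \<in> symgrp r" using snoc.prems word_symgrp[of ss r] by (simp add: w_def)
  have "w i \<noteq> w (Suc i)" using w by (simp add: symgrp_inj_iff)
  then have "card (invset r (w \<circ> s)) \<le> Suc (card (invset r w))"
    using invset_card_up[OF i(2,3), of w] invset_card_down[OF i(2,3), of w] i(1)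
    by (cases "w i < w (Suc i)") auto
  moreover have "card (invset r w) \<le> length ss" using snoc by (simp add: w_def)
  ultimately show ?case by (simp add: word_prod_snoc w_def[symmetric] comp_def)
qed

text \<open>An increasing map of {1..r} into itself satisfies i \<le> w i, and a permutation that
  moves nothing down is the identity.\<close>

lemma symgrp_increasing_id:
  assumes "w \<in> symgrp r" "\<And>i. 1 \<le> i \<Longrightarrow> i < r \<Longrightarrow> w i < w (Suc i)"
  shows "w = id"
proof -
  have "i \<le> w i" if "1 \<le> i" "i \<le> r" for i
    using that
  proof (induction i)
    case (Suc i)
    show ?case
    proof (cases "i = 0")
      case True then show ?thesis using symgrp_bounds[OF assms(1), of "Suc i"] Suc by auto
    next
      case False then show ?thesis using Suc assms(2)[of i] by auto
    qed
  qed simp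
  then show ?thesis using permutes_natset_ge[of w "{1..r}"] assms(1) by (auto simp: symgrp_def)
qed

lemma descent_exists:
  assumes "w \<in> symgrp r" "w \<noteq> id"
  obtains i where "1 \<le> i" "i < r" "w (Suc i) < w i"
proof -
  have "\<exists>i. 1 \<le> i \<and> i < r \<and> \<not> w i < w (Suc i)"
    using symgrp_increasing_id[OF assms(1)] assms(2) by blast
  moreover have "w i \<noteq> w (Suc i)" for i using assms by (simp add: symgrp_inj_iff)
  ultimately show thesis using that by (metis linorder_neqE_nat)
qed

text \<open>Sorting by adjacent exchanges: every descent can be removed at the cost of one letter
  and one inversion. With \<open>card_invset_word\<close> this identifies the length with the number
  of inversions.\<close>

lemma exists_reduced_word:
  assumes "w \<in> symgrp r"
  shows "\<exists>ss. set ss \<subseteq> simple_refls r \<and> length ss = card (invset r w) \<and> w = word_prod ss"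
  using assms
proof (induction "card (invset r w)" arbitrary: w)
  case 0
  have "w = id"
  proof (rule symgrp_increasing_id[OF 0(2)])
    fix i assume i: "1 \<le> i" "i < r"
    have "w i \<noteq> w (Suc i)" using 0 by (simp add: symgrp_inj_iff)
    then show "w i < w (Suc i)"
      using invset_card_down[OF i, of w] 0(1) by (cases "w i < w (Suc i)") auto
  qed
  then show ?case using 0 by (intro exI[of _ "[]"]) auto
next
  case (Suc n)
  have "w \<noteq> id"
  proof
    assume "w = id"
    then have "invset r w = {}" by (auto simp: invset_def)
    then show False using Suc(2) by simp
  qed
  then obtain i where i: "1 \<le> i" "i < r" "w (Suc i) < w i"
    using descent_exists[OF Suc.prems] by blast
  have "n = card (invset r (w \<circ> sr i))" using invset_card_down[OF i] Suc(2) by simp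
  then obtain ss where ss: "set ss \<subseteq> simple_refls r" "length ss = n" "w \<circ> sr i = word_prod ss"
    using Suc(1)[of "w \<circ> sr i"] Suc.prems i by auto
  have "w = word_prod (ss @ [sr i])"
    unfolding word_prod_snoc ss(3)[symmetric] by (simp only: sr_sr)
  moreover have "set (ss @ [sr i]) \<subseteq> simple_refls r" using ss(1) i by (auto simp: simple_refls_def)
  ultimately show ?case using ss(2) Suc(2) by (intro exI[of _ "ss @ [sr i]"]) auto
qed

lemma cox_length_eq: "w \<in> symgrp r \<Longrightarrow> cox_length r w = card (invset r w)"
  unfolding cox_length_def word_prod_def[symmetric]
  by (rule Least_equality) (use exists_reduced_word card_invset_word in auto)

lemma cox_length_id [simp]: "cox_length r id = 0"
proof -
  have "invset r id = {}" by (auto simp: invset_def)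
  then show ?thesis by (simp add: cox_length_eq)
qed

text \<open>The map (i, j) to (w j, w i) embeds the inversions of w into those of its inverse; using
  it for w and for the inverse gives both inequalities.\<close>

lemma cox_length_inv [simp]:
  assumes "w \<in> symgrp r" shows "cox_length r (pinv w) = cox_length r w"
proof -
  have *: "(\<lambda>(i, j). (w j, w i)) ` invset r w \<subseteq> invset r (pinv w)" if "w \<in> symgrp r" for w
  proof (intro subsetI)
    fix p assume "p \<in> (\<lambda>(i, j). (w j, w i)) ` invset r w"
    then obtain i j where p: "p = (w j, w i)" and ij: "1 \<le> i" "i < j" "j \<le> r" "w j < w i"
      by (auto simp: invset_def)
    then show "p \<in> invset r (pinv w)"
      using symgrp_bounds[OF that, of i] symgrp_bounds[OF that, of j]
      by (simp add: invset_def symgrp_inv_app[OF that])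
  qed
  have inj: "inj_on (\<lambda>(i, j). (w j, w i)) (invset r w)" if "w \<in> symgrp r" for w
    by (auto simp: inj_on_def symgrp_inj_iff[OF that])
  have "card (invset r w) \<le> card (invset r (pinv w))" if "w \<in> symgrp r" for w
    using card_inj_on_le[OF inj * finite_invset] that by blast
  from this[of w] this[of "pinv w"] show ?thesis using assms by (simp add: cox_length_eq)
qed

lemma len_right_up:
  "w \<in> symgrp r \<Longrightarrow> 1 \<le> i \<Longrightarrow> i < r \<Longrightarrow> w i < w (Suc i) \<Longrightarrow> cox_length r (w \<circ> sr i) = Suc (cox_length r w)"
  by (simp add: cox_length_eq invset_card_up)

lemma len_right_down:
  "w \<in> symgrp r \<Longrightarrow> 1 \<le> i \<Longrightarrow> i < r \<Longrightarrow> w (Suc i) < w i \<Longrightarrow> cox_length r w = Suc (cox_length r (w \<circ> sr i))"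
  by (simp add: cox_length_eq invset_card_down)

lemma len_left_up:
  assumes "w \<in> symgrp r" "1 \<le> i" "i < r" "pinv w i < pinv w (Suc i)"
  shows "cox_length r (sr i \<circ> w) = Suc (cox_length r w)"
  using len_right_up[of "pinv w" r i] assms cox_length_inv[of "sr i \<circ> w" r]
  by (simp add: symgrp_inv_sr_comp)

lemma len_left_down:
  assumes "w \<in> symgrp r" "1 \<le> i" "i < r" "pinv w (Suc i) < pinv w i"
  shows "cox_length r w = Suc (cox_length r (sr i \<circ> w))"
  using len_right_down[of "pinv w" r i] assms cox_length_inv[of "sr i \<circ> w" r]
  by (simp add: symgrp_inv_sr_comp)

lemma len_sr [simp]: "1 \<le> i \<Longrightarrow> i < r \<Longrightarrow> cox_length r (sr i) = 1"
  using len_right_up[of id r i] by simp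

lemma left_descent_exists:
  assumes "w \<in> symgrp r" "w \<noteq> id"
  obtains i where "1 \<le> i" "i < r" "pinv w (Suc i) < pinv w i"
proof -
  have "pinv w \<noteq> id" using assms by (metis inv_id symgrp_inv_inv)
  then show ?thesis using descent_exists[of "pinv w" r] assms that by auto
qed

subsection \<open>Stabilizers of convex partitions\<close>

text \<open>Young subgroups are handled as stabilizers of labellings whose fibres are the blocks.
  The label type is left free because intersections and refinements of partitions are then
  labellings by pairs, as in \<open>refine\<close> and \<open>gam\<close>.\<close>

definition stab :: "nat \<Rightarrow> (nat \<Rightarrow> 'b) \<Rightarrow> (nat \<Rightarrow> nat) set" where
  "stab r b = {w \<in> symgrp r. \<forall>k. b (w k) = b k}"

definition convex_blocks :: "nat \<Rightarrow> (nat \<Rightarrow> 'b) \<Rightarrow> bool" where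
  "convex_blocks r b \<longleftrightarrow> (\<forall>i j k. 1 \<le> i \<longrightarrow> i < j \<longrightarrow> j < k \<longrightarrow> k \<le> r \<longrightarrow> b i = b k \<longrightarrow> b j = b i)"

text \<open>The combinatorial form of being a shortest coset representative:
  \<open>incr_blocks r b w\<close> for cosets w W, and \<open>incr_blocks r b (pinv d)\<close> for
  cosets W d, where W is the stabilizer of b.\<close>

definition incr_blocks :: "nat \<Rightarrow> (nat \<Rightarrow> 'b) \<Rightarrow> (nat \<Rightarrow> nat) \<Rightarrow> bool" where
  "incr_blocks r b w \<longleftrightarrow> (\<forall>i j. 1 \<le> i \<longrightarrow> i < j \<longrightarrow> j \<le> r \<longrightarrow> b i = b j \<longrightarrow> w i < w j)"

lemma convex_blocksD: "convex_blocks r b \<Longrightarrow> 1 \<le> i \<Longrightarrow> i < j \<Longrightarrow> j < k \<Longrightarrow> k \<le> r \<Longrightarrow> b i = b k \<Longrightarrow> b j = b i"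
  unfolding convex_blocks_def by blast

lemma incr_blocksD: "incr_blocks r b w \<Longrightarrow> 1 \<le> i \<Longrightarrow> i < j \<Longrightarrow> j \<le> r \<Longrightarrow> b i = b j \<Longrightarrow> w i < w j"
  unfolding incr_blocks_def by blast

lemma stab_symgrp: "w \<in> stab r b \<Longrightarrow> w \<in> symgrp r" by (simp add: stab_def)

lemma stab_id [simp]: "id \<in> stab r b" by (simp add: stab_def)

lemma stab_comp [simp]: "v \<in> stab r b \<Longrightarrow> w \<in> stab r b \<Longrightarrow> v \<circ> w \<in> stab r b"
  by (simp add: stab_def)

lemma stab_inv [simp]: "w \<in> stab r b \<Longrightarrow> pinv w \<in> stab r b"
  unfolding stab_def by (auto) (metis symgrp_inv_app(2))

lemma stab_finite [simp]: "finite (stab r b)"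
  by (rule finite_subset[OF _ symgrp_finite[of r]]) (auto simp: stab_def)

lemma sr_stab: "1 \<le> i \<Longrightarrow> i < r \<Longrightarrow> b i = b (Suc i) \<Longrightarrow> sr i \<in> stab r b"
  by (auto simp: stab_def Transposition.transpose_def)

text \<open>Convex blocks are intervals, so the order of two positions in different blocks depends
  only on the blocks. Otherwise one interval would contain a point of the other.\<close>

lemma block_order:
  assumes c: "convex_blocks r b" and "{x, y, x', y'} \<subseteq> {1..r}"
    and "b x = b x'" "b y = b y'" "b x \<noteq> b y" "x < y"
  shows "x' < y'"
proof (rule ccontr)
  assume n: "\<not> x' < y'"
  have "x' < y"
  proof (rule ccontr)
    assume "\<not> x' < y"
    then have "y < x'" using assms by (cases "y = x'") auto
    then show False using convex_blocksD[OF c, of x y x'] assms by auto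
  qed
  moreover have "y' < x'" using n assms by (cases "x' = y'") auto
  ultimately show False using convex_blocksD[OF c, of y' x' y] assms by auto
qed

text \<open>By convexity every position between i and j lies in their block, so ascents at adjacent
  positions can be chained.\<close>

lemma incr_blocks_adjacent:
  assumes "convex_blocks r b" "\<And>i. 1 \<le> i \<Longrightarrow> i < r \<Longrightarrow> b i = b (Suc i) \<Longrightarrow> w i < w (Suc i)"
  shows "incr_blocks r b w"
  unfolding incr_blocks_def
proof (intro allI impI)
  fix i j assume "1 \<le> i" "i < j" "j \<le> r" "b i = b j"
  then show "w i < w j"
  proof (induction j)
    case (Suc j)
    show ?case
    proof (cases "i = j")
      case True then show ?thesis using Suc assms(2)[of i] by auto
    next
      case False
      then have "b j = b i" using Suc convex_blocksD[OF assms(1), of i j "Suc j"] by auto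
      then show ?thesis using False Suc assms(2)[of j] by auto
    qed
  qed simp
qed

lemma stab_inversion_same_block:
  assumes "convex_blocks r b" "w \<in> stab r b" "(i, j) \<in> invset r w"
  shows "b i = b j"
proof (rule ccontr)
  assume "b i \<noteq> b j"
  moreover have "{i, j, w i, w j} \<subseteq> {1..r}"
    using assms symgrp_bounds[OF stab_symgrp[OF assms(2)]] by (auto simp: invset_def)
  ultimately have "w i < w j"
    using block_order[OF assms(1), of i j "w i" "w j"] assms by (auto simp: stab_def invset_def)
  then show False using assms by (auto simp: invset_def)
qed

text \<open>The inversions of \<open>pinv d \<circ> pinv w\<close> are split by whether the two
  positions share a block. Those that do are exactly the inversions of \<open>pinv w\<close>, since
  \<open>pinv d\<close> preserves order on blocks. Those that do not are carried by
  \<open>pinv w\<close> onto the inversions of \<open>pinv d\<close>, since \<open>pinv w\<close>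
  preserves the order between blocks; and \<open>pinv d\<close> has no inversion inside a
  block.\<close>

lemma len_additive:
  assumes c: "convex_blocks r b" and w: "w \<in> stab r b" and d: "d \<in> symgrp r" and i: "incr_blocks r b (pinv d)"
  shows "cox_length r (w \<circ> d) = cox_length r w + cox_length r d"
proof -
  define w' d' where "w' = pinv w" and "d' = pinv d"
  have w': "w' \<in> stab r b" "w' \<in> symgrp r" using w by (auto simp: w'_def stab_symgrp)
  have d': "d' \<in> symgrp r" using d by (auto simp: d'_def)
  define same where "same = {(i, j). b i = b j}"
  have bw: "b (w' k) = b k" for k using w'(1) by (simp add: stab_def)
  note bd = symgrp_bounds[OF w'(2)]
  have dd: "d' x < d' y \<longleftrightarrow> x < y" if "x \<in> {1..r}" "y \<in> {1..r}" "b x = b y" for x y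
    using incr_blocksD[OF i, of x y] incr_blocksD[OF i, of y x] that
    by (cases x y rule: linorder_cases) (auto simp: d'_def)
  have rg: "w' x \<in> {1..r}" if "x \<in> {1..r}" for x using bd[of x] that by simp
  have A: "invset r (d' \<circ> w') \<inter> same = invset r w'"
  proof (rule Set.set_eqI, rule iffI)
    fix p :: "nat \<times> nat" assume p: "p \<in> invset r (d' \<circ> w') \<inter> same"
    obtain x y :: nat where xy: "p = (x, y)" by (cases p)
    have 1: "x \<in> {1..r}" "y \<in> {1..r}" "x < y" "b x = b y" "d' (w' y) < d' (w' x)"
      using p by (simp_all add: xy invset_def same_def)
    then have "w' y < w' x" using dd[of "w' y" "w' x"] rg[of x] rg[of y] by (simp add: bw)
    then show "p \<in> invset r w'" using 1 by (simp add: xy invset_def)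
  next
    fix p :: "nat \<times> nat" assume p: "p \<in> invset r w'"
    obtain x y :: nat where xy: "p = (x, y)" by (cases p)
    have "b x = b y" using stab_inversion_same_block[OF c w'(1)] p xy by simp
    moreover have 1: "x \<in> {1..r}" "y \<in> {1..r}" "x < y" "w' y < w' x"
      using p by (simp_all add: xy invset_def)
    moreover have "d' (w' y) < d' (w' x)"
      using dd[of "w' y" "w' x"] rg[of x] rg[of y] calculation by (simp add: bw)
    ultimately show "p \<in> invset r (d' \<circ> w') \<inter> same" by (simp add: xy invset_def same_def)
  qed
  have ord: "x < y \<longleftrightarrow> w' x < w' y" if "x \<in> {1..r}" "y \<in> {1..r}" "b x \<noteq> b y" for x y
    using block_order[OF c, of x y "w' x" "w' y"] block_order[OF c, of "w' x" "w' y" x y]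
      rg[OF that(1)] rg[OF that(2)] that
    by (auto simp: bw)
  have inj: "inj_on (map_prod w' w') X" for X
    using w' by (auto simp: inj_on_def symgrp_inj_iff[OF w'(2)])
  have B: "map_prod w' w' ` (invset r (d' \<circ> w') - same) = invset r d' - same"
  proof (rule Set.set_eqI, rule iffI)
    fix p :: "nat \<times> nat" assume "p \<in> map_prod w' w' ` (invset r (d' \<circ> w') - same)"
    then obtain x y where p: "p = (w' x, w' y)" "(x, y) \<in> invset r (d' \<circ> w') - same" by auto
    then have 1: "x \<in> {1..r}" "y \<in> {1..r}" "x < y" "b x \<noteq> b y" "d' (w' y) < d' (w' x)"
      by (simp_all add: invset_def same_def)
    then show "p \<in> invset r d' - same"
      using ord[of x y] rg[of x] rg[of y] by (simp add: p(1) invset_def same_def bw)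
  next
    fix p :: "nat \<times> nat" assume p: "p \<in> invset r d' - same"
    obtain x y :: nat where xy: "p = (x, y)" by (cases p)
    have wx: "w' (w z) = z" for z using stab_symgrp[OF w] by (simp add: w'_def)
    have bws: "b (w z) = b z" for z using w by (simp add: stab_def)
    have 1: "x \<in> {1..r}" "y \<in> {1..r}" "x < y" "b x \<noteq> b y" "d' y < d' x"
      using p by (simp_all add: xy invset_def same_def)
    have 2: "w x \<in> {1..r}" "w y \<in> {1..r}"
      using symgrp_range[OF stab_symgrp[OF w]] 1 by blast+
    have "(w x, w y) \<in> invset r (d' \<circ> w') - same"
      using 1 2 ord[OF 2] by (simp add: invset_def same_def bws wx)
    then show "p \<in> map_prod w' w' ` (invset r (d' \<circ> w') - same)"
      by (rule image_eqI[rotated]) (simp add: xy wx)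
  qed
  have E: "invset r d' \<inter> same = {}"
  proof (intro equals0I)
    fix p :: "nat \<times> nat" assume p: "p \<in> invset r d' \<inter> same"
    obtain x y :: nat where xy: "p = (x, y)" by (cases p)
    show False using p dd[of x y] by (simp add: xy invset_def same_def)
  qed
  have split: "card X = card (X \<inter> same) + card (X - same)" if "finite X" for X
    using that by (metis card_Diff_subset_Int card_mono finite_Int inf_le1 le_add_diff_inverse)
  have "card (invset r (d' \<circ> w')) = card (invset r w') + card (invset r d' - same)"
    unfolding split[OF finite_invset, of r "d' \<circ> w'"] A B[symmetric] by (simp add: card_image[OF inj])
  also have "card (invset r d' - same) = card (invset r d')" using E by (simp add: Diff_triv)
  finally have "cox_length r (d' \<circ> w') = cox_length r w' + cox_length r d'"
    by (simp only: cox_length_eq[OF w'(2)] cox_length_eq[OF d'] cox_length_eq[OF symgrp_comp[OF d' w'(2)]])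
  moreover have "d' \<circ> w' = pinv (w \<circ> d)"
    using symgrp_inv_comp[OF stab_symgrp[OF w] d] by (simp add: w'_def d'_def)
  ultimately show ?thesis using stab_symgrp[OF w] d by (simp add: w'_def d'_def)
qed

subsection \<open>Existence and uniqueness of the Hecke algebra\<close>

text \<open>Left multiplication by T_s read off on coefficients. If s w < w, then T_w arises from
  T_s T_(s w) with coefficient 1 and from T_s T_w with coefficient q - 1; otherwise it arises only
  from T_s T_(s w), with coefficient q. \<open>Rop\<close> is the same on the right.\<close>

definition Lop :: "'r::comm_ring_1 \<Rightarrow> nat \<Rightarrow> 'r hecke \<Rightarrow> 'r hecke" where
  "Lop q i h = (\<lambda>w. if pinv w (Suc i) < pinv w i then h (sr i \<circ> w) + (q - 1) * h w else q * h (sr i \<circ> w))"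

definition Rop :: "'r::comm_ring_1 \<Rightarrow> nat \<Rightarrow> 'r hecke \<Rightarrow> 'r hecke" where
  "Rop q i h = (\<lambda>w. if w (Suc i) < w i then h (w \<circ> sr i) + (q - 1) * h w else q * h (w \<circ> sr i))"

lemma hecke_carrierD: "h \<in> hecke_carrier r \<Longrightarrow> w \<notin> symgrp r \<Longrightarrow> h w = 0"
  unfolding hecke_carrier_def by blast

lemma hecke_carrierI: "(\<And>w. w \<notin> symgrp r \<Longrightarrow> h w = 0) \<Longrightarrow> h \<in> hecke_carrier r"
  unfolding hecke_carrier_def by blast

lemma hecke_ext:
  assumes "a \<in> hecke_carrier r" "b \<in> hecke_carrier r" "\<And>w. w \<in> symgrp r \<Longrightarrow> a w = b w"
  shows "a = b"
  using assms by (metis ext hecke_carrierD)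

lemma T_carrier [simp]: "w \<in> symgrp r \<Longrightarrow> T_elt w \<in> hecke_carrier r"
  by (rule hecke_carrierI) (auto simp: T_elt_def)

lemma sum_carrier:
  assumes "\<And>x. x \<in> X \<Longrightarrow> g x \<in> hecke_carrier r"
  shows "(\<lambda>w. \<Sum>x\<in>X. c x * g x w) \<in> hecke_carrier r"
proof (rule hecke_carrierI)
  fix w assume "w \<notin> symgrp r"
  then have "g x w = 0" if "x \<in> X" for x using assms[OF that] by (rule hecke_carrierD[rotated])
  then show "(\<Sum>x\<in>X. c x * g x w) = 0" by simp
qed

lemma add_carrier [simp]:
  "a \<in> hecke_carrier r \<Longrightarrow> b \<in> hecke_carrier r \<Longrightarrow> (\<lambda>w. a w + b w) \<in> hecke_carrier r"
  by (rule hecke_carrierI) (simp add: hecke_carrierD)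

lemma scale_carrier [simp]: "a \<in> hecke_carrier r \<Longrightarrow> (\<lambda>w. c * a w) \<in> hecke_carrier r"
  by (rule hecke_carrierI) (simp add: hecke_carrierD)

lemma zero_carrier [simp]: "(\<lambda>w. 0) \<in> hecke_carrier r"
  by (rule hecke_carrierI) simp

lemma Lop_closed [simp]:
  "1 \<le> i \<Longrightarrow> i < r \<Longrightarrow> h \<in> hecke_carrier r \<Longrightarrow> Lop q i h \<in> hecke_carrier r"
  by (rule hecke_carrierI) (simp add: Lop_def hecke_carrierD symgrp_sr_comp_iff)

lemma Rop_closed [simp]:
  "1 \<le> i \<Longrightarrow> i < r \<Longrightarrow> h \<in> hecke_carrier r \<Longrightarrow> Rop q i h \<in> hecke_carrier r"
  by (rule hecke_carrierI) (simp add: Rop_def hecke_carrierD symgrp_comp_sr_iff)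

lemma Lop_sum: "Lop q i (\<lambda>w. \<Sum>x\<in>X. c x * g x w) = (\<lambda>w. \<Sum>x\<in>X. c x * Lop q i (g x) w)"
  unfolding Lop_def by (rule ext) (simp add: sum.distrib sum_subtractf sum_distrib_left algebra_simps)

lemma Rop_sum: "Rop q i (\<lambda>w. \<Sum>x\<in>X. c x * g x w) = (\<lambda>w. \<Sum>x\<in>X. c x * Rop q i (g x) w)"
  unfolding Rop_def by (rule ext) (simp add: sum.distrib sum_subtractf sum_distrib_left algebra_simps)

lemma comp_sr_eq:
  assumes "w \<in> symgrp r" "{w j, w (Suc j)} = {i, Suc i}"
  shows "sr i \<circ> w = w \<circ> sr j"
proof
  fix x
  note inj = symgrp_inj_iff[OF assms(1)]
  consider "x = j" | "x = Suc j" | "x \<noteq> j" "x \<noteq> Suc j" by blast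
  then show "(sr i \<circ> w) x = (w \<circ> sr j) x"
  proof cases
    case 3
    then have "w x \<notin> {w j, w (Suc j)}" by (simp add: inj)
    then have "w x \<noteq> i" "w x \<noteq> Suc i" unfolding assms(2) by simp_all
    then show ?thesis using 3 by simp
  qed (use assms(2) in \<open>auto simp: doubleton_eq_iff\<close>)
qed

text \<open>The dichotomy behind the commutation of left and right multiplications. Exchanging the
  values i and i + 1 affects a descent at j only if these are the values at j and j + 1, that is,
  only if s_i w = w s_j; then the descent is reversed, and left and right descents of w
  agree.\<close>

lemma comp_sr_descent:
  assumes w: "w \<in> symgrp r" and ij: "1 \<le> i" "i < r" "1 \<le> j" "j < r"
  shows "sr i \<circ> w = w \<circ> sr j \<longleftrightarrow> {w j, w (Suc j)} = {i, Suc i}"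
    and "sr i \<circ> w \<noteq> w \<circ> sr j \<Longrightarrow> sr i (w (Suc j)) < sr i (w j) \<longleftrightarrow> w (Suc j) < w j"
    and "sr i \<circ> w = w \<circ> sr j \<Longrightarrow> sr i (w (Suc j)) < sr i (w j) \<longleftrightarrow> w j < w (Suc j)"
    and "sr i \<circ> w = w \<circ> sr j \<Longrightarrow> pinv w (Suc i) < pinv w i \<longleftrightarrow> w (Suc j) < w j"
proof -
  have ne: "w j \<noteq> w (Suc j)" using symgrp_inj_iff[OF w, of j "Suc j"] by simp
  show 1: "sr i \<circ> w = w \<circ> sr j \<longleftrightarrow> {w j, w (Suc j)} = {i, Suc i}"
  proof
    assume "sr i \<circ> w = w \<circ> sr j"
    then have "sr i (w j) = w (Suc j)" by (metis comp_apply transpose_apply_first)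
    then show "{w j, w (Suc j)} = {i, Suc i}"
      using ne by (auto simp: Transposition.transpose_def split: if_splits)
  qed (rule comp_sr_eq[OF w])
  show "sr i \<circ> w \<noteq> w \<circ> sr j \<Longrightarrow> sr i (w (Suc j)) < sr i (w j) \<longleftrightarrow> w (Suc j) < w j"
    unfolding 1 by (rule sr_less_iff) (use ne in \<open>auto simp: doubleton_eq_iff\<close>)
  show "sr i \<circ> w = w \<circ> sr j \<Longrightarrow> sr i (w (Suc j)) < sr i (w j) \<longleftrightarrow> w j < w (Suc j)"
    unfolding 1 by (auto simp: doubleton_eq_iff)
  show "sr i \<circ> w = w \<circ> sr j \<Longrightarrow> pinv w (Suc i) < pinv w i \<longleftrightarrow> w (Suc j) < w j"
    unfolding 1 using symgrp_inv_app(1)[OF w, of j] symgrp_inv_app(1)[OF w, of "Suc j"]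
    by (auto simp: doubleton_eq_iff)
qed

lemma inv_comp_sr_descent:
  assumes w: "w \<in> symgrp r" and ij: "1 \<le> i" "i < r" "1 \<le> j" "j < r"
    and ne: "sr i \<circ> w \<noteq> w \<circ> sr j"
  shows "pinv (w \<circ> sr j) (Suc i) < pinv (w \<circ> sr j) i \<longleftrightarrow> pinv w (Suc i) < pinv w i"
proof -
  have "sr j \<circ> pinv w \<noteq> pinv w \<circ> sr i"
  proof
    assume *: "sr j \<circ> pinv w = pinv w \<circ> sr i"
    have "sr i \<circ> w = w \<circ> (pinv w \<circ> sr i) \<circ> w" using w by (simp add: comp_def)
    also have "\<dots> = w \<circ> sr j" unfolding *[symmetric] using w by (simp add: comp_def)
    finally show False using ne by simp
  qed
  then show ?thesis
    using comp_sr_descent(2)[OF symgrp_inv[OF w] ij(3,4,1,2)] symgrp_inv_comp_sr[OF ij(3,4) w] by simp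
qed

text \<open>If s_i w and w s_j differ, the two descent tests do not influence each other and both
  sides expand to the same expression. If they coincide, only the values at w and s_i w occur and
  both operators act on them in the same way.\<close>

lemma Lop_Rop_commute:
  assumes ij: "1 \<le> i" "i < r" "1 \<le> j" "j < r" and h: "h \<in> hecke_carrier r"
  shows "Lop q i (Rop q j h) = Rop q j (Lop q i h)"
proof (rule hecke_ext[of _ r])
  fix w assume w: "w \<in> symgrp r"
  have assoc: "sr i \<circ> (w \<circ> sr j) = sr i \<circ> w \<circ> sr j" by (simp add: comp_assoc)
  have ne: "w j \<noteq> w (Suc j)" using symgrp_inj_iff[OF w, of j "Suc j"] by simp
  show "Lop q i (Rop q j h) w = Rop q j (Lop q i h) w"
  proof (cases "sr i \<circ> w = w \<circ> sr j")
    case True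
    note d = comp_sr_descent(3,4)[OF w ij True]
    have e: "sr i \<circ> w \<circ> sr j = w" "pinv (w \<circ> sr j) = pinv w \<circ> sr i"
      unfolding True[symmetric] using symgrp_inv_sr_comp[OF ij(1,2) w] by (simp_all add: True)
    moreover have "pinv w i \<noteq> pinv w (Suc i)" using symgrp_inj_iff[OF symgrp_inv[OF w], of i "Suc i"] by simp
    ultimately show ?thesis unfolding Lop_def Rop_def assoc
      using d ne by (simp add: True) (auto simp: algebra_simps)
  next
    case False
    note d = comp_sr_descent(2)[OF w ij False] inv_comp_sr_descent[OF w ij False]
    show ?thesis unfolding Lop_def Rop_def assoc o_apply d
      by (simp add: algebra_simps)
  qed
qed (use ij h in simp_all)

lemma hecke_expand:
  "h \<in> hecke_carrier r \<Longrightarrow> h = (\<lambda>w. \<Sum>y\<in>symgrp r. h y * T_elt y w)"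
  by (rule ext) (auto simp: T_elt_def hecke_carrierD if_distrib cong: if_cong)

lemma Lop_T_up:
  assumes "w \<in> symgrp r" "1 \<le> i" "i < r" "pinv w i < pinv w (Suc i)"
  shows "Lop q i (T_elt w) = T_elt (sr i \<circ> w)"
proof (rule hecke_ext[of _ r])
  fix u assume u: "u \<in> symgrp r"
  have 1: "sr i \<circ> u = w \<longleftrightarrow> u = sr i \<circ> w" by auto
  have 2: "pinv (sr i \<circ> w) (Suc i) < pinv (sr i \<circ> w) i"
    using assms by (simp add: symgrp_inv_sr_comp)
  have 3: "sr i \<circ> w \<noteq> w" using assms 2 by auto
  show "Lop q i (T_elt w) u = T_elt (sr i \<circ> w) u"
    unfolding Lop_def T_elt_def 1 using assms 2 3 by auto
qed (use assms in simp_all)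

lemma Lop_T_down:
  assumes "w \<in> symgrp r" "1 \<le> i" "i < r" "pinv w (Suc i) < pinv w i"
  shows "Lop q i (T_elt w) = (\<lambda>u. (q - 1) * T_elt w u + q * T_elt (sr i \<circ> w) u)"
proof (rule hecke_ext[of _ r])
  fix u assume u: "u \<in> symgrp r"
  have 1: "sr i \<circ> u = w \<longleftrightarrow> u = sr i \<circ> w" by auto
  have 2: "pinv (sr i \<circ> w) i < pinv (sr i \<circ> w) (Suc i)"
    using assms by (simp add: symgrp_inv_sr_comp)
  have 3: "sr i \<circ> w \<noteq> w" using assms 2 by auto
  show "Lop q i (T_elt w) u = (q - 1) * T_elt w u + q * T_elt (sr i \<circ> w) u"
    unfolding Lop_def T_elt_def 1 using assms 2 3 by auto
qed (use assms in simp_all)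

lemma Rop_T_up:
  assumes "w \<in> symgrp r" "1 \<le> i" "i < r" "w i < w (Suc i)"
  shows "Rop q i (T_elt w) = T_elt (w \<circ> sr i)"
proof (rule hecke_ext[of _ r])
  fix u assume u: "u \<in> symgrp r"
  have 1: "u \<circ> sr i = w \<longleftrightarrow> u = w \<circ> sr i" by auto
  have 2: "(w \<circ> sr i) (Suc i) < (w \<circ> sr i) i" using assms by simp
  have 3: "w \<circ> sr i \<noteq> w" using assms 2 by (metis not_less_iff_gr_or_eq)
  show "Rop q i (T_elt w) u = T_elt (w \<circ> sr i) u"
    unfolding Rop_def T_elt_def 1 using assms 2 3 by auto
qed (use assms in simp_all)

section \<open>Left multiplication operators and the product they define\<close>

text \<open>The operators that behave like left multiplications: they commute with all right multiplications and are
  therefore determined by their value at the unit. This is what yields associativity.\<close>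

definition leftop :: "nat \<Rightarrow> 'r::comm_ring_1 \<Rightarrow> ('r hecke \<Rightarrow> 'r hecke) \<Rightarrow> bool" where
  "leftop r q P \<longleftrightarrow> (\<forall>h \<in> hecke_carrier r. P h \<in> hecke_carrier r) \<and>
     (\<forall>c g. (\<forall>y \<in> symgrp r. g y \<in> hecke_carrier r) \<longrightarrow>
       P (\<lambda>w. \<Sum>y\<in>symgrp r. c y * g y w) = (\<lambda>w. \<Sum>y\<in>symgrp r. c y * P (g y) w)) \<and>
     (\<forall>h \<in> hecke_carrier r. \<forall>j. 1 \<le> j \<longrightarrow> j < r \<longrightarrow> P (Rop q j h) = Rop q j (P h))"

lemma leftopD:
  assumes "leftop r q P"
  shows "h \<in> hecke_carrier r \<Longrightarrow> P h \<in> hecke_carrier r"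
    and "(\<And>y. y \<in> symgrp r \<Longrightarrow> g y \<in> hecke_carrier r) \<Longrightarrow>
      P (\<lambda>w. \<Sum>y\<in>symgrp r. c y * g y w) = (\<lambda>w. \<Sum>y\<in>symgrp r. c y * P (g y) w)"
    and "h \<in> hecke_carrier r \<Longrightarrow> 1 \<le> j \<Longrightarrow> j < r \<Longrightarrow> P (Rop q j h) = Rop q j (P h)"
  using assms unfolding leftop_def by blast+

text \<open>Right operators lead from \<open>T_elt id\<close> to every \<open>T_elt w\<close> along
  right descents, and P and Q commute with them; linearity does the rest.\<close>

lemma leftop_unique:
  assumes P: "leftop r q P" and Q: "leftop r q Q" and e: "P (T_elt id) = Q (T_elt id)" and h: "h \<in> hecke_carrier r"
  shows "P h = Q h"
proof -
  have T: "P (T_elt w) = Q (T_elt w)" if "w \<in> symgrp r" for w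
    using that
  proof (induction "cox_length r w" arbitrary: w rule: less_induct)
    case less
    show ?case
    proof (cases "w = id")
      case True then show ?thesis using e by simp
    next
      case False
      then obtain i where i: "1 \<le> i" "i < r" "w (Suc i) < w i"
        using descent_exists[OF less.prems] by blast
      define v where "v = w \<circ> sr i"
      have v: "v \<in> symgrp r" "v i < v (Suc i)" "w = v \<circ> sr i" using less.prems i by (simp_all add: v_def)
      have "cox_length r v < cox_length r w"
        using len_right_down[OF less.prems i] by (simp add: v_def)
      then have "P (T_elt v) = Q (T_elt v)" using less.hyps v by blast
      moreover have "T_elt w = Rop q i (T_elt v)"
        using Rop_T_up[OF v(1) i(1,2) v(2), of q] v(3) by simp
      ultimately show ?thesis
        using leftopD(3)[OF P _ i(1,2)] leftopD(3)[OF Q _ i(1,2)] v by simp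
    qed
  qed
  have "P (\<lambda>w. \<Sum>y\<in>symgrp r. h y * T_elt y w) = Q (\<lambda>w. \<Sum>y\<in>symgrp r. h y * T_elt y w)"
    by (subst leftopD(2)[OF P], simp, subst leftopD(2)[OF Q], simp) (simp add: T)
  then show ?thesis using hecke_expand[OF h] by simp
qed

lemma leftop_id: "leftop r q (\<lambda>h. h)"
  by (simp add: leftop_def)

lemma leftop_comp:
  assumes "leftop r q P" "leftop r q Q" shows "leftop r q (\<lambda>h. P (Q h))"
  unfolding leftop_def
proof (intro conjI ballI allI impI)
  fix c :: "(nat \<Rightarrow> nat) \<Rightarrow> 'a" and g :: "(nat \<Rightarrow> nat) \<Rightarrow> 'a hecke" assume "\<forall>y\<in>symgrp r. g y \<in> hecke_carrier r"
  then show "P (Q (\<lambda>w. \<Sum>y\<in>symgrp r. c y * g y w)) = (\<lambda>w. \<Sum>y\<in>symgrp r. c y * P (Q (g y)) w)"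
    by (subst leftopD(2)[OF assms(2)], simp, subst leftopD(2)[OF assms(1)])
      (simp_all add: leftopD(1)[OF assms(2)])
qed (simp_all add: leftopD[OF assms(1)] leftopD[OF assms(2)])

lemma leftop_Lop: "1 \<le> i \<Longrightarrow> i < r \<Longrightarrow> leftop r q (Lop q i)"
  unfolding leftop_def by (simp add: Lop_Rop_commute Lop_sum)

lemma leftop_sum:
  assumes "\<And>y. y \<in> symgrp r \<Longrightarrow> leftop r q (P y)"
  shows "leftop r q (\<lambda>h w. \<Sum>y\<in>symgrp r. a y * P y h w)"
  unfolding leftop_def
proof (intro conjI ballI allI impI)
  fix h :: "'a hecke" assume "h \<in> hecke_carrier r"
  then show "(\<lambda>w. \<Sum>y\<in>symgrp r. a y * P y h w) \<in> hecke_carrier r"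
    by (intro sum_carrier leftopD(1)[OF assms])
next
  fix c :: "(nat \<Rightarrow> nat) \<Rightarrow> 'a" and g :: "(nat \<Rightarrow> nat) \<Rightarrow> 'a hecke" assume g: "\<forall>y\<in>symgrp r. g y \<in> hecke_carrier r"
  have "P y (\<lambda>w. \<Sum>y\<in>symgrp r. c y * g y w) = (\<lambda>w. \<Sum>z\<in>symgrp r. c z * P y (g z) w)" if "y \<in> symgrp r" for y
    using leftopD(2)[OF assms[OF that]] g by blast
  then have "(\<Sum>y\<in>symgrp r. a y * P y (\<lambda>w. \<Sum>y\<in>symgrp r. c y * g y w) w) =
      (\<Sum>y\<in>symgrp r. \<Sum>z\<in>symgrp r. a y * (c z * P y (g z) w))" for w
    by (intro sum.cong refl) (simp add: sum_distrib_left)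
  moreover have "(\<Sum>y\<in>symgrp r. \<Sum>z\<in>symgrp r. a y * (c z * P y (g z) w)) = (\<Sum>z\<in>symgrp r. \<Sum>y\<in>symgrp r. a y * (c z * P y (g z) w))" for w
    by (rule sum.swap)
  ultimately show "(\<lambda>w. \<Sum>y\<in>symgrp r. a y * P y (\<lambda>w. \<Sum>y\<in>symgrp r. c y * g y w) w) =
      (\<lambda>w. \<Sum>y\<in>symgrp r. c y * (\<Sum>x\<in>symgrp r. a x * P x (g y) w))"
    by (simp add: sum_distrib_left mult.left_commute)
next
  fix h :: "'a hecke" and j assume "h \<in> hecke_carrier r" "1 \<le> j" "j < r"
  then show "(\<lambda>w. \<Sum>y\<in>symgrp r. a y * P y (Rop q j h) w) = Rop q j (\<lambda>w. \<Sum>y\<in>symgrp r. a y * P y h w)"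
    by (simp add: Rop_sum leftopD(3)[OF assms])
qed

text \<open>Composing the operators \<open>Lop\<close> along a reduced word of w works. Different
  words give the same operator by \<open>leftop_unique\<close>, so the choice made in
  \<open>opL\<close> is harmless and no braid relations have to be checked.\<close>

lemma exists_leftop:
  "w \<in> symgrp r \<Longrightarrow> \<exists>P. leftop r q P \<and> P (T_elt id) = T_elt w"
proof (induction "cox_length r w" arbitrary: w rule: less_induct)
  case less
  show ?case
  proof (cases "w = id")
    case True then show ?thesis using leftop_id by blast
  next
    case False
    then obtain i where i: "1 \<le> i" "i < r" "pinv w (Suc i) < pinv w i"
      using left_descent_exists[OF less.prems] by blast
    define v where "v = sr i \<circ> w"
    have v: "v \<in> symgrp r" "pinv v i < pinv v (Suc i)" "w = sr i \<circ> v"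
      using less.prems i by (simp_all add: v_def symgrp_inv_sr_comp)
    have "cox_length r v < cox_length r w"
      using len_left_down[OF less.prems i] by (simp add: v_def)
    then obtain P where "leftop r q P" "P (T_elt id) = T_elt v" using less.hyps v by blast
    then show ?thesis
      using leftop_comp[OF leftop_Lop[OF i(1,2), of q]] Lop_T_up[OF v(1) i(1,2) v(2), of q] v(3)
      by (intro exI[of _ "\<lambda>h. Lop q i (P h)"]) simp
  qed
qed

definition opL :: "nat \<Rightarrow> 'r::comm_ring_1 \<Rightarrow> (nat \<Rightarrow> nat) \<Rightarrow> 'r hecke \<Rightarrow> 'r hecke" where
  "opL r q w = (SOME P. leftop r q P \<and> P (T_elt id) = T_elt w)"

lemma opL:
  assumes "w \<in> symgrp r"
  shows "leftop r q (opL r q w)" "opL r q w (T_elt id) = T_elt w"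
  using someI_ex[OF exists_leftop[OF assms, of q]] by (simp_all add: opL_def)

definition hm :: "nat \<Rightarrow> 'r::comm_ring_1 \<Rightarrow> 'r hecke \<Rightarrow> 'r hecke \<Rightarrow> 'r hecke" where
  "hm r q a b = (\<lambda>w. \<Sum>y\<in>symgrp r. a y * opL r q y b w)"

lemma leftop_hm: "leftop r q (hm r q a)"
  unfolding hm_def by (intro leftop_sum opL)

lemma hm_closed [simp]: "b \<in> hecke_carrier r \<Longrightarrow> hm r q a b \<in> hecke_carrier r"
  by (rule leftopD(1)[OF leftop_hm])

lemma hm_T_id_right [simp]:
  assumes "a \<in> hecke_carrier r" shows "hm r q a (T_elt id) = a"
proof -
  have "hm r q a (T_elt id) = (\<lambda>w. \<Sum>y\<in>symgrp r. a y * T_elt y w)"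
    by (simp add: hm_def opL(2))
  then show ?thesis using hecke_expand[OF assms] by simp
qed

text \<open>Both operators commute with right multiplications and agree at the unit. The left unit
  law and associativity are instances of this.\<close>

lemma leftop_eq_hm:
  assumes "leftop r q P" "h \<in> hecke_carrier r"
  shows "P h = hm r q (P (T_elt id)) h"
  using leftop_unique[OF assms(1) leftop_hm _ assms(2), of "P (T_elt id)"] leftopD(1)[OF assms(1)] by simp

lemma hm_T_id_left [simp]: "h \<in> hecke_carrier r \<Longrightarrow> hm r q (T_elt id) h = h"
  using leftop_eq_hm[OF leftop_id] by metis

lemma hm_assoc:
  assumes "a \<in> hecke_carrier r" "b \<in> hecke_carrier r" "c \<in> hecke_carrier r"
  shows "hm r q (hm r q a b) c = hm r q a (hm r q b c)"
  using leftop_eq_hm[OF leftop_comp[OF leftop_hm leftop_hm] assms(3), of q a b] assms by simp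

lemma hm_T_sr_left:
  assumes "1 \<le> i" "i < r" "h \<in> hecke_carrier r"
  shows "hm r q (T_elt (sr i)) h = Lop q i h"
proof -
  have "Lop q i (T_elt id) = T_elt (sr i)"
    using Lop_T_up[of id r i q] assms by simp
  then show ?thesis using leftop_eq_hm[OF leftop_Lop[OF assms(1,2)] assms(3), of q] by simp
qed

lemma hm_T_sr_right:
  assumes "1 \<le> i" "i < r" "h \<in> hecke_carrier r"
  shows "hm r q h (T_elt (sr i)) = Rop q i h"
proof -
  have "Rop q i (T_elt id) = T_elt (sr i)"
    using Rop_T_up[of id r i q] assms by simp
  then show ?thesis using leftopD(3)[OF leftop_hm, of "T_elt id" r i q h] assms by simp
qed

lemma len_sr_comp_le:
  assumes "w \<in> symgrp r" "1 \<le> i" "i < r"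
  shows "cox_length r (sr i \<circ> w) \<le> Suc (cox_length r w)"
proof -
  have "pinv w i \<noteq> pinv w (Suc i)" using symgrp_inj_iff[OF symgrp_inv[OF assms(1)], of i "Suc i"] by simp
  then show ?thesis using len_left_up[OF assms] len_left_down[OF assms] by (cases "pinv w i < pinv w (Suc i)") auto
qed

lemma left_descent_induct [consumes 1, case_names id step]:
  assumes "w \<in> symgrp r" and "P id"
    and step: "\<And>i v. 1 \<le> i \<Longrightarrow> i < r \<Longrightarrow> v \<in> symgrp r \<Longrightarrow> pinv v i < pinv v (Suc i) \<Longrightarrow> P v \<Longrightarrow> P (sr i \<circ> v)"
  shows "P w"
  using assms(1)
proof (induction "cox_length r w" arbitrary: w rule: less_induct)
  case less
  show ?case
  proof (cases "w = id")
    case True then show ?thesis using assms(2) by simp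
  next
    case False
    then obtain i where i: "1 \<le> i" "i < r" "pinv w (Suc i) < pinv w i"
      using left_descent_exists[OF less.prems] by blast
    define v where "v = sr i \<circ> w"
    have v: "v \<in> symgrp r" "pinv v i < pinv v (Suc i)" "w = sr i \<circ> v"
      using less.prems i by (simp_all add: v_def symgrp_inv_sr_comp)
    have "cox_length r v < cox_length r w"
      using len_left_down[OF less.prems i] by (simp add: v_def)
    then have "P v" using less.hyps v by blast
    then show ?thesis using step[OF i(1,2) v(1,2)] v(3) by simp
  qed
qed

lemma cox_length_comp_le:
  assumes "v \<in> symgrp r" "w \<in> symgrp r"
  shows "cox_length r (v \<circ> w) \<le> cox_length r v + cox_length r w"
proof (rule left_descent_induct[OF assms(1), where P = "\<lambda>v. cox_length r (v \<circ> w) \<le> cox_length r v + cox_length r w"])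
  fix i v assume i: "1 \<le> i" "i < r" and v: "v \<in> symgrp r" "pinv v i < pinv v (Suc i)"
    and IH: "cox_length r (v \<circ> w) \<le> cox_length r v + cox_length r w"
  have "cox_length r (sr i \<circ> (v \<circ> w)) \<le> Suc (cox_length r (v \<circ> w))"
    using i v assms by (intro len_sr_comp_le) auto
  then show "cox_length r (sr i \<circ> v \<circ> w) \<le> cox_length r (sr i \<circ> v) + cox_length r w"
    using IH len_left_up[OF v(1) i v(2)] unfolding comp_assoc by linarith
qed (simp add: assms)

lemma hm_T_T:
  assumes "v \<in> symgrp r" "w \<in> symgrp r" "cox_length r (v \<circ> w) = cox_length r v + cox_length r w"
  shows "hm r q (T_elt v) (T_elt w) = T_elt (v \<circ> w)"
proof -
  have "cox_length r (v \<circ> w) = cox_length r v + cox_length r w \<longrightarrow> hm r q (T_elt v) (T_elt w) = T_elt (v \<circ> w)"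
    (is "?P v")
  proof (rule left_descent_induct[OF assms(1), where P = ?P])
    have "hm r q (T_elt id) (T_elt w) = T_elt (id \<circ> w)" using assms(2) by simp
    then show "?P id" by blast
  next
    fix i v assume step: "1 \<le> i" "i < r" "v \<in> symgrp r" "pinv v i < pinv v (Suc i)" "?P v"
    show "?P (sr i \<circ> v)"
    proof
      assume prem: "cox_length r (sr i \<circ> v \<circ> w) = cox_length r (sr i \<circ> v) + cox_length r w"
      have vw: "v \<circ> w \<in> symgrp r" using step assms by simp
      have len: "cox_length r (sr i \<circ> (v \<circ> w)) = Suc (cox_length r v) + cox_length r w"
        using prem len_left_up[OF step(3,1,2,4)] unfolding comp_assoc by linarith
      \<comment> \<open>The length of s v w is at most 1 + l(v w) and hence at most 1 + l(v) + l(w).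
        Equality of the outer terms forces additivity for v w, and also that multiplication by s is
        an ascent.\<close>
      have 1: "cox_length r (v \<circ> w) = cox_length r v + cox_length r w"
        using len len_sr_comp_le[OF vw step(1,2)] cox_length_comp_le[OF step(3) assms(2)] by linarith
      have "pinv (v \<circ> w) i \<noteq> pinv (v \<circ> w) (Suc i)"
        using symgrp_inj_iff[OF symgrp_inv[OF vw], of i "Suc i"] by simp
      then have 2: "pinv (v \<circ> w) i < pinv (v \<circ> w) (Suc i)"
        using len_left_down[OF vw step(1,2)] len 1 by (cases "pinv (v \<circ> w) i < pinv (v \<circ> w) (Suc i)") auto
      have T: "T_elt (sr i \<circ> v) = hm r q (T_elt (sr i)) (T_elt v)"
        using Lop_T_up[OF step(3,1,2,4), of q] step by (simp add: hm_T_sr_left)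
      have "hm r q (T_elt (sr i \<circ> v)) (T_elt w) = hm r q (T_elt (sr i)) (hm r q (T_elt v) (T_elt w))"
        unfolding T using step assms by (intro hm_assoc) auto
      also have "\<dots> = Lop q i (T_elt (v \<circ> w))"
        unfolding mp[OF step(5) 1] using step vw by (simp add: hm_T_sr_left)
      also have "\<dots> = T_elt (sr i \<circ> v \<circ> w)"
        using Lop_T_up[OF vw step(1,2) 2, of q] by (simp add: comp_assoc)
      finally show "hm r q (T_elt (sr i \<circ> v)) (T_elt w) = T_elt (sr i \<circ> v \<circ> w)" .
    qed
  qed
  then show ?thesis using assms(3) by blast
qed

lemma hm_T_left: "y \<in> symgrp r \<Longrightarrow> hm r q (T_elt y) b = opL r q y b"
proof (rule ext)
  fix w assume y: "y \<in> symgrp r"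
  have "hm r q (T_elt y) b w = (\<Sum>z\<in>symgrp r. if z = y then opL r q z b w else 0)"
    unfolding hm_def by (rule sum.cong) (auto simp: T_elt_def)
  then show "hm r q (T_elt y) b w = opL r q y b w" using y by simp
qed

lemma hm_sum_left:
  "hm r q (\<lambda>w. \<Sum>x\<in>X. c x * g x w) b = (\<lambda>w. \<Sum>x\<in>X. c x * hm r q (g x) b w)"
  unfolding hm_def
  by (rule ext) (simp add: sum_distrib_left sum_distrib_right mult.assoc sum.swap[of _ X])

lemma hm_expand:
  assumes "b \<in> hecke_carrier r"
  shows "hm r q a b = (\<lambda>w. \<Sum>y\<in>symgrp r. \<Sum>z\<in>symgrp r. a y * b z * hm r q (T_elt y) (T_elt z) w)"
proof -
  have "opL r q y b = (\<lambda>w. \<Sum>z\<in>symgrp r. b z * opL r q y (T_elt z) w)" if "y \<in> symgrp r" for y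
    using leftopD(2)[OF opL(1)[OF that, of q], where g = T_elt and c = b] hecke_expand[OF assms] by simp
  then show ?thesis
    unfolding hm_def[of r q a] by (simp add: hm_T_left sum_distrib_left mult.assoc)
qed

section \<open>Characterization of the product and the chosen \<open>hmult\<close>\<close>

lemma is_hecke_product_hm: "is_hecke_product r q (hm r q)"
  unfolding is_hecke_product_def
proof (intro conjI ballI impI)
  fix s assume "s \<in> simple_refls r"
  then obtain i where i: "s = sr i" "1 \<le> i" "i < r" by (auto simp: simple_refls_def)
  have "pinv (sr i) (Suc i) < pinv (sr i) i" by simp
  then show "hm r q (T_elt s) (T_elt s) = (\<lambda>w. (q - 1) * T_elt s w + q * T_elt id w)"
    using Lop_T_down[of "sr i" r i q] i by (simp add: hm_T_sr_left)
next
  fix a b :: "'a hecke" assume "b \<in> hecke_carrier r"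
  then show "hm r q a b = (\<lambda>w. \<Sum>y\<in>symgrp r. \<Sum>z\<in>symgrp r. a y * b z * hm r q (T_elt y) (T_elt z) w)"
    by (rule hm_expand)
qed (auto simp: hm_assoc hm_T_T)

text \<open>Bilinearity reduces the claim to left factors T_v, and induction on v to T_s. The value
  of T_s T_w is forced: at an ascent by the length rule, at a descent by writing T_w = T_s T_v and
  using associativity with the quadratic relation.\<close>

lemma is_hecke_product_unique:
  assumes M: "is_hecke_product r q mul" and a: "a \<in> hecke_carrier r" and b: "b \<in> hecke_carrier r"
  shows "mul a b = hm r q a b"
proof -
  have expand: "mul a b = (\<lambda>w. \<Sum>y\<in>symgrp r. \<Sum>z\<in>symgrp r. a y * b z * mul (T_elt y) (T_elt z) w)"
    if "a \<in> hecke_carrier r" "b \<in> hecke_carrier r" for a b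
    using M that unfolding is_hecke_product_def by blast
  have assoc: "mul (mul a b) c = mul a (mul b c)"
    if "a \<in> hecke_carrier r" "b \<in> hecke_carrier r" "c \<in> hecke_carrier r" for a b c
    using M that unfolding is_hecke_product_def by blast
  have sq: "mul (T_elt (sr i)) (T_elt (sr i)) = (\<lambda>w. (q - 1) * T_elt (sr i) w + q * T_elt id w)"
    if "1 \<le> i" "i < r" for i
    using M that unfolding is_hecke_product_def simple_refls_def by blast
  have TT: "mul (T_elt v) (T_elt w) = T_elt (v \<circ> w)"
    if "v \<in> symgrp r" "w \<in> symgrp r" "cox_length r (v \<circ> w) = cox_length r v + cox_length r w" for v w
    using M that unfolding is_hecke_product_def by blast
  have left: "mul (T_elt v) b = (\<lambda>w. \<Sum>z\<in>symgrp r. b z * mul (T_elt v) (T_elt z) w)"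
    if "v \<in> symgrp r" "b \<in> hecke_carrier r" for v b
  proof
    fix w
    have "mul (T_elt v) b w = (\<Sum>y\<in>symgrp r. if y = v then \<Sum>z\<in>symgrp r. b z * mul (T_elt v) (T_elt z) w else 0)"
      unfolding expand[OF T_carrier[OF that(1)] that(2)]
      by (rule sum.cong) (auto simp: T_elt_def)
    then show "mul (T_elt v) b w = (\<Sum>z\<in>symgrp r. b z * mul (T_elt v) (T_elt z) w)" using that by simp
  qed
  have right: "mul a (T_elt v) = (\<lambda>w. \<Sum>y\<in>symgrp r. a y * mul (T_elt y) (T_elt v) w)"
    if "v \<in> symgrp r" "a \<in> hecke_carrier r" for v a
  proof
    fix w
    have "(\<Sum>z\<in>symgrp r. a y * T_elt v z * mul (T_elt y) (T_elt z) w) =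
        (\<Sum>z\<in>symgrp r. if z = v then a y * mul (T_elt y) (T_elt v) w else 0)" for y
      by (rule sum.cong) (auto simp: T_elt_def)
    then show "mul a (T_elt v) w = (\<Sum>y\<in>symgrp r. a y * mul (T_elt y) (T_elt v) w)"
      unfolding expand[OF that(2) T_carrier[OF that(1)]] using that by simp
  qed
  have T1: "mul (T_elt id) (T_elt w) = T_elt w" if "w \<in> symgrp r" for w
    using TT[of id w] that by simp
  have sT: "mul (T_elt (sr i)) (T_elt w) = Lop q i (T_elt w)" if i: "1 \<le> i" "i < r" and w: "w \<in> symgrp r" for i w
  proof -
    have "pinv w i \<noteq> pinv w (Suc i)" using symgrp_inj_iff[OF symgrp_inv[OF w], of i "Suc i"] by simp
    then consider "pinv w i < pinv w (Suc i)" | "pinv w (Suc i) < pinv w i" by linarith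
    then show ?thesis
    proof cases
      case 1
      then show ?thesis using TT[of "sr i" w] i w len_left_up[OF w i] Lop_T_up[OF w i, of q] by simp
    next
      case 2
      \<comment> \<open>T_w = T_s T_v with v shorter, so that the square of T_s appears on the left
        and the quadratic relation applies.\<close>
      define v where "v = sr i \<circ> w"
      have v: "v \<in> symgrp r" "pinv v i < pinv v (Suc i)" "w = sr i \<circ> v"
        using w i 2 by (simp_all add: v_def symgrp_inv_sr_comp)
      have e: "T_elt w = mul (T_elt (sr i)) (T_elt v)"
        using TT[of "sr i" v] v i len_left_up[OF v(1) i] by simp
      have "mul (T_elt (sr i)) (T_elt w) = mul (mul (T_elt (sr i)) (T_elt (sr i))) (T_elt v)"
        unfolding e using assoc i v by simp
      also have "\<dots> = (\<lambda>u. \<Sum>y\<in>symgrp r. ((q - 1) * T_elt (sr i) y + q * T_elt id y) * mul (T_elt y) (T_elt v) u)"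
        unfolding sq[OF i] using i v by (intro right) auto
      also have "\<dots> = (\<lambda>u. (q - 1) * mul (T_elt (sr i)) (T_elt v) u + q * mul (T_elt id) (T_elt v) u)"
      proof
        fix u
        have "(\<Sum>y\<in>symgrp r. ((q - 1) * T_elt (sr i) y + q * T_elt id y) * mul (T_elt y) (T_elt v) u) =
          (\<Sum>y\<in>symgrp r. if y = sr i then (q - 1) * mul (T_elt (sr i)) (T_elt v) u else 0) +
          (\<Sum>y\<in>symgrp r. if y = id then q * mul (T_elt id) (T_elt v) u else 0)"
          unfolding sum.distrib[symmetric] by (rule sum.cong) (auto simp: T_elt_def algebra_simps)
        then show "(\<Sum>y\<in>symgrp r. ((q - 1) * T_elt (sr i) y + q * T_elt id y) * mul (T_elt y) (T_elt v) u) =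
           (q - 1) * mul (T_elt (sr i)) (T_elt v) u + q * mul (T_elt id) (T_elt v) u"
          using i by simp
      qed
      also have "\<dots> = (\<lambda>u. (q - 1) * T_elt w u + q * T_elt v u)"
        using T1[OF v(1)] e by simp
      finally show ?thesis using Lop_T_down[OF w i 2, of q] by (simp add: v_def)
    qed
  qed
  have sb: "mul (T_elt (sr i)) b = Lop q i b" if "1 \<le> i" "i < r" "b \<in> hecke_carrier r" for i b
  proof -
    have "Lop q i b = Lop q i (\<lambda>w. \<Sum>y\<in>symgrp r. b y * T_elt y w)"
      using hecke_expand[OF that(3)] by simp
    then show ?thesis unfolding Lop_sum using left[of "sr i" b] that sT by simp
  qed
  have Tb: "mul (T_elt v) b = hm r q (T_elt v) b" if "v \<in> symgrp r" "b \<in> hecke_carrier r" for v b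
  proof (rule left_descent_induct[OF that(1), where P = "\<lambda>v. mul (T_elt v) b = hm r q (T_elt v) b"])
    show "mul (T_elt id) b = hm r q (T_elt id) b"
      using left[of id b] T1 that(2) hecke_expand[OF that(2)] by simp
  next
    fix i v assume step: "1 \<le> i" "i < r" "v \<in> symgrp r" "pinv v i < pinv v (Suc i)"
      "mul (T_elt v) b = hm r q (T_elt v) b"
    have T: "T_elt (sr i \<circ> v) = Lop q i (T_elt v)" using Lop_T_up[OF step(3,1,2,4), of q] by simp
    have "mul (T_elt (sr i \<circ> v)) b = mul (T_elt (sr i)) (mul (T_elt v) b)"
      unfolding T sT[OF step(1-3), symmetric] using assoc step that by simp
    also have "\<dots> = Lop q i (hm r q (T_elt v) b)"
      unfolding step(5) using step that by (intro sb) auto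
    also have "\<dots> = hm r q (T_elt (sr i)) (hm r q (T_elt v) b)"
      using step that by (simp add: hm_T_sr_left)
    also have "\<dots> = hm r q (T_elt (sr i \<circ> v)) b"
      unfolding T using step that by (simp add: hm_T_sr_left[symmetric] hm_assoc)
    finally show "mul (T_elt (sr i \<circ> v)) b = hm r q (T_elt (sr i \<circ> v)) b" .
  qed
  show ?thesis
    unfolding expand[OF a b] hm_expand[OF b, of q a] using Tb by simp
qed

text \<open>The defining properties pin the product down only on the carrier, so the chosen product
  can be replaced by the constructed one only for arguments known to lie there.\<close>

lemma hmult_eq_hm:
  assumes "a \<in> hecke_carrier r" "b \<in> hecke_carrier r"
  shows "hmult r f a b = hm r (q_of f) a b"
  unfolding hmult_def
  by (rule is_hecke_product_unique[OF someI[of _ "hm r (q_of f)"]]) (use assms is_hecke_product_hm in auto)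

lemma hm_add_left: "hm r q (\<lambda>w. a w + b w) c = (\<lambda>w. hm r q a c w + hm r q b c w)"
  unfolding hm_def by (simp add: algebra_simps sum.distrib)

lemma hm_scale_left: "hm r q (\<lambda>w. k * a w) c = (\<lambda>w. k * hm r q a c w)"
  unfolding hm_def by (simp add: sum_distrib_left algebra_simps)

lemma hm_add_right:
  assumes "a \<in> hecke_carrier r" "b \<in> hecke_carrier r"
  shows "hm r q c (\<lambda>w. a w + b w) = (\<lambda>w. hm r q c a w + hm r q c b w)"
  unfolding hm_expand[OF assms(1)] hm_expand[OF assms(2)] hm_expand[OF add_carrier[OF assms]]
  by (simp add: algebra_simps sum.distrib)

lemma hm_scale_right:
  assumes "a \<in> hecke_carrier r"
  shows "hm r q c (\<lambda>w. k * a w) = (\<lambda>w. k * hm r q c a w)"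
  unfolding hm_expand[OF assms(1)] hm_expand[OF scale_carrier[OF assms]]
  by (simp add: sum_distrib_left algebra_simps)

lemma hm_zero_left [simp]: "hm r q (\<lambda>w. 0) c = (\<lambda>w. 0)"
  by (simp add: hm_def)

lemma hm_zero_right [simp]: "hm r q c (\<lambda>w. 0) = (\<lambda>w. 0)"
  by (simp add: hm_expand)

lemma hm_sum_right:
  assumes "\<And>x. x \<in> X \<Longrightarrow> g x \<in> hecke_carrier r"
  shows "hm r q a (\<lambda>w. \<Sum>x\<in>X. c x * g x w) = (\<lambda>w. \<Sum>x\<in>X. c x * hm r q a (g x) w)"
  using assms
proof (induction X rule: infinite_finite_induct)
  case (insert x X)
  then show ?case
    by (simp add: hm_add_right hm_scale_right sum_carrier)
qed simp_all

section \<open>The anti-involution T_w to T_(w^-1) and the change of base ring\<close>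

definition iota :: "nat \<Rightarrow> 'r::comm_ring_1 hecke \<Rightarrow> 'r hecke" where
  "iota r h = (\<lambda>w. if w \<in> symgrp r then h (pinv w) else 0)"

lemma iota_closed [simp]: "iota r h \<in> hecke_carrier r"
  by (rule hecke_carrierI) (simp add: iota_def)

lemma iota_iota [simp]: "h \<in> hecke_carrier r \<Longrightarrow> iota r (iota r h) = h"
  by (rule hecke_ext[of _ r], simp, simp) (simp add: iota_def)

lemma iota_T_id [simp]: "iota r (T_elt id) = T_elt id"
proof (rule hecke_ext[of _ r])
  fix w assume "w \<in> symgrp r"
  then show "iota r (T_elt id) w = T_elt id w"
    by (simp add: iota_def T_elt_def) (metis inv_id symgrp_inv_inv)
qed simp_all

lemma iota_Lop:
  assumes "1 \<le> i" "i < r"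
  shows "iota r (Lop q i h) = Rop q i (iota r h)"
proof (rule hecke_ext[of _ r])
  fix w assume w: "w \<in> symgrp r"
  then have "w \<circ> sr i \<in> symgrp r" using assms by simp
  then show "iota r (Lop q i h) w = Rop q i (iota r h) w"
    using w assms by (simp add: iota_def Lop_def Rop_def symgrp_inv_comp_sr)
qed (use assms in simp_all)

lemma iota_Rop:
  assumes "1 \<le> i" "i < r" "h \<in> hecke_carrier r"
  shows "iota r (Rop q i h) = Lop q i (iota r h)"
  using iota_Lop[OF assms(1,2), of q "iota r h"] assms by (metis Lop_closed iota_closed iota_iota)

text \<open>Since \<open>iota\<close> exchanges \<open>Lop\<close> and \<open>Rop\<close>,
  conjugating right multiplication by b with \<open>iota\<close> gives an operator that commutes
  with all right multiplications. Such an operator is left multiplication by its value at the unit,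
  which is \<open>iota r b\<close>.\<close>

lemma iota_hm:
  assumes a: "a \<in> hecke_carrier r" and b: "b \<in> hecke_carrier r"
  shows "iota r (hm r q a b) = hm r q (iota r b) (iota r a)"
proof -
  define Q where "Q x = iota r (hm r q (iota r x) b)" for x
  have "leftop r q Q"
    unfolding leftop_def
  proof (intro conjI ballI allI impI)
    fix c :: "(nat \<Rightarrow> nat) \<Rightarrow> 'a" and g :: "(nat \<Rightarrow> nat) \<Rightarrow> 'a hecke" assume "\<forall>y\<in>symgrp r. g y \<in> hecke_carrier r"
    have "iota r (\<lambda>w. \<Sum>y\<in>symgrp r. c y * g y w) = (\<lambda>w. \<Sum>y\<in>symgrp r. c y * iota r (g y) w)" for g
      by (auto simp: iota_def)
    then show "Q (\<lambda>w. \<Sum>y\<in>symgrp r. c y * g y w) = (\<lambda>w. \<Sum>y\<in>symgrp r. c y * Q (g y) w)"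
      unfolding Q_def by (simp add: hm_sum_left)
  next
    fix h :: "'a hecke" and j assume h: "h \<in> hecke_carrier r" and j: "1 \<le> j" "j < r"
    have "hm r q (Lop q j (iota r h)) b = Lop q j (hm r q (iota r h) b)"
      using hm_assoc[of "T_elt (sr j)" r "iota r h" b q] b j by (simp add: hm_T_sr_left)
    then show "Q (Rop q j h) = Rop q j (Q h)"
      unfolding Q_def using h j b by (simp add: iota_Rop iota_Lop)
  qed (simp add: Q_def)
  then have "Q (iota r a) = hm r q (Q (T_elt id)) (iota r a)" by (rule leftop_eq_hm) simp
  then show ?thesis using a b by (simp add: Q_def)
qed

text \<open>The structure constants are polynomials in q: applying f to the coefficients turns
  \<open>Lop q i\<close> into \<open>Lop (f q) i\<close>, and every T_v acts by a composition of
  such operators.\<close>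

lemma hm_ring_hom:
  assumes "comm_ring_hom f" and b: "b \<in> hecke_carrier r"
  shows "(\<lambda>w. f (hm r q a b w)) = hm r (f q) (\<lambda>w. f (a w)) (\<lambda>w. f (b w))"
proof -
  interpret comm_ring_hom f by fact
  have fT: "(\<lambda>w. f (T_elt v w)) = T_elt v" for v by (auto simp: T_elt_def)
  have fc: "(\<lambda>w. f (h w)) \<in> hecke_carrier r" if "h \<in> hecke_carrier r" for h
    by (rule hecke_carrierI) (simp add: hecke_carrierD[OF that])
  have "(\<lambda>w. f (hm r q (T_elt v) b w)) = hm r (f q) (T_elt v) (\<lambda>w. f (b w))" if "v \<in> symgrp r" for v
  proof (rule left_descent_induct[OF that,
        where P = "\<lambda>v. (\<lambda>w. f (hm r q (T_elt v) b w)) = hm r (f q) (T_elt v) (\<lambda>w. f (b w))"])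
    show "(\<lambda>w. f (hm r q (T_elt id) b w)) = hm r (f q) (T_elt id) (\<lambda>w. f (b w))" using b by (simp add: fc)
  next
    fix i v assume step: "1 \<le> i" "i < r" "v \<in> symgrp r" "pinv v i < pinv v (Suc i)"
      "(\<lambda>w. f (hm r q (T_elt v) b w)) = hm r (f q) (T_elt v) (\<lambda>w. f (b w))"
    have T: "T_elt (sr i \<circ> v) = hm r q' (T_elt (sr i)) (T_elt v)" for q' :: "'c::comm_ring_1"
      using Lop_T_up[OF step(3,1,2,4), of q'] step by (simp add: hm_T_sr_left)
    have T': "hm r q' (T_elt (sr i \<circ> v)) h = Lop q' i (hm r q' (T_elt v) h)"
      if "h \<in> hecke_carrier r" for h and q' :: "'c::comm_ring_1"
      unfolding T[of q'] using step that by (subst hm_assoc) (auto simp: hm_T_sr_left)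
    show "(\<lambda>w. f (hm r q (T_elt (sr i \<circ> v)) b w)) = hm r (f q) (T_elt (sr i \<circ> v)) (\<lambda>w. f (b w))"
      unfolding T'[OF b] T'[OF fc[OF b]] step(5)[symmetric]
      by (auto simp: Lop_def hom_distribs)
  qed
  then have *: "f (opL r q v b w) = opL r (f q) v (\<lambda>w. f (b w)) w" if "v \<in> symgrp r" for v w
    using that by (simp add: hm_T_left fun_eq_iff)
  show ?thesis unfolding hm_def by (rule ext) (simp add: hom_distribs *)
qed

subsection \<open>Eigenspaces and signed sums over double cosets\<close>

text \<open>For \<open>e = - q\<^sup>-\<^sup>1\<close> these are the common eigenspaces of left, respectively right, multiplication by the
  \<open>T_elt s\<close> with \<open>s\<close> in the Young subgroup, with eigenvalue \<open>q\<close> on even and \<open>-1\<close> on odd blocks. Blocks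
  are the fibres of \<open>\<rho>\<close>, and the even ones are those with index below \<open>m\<close>.\<close>

definition LL :: "nat \<Rightarrow> nat \<Rightarrow> 'r::comm_ring_1 \<Rightarrow> (nat \<Rightarrow> nat) \<Rightarrow> 'r hecke set" where
  "LL m r e \<rho> = {h \<in> hecke_carrier r. \<forall>i w. 1 \<le> i \<longrightarrow> i < r \<longrightarrow> \<rho> i = \<rho> (Suc i) \<longrightarrow> w \<in> symgrp r \<longrightarrow>
     pinv w i < pinv w (Suc i) \<longrightarrow> h (sr i \<circ> w) = (if \<rho> i < m then 1 else e) * h w}"

definition RR :: "nat \<Rightarrow> nat \<Rightarrow> 'r::comm_ring_1 \<Rightarrow> (nat \<Rightarrow> nat) \<Rightarrow> 'r hecke set" where
  "RR m r e \<kappa> = {h \<in> hecke_carrier r. \<forall>i w. 1 \<le> i \<longrightarrow> i < r \<longrightarrow> \<kappa> i = \<kappa> (Suc i) \<longrightarrow> w \<in> symgrp r \<longrightarrow>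
     w i < w (Suc i) \<longrightarrow> h (w \<circ> sr i) = (if \<kappa> i < m then 1 else e) * h w}"

lemma LL_carrier: "h \<in> LL m r e \<rho> \<Longrightarrow> h \<in> hecke_carrier r" by (simp add: LL_def)

lemma RR_carrier: "h \<in> RR m r e \<rho> \<Longrightarrow> h \<in> hecke_carrier r" by (simp add: RR_def)

lemma LLD: "h \<in> LL m r e \<rho> \<Longrightarrow> 1 \<le> i \<Longrightarrow> i < r \<Longrightarrow> \<rho> i = \<rho> (Suc i) \<Longrightarrow> w \<in> symgrp r \<Longrightarrow>
    pinv w i < pinv w (Suc i) \<Longrightarrow> h (sr i \<circ> w) = (if \<rho> i < m then 1 else e) * h w"
  unfolding LL_def by blast

lemma RRD: "h \<in> RR m r e \<kappa> \<Longrightarrow> 1 \<le> i \<Longrightarrow> i < r \<Longrightarrow> \<kappa> i = \<kappa> (Suc i) \<Longrightarrow> w \<in> symgrp r \<Longrightarrow>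
    w i < w (Suc i) \<Longrightarrow> h (w \<circ> sr i) = (if \<kappa> i < m then 1 else e) * h w"
  unfolding RR_def by blast

lemma LL_I:
  assumes "h \<in> hecke_carrier r" and "\<And>i w. 1 \<le> i \<Longrightarrow> i < r \<Longrightarrow> \<rho> i = \<rho> (Suc i) \<Longrightarrow> w \<in> symgrp r \<Longrightarrow>
    pinv w i < pinv w (Suc i) \<Longrightarrow> h (sr i \<circ> w) = (if \<rho> i < m then 1 else e) * h w"
  shows "h \<in> LL m r e \<rho>"
  using assms unfolding LL_def by blast

lemma RR_I:
  assumes "h \<in> hecke_carrier r" and "\<And>i w. 1 \<le> i \<Longrightarrow> i < r \<Longrightarrow> \<kappa> i = \<kappa> (Suc i) \<Longrightarrow> w \<in> symgrp r \<Longrightarrow>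
    w i < w (Suc i) \<Longrightarrow> h (w \<circ> sr i) = (if \<kappa> i < m then 1 else e) * h w"
  shows "h \<in> RR m r e \<kappa>"
  using assms unfolding RR_def by blast

lemma iota_LL:
  assumes "h \<in> LL m r e \<rho>" shows "iota r h \<in> RR m r e \<rho>"
proof (rule RR_I)
  fix i w assume i: "1 \<le> i" "i < r" and e: "\<rho> i = \<rho> (Suc i)" and w: "w \<in> symgrp r" "w i < w (Suc i)"
  have "h (sr i \<circ> pinv w) = (if \<rho> i < m then 1 else e) * h (pinv w)"
    using w by (intro LLD[OF assms i e]) auto
  moreover have "w \<circ> sr i \<in> symgrp r" using w i by simp
  ultimately show "iota r h (w \<circ> sr i) = (if \<rho> i < m then 1 else e) * iota r h w"
    unfolding iota_def using w by (simp only: symgrp_inv_comp_sr[OF i w(1)]) simp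
qed simp

lemma iota_RR:
  assumes "h \<in> RR m r e \<rho>" shows "iota r h \<in> LL m r e \<rho>"
proof (rule LL_I)
  fix i w assume i: "1 \<le> i" "i < r" and e: "\<rho> i = \<rho> (Suc i)" and w: "w \<in> symgrp r" "pinv w i < pinv w (Suc i)"
  have "h (pinv w \<circ> sr i) = (if \<rho> i < m then 1 else e) * h (pinv w)"
    using w by (intro RRD[OF assms i e]) auto
  moreover have "sr i \<circ> w \<in> symgrp r" using w i by simp
  ultimately show "iota r h (sr i \<circ> w) = (if \<rho> i < m then 1 else e) * iota r h w"
    unfolding iota_def using w by (simp only: symgrp_inv_sr_comp[OF i w(1)]) simp
qed simp

lemma LL_Lop:
  assumes q: "q * qi = 1" and h: "h \<in> LL m r (- qi) \<rho>" and i: "1 \<le> i" "i < r" "\<rho> i = \<rho> (Suc i)"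
  shows "Lop q i h = (\<lambda>w. (if \<rho> i < m then q else - 1) * h w)"
proof (rule hecke_ext[of _ r])
  fix w assume w: "w \<in> symgrp r"
  have qq: "q * (qi * x) = x" for x using q by (simp add: mult.assoc[symmetric])
  have "pinv w i \<noteq> pinv w (Suc i)" using symgrp_inj_iff[OF symgrp_inv[OF w], of i "Suc i"] by simp
  then consider "pinv w i < pinv w (Suc i)" | "pinv w (Suc i) < pinv w i" by linarith
  then show "Lop q i h w = (if \<rho> i < m then q else - 1) * h w"
  proof cases
    case 1
    then show ?thesis using LLD[OF h i w 1] by (auto simp: Lop_def qq)
  next
    case 2
    define v where "v = sr i \<circ> w"
    have v: "v \<in> symgrp r" "pinv v i < pinv v (Suc i)" "sr i \<circ> v = w"
      using w i 2 by (simp_all add: v_def symgrp_inv_sr_comp)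
    have "h w = (if \<rho> i < m then 1 else - qi) * h v" using LLD[OF h i v(1,2)] v(3) by simp
    then show ?thesis using 2 by (auto simp: Lop_def v_def[symmetric] algebra_simps qq)
  qed
qed (use LL_carrier[OF h] i in simp_all)

text \<open>At an ascent the eigenvalue equation says q h(s w) = q h(w) or q h(s w) = - h(w).
  Cancelling the unit q gives the recursion along ascents.\<close>

lemma Lop_LL:
  assumes q: "q * qi = 1" and h: "h \<in> hecke_carrier r"
    and e: "\<And>i. 1 \<le> i \<Longrightarrow> i < r \<Longrightarrow> \<rho> i = \<rho> (Suc i) \<Longrightarrow> Lop q i h = (\<lambda>w. (if \<rho> i < m then q else - 1) * h w)"
  shows "h \<in> LL m r (- qi) \<rho>"
proof (rule LL_I[OF h])
  fix i w assume i: "1 \<le> i" "i < r" "\<rho> i = \<rho> (Suc i)" and w: "w \<in> symgrp r" "pinv w i < pinv w (Suc i)"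
  have "q * h (sr i \<circ> w) = (if \<rho> i < m then q else - 1) * h w"
    using fun_cong[OF e[OF i], of w] w by (simp add: Lop_def)
  then have "qi * (q * h (sr i \<circ> w)) = qi * ((if \<rho> i < m then q else - 1) * h w)" by simp
  moreover have "qi * (q * x) = x" for x using q by (simp add: mult.assoc[symmetric] mult.commute[of qi])
  ultimately show "h (sr i \<circ> w) = (if \<rho> i < m then 1 else - qi) * h w" by (auto split: if_splits)
qed

lemma RR_Rop:
  assumes q: "q * qi = 1" and h: "h \<in> RR m r (- qi) \<rho>" and i: "1 \<le> i" "i < r" "\<rho> i = \<rho> (Suc i)"
  shows "Rop q i h = (\<lambda>w. (if \<rho> i < m then q else - 1) * h w)"
proof (rule hecke_ext[of _ r])
  fix w assume w: "w \<in> symgrp r"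
  note hc = RR_carrier[OF h]
  have "Rop q i h = iota r (Lop q i (iota r h))" using iota_Lop[OF i(1,2), of q "iota r h"] hc by simp
  also have "\<dots> = iota r (\<lambda>w. (if \<rho> i < m then q else - 1) * iota r h w)"
    by (simp only: LL_Lop[OF q iota_RR[OF h] i])
  finally show "Rop q i h w = (if \<rho> i < m then q else - 1) * h w"
    using w by (simp add: iota_def)
qed (use RR_carrier[OF h] i in simp_all)

lemma Rop_RR:
  assumes q: "q * qi = 1" and h: "h \<in> hecke_carrier r"
    and e: "\<And>i. 1 \<le> i \<Longrightarrow> i < r \<Longrightarrow> \<rho> i = \<rho> (Suc i) \<Longrightarrow> Rop q i h = (\<lambda>w. (if \<rho> i < m then q else - 1) * h w)"
  shows "h \<in> RR m r (- qi) \<rho>"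
proof -
  have "iota r h \<in> LL m r (- qi) \<rho>"
  proof (rule Lop_LL[OF q])
    fix i assume i: "1 \<le> i" "i < r" "\<rho> i = \<rho> (Suc i)"
    have "Lop q i (iota r h) = iota r (Rop q i h)" using iota_Rop[OF i(1,2) h] by simp
    also have "\<dots> = (\<lambda>w. (if \<rho> i < m then q else - 1) * iota r h w)"
      unfolding e[OF i] by (auto simp: iota_def)
    finally show "Lop q i (iota r h) = (\<lambda>w. (if \<rho> i < m then q else - 1) * iota r h w)" .
  qed simp
  then show ?thesis using iota_LL h by fastforce
qed

lemma LL_add: "a \<in> LL m r e \<rho> \<Longrightarrow> b \<in> LL m r e \<rho> \<Longrightarrow> (\<lambda>w. a w + b w) \<in> LL m r e \<rho>"
  by (rule LL_I) (auto simp: LL_carrier LLD algebra_simps)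

lemma LL_scale: "a \<in> LL m r e \<rho> \<Longrightarrow> (\<lambda>w. c * a w) \<in> LL m r e \<rho>"
  by (rule LL_I) (auto simp: LL_carrier LLD algebra_simps)

lemma LL_zero: "(\<lambda>w. 0) \<in> LL m r e \<rho>"
  by (rule LL_I) auto

lemma LL_sum:
  assumes "\<And>x. x \<in> X \<Longrightarrow> g x \<in> LL m r e \<rho>"
  shows "(\<lambda>w. \<Sum>x\<in>X. c x * g x w) \<in> LL m r e \<rho>"
  using assms
  by (induction X rule: infinite_finite_induct) (auto simp: LL_zero intro!: LL_add LL_scale)

lemma RR_add: "a \<in> RR m r e \<rho> \<Longrightarrow> b \<in> RR m r e \<rho> \<Longrightarrow> (\<lambda>w. a w + b w) \<in> RR m r e \<rho>"
  by (rule RR_I) (auto simp: RR_carrier RRD algebra_simps)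

lemma RR_scale: "a \<in> RR m r e \<rho> \<Longrightarrow> (\<lambda>w. c * a w) \<in> RR m r e \<rho>"
  by (rule RR_I) (auto simp: RR_carrier RRD algebra_simps)

lemma RR_zero: "(\<lambda>w. 0) \<in> RR m r e \<rho>"
  by (rule RR_I) auto

lemma hm_LL:
  assumes q: "q * qi = 1" and a: "a \<in> LL m r (- qi) \<rho>" and b: "b \<in> hecke_carrier r"
  shows "hm r q a b \<in> LL m r (- qi) \<rho>"
proof (rule Lop_LL[OF q])
  fix i assume i: "1 \<le> i" "i < r" "\<rho> i = \<rho> (Suc i)"
  note ac = LL_carrier[OF a]
  have "Lop q i (hm r q a b) = hm r q (Lop q i a) b"
    using hm_assoc[of "T_elt (sr i)" r a b q] i ac b by (simp add: hm_T_sr_left)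
  then show "Lop q i (hm r q a b) = (\<lambda>w. (if \<rho> i < m then q else - 1) * hm r q a b w)"
    by (simp only: LL_Lop[OF q a i] hm_scale_left)
qed (use b in simp)

lemma hm_RR:
  assumes q: "q * qi = 1" and a: "a \<in> hecke_carrier r" and b: "b \<in> RR m r (- qi) \<rho>"
  shows "hm r q a b \<in> RR m r (- qi) \<rho>"
proof -
  have "hm r q (iota r b) (iota r a) \<in> LL m r (- qi) \<rho>"
    by (rule hm_LL[OF q iota_RR[OF b]]) simp
  then have "iota r (iota r (hm r q a b)) \<in> RR m r (- qi) \<rho>"
    using a RR_carrier[OF b] by (intro iota_LL) (simp add: iota_hm)
  then show ?thesis using RR_carrier[OF b] by simp
qed

text \<open>If w is not the shortest element of its coset under the Young subgroup, some s inside a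
  block shortens it and the recursion expresses h(w) by h(s w). So an eigenvector is determined by
  its values on the shortest representatives.\<close>

lemma LL_vanish:
  assumes c: "convex_blocks r \<rho>" and h: "h \<in> LL m r e \<rho>" and g: "g \<in> LL m r e \<rho>"
    and eq: "\<And>d. d \<in> symgrp r \<Longrightarrow> incr_blocks r \<rho> (pinv d) \<Longrightarrow> h d = g d"
  shows "h = g"
proof (rule hecke_ext[OF LL_carrier[OF h] LL_carrier[OF g]])
  fix w :: "nat \<Rightarrow> nat" assume "w \<in> symgrp r"
  then show "h w = g w"
  proof (induction "cox_length r w" arbitrary: w rule: less_induct)
    case less
    show ?case
    proof (cases "incr_blocks r \<rho> (pinv w)")
      case True then show ?thesis using eq less.prems by blast
    next
      case False
      then obtain i where i: "1 \<le> i" "i < r" "\<rho> i = \<rho> (Suc i)" "\<not> pinv w i < pinv w (Suc i)"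
        using incr_blocks_adjacent[OF c] by blast
      have "pinv w i \<noteq> pinv w (Suc i)" using symgrp_inj_iff[OF symgrp_inv[OF less.prems], of i "Suc i"] by simp
      then have d: "pinv w (Suc i) < pinv w i" using i by simp
      define v where "v = sr i \<circ> w"
      have v: "v \<in> symgrp r" "pinv v i < pinv v (Suc i)" "sr i \<circ> v = w"
        using less.prems i d by (simp_all add: v_def symgrp_inv_sr_comp)
      have "cox_length r v < cox_length r w"
        using len_left_down[OF less.prems i(1,2) d] by (simp add: v_def)
      then have "h v = g v" using less.hyps v by blast
      then show ?thesis using LLD[OF h i(1-3) v(1,2)] LLD[OF g i(1-3) v(1,2)] v(3) by simp
    qed
  qed
qed

text \<open>For \<open>w = u d v\<close> in a double coset this counts the odd part of \<open>l(u) + l(v)\<close>; unlike that decomposition it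
  is manifestly invariant under inversion of \<open>w\<close> with rows and columns exchanged.\<close>

definition oset :: "nat \<Rightarrow> nat \<Rightarrow> (nat \<Rightarrow> nat) \<Rightarrow> (nat \<Rightarrow> nat) \<Rightarrow> (nat \<Rightarrow> nat) \<Rightarrow> (nat \<times> nat) set" where
  "oset m r \<rho> \<kappa> w = {(i, j) \<in> invset r w.
     (\<rho> (w i) = \<rho> (w j) \<and> \<not> \<rho> (w i) < m) \<or> (\<kappa> i = \<kappa> j \<and> \<not> \<kappa> i < m)}"

text \<open>In terms of the matrix of w: an entry whose row and column have different parity is at
  most 1.\<close>

definition parity_ok :: "nat \<Rightarrow> nat \<Rightarrow> (nat \<Rightarrow> nat) \<Rightarrow> (nat \<Rightarrow> nat) \<Rightarrow> (nat \<Rightarrow> nat) \<Rightarrow> bool" where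
  "parity_ok m r \<rho> \<kappa> w \<longleftrightarrow> (\<forall>i j. 1 \<le> i \<longrightarrow> i < j \<longrightarrow> j \<le> r \<longrightarrow>
     \<rho> (w i) = \<rho> (w j) \<longrightarrow> \<kappa> i = \<kappa> j \<longrightarrow> (\<rho> (w i) < m \<longleftrightarrow> \<kappa> i < m))"

text \<open>With e = - q^-1 this gives T_D when D is the double coset of an admissible matrix, and
  the generator x y when D is the Young subgroup itself and both labellings coincide.\<close>

definition zfun :: "nat \<Rightarrow> nat \<Rightarrow> 'r::comm_ring_1 \<Rightarrow> (nat \<Rightarrow> nat) \<Rightarrow> (nat \<Rightarrow> nat) \<Rightarrow> (nat \<Rightarrow> nat) set \<Rightarrow> 'r hecke" where
  "zfun m r e \<rho> \<kappa> D = (\<lambda>w. if w \<in> D then e ^ card (oset m r \<rho> \<kappa> w) else 0)"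

lemma finite_oset [simp]: "finite (oset m r \<rho> \<kappa> w)"
  by (rule finite_subset[OF _ finite_invset[of r w]]) (auto simp: oset_def)

lemma oset_comp_sr:
  assumes i: "1 \<le> i" "i < r" "\<kappa> i = \<kappa> (Suc i)"
  shows "oset m r \<rho> \<kappa> (w \<circ> sr i) - {(i, Suc i)} = map_prod (sr i) (sr i) ` (oset m r \<rho> \<kappa> w - {(i, Suc i)})"
proof -
  define Q where "Q w p = (case p of (a, b) \<Rightarrow> (\<rho> (w a) = \<rho> (w b) \<and> \<not> \<rho> (w a) < m) \<or> (\<kappa> a = \<kappa> b \<and> \<not> \<kappa> a < m))"
    for w :: "nat \<Rightarrow> nat" and p
  have k: "\<kappa> (sr i x) = \<kappa> x" for x using i(3) by (simp add: Transposition.transpose_def)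
  have Q: "Q (w \<circ> sr i) (map_prod (sr i) (sr i) p) = Q w p" for p
    by (cases p) (simp add: Q_def k)
  have o: "oset m r \<rho> \<kappa> w = {p \<in> invset r w. Q w p}" for w
    by (auto simp: oset_def Q_def)
  have "oset m r \<rho> \<kappa> (w \<circ> sr i) - {(i, Suc i)} =
      {p \<in> map_prod (sr i) (sr i) ` (invset r w - {(i, Suc i)}). Q (w \<circ> sr i) p}"
    unfolding invset_comp_sr[OF i(1,2), symmetric] o by blast
  also have "\<dots> = map_prod (sr i) (sr i) ` {p \<in> invset r w - {(i, Suc i)}. Q w p}"
  proof (rule Set.set_eqI, rule iffI)
    fix p assume "p \<in> {p \<in> map_prod (sr i) (sr i) ` (invset r w - {(i, Suc i)}). Q (w \<circ> sr i) p}"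
    then obtain x where x: "p = map_prod (sr i) (sr i) x" "x \<in> invset r w - {(i, Suc i)}" "Q (w \<circ> sr i) p"
      by (metis (no_types, lifting) imageE mem_Collect_eq)
    then show "p \<in> map_prod (sr i) (sr i) ` {p \<in> invset r w - {(i, Suc i)}. Q w p}"
      using Q[of x] by blast
  next
    fix p assume "p \<in> map_prod (sr i) (sr i) ` {p \<in> invset r w - {(i, Suc i)}. Q w p}"
    then obtain x where x: "p = map_prod (sr i) (sr i) x" "x \<in> {p \<in> invset r w - {(i, Suc i)}. Q w p}"
      by (rule imageE)
    show "p \<in> {p \<in> map_prod (sr i) (sr i) ` (invset r w - {(i, Suc i)}). Q (w \<circ> sr i) p}"
      unfolding x(1) using Q[of x] x(2) by (intro CollectI conjI imageI) simp_all
  qed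
  also have "{p \<in> invset r w - {(i, Suc i)}. Q w p} = oset m r \<rho> \<kappa> w - {(i, Suc i)}"
    unfolding o by blast
  finally show ?thesis .
qed

text \<open>Passing from w to w s adds the single inversion (i, i + 1) and relabels the others
  inside \<open>oset\<close>. In an odd column block the new pair counts. In an even one it could
  count only through an odd row block, and a pair lying in an even column block and an odd row block
  is excluded by \<open>parity_ok\<close>.\<close>

lemma zfun_RR:
  assumes D: "D \<subseteq> symgrp r"
    and cl: "\<And>w i. w \<in> D \<Longrightarrow> 1 \<le> i \<Longrightarrow> i < r \<Longrightarrow> \<kappa> i = \<kappa> (Suc i) \<Longrightarrow> w \<circ> sr i \<in> D"
    and ok: "\<And>w. w \<in> D \<Longrightarrow> parity_ok m r \<rho> \<kappa> w"
  shows "zfun m r e \<rho> \<kappa> D \<in> RR m r e \<kappa>"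
proof (rule RR_I)
  show "zfun m r e \<rho> \<kappa> D \<in> hecke_carrier r"
    by (rule hecke_carrierI) (use D in \<open>auto simp: zfun_def\<close>)
next
  fix i w assume i: "1 \<le> i" "i < r" "\<kappa> i = \<kappa> (Suc i)" and w: "w \<in> symgrp r" "w i < w (Suc i)"
  have D_iff: "w \<circ> sr i \<in> D \<longleftrightarrow> w \<in> D" using cl[of w i] cl[of "w \<circ> sr i" i] i by auto
  show "zfun m r e \<rho> \<kappa> D (w \<circ> sr i) = (if \<kappa> i < m then 1 else e) * zfun m r e \<rho> \<kappa> D w"
  proof (cases "w \<in> D")
    case False then show ?thesis unfolding zfun_def D_iff by simp
  next
    case True
    have n: "(i, Suc i) \<notin> oset m r \<rho> \<kappa> w" using w by (simp add: oset_def invset_def)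
    have c: "card (oset m r \<rho> \<kappa> (w \<circ> sr i) - {(i, Suc i)}) = card (oset m r \<rho> \<kappa> w)"
      unfolding oset_comp_sr[of i r \<kappa>, OF i] using n by (simp add: card_image[OF inj_map_prod_sr])
    have inv: "(i, Suc i) \<in> invset r (w \<circ> sr i)" using w i by (simp add: invset_def)
    show ?thesis
    proof (cases "\<kappa> i < m")
      case even: True
      have "\<not> (\<rho> (w i) = \<rho> (w (Suc i)) \<and> \<not> \<rho> (w i) < m)"
        using ok[OF True] i even unfolding parity_ok_def by (metis Suc_leI lessI)
      then have "(i, Suc i) \<notin> oset m r \<rho> \<kappa> (w \<circ> sr i)"
        using even by (auto simp: oset_def)
      then have "card (oset m r \<rho> \<kappa> (w \<circ> sr i)) = card (oset m r \<rho> \<kappa> w)" using c by simp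
      then show ?thesis using True D_iff even by (simp add: zfun_def)
    next
      case odd: False
      then have "(i, Suc i) \<in> oset m r \<rho> \<kappa> (w \<circ> sr i)"
        using inv i by (simp add: oset_def)
      then have "card (oset m r \<rho> \<kappa> (w \<circ> sr i)) = Suc (card (oset m r \<rho> \<kappa> w))"
        using c by (metis card.remove finite_oset)
      then show ?thesis using True D_iff odd by (simp add: zfun_def)
    qed
  qed
qed

lemma card_oset_inv:
  assumes w: "w \<in> symgrp r"
  shows "card (oset m r \<kappa> \<rho> (pinv w)) = card (oset m r \<rho> \<kappa> w)"
proof -
  have le: "card (oset m r \<rho> \<kappa> w) \<le> card (oset m r \<kappa> \<rho> (pinv w))" if w: "w \<in> symgrp r" for w \<rho> \<kappa>
  proof (rule card_inj_on_le[where f = "\<lambda>(i, j). (w j, w i)"])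
    show "inj_on (\<lambda>(i, j). (w j, w i)) (oset m r \<rho> \<kappa> w)"
      by (auto simp: inj_on_def symgrp_inj_iff[OF w])
    show "(\<lambda>(i, j). (w j, w i)) ` oset m r \<rho> \<kappa> w \<subseteq> oset m r \<kappa> \<rho> (pinv w)"
    proof
      fix p assume "p \<in> (\<lambda>(i, j). (w j, w i)) ` oset m r \<rho> \<kappa> w"
      then obtain i j where p: "p = (w j, w i)" "(i, j) \<in> oset m r \<rho> \<kappa> w" by auto
      then have "1 \<le> i" "i < j" "j \<le> r" by (simp_all add: oset_def invset_def)
      then have "1 \<le> w j" "w i \<le> r" using symgrp_bounds[OF w, of i] symgrp_bounds[OF w, of j] by simp_all
      then show "p \<in> oset m r \<kappa> \<rho> (pinv w)"
        using p(2) by (auto simp: p(1) oset_def invset_def symgrp_inv_app[OF w])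
    qed
  qed simp
  from le[OF w, of \<rho> \<kappa>] le[OF symgrp_inv[OF w], of \<kappa> \<rho>] show ?thesis using w by simp
qed

lemma parity_ok_inv:
  assumes w: "w \<in> symgrp r" and ok: "parity_ok m r \<rho> \<kappa> w"
  shows "parity_ok m r \<kappa> \<rho> (pinv w)"
  unfolding parity_ok_def
proof (intro allI impI)
  fix i j assume ij: "1 \<le> i" "i < j" "j \<le> r" "\<kappa> (pinv w i) = \<kappa> (pinv w j)" "\<rho> i = \<rho> j"
  have b: "1 \<le> pinv w i" "pinv w i \<le> r" "1 \<le> pinv w j" "pinv w j \<le> r"
    using symgrp_bounds[OF symgrp_inv[OF w]] ij by auto
  have ok': "1 \<le> a \<Longrightarrow> a < b \<Longrightarrow> b \<le> r \<Longrightarrow> \<rho> (w a) = \<rho> (w b) \<Longrightarrow> \<kappa> a = \<kappa> b \<Longrightarrow> \<rho> (w a) < m \<longleftrightarrow> \<kappa> a < m" for a b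
    using ok unfolding parity_ok_def by blast
  have "pinv w i \<noteq> pinv w j" using symgrp_inj_iff[OF symgrp_inv[OF w], of i j] ij by simp
  then consider "pinv w i < pinv w j" | "pinv w j < pinv w i" by linarith
  then show "\<kappa> (pinv w i) < m \<longleftrightarrow> \<rho> i < m"
    using ok'[of "pinv w i" "pinv w j"] ok'[of "pinv w j" "pinv w i"] b ij symgrp_inv_app(2)[OF w, of i] symgrp_inv_app(2)[OF w, of j]
    by cases simp_all
qed

lemma iota_zfun:
  assumes D: "D \<subseteq> symgrp r"
  shows "iota r (zfun m r e \<rho> \<kappa> D) = zfun m r e \<kappa> \<rho> (pinv ` D)"
proof
  fix w
  show "iota r (zfun m r e \<rho> \<kappa> D) w = zfun m r e \<kappa> \<rho> (pinv ` D) w"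
  proof (cases "w \<in> symgrp r")
    case True
    have "pinv w \<in> D \<longleftrightarrow> w \<in> pinv ` D"
    proof
      assume "pinv w \<in> D"
      then show "w \<in> pinv ` D" using symgrp_inv_inv[OF True] by (metis image_eqI)
    next
      assume "w \<in> pinv ` D"
      then obtain v where v: "v \<in> D" "w = pinv v" by blast
      then have "pinv w = v" using symgrp_inv_inv[of v r] D by blast
      then show "pinv w \<in> D" using v by simp
    qed
    then show ?thesis using True card_oset_inv[OF True, of m \<rho> \<kappa>] by (simp add: iota_def zfun_def)
  next
    case False
    then have "w \<notin> pinv ` D" using D symgrp_inv by blast
    then show ?thesis using False by (simp add: iota_def zfun_def)
  qed
qed

text \<open>The mirror image of \<open>zfun_RR\<close> under inversion, which exchanges the roles of
  rows and columns.\<close>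

lemma zfun_LL:
  assumes D: "D \<subseteq> symgrp r"
    and cl: "\<And>w i. w \<in> D \<Longrightarrow> 1 \<le> i \<Longrightarrow> i < r \<Longrightarrow> \<rho> i = \<rho> (Suc i) \<Longrightarrow> sr i \<circ> w \<in> D"
    and ok: "\<And>w. w \<in> D \<Longrightarrow> parity_ok m r \<rho> \<kappa> w"
  shows "zfun m r e \<rho> \<kappa> D \<in> LL m r e \<rho>"
proof -
  have D': "pinv ` D \<subseteq> symgrp r" using D symgrp_inv by blast
  have "zfun m r e \<kappa> \<rho> (pinv ` D) \<in> RR m r e \<rho>"
  proof (rule zfun_RR[OF D'])
    fix w i assume w: "w \<in> pinv ` D" and i: "1 \<le> i" "i < r" "\<rho> i = \<rho> (Suc i)"
    then obtain v where v: "v \<in> D" "w = pinv v" by blast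
    then have "v \<in> symgrp r" using D by blast
    then have "w \<circ> sr i = pinv (sr i \<circ> v)" using i v by (simp add: symgrp_inv_sr_comp)
    then show "w \<circ> sr i \<in> pinv ` D" using cl[OF v(1) i] by blast
  next
    fix w assume "w \<in> pinv ` D"
    then show "parity_ok m r \<kappa> \<rho> w" using ok D parity_ok_inv by blast
  qed
  then have "iota r (iota r (zfun m r e \<rho> \<kappa> D)) \<in> LL m r e \<rho>"
    unfolding iota_zfun[OF D] by (rule iota_RR)
  moreover have "zfun m r e \<rho> \<kappa> D \<in> hecke_carrier r"
    by (rule hecke_carrierI) (use D in \<open>auto simp: zfun_def\<close>)
  ultimately show ?thesis by simp
qed

section \<open>Even and odd factors of Young subgroups, shortest coset representatives\<close>

text \<open>The even and odd Young subgroups of the paper are the stabilizers of the partitions in which the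
  blocks of the other parity are split into singletons.\<close>

definition refine :: "(nat \<Rightarrow> bool) \<Rightarrow> (nat \<Rightarrow> nat) \<Rightarrow> nat \<Rightarrow> nat \<times> nat" where
  "refine E b k = (b k, if E (b k) then 0 else k)"

text \<open>The factor of w that moves only the blocks selected by E. Every element of the Young
  subgroup is the product of its even part and its odd part.\<close>

definition part :: "(nat \<Rightarrow> bool) \<Rightarrow> (nat \<Rightarrow> nat) \<Rightarrow> (nat \<Rightarrow> nat) \<Rightarrow> nat \<Rightarrow> nat" where
  "part E b w k = (if E (b k) then w k else k)"

lemma refine_eq_iff: "refine E b x = refine E b y \<longleftrightarrow> b x = b y \<and> (E (b x) \<or> x = y)"
  by (auto simp: refine_def)

lemma convex_refine:
  assumes "convex_blocks r b" shows "convex_blocks r (refine E b)"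
  unfolding convex_blocks_def refine_eq_iff
proof (intro allI impI)
  fix i j k assume "1 \<le> i" "i < j" "j < k" "k \<le> r" "b i = b k \<and> (E (b i) \<or> i = k)"
  then show "b j = b i \<and> (E (b j) \<or> j = i)"
    using convex_blocksD[OF assms, of i j k] by auto
qed

lemma stab_refineD:
  assumes "w \<in> stab r (refine E b)"
  shows "b (w k) = b k" "\<not> E (b k) \<Longrightarrow> w k = k"
proof -
  have "refine E b (w k) = refine E b k" using assms by (simp add: stab_def)
  then show "b (w k) = b k" "\<not> E (b k) \<Longrightarrow> w k = k" unfolding refine_eq_iff by auto
qed

lemma stab_refineI:
  assumes "w \<in> symgrp r" "\<And>k. b (w k) = b k" "\<And>k. \<not> E (b k) \<Longrightarrow> w k = k"
  shows "w \<in> stab r (refine E b)"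
  using assms unfolding stab_def refine_eq_iff by auto

lemma stab_refine_subset: "w \<in> stab r (refine E b) \<Longrightarrow> w \<in> stab r b"
  using stab_refineD(1)[of w r E b] by (simp add: stab_def)

lemma stabD: "w \<in> stab r b \<Longrightarrow> b (w k) = b k"
  by (simp add: stab_def)

lemma part_stab:
  assumes w: "w \<in> stab r b" shows "part E b w \<in> stab r (refine E b)"
proof (rule stab_refineI)
  note b = stabD[OF w] stabD[OF stab_inv[OF w]]
  note i = symgrp_inv_app[OF stab_symgrp[OF w]]
  have "part E b (pinv w) \<circ> part E b w = id" "part E b w \<circ> part E b (pinv w) = id"
    by (auto simp: fun_eq_iff part_def b i)
  then have "bij (part E b w)" by (rule o_bij)
  moreover have "part E b w x = x" if "x \<notin> {1..r}" for x
    using symgrp_fix[OF stab_symgrp[OF w] that] by (simp add: part_def)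
  ultimately show "part E b w \<in> symgrp r" unfolding symgrp_def
    by (simp add: permutes_def bij_iff)
qed (use w in \<open>auto simp: part_def stabD\<close>)

lemma part_comp: "w \<in> stab r b \<Longrightarrow> part E b w \<circ> part (\<lambda>j. \<not> E j) b w = w"
  by (auto simp: fun_eq_iff part_def stabD)

lemma part_of_comp:
  assumes "u \<in> stab r (refine E b)" "v \<in> stab r (refine (\<lambda>j. \<not> E j) b)"
  shows "part E b (u \<circ> v) = u" "part (\<lambda>j. \<not> E j) b (u \<circ> v) = v"
  using stab_refineD[OF assms(1)] stab_refineD[OF assms(2)]
  by (auto simp: fun_eq_iff part_def)

text \<open>A permutation moving only the complementary blocks fixes every point of the blocks in E,
  hence is increasing on them; this is the hypothesis of \<open>len_additive\<close> for the refined
  labelling.\<close>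

lemma len_refine_comp:
  assumes c: "convex_blocks r b"
    and u: "u \<in> stab r (refine E b)" and v: "v \<in> stab r (refine (\<lambda>j. \<not> E j) b)"
  shows "cox_length r (u \<circ> v) = cox_length r u + cox_length r v"
proof (rule len_additive[OF convex_refine[OF c] u stab_symgrp[OF v]])
  note v' = stab_refineD(2)[OF stab_inv[OF v]]
  show "incr_blocks r (refine E b) (pinv v)"
    unfolding incr_blocks_def refine_eq_iff
  proof (intro allI impI)
    fix i j :: nat assume ij: "i < j" "b i = b j \<and> (E (b i) \<or> i = j)"
    then have "pinv v i = i" "pinv v j = j" by (auto intro!: v')
    then show "pinv v i < pinv v j" using ij by simp
  qed
qed

lemma stab_incr_id:
  assumes c: "convex_blocks r b" and w: "w \<in> stab r b" and i: "incr_blocks r b w"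
  shows "w = id"
proof (rule symgrp_increasing_id[OF stab_symgrp[OF w]])
  fix k assume k: "1 \<le> k" "k < r"
  show "w k < w (Suc k)"
  proof (rule ccontr)
    assume n: "\<not> w k < w (Suc k)"
    have "w k \<noteq> w (Suc k)" using symgrp_inj_iff[OF stab_symgrp[OF w], of k "Suc k"] by simp
    then have "(k, Suc k) \<in> invset r w" using n k by (simp add: invset_def)
    then have "b k = b (Suc k)" by (rule stab_inversion_same_block[OF c w])
    then show False using incr_blocksD[OF i, of k "Suc k"] k n by simp
  qed
qed

text \<open>On each block \<open>pinv e\<close> preserves order. If
  \<open>pinv e \<circ> pinv y\<close> does so as well, then \<open>pinv y\<close> is increasing on
  each block, and since it preserves the blocks it is the identity.\<close>

lemma incr_coset_unique:
  assumes c: "convex_blocks r b" and y: "y \<in> stab r b" and e: "e \<in> symgrp r"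
    and i: "incr_blocks r b (pinv e)" and i': "incr_blocks r b (pinv (y \<circ> e))"
  shows "y = id"
proof -
  have "incr_blocks r b (pinv y)"
    unfolding incr_blocks_def
  proof (intro allI impI)
    fix k l assume kl: "1 \<le> k" "k < l" "l \<le> r" "b k = b l"
    have "pinv e (pinv y k) < pinv e (pinv y l)"
      using incr_blocksD[OF i' kl] symgrp_inv_comp[OF stab_symgrp[OF y] e] by simp
    moreover have "1 \<le> pinv y k" "pinv y k \<le> r" "1 \<le> pinv y l" "pinv y l \<le> r"
      using symgrp_bounds[OF symgrp_inv[OF stab_symgrp[OF y]]] kl by auto
    moreover have "b (pinv y k) = b (pinv y l)" using stabD[OF stab_inv[OF y]] kl by simp
    ultimately show "pinv y k < pinv y l"
      using incr_blocksD[OF i, of "pinv y l" "pinv y k"] by (metis linorder_neqE_nat not_less_iff_gr_or_eq)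
  qed
  then have "pinv y = id" by (rule stab_incr_id[OF c stab_inv[OF y]])
  then show ?thesis using symgrp_inv_inv[OF stab_symgrp[OF y]] by (metis inv_id)
qed

text \<open>A descent inside a block would allow shortening by an element of the subgroup;
  conversely lengths add for an increasing representative, so nothing in its coset is
  shorter.\<close>

lemma min_right_reps_eq:
  assumes c: "convex_blocks r g" and sub: "V \<subseteq> symgrp r"
  shows "min_right_reps r (stab r g) V = {u \<in> V. incr_blocks r g (pinv u)}"
proof (rule Set.set_eqI, rule iffI)
  fix u assume u: "u \<in> min_right_reps r (stab r g) V"
  then have uV: "u \<in> V" "u \<in> symgrp r" using sub by (auto simp: min_right_reps_def)
  have "incr_blocks r g (pinv u)"
  proof (rule incr_blocks_adjacent[OF c], rule ccontr)
    fix i assume i: "1 \<le> i" "i < r" "g i = g (Suc i)" "\<not> pinv u i < pinv u (Suc i)"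
    have "pinv u i \<noteq> pinv u (Suc i)" using symgrp_inj_iff[OF symgrp_inv[OF uV(2)], of i "Suc i"] by simp
    then have "cox_length r (sr i \<circ> u) < cox_length r u"
      using len_left_down[OF uV(2) i(1,2)] i(4) by simp
    moreover have "cox_length r u \<le> cox_length r (sr i \<circ> u)"
      using u sr_stab[OF i(1-3)] unfolding min_right_reps_def by blast
    ultimately show False by simp
  qed
  then show "u \<in> {u \<in> V. incr_blocks r g (pinv u)}" using uV by blast
next
  fix u assume u: "u \<in> {u \<in> V. incr_blocks r g (pinv u)}"
  then have uV: "u \<in> V" "u \<in> symgrp r" "incr_blocks r g (pinv u)" using sub by auto
  then show "u \<in> min_right_reps r (stab r g) V"
    using len_additive[OF c _ uV(2,3)] by (simp add: min_right_reps_def)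
qed

section \<open>The generator x y as a signed sum and the eigenspaces it generates\<close>

definition xyf :: "nat \<Rightarrow> nat \<Rightarrow> 'r::comm_ring_1 \<Rightarrow> (nat \<Rightarrow> nat) \<Rightarrow> 'r hecke" where
  "xyf m r e \<rho> = zfun m r e \<rho> \<rho> (stab r \<rho>)"

text \<open>An element of the Young subgroup has inversions only inside blocks, and those in odd
  blocks are precisely the inversions of its odd part. This makes the exponent in \<open>xyf\<close>
  the length of the odd factor.\<close>

lemma oset_stab:
  assumes c: "convex_blocks r \<rho>" and w: "w \<in> stab r \<rho>"
  shows "oset m r \<rho> \<rho> w = invset r (part (\<lambda>j. \<not> j < m) \<rho> w)"
proof (rule Set.set_eqI, rule iffI)
  fix p assume "p \<in> oset m r \<rho> \<rho> w"
  then show "p \<in> invset r (part (\<lambda>j. \<not> j < m) \<rho> w)"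
    using stabD[OF w] by (auto simp: oset_def invset_def part_def)
next
  let ?v = "part (\<lambda>j. \<not> j < m) \<rho> w"
  fix p assume p: "p \<in> invset r ?v"
  obtain i j where ij: "p = (i, j)" by (cases p)
  have "\<rho> i = \<rho> j"
    using stab_inversion_same_block[OF c stab_refine_subset[OF part_stab[OF w]]] p ij by blast
  then show "p \<in> oset m r \<rho> \<rho> w"
    using p by (auto simp: ij oset_def invset_def part_def split: if_splits)
qed

text \<open>Each element of the Young subgroup is u v for a unique even u and odd v, and the lengths
  add, so T_u T_v = T_(u v) and the double sum has one term for every element.\<close>

lemma xyf_product:
  assumes c: "convex_blocks r \<rho>"
  shows "hm r q (\<lambda>w. \<Sum>u\<in>stab r (refine (\<lambda>j. j < m) \<rho>). T_elt u w)
      (\<lambda>w. \<Sum>v\<in>stab r (refine (\<lambda>j. \<not> j < m) \<rho>). e ^ cox_length r v * T_elt v w) = xyf m r e \<rho>"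
proof
  fix w
  let ?U = "stab r (refine (\<lambda>j. j < m) \<rho>)" and ?V = "stab r (refine (\<lambda>j. \<not> j < m) \<rho>)"
  have TT: "hm r q (T_elt u) (T_elt v) = T_elt (u \<circ> v)" if "u \<in> ?U" "v \<in> ?V" for u v
    using that by (intro hm_T_T stab_symgrp len_refine_comp[OF c]) auto
  have "hm r q (\<lambda>w. \<Sum>u\<in>?U. 1 * T_elt u w) (\<lambda>w. \<Sum>v\<in>?V. e ^ cox_length r v * T_elt v w) w =
      (\<Sum>u\<in>?U. \<Sum>v\<in>?V. e ^ cox_length r v * hm r q (T_elt u) (T_elt v) w)"
    unfolding hm_sum_left by (subst hm_sum_right) (auto simp: stab_symgrp)
  also have "\<dots> = (\<Sum>(u, v)\<in>?U \<times> ?V. e ^ cox_length r v * T_elt (u \<circ> v) w)"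
    unfolding sum.cartesian_product by (intro sum.cong) (auto simp: TT)
  also have "\<dots> = xyf m r e \<rho> w"
  proof (cases "w \<in> stab r \<rho>")
    case True
    let ?p = "(part (\<lambda>j. j < m) \<rho> w, part (\<lambda>j. \<not> j < m) \<rho> w)"
    have p: "?p \<in> ?U \<times> ?V" using part_stab[OF True] by simp
    have "(\<Sum>(u, v)\<in>?U \<times> ?V. e ^ cox_length r v * T_elt (u \<circ> v) w) =
        (\<Sum>p\<in>?U \<times> ?V. if p = ?p then e ^ cox_length r (snd ?p) else 0)"
    proof (rule sum.cong[OF refl])
      fix p assume "p \<in> ?U \<times> ?V"
      then obtain u v where uv: "p = (u, v)" "u \<in> ?U" "v \<in> ?V" by blast
      have "u \<circ> v = w \<longleftrightarrow> p = ?p"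
        using part_of_comp[OF uv(2,3)] part_comp[OF True, of "\<lambda>j. j < m"] uv(1) by auto
      then show "(case p of (u, v) \<Rightarrow> e ^ cox_length r v * T_elt (u \<circ> v) w) =
          (if p = ?p then e ^ cox_length r (snd ?p) else 0)"
        by (auto simp: uv(1) T_elt_def)
    qed
    also have "\<dots> = e ^ cox_length r (snd ?p)" using p by (subst sum.delta) auto
    also have "\<dots> = xyf m r e \<rho> w"
      using True stab_symgrp[OF part_stab[OF True, of "\<lambda>j. \<not> j < m"]]
      by (simp add: xyf_def zfun_def oset_stab[OF c True] cox_length_eq)
    finally show ?thesis .
  next
    case False
    have "T_elt (u \<circ> v) w = (0 :: 'a)" if "u \<in> ?U" "v \<in> ?V" for u v
      using that False stab_comp[of u r \<rho> v] stab_refine_subset by (auto simp: T_elt_def)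
    then show ?thesis using False by (auto simp: xyf_def zfun_def intro!: sum.neutral)
  qed
  finally show "hm r q (\<lambda>w. \<Sum>u\<in>?U. T_elt u w)
      (\<lambda>w. \<Sum>v\<in>?V. e ^ cox_length r v * T_elt v w) w = xyf m r e \<rho> w" by simp
qed

lemma xyf_LL: "xyf m r e \<rho> \<in> LL m r e \<rho>"
  unfolding xyf_def
proof (rule zfun_LL)
  show "stab r \<rho> \<subseteq> symgrp r" by (auto simp: stab_symgrp)
  show "parity_ok m r \<rho> \<rho> w" if "w \<in> stab r \<rho>" for w
    unfolding parity_ok_def by (simp add: stabD[OF that])
qed (simp add: sr_stab)

lemma xyf_carrier [simp]: "xyf m r e \<rho> \<in> hecke_carrier r"
  using LL_carrier[OF xyf_LL] .

lemma iota_xyf: "iota r (xyf m r e \<rho>) = xyf m r e \<rho>"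
proof -
  have "pinv ` stab r \<rho> = stab r \<rho>"
  proof (rule Set.set_eqI, rule iffI)
    fix w assume "w \<in> stab r \<rho>"
    then have "w = pinv (pinv w)" "pinv w \<in> stab r \<rho>" by (simp_all add: symgrp_inv_inv[OF stab_symgrp])
    then show "w \<in> pinv ` stab r \<rho>" by blast
  qed auto
  moreover have "stab r \<rho> \<subseteq> symgrp r" by (auto simp: stab_symgrp)
  ultimately show ?thesis unfolding xyf_def by (simp add: iota_zfun)
qed

lemma xyf_RR: "xyf m r e \<rho> \<in> RR m r e \<rho>"
  using iota_LL[OF xyf_LL, of r m e \<rho>] by (simp add: iota_xyf)

text \<open>The product of the generator with T_e is supported on the coset of e, because lengths
  add there. That coset has e as its only shortest representative, with coefficient 1. These
  products are therefore dual to evaluation at the shortest representatives.\<close>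

lemma xyf_T_at_reps:
  assumes c: "convex_blocks r \<rho>" and e: "e \<in> symgrp r" "incr_blocks r \<rho> (pinv e)"
    and e': "e' \<in> symgrp r" "incr_blocks r \<rho> (pinv e')"
  shows "hm r q (xyf m r x \<rho>) (T_elt e) e' = (if e' = e then 1 else 0)"
proof -
  have "xyf m r x \<rho> = (\<lambda>w. \<Sum>y\<in>symgrp r. xyf m r x \<rho> y * T_elt y w)"
    by (rule hecke_expand) simp
  then have "hm r q (xyf m r x \<rho>) (T_elt e) e' =
      hm r q (\<lambda>w. \<Sum>y\<in>symgrp r. xyf m r x \<rho> y * T_elt y w) (T_elt e) e'"
    by (rule arg_cong[where f = "\<lambda>h. hm r q h (T_elt e) e'"])
  also have "\<dots> = (\<Sum>y\<in>symgrp r. xyf m r x \<rho> y * hm r q (T_elt y) (T_elt e) e')"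
    by (simp only: hm_sum_left)
  also have "\<dots> = (\<Sum>y\<in>symgrp r. if y = id then (if e' = e then 1 else 0) else 0)"
  proof (rule sum.cong[OF refl])
    fix y assume y: "y \<in> symgrp r"
    show "xyf m r x \<rho> y * hm r q (T_elt y) (T_elt e) e' = (if y = id then (if e' = e then 1 else 0) else 0)"
    proof (cases "y \<in> stab r \<rho>")
      case False
      then show ?thesis by (auto simp: xyf_def zfun_def)
    next
      case True
      have T: "hm r q (T_elt y) (T_elt e) = T_elt (y \<circ> e)"
        using len_additive[OF c True e] y e by (intro hm_T_T) auto
      have "y \<circ> e = e' \<Longrightarrow> y = id"
        using incr_coset_unique[OF c True e] e'(2) by blast
      moreover have "oset m r \<rho> \<rho> id = {}" by (auto simp: oset_def invset_def)
      then have "xyf m r x \<rho> id = 1" by (simp add: xyf_def zfun_def)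
      ultimately show ?thesis unfolding T by (auto simp: T_elt_def)
    qed
  qed
  finally show ?thesis by simp
qed

text \<open>An eigenvector h agrees with the combination of the products x y T_d with coefficients
  h(d) at all shortest representatives d, hence everywhere by \<open>LL_vanish\<close>.\<close>

lemma LL_eq_xyf:
  assumes c: "convex_blocks r \<rho>" and q: "q * qi = 1"
  shows "LL m r (- qi) \<rho> = {hm r q (xyf m r (- qi) \<rho>) h | h. h \<in> hecke_carrier r}"
proof (rule Set.set_eqI, rule iffI)
  fix h assume h: "h \<in> LL m r (- qi) \<rho>"
  define Mn where "Mn = {d \<in> symgrp r. incr_blocks r \<rho> (pinv d)}"
  define g where "g = (\<lambda>w. \<Sum>d\<in>Mn. h d * T_elt d w)"
  have g: "g \<in> hecke_carrier r" unfolding g_def by (intro sum_carrier) (simp add: Mn_def)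
  have fin: "finite Mn" by (simp add: Mn_def)
  have gx: "hm r q (xyf m r (- qi) \<rho>) g = (\<lambda>w. \<Sum>d\<in>Mn. h d * hm r q (xyf m r (- qi) \<rho>) (T_elt d) w)"
    unfolding g_def by (rule hm_sum_right) (simp add: Mn_def)
  have "h = hm r q (xyf m r (- qi) \<rho>) g"
  proof (rule LL_vanish[OF c h hm_LL[OF q xyf_LL g]])
    fix d assume d: "d \<in> symgrp r" "incr_blocks r \<rho> (pinv d)"
    have "hm r q (xyf m r (- qi) \<rho>) g d = (\<Sum>d'\<in>Mn. if d = d' then h d' else 0)"
      unfolding gx by (rule sum.cong) (auto simp: Mn_def xyf_T_at_reps[OF c _ _ d])
    then show "h d = hm r q (xyf m r (- qi) \<rho>) g d" using d fin by (simp add: Mn_def)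
  qed
  then show "h \<in> {hm r q (xyf m r (- qi) \<rho>) h | h. h \<in> hecke_carrier r}" using g by blast
next
  fix h assume "h \<in> {hm r q (xyf m r (- qi) \<rho>) h | h. h \<in> hecke_carrier r}"
  then show "h \<in> LL m r (- qi) \<rho>" using hm_LL[OF q xyf_LL] by blast
qed

text \<open>Apply \<open>iota\<close>: the generator is invariant under it, and left and right
  eigenspaces are exchanged.\<close>

lemma RR_eq_xyf:
  assumes c: "convex_blocks r \<rho>" and q: "q * qi = 1" and h: "h \<in> RR m r (- qi) \<rho>"
  obtains a where "a \<in> hecke_carrier r" "h = hm r q a (xyf m r (- qi) \<rho>)"
proof -
  have "iota r h \<in> LL m r (- qi) \<rho>" by (rule iota_RR[OF h])
  then obtain a where a: "a \<in> hecke_carrier r" "iota r h = hm r q (xyf m r (- qi) \<rho>) a"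
    unfolding LL_eq_xyf[OF c q] by blast
  have "h = iota r (iota r h)" using RR_carrier[OF h] by simp
  also have "\<dots> = hm r q (iota r a) (xyf m r (- qi) \<rho>)"
    unfolding a(2) using a(1) by (simp add: iota_hm iota_xyf)
  finally show ?thesis using that[of "iota r a"] by simp
qed

subsection \<open>Double cosets\<close>

text \<open>Convexity with block labels in their natural order. It allows order relations between
  positions to be compared with order relations between block indices, as needed in
  \<open>fiber_le\<close>.\<close>

definition mono_blocks :: "nat \<Rightarrow> (nat \<Rightarrow> nat) \<Rightarrow> bool" where
  "mono_blocks r b \<longleftrightarrow> (\<forall>x y. 1 \<le> x \<longrightarrow> x \<le> y \<longrightarrow> y \<le> r \<longrightarrow> b x \<le> b y)"

lemma mono_blocksD: "mono_blocks r b \<Longrightarrow> 1 \<le> x \<Longrightarrow> x \<le> y \<Longrightarrow> y \<le> r \<Longrightarrow> b x \<le> b y"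
  unfolding mono_blocks_def by blast

lemma mono_convex: 
  assumes "mono_blocks r b" shows "convex_blocks r b"
  unfolding convex_blocks_def
proof (intro allI impI)
  fix i j k assume "1 \<le> i" "i < j" "j < k" "k \<le> r" "b i = b k"
  then show "b j = b i"
    using mono_blocksD[OF assms, of i j] mono_blocksD[OF assms, of j k] by simp
qed

text \<open>The number of elements of the intersection of the i-th row block with the image under w
  of the j-th column block, counted through preimages.\<close>

definition mt :: "nat \<Rightarrow> (nat \<Rightarrow> nat) \<Rightarrow> (nat \<Rightarrow> nat) \<Rightarrow> (nat \<Rightarrow> nat) \<Rightarrow> nat \<Rightarrow> nat \<Rightarrow> nat" where
  "mt r \<rho> \<kappa> w i j = card {k \<in> {1..r}. \<rho> (w k) = i \<and> \<kappa> k = j}"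

definition Dset :: "nat \<Rightarrow> nat \<Rightarrow> (nat \<Rightarrow> nat) \<Rightarrow> (nat \<Rightarrow> nat) \<Rightarrow> (nat \<Rightarrow> nat \<Rightarrow> nat) \<Rightarrow> (nat \<Rightarrow> nat) set" where
  "Dset N r \<rho> \<kappa> A = {w \<in> symgrp r. \<forall>i<N. \<forall>j<N. mt r \<rho> \<kappa> w i j = A i j}"

lemma mt_right:
  assumes c: "c \<in> stab r \<kappa>" shows "mt r \<rho> \<kappa> (w \<circ> c) i j = mt r \<rho> \<kappa> w i j"
  unfolding mt_def
proof (rule bij_betw_same_card[of c], rule bij_betwI[where g = "pinv c"])
  note cs = stab_symgrp[OF c]
  show "c \<in> {k \<in> {1..r}. \<rho> ((w \<circ> c) k) = i \<and> \<kappa> k = j} \<rightarrow> {k \<in> {1..r}. \<rho> (w k) = i \<and> \<kappa> k = j}"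
    using symgrp_range[OF cs] stabD[OF c] by auto
  show "pinv c \<in> {k \<in> {1..r}. \<rho> (w k) = i \<and> \<kappa> k = j} \<rightarrow> {k \<in> {1..r}. \<rho> ((w \<circ> c) k) = i \<and> \<kappa> k = j}"
    using symgrp_range[OF symgrp_inv[OF cs]] stabD[OF stab_inv[OF c]] symgrp_inv_app(2)[OF cs] by auto
qed (simp_all add: symgrp_inv_app[OF stab_symgrp[OF c]])

lemma mt_left:
  assumes c: "c \<in> stab r \<rho>" shows "mt r \<rho> \<kappa> (c \<circ> w) i j = mt r \<rho> \<kappa> w i j"
  unfolding mt_def by (simp add: stabD[OF c])

lemma mt_inv:
  assumes w: "w \<in> symgrp r" shows "mt r \<kappa> \<rho> (pinv w) j i = mt r \<rho> \<kappa> w i j"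
  unfolding mt_def
proof (rule bij_betw_same_card[of "pinv w"], rule bij_betwI[where g = w])
  show "pinv w \<in> {k \<in> {1..r}. \<kappa> (pinv w k) = j \<and> \<rho> k = i} \<rightarrow> {k \<in> {1..r}. \<rho> (w k) = i \<and> \<kappa> k = j}"
    using symgrp_range[OF symgrp_inv[OF w]] symgrp_inv_app(2)[OF w] by auto
  show "w \<in> {k \<in> {1..r}. \<rho> (w k) = i \<and> \<kappa> k = j} \<rightarrow> {k \<in> {1..r}. \<kappa> (pinv w k) = j \<and> \<rho> k = i}"
    using symgrp_range[OF w] symgrp_inv_app(1)[OF w] by auto
qed (simp_all add: symgrp_inv_app[OF w])

lemma Dset_symgrp: "w \<in> Dset N r \<rho> \<kappa> A \<Longrightarrow> w \<in> symgrp r"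
  by (simp add: Dset_def)

lemma Dset_subset: "Dset N r \<rho> \<kappa> A \<subseteq> symgrp r"
  by (auto simp: Dset_def)

lemma Dset_right: "w \<in> Dset N r \<rho> \<kappa> A \<Longrightarrow> c \<in> stab r \<kappa> \<Longrightarrow> w \<circ> c \<in> Dset N r \<rho> \<kappa> A"
  by (simp add: Dset_def stab_symgrp mt_right)

lemma Dset_left: "w \<in> Dset N r \<rho> \<kappa> A \<Longrightarrow> c \<in> stab r \<rho> \<Longrightarrow> c \<circ> w \<in> Dset N r \<rho> \<kappa> A"
  by (simp add: Dset_def stab_symgrp mt_left)

lemma Dset_inv: "pinv ` Dset N r \<rho> \<kappa> A = Dset N r \<kappa> \<rho> (\<lambda>i j. A j i)"
proof (rule Set.set_eqI, rule iffI)
  fix w assume "w \<in> pinv ` Dset N r \<rho> \<kappa> A"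
  then show "w \<in> Dset N r \<kappa> \<rho> (\<lambda>i j. A j i)" by (auto simp: Dset_def mt_inv)
next
  fix w assume w: "w \<in> Dset N r \<kappa> \<rho> (\<lambda>i j. A j i)"
  then have "pinv w \<in> Dset N r \<rho> \<kappa> A" by (auto simp: Dset_def mt_inv)
  moreover have "w = pinv (pinv w)" using w by (simp add: symgrp_inv_inv[OF Dset_symgrp])
  ultimately show "w \<in> pinv ` Dset N r \<rho> \<kappa> A" by blast
qed

lemma mt_fiber:
  assumes w: "w \<in> symgrp r"
  shows "card {x \<in> {1..r}. \<rho> x = i \<and> \<kappa> (pinv w x) = j} = mt r \<rho> \<kappa> w i j"
  using mt_inv[OF w, of \<kappa> \<rho> j i] by (simp add: mt_def conj_commute)

lemma Dset_parity_ok: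
  assumes w: "w \<in> Dset N r \<rho> \<kappa> A"
    and bd: "\<And>x. x \<in> {1..r} \<Longrightarrow> \<rho> x < N \<and> \<kappa> x < N"
    and A: "\<And>i j. i < N \<Longrightarrow> j < N \<Longrightarrow> (i < m) \<noteq> (j < m) \<Longrightarrow> A i j \<le> 1"
  shows "parity_ok m r \<rho> \<kappa> w"
  unfolding parity_ok_def
proof (intro allI impI)
  fix k l assume kl: "1 \<le> k" "k < l" "l \<le> r" "\<rho> (w k) = \<rho> (w l)" "\<kappa> k = \<kappa> l"
  have b: "\<rho> (w k) < N" "\<kappa> k < N"
    using bd[of k] bd[of "w k"] symgrp_bounds[OF Dset_symgrp[OF w], of k] kl by auto
  show "\<rho> (w k) < m \<longleftrightarrow> \<kappa> k < m"
  proof (rule ccontr)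
    assume n: "\<not> ?thesis"
    have "card {k, l} \<le> mt r \<rho> \<kappa> w (\<rho> (w k)) (\<kappa> k)"
      unfolding mt_def by (rule card_mono) (use kl in auto)
    then have "2 \<le> mt r \<rho> \<kappa> w (\<rho> (w k)) (\<kappa> k)" using kl by simp
    also have "\<dots> \<le> 1" using w A[OF b] n b by (simp add: Dset_def)
    finally show False by simp
  qed
qed

text \<open>Along a row block the column index of \<open>pinv d\<close> is weakly increasing, and
  how often it is at most j is a partial row sum of A, the same for d and e. If the inequality
  failed at x, then for j the column index at x under e this count would be at most the number of
  block elements before x for d, but at least one more for e.\<close>

lemma fiber_le:
  assumes d: "d \<in> Dset N r \<rho> \<kappa> A" and e: "e \<in> Dset N r \<rho> \<kappa> A"
    and bd: "\<And>x. x \<in> {1..r} \<Longrightarrow> \<rho> x < N \<and> \<kappa> x < N" and m: "mono_blocks r \<kappa>"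
    and di: "incr_blocks r \<rho> (pinv d)" and ei: "incr_blocks r \<rho> (pinv e)" and x: "x \<in> {1..r}"
  shows "\<kappa> (pinv d x) \<le> \<kappa> (pinv e x)"
proof (rule ccontr)
  assume n: "\<not> \<kappa> (pinv d x) \<le> \<kappa> (pinv e x)"
  define i j where "i = \<rho> x" and "j = \<kappa> (pinv e x)"
  have iN: "i < N" using bd[OF x] by (simp add: i_def)
  have rg: "pinv w y \<in> {1..r}" if "w \<in> Dset N r \<rho> \<kappa> A" "y \<in> {1..r}" for w y
    using symgrp_range[OF symgrp_inv[OF Dset_symgrp[OF that(1)]]] that(2) by blast
  have jN: "j < N" using bd[OF rg[OF e x]] by (simp add: j_def)
  have B: "card {y \<in> {1..r}. \<rho> y = i \<and> \<kappa> (pinv w y) \<le> j} = (\<Sum>j'\<le>j. A i j')"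
    if w: "w \<in> Dset N r \<rho> \<kappa> A" for w
  proof -
    have "{y \<in> {1..r}. \<rho> y = i \<and> \<kappa> (pinv w y) \<le> j} = (\<Union>j'\<in>{..j}. {y \<in> {1..r}. \<rho> y = i \<and> \<kappa> (pinv w y) = j'})"
      by auto
    also have "card \<dots> = (\<Sum>j'\<le>j. card {y \<in> {1..r}. \<rho> y = i \<and> \<kappa> (pinv w y) = j'})"
      by (rule card_UN_disjoint) auto
    also have "\<dots> = (\<Sum>j'\<le>j. A i j')"
      unfolding mt_fiber[OF Dset_symgrp[OF w]] using w iN jN by (intro sum.cong) (auto simp: Dset_def)
    finally show ?thesis .
  qed
  have "{y \<in> {1..r}. \<rho> y = i \<and> \<kappa> (pinv d y) \<le> j} \<subseteq> {y \<in> {1..r}. \<rho> y = i \<and> y < x}"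
  proof
    fix y assume "y \<in> {y \<in> {1..r}. \<rho> y = i \<and> \<kappa> (pinv d y) \<le> j}"
    then have y: "y \<in> {1..r}" "\<rho> y = i" "\<kappa> (pinv d y) \<le> j" by simp_all
    have "y < x"
    proof (rule ccontr)
      assume "\<not> y < x"
      then have "x \<le> y" by simp
      have "pinv d x \<le> pinv d y"
      proof (cases "x = y")
        case False
        have "1 \<le> x" "x < y" "y \<le> r" "\<rho> x = \<rho> y" using False \<open>x \<le> y\<close> x y(1,2) by (simp_all add: i_def)
        then show ?thesis using incr_blocksD[OF di, of x y] by simp
      qed simp
      then have "\<kappa> (pinv d x) \<le> \<kappa> (pinv d y)"
        using mono_blocksD[OF m, of "pinv d x" "pinv d y"] rg[OF d x] rg[OF d y(1)] by simp
      then show False using n y by (simp add: j_def)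
    qed
    then show "y \<in> {y \<in> {1..r}. \<rho> y = i \<and> y < x}" using y by simp
  qed
  then have 1: "card {y \<in> {1..r}. \<rho> y = i \<and> \<kappa> (pinv d y) \<le> j} \<le> card {y \<in> {1..r}. \<rho> y = i \<and> y < x}"
    by (rule card_mono[rotated]) simp
  have "insert x {y \<in> {1..r}. \<rho> y = i \<and> y < x} \<subseteq> {y \<in> {1..r}. \<rho> y = i \<and> \<kappa> (pinv e y) \<le> j}"
  proof
    fix y assume y: "y \<in> insert x {y \<in> {1..r}. \<rho> y = i \<and> y < x}"
    then have y': "y \<in> {1..r}" "\<rho> y = i" "y \<le> x" using x by (auto simp: i_def)
    then have "pinv e y \<le> pinv e x"
      using incr_blocksD[OF ei, of y x] x by (cases "x = y") (auto simp: i_def)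
    then have "\<kappa> (pinv e y) \<le> \<kappa> (pinv e x)"
      using mono_blocksD[OF m, of "pinv e y" "pinv e x"] rg[OF e x] rg[OF e y'(1)] by simp
    then show "y \<in> {y \<in> {1..r}. \<rho> y = i \<and> \<kappa> (pinv e y) \<le> j}" using y' by (simp add: j_def)
  qed
  then have "card (insert x {y \<in> {1..r}. \<rho> y = i \<and> y < x}) \<le> card {y \<in> {1..r}. \<rho> y = i \<and> \<kappa> (pinv e y) \<le> j}"
    by (rule card_mono[rotated]) simp
  then show False using 1 B[OF d] B[OF e] by simp
qed

text \<open>By \<open>fiber_le\<close> in both directions, d and e pull every position back into the
  same column block, so they differ on the right by an element preserving column blocks.\<close>

lemma reps_coset:
  assumes d: "d \<in> Dset N r \<rho> \<kappa> A" and e: "e \<in> Dset N r \<rho> \<kappa> A"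
    and bd: "\<And>x. x \<in> {1..r} \<Longrightarrow> \<rho> x < N \<and> \<kappa> x < N" and m: "mono_blocks r \<kappa>"
    and di: "incr_blocks r \<rho> (pinv d)" and ei: "incr_blocks r \<rho> (pinv e)"
  shows "pinv d \<circ> e \<in> stab r \<kappa>"
  unfolding stab_def
proof (intro CollectI conjI allI)
  note ds = Dset_symgrp[OF d] and es = Dset_symgrp[OF e]
  show "pinv d \<circ> e \<in> symgrp r" using ds es by simp
  fix k
  show "\<kappa> ((pinv d \<circ> e) k) = \<kappa> k"
  proof (cases "k \<in> {1..r}")
    case True
    then have "e k \<in> {1..r}" using symgrp_range[OF es] by blast
    then show ?thesis
      using fiber_le[OF d e bd m di ei, of "e k"] fiber_le[OF e d bd m ei di, of "e k"]
        symgrp_inv_app(1)[OF es, of k] by simp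
  next
    case False
    then show ?thesis using symgrp_fix[OF es False] symgrp_fix[OF symgrp_inv[OF ds] False] by simp
  qed
qed

text \<open>Once e = d c with c in the column subgroup, both factors being shortest in the same
  coset on that side forces c to be the identity.\<close>

lemma double_rep_unique:
  assumes d: "d \<in> Dset N r \<rho> \<kappa> A" and e: "e \<in> Dset N r \<rho> \<kappa> A"
    and bd: "\<And>x. x \<in> {1..r} \<Longrightarrow> \<rho> x < N \<and> \<kappa> x < N" and m: "mono_blocks r \<kappa>"
    and di: "incr_blocks r \<rho> (pinv d)" and ei: "incr_blocks r \<rho> (pinv e)"
    and di': "incr_blocks r \<kappa> d" and ei': "incr_blocks r \<kappa> e"
  shows "e = d"
proof -
  note ds = Dset_symgrp[OF d] and es = Dset_symgrp[OF e]
  define c where "c = pinv d \<circ> e"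
  have c: "c \<in> stab r \<kappa>" unfolding c_def by (rule reps_coset[OF d e bd m di ei])
  have ed: "e k = d (c k)" for k by (simp add: c_def symgrp_inv_app(2)[OF ds])
  have "pinv c = id"
  proof (rule incr_coset_unique[OF mono_convex[OF m] stab_inv[OF c] symgrp_inv[OF ds]])
    show "incr_blocks r \<kappa> (pinv (pinv d))" using di' ds by simp
    have "pinv c \<circ> pinv d = pinv e"
      unfolding c_def using symgrp_inv_comp[OF symgrp_inv[OF ds] es] ds by (simp add: comp_assoc)
    then show "incr_blocks r \<kappa> (pinv (pinv c \<circ> pinv d))" using ei' es by simp
  qed
  then have "c = id" using symgrp_inv_inv[OF stab_symgrp[OF c]] by (metis inv_id)
  then show "e = d" by (intro ext) (simp add: ed)
qed

text \<open>A descent inside a row block or a column block could be removed by a simple reflection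
  without leaving the double coset, contradicting minimal length.\<close>

lemma shortest_incr:
  assumes D: "Dset N r \<rho> \<kappa> A \<noteq> {}" and c: "convex_blocks r \<rho>" "convex_blocks r \<kappa>"
    and d: "d = arg_min_on (cox_length r) (Dset N r \<rho> \<kappa> A)"
  shows "d \<in> Dset N r \<rho> \<kappa> A" "incr_blocks r \<rho> (pinv d)" "incr_blocks r \<kappa> d"
proof -
  have fin: "finite (Dset N r \<rho> \<kappa> A)" by (rule finite_subset[OF Dset_subset]) simp
  show dD: "d \<in> Dset N r \<rho> \<kappa> A" unfolding d by (rule arg_min_if_finite[OF fin D])
  have least: "\<not> cox_length r w < cox_length r d" if "w \<in> Dset N r \<rho> \<kappa> A" for w
    using arg_min_if_finite(2)[OF fin D, of "cox_length r"] that d by blast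
  note ds = Dset_symgrp[OF dD]
  show "incr_blocks r \<rho> (pinv d)"
  proof (rule incr_blocks_adjacent[OF c(1)], rule ccontr)
    fix i assume i: "1 \<le> i" "i < r" "\<rho> i = \<rho> (Suc i)" "\<not> pinv d i < pinv d (Suc i)"
    have "pinv d i \<noteq> pinv d (Suc i)" using symgrp_inj_iff[OF symgrp_inv[OF ds], of i "Suc i"] by simp
    then have "cox_length r (sr i \<circ> d) < cox_length r d" using len_left_down[OF ds i(1,2)] i(4) by simp
    then show False using least Dset_left[OF dD sr_stab[OF i(1-3)]] by blast
  qed
  show "incr_blocks r \<kappa> d"
  proof (rule incr_blocks_adjacent[OF c(2)], rule ccontr)
    fix i assume i: "1 \<le> i" "i < r" "\<kappa> i = \<kappa> (Suc i)" "\<not> d i < d (Suc i)"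
    have "d i \<noteq> d (Suc i)" using symgrp_inj_iff[OF ds, of i "Suc i"] by simp
    then have "cox_length r (d \<circ> sr i) < cox_length r d" using len_right_down[OF ds i(1,2)] i(4) by simp
    then show False using least Dset_right[OF dD sr_stab[OF i(1-3)]] by blast
  qed
qed

lemma zfun_Dset_LL:
  assumes "\<And>w. w \<in> Dset N r \<rho> \<kappa> A \<Longrightarrow> parity_ok m r \<rho> \<kappa> w"
  shows "zfun m r e \<rho> \<kappa> (Dset N r \<rho> \<kappa> A) \<in> LL m r e \<rho>"
  by (rule zfun_LL) (auto simp: Dset_subset assms sr_stab Dset_left)

lemma zfun_Dset_RR:
  assumes "\<And>w. w \<in> Dset N r \<rho> \<kappa> A \<Longrightarrow> parity_ok m r \<rho> \<kappa> w"
  shows "zfun m r e \<rho> \<kappa> (Dset N r \<rho> \<kappa> A) \<in> RR m r e \<kappa>"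
  by (rule zfun_RR) (auto simp: Dset_subset assms sr_stab Dset_right)

section \<open>The sum T_D of a double coset in closed form\<close>

locale double_rep =
  fixes N m r :: nat and \<rho> \<kappa> :: "nat \<Rightarrow> nat" and A :: "nat \<Rightarrow> nat \<Rightarrow> nat" and d :: "nat \<Rightarrow> nat"
  assumes mono: "mono_blocks r \<rho>" "mono_blocks r \<kappa>"
    and bd: "\<And>x. x \<in> {1..r} \<Longrightarrow> \<rho> x < N \<and> \<kappa> x < N"
    and A_le: "\<And>i j. i < N \<Longrightarrow> j < N \<Longrightarrow> (i < m) \<noteq> (j < m) \<Longrightarrow> A i j \<le> 1"
    and dD: "d \<in> Dset N r \<rho> \<kappa> A" and di: "incr_blocks r \<rho> (pinv d)" and di': "incr_blocks r \<kappa> d"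
begin

lemmas convex = mono_convex[OF mono(1)] mono_convex[OF mono(2)]
lemmas ds = Dset_symgrp[OF dD]

text \<open>The blocks of the compositions \<open>\<alpha>\<close> and \<open>\<beta>\<close> of the paper, for \<open>E\<close> the even and the odd indices, respectively.\<close>

definition gam :: "(nat \<Rightarrow> bool) \<Rightarrow> nat \<Rightarrow> (nat \<times> nat) \<times> (nat \<times> nat)" where
  "gam E k = (refine E \<kappa> k, refine E \<rho> (d k))"

text \<open>Since d is increasing on column blocks, a position between i and k in one column block
  is sent between d i and d k, and convexity of the row blocks applies to the images.\<close>

lemma convex_gam: "convex_blocks r (gam E)"
  unfolding convex_blocks_def gam_def prod.inject refine_eq_iff
proof (intro allI impI)
  fix i j k assume ijk: "1 \<le> i" "i < j" "j < k" "k \<le> r"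
    and g: "(\<kappa> i = \<kappa> k \<and> (E (\<kappa> i) \<or> i = k)) \<and> \<rho> (d i) = \<rho> (d k) \<and> (E (\<rho> (d i)) \<or> d i = d k)"
  have k: "\<kappa> j = \<kappa> i" using convex_blocksD[OF convex(2) ijk] g by simp
  have "d i < d j" "d j < d k"
    using incr_blocksD[OF di', of i j] incr_blocksD[OF di', of j k] ijk k g by auto
  moreover have "1 \<le> d i" "d k \<le> r" using symgrp_bounds[OF ds] ijk by auto
  ultimately have "\<rho> (d j) = \<rho> (d i)"
    using convex_blocksD[OF convex(1), of "d i" "d j" "d k"] g by simp
  moreover have "d i \<noteq> d k" using symgrp_inj_iff[OF ds] ijk by simp
  ultimately show "(\<kappa> j = \<kappa> i \<and> (E (\<kappa> j) \<or> j = i)) \<and> \<rho> (d j) = \<rho> (d i) \<and> (E (\<rho> (d j)) \<or> d j = d i)"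
    using k g ijk by auto
qed

lemma conj_inter_eq: "conj_inter d (stab r (refine E \<rho>)) (stab r (refine E \<kappa>)) = stab r (gam E)"
proof (rule Set.set_eqI, rule iffI)
  fix w assume "w \<in> conj_inter d (stab r (refine E \<rho>)) (stab r (refine E \<kappa>))"
  then obtain v where v: "w = pinv d \<circ> v \<circ> d" "v \<in> stab r (refine E \<rho>)" "w \<in> stab r (refine E \<kappa>)"
    unfolding conj_inter_def by blast
  have "d (w k) = v (d k)" for k by (simp add: v(1) symgrp_inv_app(2)[OF ds])
  then show "w \<in> stab r (gam E)" using v(2,3) by (simp add: stab_def gam_def)
next
  fix w assume w: "w \<in> stab r (gam E)"
  then have w1: "w \<in> symgrp r" "\<And>k. refine E \<kappa> (w k) = refine E \<kappa> k" "\<And>k. refine E \<rho> (d (w k)) = refine E \<rho> (d k)"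
    by (simp_all add: stab_def gam_def)
  define v where "v = d \<circ> w \<circ> pinv d"
  have "v \<in> stab r (refine E \<rho>)"
    unfolding stab_def using w1 ds symgrp_inv_app(2)[OF ds] by (auto simp: v_def)
  moreover have "w = pinv d \<circ> v \<circ> d" by (auto simp: fun_eq_iff v_def symgrp_inv_app[OF ds])
  moreover have "w \<in> stab r (refine E \<kappa>)" using w1 by (simp add: stab_def)
  ultimately show "w \<in> conj_inter d (stab r (refine E \<rho>)) (stab r (refine E \<kappa>))"
    unfolding conj_inter_def by blast
qed

abbreviation "Ev \<equiv> (\<lambda>j. j < m)"
abbreviation "Od \<equiv> (\<lambda>j. \<not> j < m)"

lemma reps_eq:
  "min_right_reps r (conj_inter d (stab r (refine E \<rho>)) (stab r (refine E \<kappa>))) (stab r (refine E \<kappa>)) =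
   {u \<in> stab r (refine E \<kappa>). incr_blocks r (gam E) (pinv u)}"
  unfolding conj_inter_eq by (rule min_right_reps_eq[OF convex_gam]) (auto simp: stab_symgrp)

lemma parity: "w \<in> Dset N r \<rho> \<kappa> A \<Longrightarrow> parity_ok m r \<rho> \<kappa> w"
  by (rule Dset_parity_ok[OF _ bd A_le])

text \<open>A pair in one row block corresponds under d to a < b. If the column blocks of a and b
  differ, u v cannot disturb their order. If they agree, \<open>parity\<close> makes row and column
  block equally even or odd, so that only u or only v moves the pair, and the condition becomes the
  one for the corresponding labelling \<open>gam\<close>.\<close>

lemma incr_comp_iff:
  assumes u: "u \<in> stab r (refine Ev \<kappa>)" and v: "v \<in> stab r (refine Od \<kappa>)"
  shows "incr_blocks r \<rho> (pinv (d \<circ> (u \<circ> v))) \<longleftrightarrow> incr_blocks r (gam Ev) (pinv u) \<and> incr_blocks r (gam Od) (pinv v)"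
    (is "?l \<longleftrightarrow> ?r")
proof -
  note us = stab_symgrp[OF u] and vs = stab_symgrp[OF v]
  have cinv: "pinv (d \<circ> (u \<circ> v)) = pinv v \<circ> pinv u \<circ> pinv d"
    using ds us vs by (simp add: symgrp_inv_comp symgrp_inv_comp[OF ds])
  note ui = stab_refineD[OF stab_inv[OF u]] and vi = stab_refineD[OF stab_inv[OF v]]
  have ev: "pinv v (pinv u a) = pinv u a" if "\<kappa> a < m" for a
    using vi(2)[of "pinv u a"] ui(1)[of a] that by simp
  have od: "pinv v (pinv u a) = pinv v a" if "\<not> \<kappa> a < m" for a
    using ui(2)[of a] that by simp
  have c: "u \<circ> v \<in> stab r \<kappa>" using stab_refine_subset[OF u] stab_refine_subset[OF v] by simp
  have cc: "pinv (u \<circ> v) a = pinv v (pinv u a)" for a using symgrp_inv_comp[OF us vs] by simp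
  have d_order: "d a < d b" if "1 \<le> a" "a < b" "b \<le> r" "\<kappa> a = \<kappa> b" for a b
    using incr_blocksD[OF di' that] .
  show ?thesis
  proof
    assume l: ?l
    have main: "pinv v (pinv u a) < pinv v (pinv u b)"
      if "1 \<le> a" "a < b" "b \<le> r" "\<kappa> a = \<kappa> b" "\<rho> (d a) = \<rho> (d b)" for a b
    proof -
      have "1 \<le> d a" "d b \<le> r" using symgrp_bounds[OF ds] that by auto
      then have "pinv (d \<circ> (u \<circ> v)) (d a) < pinv (d \<circ> (u \<circ> v)) (d b)"
        using incr_blocksD[OF l _ d_order[OF that(1-4)]] that by blast
      then show ?thesis by (simp add: cinv symgrp_inv_app[OF ds])
    qed
    show ?r
    proof
      show "incr_blocks r (gam Ev) (pinv u)"
        unfolding incr_blocks_def gam_def prod.inject refine_eq_iff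
      proof (intro allI impI)
        fix a b assume ab: "1 \<le> a" "a < b" "b \<le> r"
          "(\<kappa> a = \<kappa> b \<and> (\<kappa> a < m \<or> a = b)) \<and> \<rho> (d a) = \<rho> (d b) \<and> (\<rho> (d a) < m \<or> d a = d b)"
        then show "pinv u a < pinv u b" using main[of a b] ev[of a] ev[of b] by auto
      qed
      show "incr_blocks r (gam Od) (pinv v)"
        unfolding incr_blocks_def gam_def prod.inject refine_eq_iff
      proof (intro allI impI)
        fix a b assume ab: "1 \<le> a" "a < b" "b \<le> r"
          "(\<kappa> a = \<kappa> b \<and> (\<not> \<kappa> a < m \<or> a = b)) \<and> \<rho> (d a) = \<rho> (d b) \<and> (\<not> \<rho> (d a) < m \<or> d a = d b)"
        then show "pinv v a < pinv v b" using main[of a b] od[of a] od[of b] by auto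
      qed
    qed
  next
    assume r: ?r
    show ?l
      unfolding incr_blocks_def
    proof (intro allI impI)
      fix x y assume xy: "1 \<le> x" "x < y" "y \<le> r" "\<rho> x = \<rho> y"
      define a b where "a = pinv d x" and "b = pinv d y"
      have ab: "a < b" using incr_blocksD[OF di xy] by (simp add: a_def b_def)
      have rg: "1 \<le> a" "a \<le> r" "1 \<le> b" "b \<le> r"
        using symgrp_bounds[OF symgrp_inv[OF ds]] xy by (auto simp: a_def b_def)
      have dab: "d a = x" "d b = y" by (simp_all add: a_def b_def symgrp_inv_app[OF ds])
      have "pinv v (pinv u a) < pinv v (pinv u b)"
      proof (cases "\<kappa> a = \<kappa> b")
        case False
        have "{a, b, pinv (u \<circ> v) a, pinv (u \<circ> v) b} \<subseteq> {1..r}"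
          using rg symgrp_bounds[OF symgrp_inv[OF stab_symgrp[OF c]]] by auto
        then have "pinv (u \<circ> v) a < pinv (u \<circ> v) b"
          by (rule block_order[OF convex(2)]) (simp_all only: stabD[OF stab_inv[OF c]] False ab not_False_eq_True)
        then show ?thesis by (simp add: cc)
      next
        case True
        have p: "\<rho> (d a) < m \<longleftrightarrow> \<kappa> a < m"
          using parity[OF dD, unfolded parity_ok_def, rule_format, OF rg(1) ab rg(4) _ True] xy(4) dab by simp
        show ?thesis
        proof (cases "\<kappa> a < m")
          case even: True
          have "gam Ev a = gam Ev b" using even p True xy(4) dab by (simp add: gam_def refine_eq_iff)
          then show ?thesis using incr_blocksD[OF conjunct1[OF r] rg(1) ab rg(4)] ev[of a] ev[of b] even True by simp
        next
          case odd: False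
          have "gam Od a = gam Od b" using odd p True xy(4) dab by (simp add: gam_def refine_eq_iff)
          then show ?thesis using incr_blocksD[OF conjunct2[OF r] rg(1) ab rg(4)] od[of a] od[of b] odd True by simp
        qed
      qed
      then show "pinv (d \<circ> (u \<circ> v)) x < pinv (d \<circ> (u \<circ> v)) y" by (simp add: cinv a_def b_def)
    qed
  qed
qed

text \<open>A representative that is shortest on the left has no inversion inside a row block, so
  only odd column blocks contribute. There u is the identity and d preserves order, which leaves the
  inversions of v.\<close>

lemma oset_rep:
  assumes u: "u \<in> stab r (refine Ev \<kappa>)" and v: "v \<in> stab r (refine Od \<kappa>)"
    and i: "incr_blocks r \<rho> (pinv (d \<circ> (u \<circ> v)))"
  shows "oset m r \<rho> \<kappa> (d \<circ> (u \<circ> v)) = invset r v"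
proof (rule Set.set_eqI)
  fix p :: "nat \<times> nat"
  note us = stab_symgrp[OF u] and vs = stab_symgrp[OF v]
  define e where "e = d \<circ> (u \<circ> v)"
  have es: "e \<in> symgrp r" using ds us vs by (simp add: e_def)
  obtain a b where p: "p = (a, b)" by (cases p)
  have k: "\<kappa> (u (v k)) = \<kappa> k" for k using stab_refineD(1)[OF u] stab_refineD(1)[OF v] by simp
  have no: "\<rho> (e a) \<noteq> \<rho> (e b)" if "1 \<le> a" "a < b" "b \<le> r" "e b < e a"
  proof
    assume "\<rho> (e a) = \<rho> (e b)"
    moreover have "1 \<le> e b" "e a \<le> r" using symgrp_bounds[OF es] that by auto
    ultimately have "pinv e (e b) < pinv e (e a)"
      using incr_blocksD[OF i[folded e_def], of "e b" "e a"] that by simp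
    then show False using that by (simp add: symgrp_inv_app[OF es])
  qed
  have key: "e b < e a \<longleftrightarrow> v b < v a" if "1 \<le> a" "a < b" "b \<le> r" "\<kappa> a = \<kappa> b" "\<not> \<kappa> a < m"
  proof -
    have uv: "u (v a) = v a" "u (v b) = v b"
      using stab_refineD(2)[OF u] stab_refineD(1)[OF v] that by auto
    have rg: "1 \<le> v a" "v a \<le> r" "1 \<le> v b" "v b \<le> r" using symgrp_bounds[OF vs] that by auto
    have kv: "\<kappa> (v a) = \<kappa> (v b)" using stab_refineD(1)[OF v] that by simp
    have "v a \<noteq> v b" using symgrp_inj_iff[OF vs] that by simp
    then show ?thesis
      using incr_blocksD[OF di', of "v a" "v b"] incr_blocksD[OF di', of "v b" "v a"] rg kv
      by (cases "v a < v b") (auto simp: e_def uv)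
  qed
  show "p \<in> oset m r \<rho> \<kappa> (d \<circ> (u \<circ> v)) \<longleftrightarrow> p \<in> invset r v"
  proof
    assume "p \<in> oset m r \<rho> \<kappa> (d \<circ> (u \<circ> v))"
    then have *: "1 \<le> a" "a < b" "b \<le> r" "e b < e a"
        "(\<rho> (e a) = \<rho> (e b) \<and> \<not> \<rho> (e a) < m) \<or> (\<kappa> a = \<kappa> b \<and> \<not> \<kappa> a < m)"
      unfolding e_def[symmetric] by (simp_all add: p oset_def invset_def)
    then show "p \<in> invset r v" using no key by (auto simp: p invset_def)
  next
    assume pv: "p \<in> invset r v"
    then have *: "1 \<le> a" "a < b" "b \<le> r" "v b < v a" by (simp_all add: p invset_def)
    have kk: "\<kappa> a = \<kappa> b"
      using stab_inversion_same_block[OF convex(2) stab_refine_subset[OF v]] pv p by blast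
    have "\<not> \<kappa> a < m" using stab_refineD(2)[OF v, of a] stab_refineD(2)[OF v, of b] kk * by auto
    then show "p \<in> oset m r \<rho> \<kappa> (d \<circ> (u \<circ> v))"
      unfolding e_def[symmetric] using * kk key by (simp add: p oset_def invset_def)
  qed
qed

text \<open>Both sides are left eigenvectors, so it suffices to compare them at shortest
  representatives e. As lengths add, a summand is (- q)^(- l(v)) times x y T_(d u v), and by duality
  it contributes only at e = d u v. Each such e in the double coset comes from exactly one pair (u,
  v), and l(v) is the exponent of the right-hand side by \<open>oset_rep\<close>.\<close>

lemma TD_eq_zfun:
  assumes q: "q * qi = 1"
  shows "(\<lambda>w. \<Sum>u\<in>min_right_reps r (conj_inter d (stab r (refine Ev \<rho>)) (stab r (refine Ev \<kappa>))) (stab r (refine Ev \<kappa>)).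
      \<Sum>v\<in>min_right_reps r (conj_inter d (stab r (refine Od \<rho>)) (stab r (refine Od \<kappa>))) (stab r (refine Od \<kappa>)).
        (- qi) ^ cox_length r v * hm r q (hm r q (hm r q (xyf m r (- qi) \<rho>) (T_elt d)) (T_elt u)) (T_elt v) w) =
    zfun m r (- qi) \<rho> \<kappa> (Dset N r \<rho> \<kappa> A)" (is "(\<lambda>w. \<Sum>u\<in>?U. \<Sum>v\<in>?V. ?t u v w) = ?z")
proof (rule LL_vanish[OF convex(1)])
  let ?x = "xyf m r (- qi) \<rho>"
  have U: "?U = {u \<in> stab r (refine Ev \<kappa>). incr_blocks r (gam Ev) (pinv u)}"
    and V: "?V = {u \<in> stab r (refine Od \<kappa>). incr_blocks r (gam Od) (pinv u)}"
    by (rule reps_eq)+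
  have t: "?t u v = (\<lambda>w. (- qi) ^ cox_length r v * hm r q ?x (T_elt (d \<circ> (u \<circ> v))) w)"
    if u: "u \<in> stab r (refine Ev \<kappa>)" and v: "v \<in> stab r (refine Od \<kappa>)" for u v
  proof -
    note us = stab_symgrp[OF u] and vs = stab_symgrp[OF v]
    have uv: "u \<circ> v \<in> stab r \<kappa>" using stab_refine_subset[OF u] stab_refine_subset[OF v] by simp
    have "cox_length r (pinv (u \<circ> v) \<circ> pinv d) = cox_length r (pinv (u \<circ> v)) + cox_length r (pinv d)"
      using di' ds by (intro len_additive[OF convex(2) stab_inv[OF uv]]) simp_all
    moreover have "pinv (u \<circ> v) \<circ> pinv d = pinv (d \<circ> (u \<circ> v))"
      using symgrp_inv_comp[OF ds stab_symgrp[OF uv]] by simp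
    moreover have duv: "d \<circ> (u \<circ> v) \<in> symgrp r" using ds us vs by simp
    ultimately have "cox_length r (d \<circ> (u \<circ> v)) = cox_length r d + cox_length r (u \<circ> v)"
      using cox_length_inv[OF duv] cox_length_inv[OF ds] cox_length_inv[OF stab_symgrp[OF uv]] by simp
    then have "hm r q (T_elt d) (T_elt (u \<circ> v)) = T_elt (d \<circ> (u \<circ> v))"
      by (rule hm_T_T[OF ds stab_symgrp[OF uv]])
    moreover have "hm r q (T_elt u) (T_elt v) = T_elt (u \<circ> v)"
      by (rule hm_T_T[OF us vs len_refine_comp[OF convex(2) u v]])
    ultimately have D: "hm r q (T_elt d) (hm r q (T_elt u) (T_elt v)) = T_elt (d \<circ> (u \<circ> v))"
      by (simp only:)
    have "hm r q (hm r q (hm r q ?x (T_elt d)) (T_elt u)) (T_elt v) =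
        hm r q ?x (hm r q (T_elt d) (hm r q (T_elt u) (T_elt v)))"
      using us vs ds by (simp add: hm_assoc)
    then show ?thesis by (simp only: D)
  qed
  have fin: "finite ?U" "finite ?V" unfolding U V by simp_all
  have "(\<lambda>w. \<Sum>v\<in>?V. ?t u v w) \<in> LL m r (- qi) \<rho>" if "u \<in> ?U" for u
  proof (rule LL_sum)
    fix v assume "v \<in> ?V"
    then show "hm r q (hm r q (hm r q ?x (T_elt d)) (T_elt u)) (T_elt v) \<in> LL m r (- qi) \<rho>"
      using that ds stab_symgrp unfolding U V by (intro hm_LL[OF q] xyf_LL T_carrier) auto
  qed
  then have "(\<lambda>w. \<Sum>u\<in>?U. 1 * (\<Sum>v\<in>?V. ?t u v w)) \<in> LL m r (- qi) \<rho>"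
    by (rule LL_sum)
  then show "(\<lambda>w. \<Sum>u\<in>?U. \<Sum>v\<in>?V. ?t u v w) \<in> LL m r (- qi) \<rho>" by simp
  show "?z \<in> LL m r (- qi) \<rho>" by (rule zfun_Dset_LL[OF parity])
  fix e assume e: "e \<in> symgrp r" "incr_blocks r \<rho> (pinv e)"
  have sum: "(\<Sum>u\<in>?U. \<Sum>v\<in>?V. ?t u v e) =
      (\<Sum>(u, v)\<in>?U \<times> ?V. if e = d \<circ> (u \<circ> v) then (- qi) ^ cox_length r v else 0)"
    unfolding sum.cartesian_product
  proof (rule sum.cong[OF refl])
    fix p assume "p \<in> ?U \<times> ?V"
    then obtain u v where uv: "p = (u, v)" "u \<in> stab r (refine Ev \<kappa>)" "v \<in> stab r (refine Od \<kappa>)"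
        "incr_blocks r (gam Ev) (pinv u)" "incr_blocks r (gam Od) (pinv v)"
      unfolding U V by blast
    have "incr_blocks r \<rho> (pinv (d \<circ> (u \<circ> v)))" using incr_comp_iff[OF uv(2,3)] uv(4,5) by blast
    moreover have "d \<circ> (u \<circ> v) \<in> symgrp r" using ds uv(2,3) by (simp add: stab_symgrp)
    ultimately have x: "hm r q ?x (T_elt (d \<circ> (u \<circ> v))) e = (if e = d \<circ> (u \<circ> v) then 1 else 0)"
      using xyf_T_at_reps[OF convex(1) _ _ e] by blast
    have "?t u v e = (if e = d \<circ> (u \<circ> v) then (- qi) ^ cox_length r v else 0)"
      using fun_cong[OF t[OF uv(2,3)], of e] unfolding x by simp
    then show "(case p of (u, v) \<Rightarrow> ?t u v e) = (case p of (u, v) \<Rightarrow> if e = d \<circ> (u \<circ> v) then (- qi) ^ cox_length r v else 0)"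
      by (simp add: uv(1))
  qed
  show "(\<Sum>u\<in>?U. \<Sum>v\<in>?V. ?t u v e) = ?z e"
  proof (cases "e \<in> Dset N r \<rho> \<kappa> A")
    case False
    have "e \<noteq> d \<circ> (u \<circ> v)" if "u \<in> ?U" "v \<in> ?V" for u v
    proof -
      have "u \<circ> v \<in> stab r \<kappa>" using that stab_refine_subset unfolding U V by (intro stab_comp) blast+
      then show ?thesis using Dset_right[OF dD] False by blast
    qed
    then show ?thesis unfolding sum using False by (auto simp: zfun_def intro!: sum.neutral)
  next
    case True
    \<comment> \<open>The column factor of e; its even and odd parts are the only candidates for u
      and v.\<close>
    define c where "c = pinv d \<circ> e"
    have c: "c \<in> stab r \<kappa>" unfolding c_def by (rule reps_coset[OF dD True bd mono(2) di e(2)])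
    define u v where "u = part Ev \<kappa> c" and "v = part Od \<kappa> c"
    have uv: "u \<in> stab r (refine Ev \<kappa>)" "v \<in> stab r (refine Od \<kappa>)" "u \<circ> v = c"
      using part_stab[OF c] part_comp[OF c] by (auto simp: u_def v_def)
    have duv: "d \<circ> (u \<circ> v) = e" unfolding uv(3) c_def by (auto simp: fun_eq_iff symgrp_inv_app[OF ds])
    have UV: "(u, v) \<in> ?U \<times> ?V"
      unfolding U V using incr_comp_iff[OF uv(1,2)] e(2) uv(1,2) duv by auto
    have "(\<Sum>(u, v)\<in>?U \<times> ?V. if e = d \<circ> (u \<circ> v) then (- qi) ^ cox_length r v else 0) =
        (\<Sum>p\<in>?U \<times> ?V. if p = (u, v) then (- qi) ^ cox_length r v else 0)"
    proof (rule sum.cong[OF refl])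
      fix p assume "p \<in> ?U \<times> ?V"
      then obtain u' v' where p: "p = (u', v')" "u' \<in> stab r (refine Ev \<kappa>)" "v' \<in> stab r (refine Od \<kappa>)"
        unfolding U V by blast
      have "e = d \<circ> (u' \<circ> v') \<longleftrightarrow> p = (u, v)"
      proof
        assume "e = d \<circ> (u' \<circ> v')"
        then have "u' \<circ> v' = c" by (auto simp: c_def fun_eq_iff symgrp_inv_app[OF ds])
        then show "p = (u, v)" using part_of_comp[OF p(2,3)] by (simp add: p(1) u_def v_def)
      qed (simp add: p(1) duv)
      then show "(case p of (u, v) \<Rightarrow> if e = d \<circ> (u \<circ> v) then (- qi) ^ cox_length r v else 0) =
          (if p = (u, v) then (- qi) ^ cox_length r v else 0)"
        by (auto simp: p(1))
    qed
    also have "\<dots> = (- qi) ^ cox_length r v"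
      using UV fin by (subst sum.delta) (auto intro: finite_cartesian_product)
    also have "\<dots> = ?z e"
      using oset_rep[OF uv(1,2)] True e(2) stab_symgrp[OF uv(2)] by (simp add: duv zfun_def cox_length_eq)
    finally show ?thesis unfolding sum .
  qed
qed

end

text \<open>A pair violating the parity condition can be taken adjacent in both positions and
  values. Then s d = d t for simple reflections s and t inside a row block and a column block of
  opposite parity. One recursion gives h(s d) = h(d), the other h(d t) = e h(d).\<close>

lemma bad_pair_vanish:
  assumes mono: "mono_blocks r \<rho>" "mono_blocks r \<kappa>" and d: "d \<in> symgrp r"
    and di: "incr_blocks r \<rho> (pinv d)" and di': "incr_blocks r \<kappa> d"
    and hL: "h \<in> LL m r e \<rho>" and hR: "h \<in> RR m r e \<kappa>"
    and bad: "\<not> parity_ok m r \<rho> \<kappa> d" and e: "\<And>a. e * a = a \<Longrightarrow> a = 0"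
  shows "h d = 0"
proof -
  obtain i j where ij: "1 \<le> i" "i < j" "j \<le> r" "\<rho> (d i) = \<rho> (d j)" "\<kappa> i = \<kappa> j" "(\<rho> (d i) < m) \<noteq> (\<kappa> i < m)"
    using bad unfolding parity_ok_def by blast
  \<comment> \<open>Convexity permits replacing j by i + 1 without leaving the column block.\<close>
  have k: "\<kappa> (Suc i) = \<kappa> i"
    using convex_blocksD[OF mono_convex[OF mono(2)], of i "Suc i" j] ij by (cases "Suc i = j") auto
  have dd: "d i < d (Suc i)" "d (Suc i) \<le> d j"
  proof -
    show "d i < d (Suc i)" by (rule incr_blocksD[OF di' ij(1)]) (use ij k in simp_all)
    show "d (Suc i) \<le> d j"
    proof (cases "Suc i = j")
      case False
      have "d (Suc i) < d j" by (rule incr_blocksD[OF di']) (use ij k False in simp_all)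
      then show ?thesis by simp
    qed simp
  qed
  have rg: "1 \<le> d i" "d i \<le> r" "d j \<le> r" "1 \<le> d (Suc i)" "d (Suc i) \<le> r" using symgrp_bounds[OF d] ij by auto
  \<comment> \<open>A value strictly between d i and d (i + 1) would lie in the same row block, on
    which \<open>pinv d\<close> is increasing; its preimage would lie strictly between i and i +
    1.\<close>
  have S: "d (Suc i) = Suc (d i)"
  proof (rule ccontr)
    assume n: "d (Suc i) \<noteq> Suc (d i)"
    then have lt: "d i < Suc (d i)" "Suc (d i) < d (Suc i)" using dd by simp_all
    have r1: "\<rho> (Suc (d i)) = \<rho> (d i)"
      using convex_blocksD[OF mono_convex[OF mono(1)], of "d i" "Suc (d i)" "d j"] rg ij lt dd by simp
    have r2: "\<rho> (d (Suc i)) = \<rho> (d i)"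
      using convex_blocksD[OF mono_convex[OF mono(1)], of "d i" "d (Suc i)" "d j"] rg ij lt dd
      by (cases "d (Suc i) = d j") auto
    have "pinv d (d i) < pinv d (Suc (d i))"
      using incr_blocksD[OF di, of "d i" "Suc (d i)"] rg r1 lt dd by simp
    moreover have "pinv d (Suc (d i)) < pinv d (d (Suc i))"
      using incr_blocksD[OF di, of "Suc (d i)" "d (Suc i)"] rg r1 r2 lt by simp
    ultimately show False by (simp add: symgrp_inv_app[OF d])
  qed
  have rS: "\<rho> (Suc (d i)) = \<rho> (d i)"
    using convex_blocksD[OF mono_convex[OF mono(1)], of "d i" "Suc (d i)" "d j"] rg ij dd S
    by (cases "d (Suc i) = d j") auto
  have di_r: "d i < r" using rg S by simp
  have i_r: "i < r" using ij by simp
  have com: "sr (d i) \<circ> d = d \<circ> sr i" by (rule comp_sr_eq[OF d]) (simp add: S)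
  have l: "h (sr (d i) \<circ> d) = (if \<rho> (d i) < m then 1 else e) * h d"
    by (rule LLD[OF hL rg(1) di_r rS[symmetric] d]) (simp add: S[symmetric] symgrp_inv_app[OF d])
  have r: "h (d \<circ> sr i) = (if \<kappa> i < m then 1 else e) * h d"
    by (rule RRD[OF hR ij(1) i_r k[symmetric] d dd(1)])
  have "e * h d = h d" using l r ij(6) unfolding com by (auto split: if_splits)
  then show ?thesis by (rule e)
qed

text \<open>The two recursions lower the length on either side until the shortest element of a
  double coset is reached.\<close>

lemma LR_vanish:
  assumes c: "convex_blocks r \<rho>" "convex_blocks r \<kappa>"
    and hL: "h \<in> LL m r e \<rho>" and hR: "h \<in> RR m r e \<kappa>"
    and z: "\<And>d. d \<in> symgrp r \<Longrightarrow> incr_blocks r \<rho> (pinv d) \<Longrightarrow> incr_blocks r \<kappa> d \<Longrightarrow> h d = 0"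
  shows "h = (\<lambda>w. 0)"
proof (rule hecke_ext[OF LL_carrier[OF hL] zero_carrier])
  fix w :: "nat \<Rightarrow> nat" assume "w \<in> symgrp r"
  then show "h w = 0"
  proof (induction "cox_length r w" arbitrary: w rule: less_induct)
    case less
    show ?case
    proof (cases "incr_blocks r \<rho> (pinv w)")
      case False
      then obtain i where i: "1 \<le> i" "i < r" "\<rho> i = \<rho> (Suc i)" "\<not> pinv w i < pinv w (Suc i)"
        using incr_blocks_adjacent[OF c(1)] by blast
      have "pinv w i \<noteq> pinv w (Suc i)" using symgrp_inj_iff[OF symgrp_inv[OF less.prems], of i "Suc i"] by simp
      then have d: "pinv w (Suc i) < pinv w i" using i by simp
      define v where "v = sr i \<circ> w"
      have v: "v \<in> symgrp r" "pinv v i < pinv v (Suc i)" "sr i \<circ> v = w"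
        using less.prems i d by (simp_all add: v_def symgrp_inv_sr_comp)
      have "cox_length r v < cox_length r w"
        using len_left_down[OF less.prems i(1,2) d] by (simp add: v_def)
      then have "h v = 0" using less.hyps v by blast
      then show ?thesis using LLD[OF hL i(1-3) v(1,2)] v(3) by simp
    next
      case l: True
      show ?thesis
      proof (cases "incr_blocks r \<kappa> w")
        case True then show ?thesis using z l less.prems by blast
      next
        case False
        then obtain i where i: "1 \<le> i" "i < r" "\<kappa> i = \<kappa> (Suc i)" "\<not> w i < w (Suc i)"
          using incr_blocks_adjacent[OF c(2)] by blast
        have "w i \<noteq> w (Suc i)" using symgrp_inj_iff[OF less.prems, of i "Suc i"] by simp
        then have d: "w (Suc i) < w i" using i by simp
        define v where "v = w \<circ> sr i"
        have v: "v \<in> symgrp r" "v i < v (Suc i)" "v \<circ> sr i = w"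
          using less.prems i d by (simp_all add: v_def)
        have "cox_length r v < cox_length r w"
          using len_right_down[OF less.prems i(1,2) d] by (simp add: v_def)
        then have "h v = 0" using less.hyps v by blast
        then show ?thesis using RRD[OF hR i(1-3) v(1,2)] v(3) by simp
      qed
    qed
  qed
qed

subsection \<open>Blocks of compositions\<close>

text \<open>Block index of a position. The least index whose partial sum reaches k skips empty
  blocks: the preceding partial sum is still smaller than k.\<close>

definition bidx :: "nat list \<Rightarrow> nat \<Rightarrow> nat" where
  "bidx \<nu> k = (LEAST j. k \<le> sum_list (take (Suc j) \<nu>))"

lemma psum_mono: "i \<le> j \<Longrightarrow> sum_list (take i \<nu>) \<le> sum_list (take j (\<nu> :: nat list))"
  using take_add[of i "j - i" \<nu>] by simp

lemma psum_le: "sum_list (take i \<nu>) \<le> sum_list (\<nu> :: nat list)"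
  using psum_mono[of i "max i (length \<nu>)" \<nu>] by simp

lemma bidx_props:
  assumes "1 \<le> k" "k \<le> sum_list \<nu>"
  shows "bidx \<nu> k < length \<nu>" "sum_list (take (bidx \<nu> k) \<nu>) < k" "k \<le> sum_list (take (Suc (bidx \<nu> k)) \<nu>)"
proof -
  have "\<nu> \<noteq> []" using assms by auto
  then have *: "k \<le> sum_list (take (Suc (length \<nu> - 1)) \<nu>)" using assms by simp
  show "k \<le> sum_list (take (Suc (bidx \<nu> k)) \<nu>)"
    unfolding bidx_def by (rule LeastI[of "\<lambda>j. k \<le> sum_list (take (Suc j) \<nu>)", OF *])
  have "bidx \<nu> k \<le> length \<nu> - 1"
    unfolding bidx_def by (rule Least_le[of "\<lambda>j. k \<le> sum_list (take (Suc j) \<nu>)", OF *])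
  then show "bidx \<nu> k < length \<nu>" using \<open>\<nu> \<noteq> []\<close> by (cases \<nu>) auto
  show "sum_list (take (bidx \<nu> k) \<nu>) < k"
  proof (cases "bidx \<nu> k")
    case 0 then show ?thesis using assms by simp
  next
    case (Suc j)
    then have "\<not> k \<le> sum_list (take (Suc j) \<nu>)"
      using not_less_Least[of j "\<lambda>j. k \<le> sum_list (take (Suc j) \<nu>)"] unfolding bidx_def by simp
    then show ?thesis using Suc by simp
  qed
qed

lemma bidx_eqI:
  assumes "sum_list (take j \<nu>) < k" "k \<le> sum_list (take (Suc j) \<nu>)"
  shows "bidx \<nu> k = j"
  unfolding bidx_def
proof (rule Least_equality)
  show "k \<le> sum_list (take (Suc j) \<nu>)" by (rule assms(2))
  fix i assume "k \<le> sum_list (take (Suc i) \<nu>)"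
  then show "j \<le> i" using psum_mono[of "Suc i" j \<nu>] assms(1) by (cases "Suc i \<le> j") auto
qed

lemma block_iff:
  assumes "1 \<le> k" "k \<le> sum_list \<nu>"
  shows "k \<in> block \<nu> j \<longleftrightarrow> bidx \<nu> k = j"
proof
  assume "k \<in> block \<nu> j"
  then show "bidx \<nu> k = j" by (intro bidx_eqI) (simp_all add: block_def)
next
  assume "bidx \<nu> k = j"
  then show "k \<in> block \<nu> j" using bidx_props[OF assms] by (simp add: block_def)
qed

lemma block_range: "block \<nu> j \<subseteq> {1..sum_list \<nu>}"
  using psum_le[of "Suc j" \<nu>] by (auto simp: block_def)

lemma block_eq: "block \<nu> j = {k \<in> {1..sum_list \<nu>}. bidx \<nu> k = j}"
proof (rule Set.set_eqI, rule iffI)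
  fix k assume k: "k \<in> block \<nu> j"
  then have "k \<in> {1..sum_list \<nu>}" using block_range by blast
  then show "k \<in> {k \<in> {1..sum_list \<nu>}. bidx \<nu> k = j}" using k block_iff[of k \<nu> j] by simp
qed (simp add: block_iff)

lemma card_block: "j < length \<nu> \<Longrightarrow> card (block \<nu> j) = \<nu> ! j"
  by (simp add: block_def take_Suc_conv_app_nth)

lemma mono_bidx: "mono_blocks (sum_list \<nu>) (bidx \<nu>)"
  unfolding mono_blocks_def
proof (intro allI impI)
  fix x y assume "1 \<le> x" "x \<le> y" "y \<le> sum_list \<nu>"
  then have "x \<le> sum_list (take (Suc (bidx \<nu> y)) \<nu>)" using bidx_props(3)[of y \<nu>] by simp
  then show "bidx \<nu> x \<le> bidx \<nu> y" unfolding bidx_def[of \<nu> x] by (rule Least_le)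
qed

lemma young_eq: "young \<nu> = stab (sum_list \<nu>) (bidx \<nu>)"
proof (rule Set.set_eqI, rule iffI)
  fix w assume "w \<in> young \<nu>"
  then have w: "w \<in> symgrp (sum_list \<nu>)" "\<And>k. k < length \<nu> \<Longrightarrow> w ` block \<nu> k = block \<nu> k"
    by (auto simp: young_def)
  have "bidx \<nu> (w k) = bidx \<nu> k" for k
  proof (cases "k \<in> {1..sum_list \<nu>}")
    case True
    then have k: "k \<in> block \<nu> (bidx \<nu> k)" "bidx \<nu> k < length \<nu>" using block_iff[of k \<nu>] bidx_props(1)[of k \<nu>] by auto
    then have "w k \<in> block \<nu> (bidx \<nu> k)" using w(2)[OF k(2)] by blast
    then show ?thesis unfolding block_eq by simp
  next
    case False then show ?thesis using symgrp_fix[OF w(1)] by simp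
  qed
  then show "w \<in> stab (sum_list \<nu>) (bidx \<nu>)" using w by (simp add: stab_def)
next
  fix w assume w: "w \<in> stab (sum_list \<nu>) (bidx \<nu>)"
  have sub: "v ` block \<nu> k \<subseteq> block \<nu> k" if v: "v \<in> stab (sum_list \<nu>) (bidx \<nu>)" for v k
  proof
    fix y assume "y \<in> v ` block \<nu> k"
    then obtain x where x: "y = v x" "x \<in> {1..sum_list \<nu>}" "bidx \<nu> x = k" unfolding block_eq by blast
    then show "y \<in> block \<nu> k"
      unfolding block_eq using symgrp_range[OF stab_symgrp[OF v], of x] stabD[OF v, of x] by simp
  qed
  have "block \<nu> k \<subseteq> w ` block \<nu> k" for k
  proof
    fix y assume "y \<in> block \<nu> k"
    then have "pinv w y \<in> block \<nu> k" using sub[OF stab_inv[OF w]] by blast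
    moreover have "y = w (pinv w y)" by (simp add: symgrp_inv_app[OF stab_symgrp[OF w]])
    ultimately show "y \<in> w ` block \<nu> k" by (rule image_eqI[rotated])
  qed
  then have "w ` block \<nu> k = block \<nu> k" for k using sub[OF w] by blast
  then show "w \<in> young \<nu>" using stab_symgrp[OF w] by (simp add: young_def)
qed

lemma bidx_append1:
  assumes "1 \<le> k" "k \<le> sum_list la" shows "bidx (la @ \<mu>) k = bidx la k"
  using bidx_props[OF assms] by (intro bidx_eqI) simp_all

lemma bidx_append2:
  assumes "sum_list la < k" "k \<le> sum_list la + sum_list \<mu>"
  shows "bidx (la @ \<mu>) k = length la + bidx \<mu> (k - sum_list la)"
proof -
  have *: "1 \<le> k - sum_list la" "k - sum_list la \<le> sum_list \<mu>" using assms by auto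
  show ?thesis using bidx_props[OF *] assms by (intro bidx_eqI) (simp_all add: take_append)
qed

lemma bidx_ones: "1 \<le> k \<Longrightarrow> k \<le> t \<Longrightarrow> bidx (replicate t 1) k = k - 1"
  by (rule bidx_eqI) (auto simp: sum_list_replicate min_def)

section \<open>Even and odd Young subgroups of a bicomposition\<close>

lemma stab_cong:
  assumes "\<And>x y. x \<in> {1..r} \<Longrightarrow> y \<in> {1..r} \<Longrightarrow> b x = b y \<longleftrightarrow> b' x = b' y"
  shows "stab r b = stab r b'"
proof -
  have "(\<forall>k. b (w k) = b k) \<longleftrightarrow> (\<forall>k. b' (w k) = b' k)" if w: "w \<in> symgrp r" for w
  proof -
    have "b (w k) = b k \<longleftrightarrow> b' (w k) = b' k" for k
    proof (cases "k \<in> {1..r}")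
      case True
      then show ?thesis using assms[of "w k" k] symgrp_range[OF w, of k] by blast
    next
      case False then show ?thesis using symgrp_fix[OF w] by simp
    qed
    then show ?thesis by blast
  qed
  then show ?thesis unfolding stab_def by blast
qed

text \<open>The labelling by blocks of the concatenation. The first m indices are those of the even
  part, so comparing a label with m tests its parity.\<close>

definition rho :: "nat list \<times> nat list \<Rightarrow> nat \<Rightarrow> nat" where
  "rho p = bidx (fst p @ snd p)"

lemma bicompsD:
  assumes "p \<in> bicomps m n r"
  shows "length (fst p) = m" "length (snd p) = n" "sum_list (fst p @ snd p) = r" "length (fst p @ snd p) = m + n"
  using assms by (auto simp: bicomps_def)

lemma rho_mono: "p \<in> bicomps m n r \<Longrightarrow> mono_blocks r (rho p)"
  using mono_bidx[of "fst p @ snd p"] bicompsD(3)[of p m n r] by (simp add: rho_def)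

lemma rho_convex: "p \<in> bicomps m n r \<Longrightarrow> convex_blocks r (rho p)"
  by (rule mono_convex[OF rho_mono])

lemma rho_bound: "p \<in> bicomps m n r \<Longrightarrow> x \<in> {1..r} \<Longrightarrow> rho p x < m + n"
  using bidx_props(1)[of x "fst p @ snd p"] bicompsD(3,4)[of p m n r] by (simp add: rho_def)

lemma rho_left: 
  assumes "p \<in> bicomps m n r" "1 \<le> x" "x \<le> sum_list (fst p)"
  shows "rho p x = bidx (fst p) x" "rho p x < m"
  using bidx_append1[OF assms(2,3)] bidx_props(1)[OF assms(2,3)] bicompsD[OF assms(1)] by (simp_all add: rho_def)

lemma rho_right: 
  assumes "p \<in> bicomps m n r" "sum_list (fst p) < x" "x \<le> r"
  shows "rho p x = m + bidx (snd p) (x - sum_list (fst p))"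
  using bidx_append2[OF assms(2)] bicompsD[OF assms(1)] assms(3) by (simp add: rho_def)

text \<open>Padding with parts equal to 1 labels every position beyond the even part injectively,
  which is what \<open>refine\<close> does with the odd blocks. The labels themselves differ; only
  the induced partition of positions matters, by \<open>stab_cong\<close>.\<close>

lemma young_lstar:
  assumes p: "p \<in> bicomps m n r"
  shows "young (lstar r (fst p)) = stab r (refine (\<lambda>j. j < m) (rho p))"
proof -
  note pD = bicompsD[OF p]
  let ?s = "sum_list (fst p)"
  have sum: "sum_list (lstar r (fst p)) = r" using pD by (simp add: lstar_def sum_list_replicate)
  have L: "bidx (lstar r (fst p)) x = bidx (fst p) x" "bidx (fst p) x < m" if "1 \<le> x" "x \<le> ?s" for x
    using bidx_append1[OF that] bidx_props(1)[OF that] pD by (simp_all add: lstar_def)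
  \<comment> \<open>Positions start at 1 and block indices at 0, hence the subtraction of 1 within
    the run of ones.\<close>
  have R: "bidx (lstar r (fst p)) x = m + (x - ?s - 1)" if "?s < x" "x \<le> r" for x
    using bidx_append2[of "fst p" x "replicate (r - ?s) 1"] bidx_ones[of "x - ?s" "r - ?s"] that pD
    by (simp add: lstar_def sum_list_replicate)
  have "stab r (bidx (lstar r (fst p))) = stab r (refine (\<lambda>j. j < m) (rho p))"
  proof (rule stab_cong)
    fix x y assume xy: "x \<in> {1..r}" "y \<in> {1..r}"
    show "bidx (lstar r (fst p)) x = bidx (lstar r (fst p)) y \<longleftrightarrow>
        refine (\<lambda>j. j < m) (rho p) x = refine (\<lambda>j. j < m) (rho p) y"
    proof -
      have key: "m + (x - ?s - 1) = m + (y - ?s - 1) \<longleftrightarrow> x = y" if "?s < x" "?s < y" using that by arith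
      consider "x \<le> ?s" "y \<le> ?s" | "x \<le> ?s" "?s < y" | "?s < x" "y \<le> ?s" | "?s < x" "?s < y" by linarith
      then show ?thesis
      proof cases
        case 4
        then show ?thesis using R[of x] R[of y] key rho_right[OF p, of x] xy by (auto simp: refine_eq_iff)
      qed (use L[of x] L[of y] R[of x] R[of y] rho_left[OF p, of x] rho_left[OF p, of y]
        rho_right[OF p, of x] rho_right[OF p, of y] xy in \<open>simp_all add: refine_eq_iff\<close>)
    qed
  qed
  then show ?thesis unfolding young_eq sum .
qed

lemma young_rstar:
  assumes p: "p \<in> bicomps m n r"
  shows "young (rstar r (snd p)) = stab r (refine (\<lambda>j. \<not> j < m) (rho p))"
proof -
  note pD = bicompsD[OF p]
  let ?s = "sum_list (fst p)"
  have s: "r - sum_list (snd p) = ?s" using pD by simp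
  have sum: "sum_list (rstar r (snd p)) = r" using pD by (simp add: rstar_def sum_list_replicate)
  have L: "bidx (rstar r (snd p)) x = x - 1" "rho p x < m" if "1 \<le> x" "x \<le> ?s" for x
    using bidx_append1[of x "replicate ?s 1"] bidx_ones[OF that] rho_left[OF p that] that
    by (simp_all add: rstar_def s sum_list_replicate)
  have R: "bidx (rstar r (snd p)) x = ?s + bidx (snd p) (x - ?s)" if "?s < x" "x \<le> r" for x
    using bidx_append2[of "replicate ?s 1" x "snd p"] that pD
    by (simp add: rstar_def s sum_list_replicate)
  have "stab r (bidx (rstar r (snd p))) = stab r (refine (\<lambda>j. \<not> j < m) (rho p))"
  proof (rule stab_cong)
    fix x y assume xy: "x \<in> {1..r}" "y \<in> {1..r}"
    show "bidx (rstar r (snd p)) x = bidx (rstar r (snd p)) y \<longleftrightarrow>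
        refine (\<lambda>j. \<not> j < m) (rho p) x = refine (\<lambda>j. \<not> j < m) (rho p) y"
    proof -
      have key: "x - 1 = y - 1 \<longleftrightarrow> x = y" using xy by auto
      have lt: "x - 1 < ?s" if "x \<le> ?s" "x \<in> {1..r}" for x using that by auto
      consider "x \<le> ?s" "y \<le> ?s" | "x \<le> ?s" "?s < y" | "?s < x" "y \<le> ?s" | "?s < x" "?s < y" by linarith
      then show ?thesis
      proof cases
        case 1
        then show ?thesis using L[of x] L[of y] key xy by (auto simp: refine_eq_iff)
      qed (use L[of x] L[of y] R[of x] R[of y] lt[of x] lt[of y]
        rho_right[OF p, of x] rho_right[OF p, of y] xy in \<open>simp_all add: refine_eq_iff\<close>)
    qed
  qed
  then show ?thesis unfolding young_eq sum .
qed

section \<open>Generators and summands of the tensor space as eigenvectors and eigenspaces\<close>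

lemma q_qinv:
  assumes "comm_ring_hom f" shows "q_of f * qinv_of f = 1"
proof -
  interpret comm_ring_hom f by fact
  have "q_of f * qinv_of f = f (Poly_Mapping.single 2 1 * Poly_Mapping.single (-2) 1)"
    by (simp only: q_of_def qinv_of_def hom_mult)
  also have "\<dots> = 1" by (simp add: mult_single)
  finally show ?thesis .
qed

lemma x_elt_eq:
  assumes "p \<in> bicomps m n r"
  shows "x_elt r (fst p) = (\<lambda>w. \<Sum>u\<in>stab r (refine (\<lambda>j. j < m) (rho p)). T_elt u w)"
  by (simp only: x_elt_def young_lstar[OF assms])

lemma y_elt_eq:
  assumes "p \<in> bicomps m n r"
  shows "y_elt r f (snd p) =
    (\<lambda>w. \<Sum>v\<in>stab r (refine (\<lambda>j. \<not> j < m) (rho p)). (- qinv_of f) ^ cox_length r v * T_elt v w)"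
  by (simp only: y_elt_def young_rstar[OF assms])

lemma xy_elt_eq:
  assumes "p \<in> bicomps m n r"
  shows "xy_elt r f p = xyf m r (- qinv_of f) (rho p)"
proof -
  have "x_elt r (fst p) \<in> (hecke_carrier r :: 'a hecke set)"
    using sum_carrier[of "stab r (refine (\<lambda>j. j < m) (rho p))" T_elt r "\<lambda>_. 1"]
    by (simp add: x_elt_eq[OF assms] stab_symgrp)
  moreover have "y_elt r f (snd p) \<in> hecke_carrier r"
    unfolding y_elt_eq[OF assms] by (rule sum_carrier) (simp add: stab_symgrp)
  ultimately show ?thesis
    unfolding xy_elt_def by (simp add: hmult_eq_hm x_elt_eq[OF assms] y_elt_eq[OF assms] xyf_product[OF rho_convex[OF assms]])
qed

lemma xyH_eq:
  assumes f: "comm_ring_hom f" and p: "p \<in> bicomps m n r"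
  shows "xyH r f p = LL m r (- qinv_of f) (rho p)"
proof -
  have "xyH r f p = {hm r (q_of f) (xyf m r (- qinv_of f) (rho p)) h | h. h \<in> hecke_carrier r}"
    unfolding xyH_def xy_elt_eq[OF p] by (force simp: hmult_eq_hm)
  then show ?thesis using LL_eq_xyf[OF rho_convex[OF p] q_qinv[OF f]] by simp
qed

subsection \<open>Matrices and double cosets\<close>

lemma sum_list_map_upt: "sum_list (map g [a..<b]) = (\<Sum>i\<in>{a..<b}. g i :: nat)"
  by (simp add: sum_list_distinct_conv_sum_set)

lemma row_comp_bicomps: "A \<in> matrices m n r \<Longrightarrow> row_comp m n A \<in> bicomps m n r"
  unfolding row_comp_def bicomps_def matrices_def
  using sum.atLeastLessThan_concat[of 0 m "m + n" "\<lambda>i. \<Sum>j<m + n. A $$ (i, j)"]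
  by (simp add: sum_list_map_upt lessThan_atLeast0)

lemma col_comp_transpose: "A \<in> carrier_mat (m + n) (m + n) \<Longrightarrow> row_comp m n (transpose_mat A) = col_comp m n A"
  by (auto simp: row_comp_def col_comp_def)

lemma row_comp_transpose: "A \<in> carrier_mat (m + n) (m + n) \<Longrightarrow> col_comp m n (transpose_mat A) = row_comp m n A"
  by (auto simp: row_comp_def col_comp_def)

lemma matrices_carrier: "A \<in> matrices m n r \<Longrightarrow> A \<in> carrier_mat (m + n) (m + n)"
  by (simp add: matrices_def)

lemma transpose_matrices:
  assumes "A \<in> matrices m n r" shows "transpose_mat A \<in> matrices m n r"
proof -
  have "(\<Sum>i<m + n. \<Sum>j<m + n. transpose_mat A $$ (i, j)) = (\<Sum>i<m + n. \<Sum>j<m + n. A $$ (j, i))"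
    using matrices_carrier[OF assms] by (intro sum.cong) auto
  also have "\<dots> = (\<Sum>i<m + n. \<Sum>j<m + n. A $$ (i, j))" by (rule sum.swap)
  moreover have "A $$ (j, i) \<in> {0, 1}" if "i < m + n" "j < m + n" "(i < m) \<noteq> (j < m)" for i j
    using assms that unfolding matrices_def by blast
  moreover have "transpose_mat A $$ (i, j) = A $$ (j, i)" if "i < m + n" "j < m + n" for i j
    using matrices_carrier[OF assms] that by auto
  ultimately show ?thesis using assms by (simp add: matrices_def)
qed

lemma col_comp_bicomps: "A \<in> matrices m n r \<Longrightarrow> col_comp m n A \<in> bicomps m n r"
  using row_comp_bicomps[OF transpose_matrices] col_comp_transpose matrices_carrier by metis

definition rowb :: "nat \<Rightarrow> nat \<Rightarrow> nat mat \<Rightarrow> nat \<Rightarrow> nat" where "rowb m n A = rho (row_comp m n A)"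
definition colb :: "nat \<Rightarrow> nat \<Rightarrow> nat mat \<Rightarrow> nat \<Rightarrow> nat" where "colb m n A = rho (col_comp m n A)"

definition DA :: "nat \<Rightarrow> nat \<Rightarrow> nat \<Rightarrow> nat mat \<Rightarrow> (nat \<Rightarrow> nat) set" where
  "DA m n r A = Dset (m + n) r (rowb m n A) (colb m n A) (\<lambda>i j. A $$ (i, j))"

lemma card_block_inter:
  assumes p: "p \<in> bicomps m n r" and p': "p' \<in> bicomps m n r" and w: "w \<in> symgrp r"
  shows "card (block (fst p @ snd p) i \<inter> w ` block (fst p' @ snd p') j) = mt r (rho p) (rho p') w i j"
proof -
  have "block (fst p @ snd p) i \<inter> w ` block (fst p' @ snd p') j = w ` {k \<in> {1..r}. rho p (w k) = i \<and> rho p' k = j}"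
    unfolding block_eq bicompsD(3)[OF p] bicompsD(3)[OF p'] rho_def using symgrp_range[OF w] by auto
  moreover have "inj_on w X" for X by (simp add: inj_on_def symgrp_inj_iff[OF w])
  ultimately show ?thesis by (simp add: mt_def card_image)
qed

lemma double_coset_eq:
  assumes A: "A \<in> matrices m n r"
  shows "double_coset m n r A = DA m n r A"
proof -
  note r = row_comp_bicomps[OF A] and c = col_comp_bicomps[OF A]
  have "double_coset m n r A = {w \<in> symgrp r. \<forall>i<m + n. \<forall>j<m + n.
      card (block (fst (row_comp m n A) @ snd (row_comp m n A)) i \<inter>
        w ` block (fst (col_comp m n A) @ snd (col_comp m n A)) j) = A $$ (i, j)}"
    by (simp add: double_coset_def case_prod_beta)
  then show ?thesis
    by (auto simp: DA_def Dset_def rowb_def colb_def card_block_inter[OF r c])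
qed

lemma card_block_rho:
  assumes "p \<in> bicomps m n r" "i < m + n"
  shows "card {k \<in> {1..r}. rho p k = i} = (fst p @ snd p) ! i"
  using card_block[of i "fst p @ snd p"] bicompsD(3,4)[OF assms(1)] assms(2)
  unfolding block_eq by (simp add: rho_def)

lemma row_comp_nth:
  assumes "i < m + n"
  shows "(fst (row_comp m n A) @ snd (row_comp m n A)) ! i = (\<Sum>j<m + n. A $$ (i, j))"
  using assms by (auto simp: row_comp_def nth_append)

lemma col_comp_nth:
  assumes "j < m + n"
  shows "(fst (col_comp m n A) @ snd (col_comp m n A)) ! j = (\<Sum>i<m + n. A $$ (i, j))"
  using assms by (auto simp: col_comp_def nth_append)

text \<open>Fibres of equal size are matched one label at a time; the resulting bijections have
  disjoint domains and images and can be glued.\<close>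

lemma fiber_bijection:
  assumes fin: "finite X" "finite Y"
    and card: "\<And>i. card {x \<in> X. f x = i} = card {y \<in> Y. g y = i}"
  obtains h where "bij_betw h X Y" "\<And>x. x \<in> X \<Longrightarrow> g (h x) = f x"
proof -
  have "\<exists>h. bij_betw h {x \<in> X. f x = i} {y \<in> Y. g y = i}" for i
    using card[of i] fin by (intro finite_same_card_bij) auto
  then obtain H where H: "\<And>i. bij_betw (H i) {x \<in> X. f x = i} {y \<in> Y. g y = i}" by metis
  define h where "h x = H (f x) x" for x
  have hY: "h x \<in> Y \<and> g (h x) = f x" if "x \<in> X" for x
    using bij_betwE[OF H[of "f x"]] that unfolding h_def by blast
  have "bij_betw h X Y"
    unfolding bij_betw_def
  proof
    show "inj_on h X"
    proof (rule inj_onI)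
      fix x y assume xy: "x \<in> X" "y \<in> X" "h x = h y"
      then have "f x = f y" using hY by metis
      then show "x = y"
        using xy bij_betw_imp_inj_on[OF H[of "f x"]] unfolding h_def inj_on_def by auto
    qed
    show "h ` X = Y"
    proof (rule Set.set_eqI, rule iffI)
      fix y assume "y \<in> Y"
      then have "y \<in> H (g y) ` {x \<in> X. f x = g y}" using bij_betw_imp_surj_on[OF H[of "g y"]] by blast
      then obtain x where "x \<in> X" "f x = g y" "y = H (g y) x" by blast
      then show "y \<in> h ` X" by (intro image_eqI[of y h x]) (simp_all add: h_def)
    qed (use hY in blast)
  qed
  then show ?thesis using that hY by blast
qed

text \<open>An auxiliary set K of cells has as many cells over (i, j) as the entry prescribes.
  Matching positions with cells, once by column and once by row, and composing the two matchings
  gives a permutation with the given matrix.\<close>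

lemma DA_nonempty:
  assumes A: "A \<in> matrices m n r" shows "DA m n r A \<noteq> {}"
proof -
  let ?N = "m + n"
  define K where "K = (SIGMA i:{..<?N}. SIGMA j:{..<?N}. {..<A $$ (i, j)})"
  have finK: "finite K" by (simp add: K_def)
  note rb = row_comp_bicomps[OF A] and cb = col_comp_bicomps[OF A]
  have row: "card {z \<in> K. fst z = i} = card {k \<in> {1..r}. rowb m n A k = i}" for i
  proof (cases "i < ?N")
    case True
    have "{z \<in> K. fst z = i} = {i} \<times> (SIGMA j:{..<?N}. {..<A $$ (i, j)})" using True by (auto simp: K_def)
    then have "card {z \<in> K. fst z = i} = (\<Sum>j<?N. A $$ (i, j))" by (simp add: card_cartesian_product_singleton)
    then show ?thesis using card_block_rho[OF rb True] row_comp_nth[OF True] by (simp add: rowb_def)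
  next
    case False
    then have "{z \<in> K. fst z = i} = {}" by (auto simp: K_def)
    moreover have "{k \<in> {1..r}. rowb m n A k = i} = {}" using rho_bound[OF rb] False by (auto simp: rowb_def)
    ultimately show ?thesis by (simp only: card.empty)
  qed
  have col: "card {k \<in> {1..r}. colb m n A k = j} = card {z \<in> K. fst (snd z) = j}" for j
  proof (cases "j < ?N")
    case True
    have "bij_betw (\<lambda>(i, k). (i, j, k)) (SIGMA i:{..<?N}. {..<A $$ (i, j)}) {z \<in> K. fst (snd z) = j}"
      using True by (intro bij_betwI[where g = "\<lambda>(i, j, k). (i, k)"]) (auto simp: K_def)
    then have "card {z \<in> K. fst (snd z) = j} = (\<Sum>i<?N. A $$ (i, j))"
      using bij_betw_same_card by fastforce
    then show ?thesis using card_block_rho[OF cb True] col_comp_nth[OF True] by (simp add: colb_def)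
  next
    case False
    then have "{z \<in> K. fst (snd z) = j} = {}" by (auto simp: K_def)
    moreover have "{k \<in> {1..r}. colb m n A k = j} = {}" using rho_bound[OF cb] False by (auto simp: colb_def)
    ultimately show ?thesis by (simp only: card.empty)
  qed
  obtain h1 where h1: "bij_betw h1 K {1..r}" "\<And>z. z \<in> K \<Longrightarrow> rowb m n A (h1 z) = fst z"
    using fiber_bijection[of K "{1..r}" fst "rowb m n A", OF finK _ row] by auto
  obtain h2 where h2: "bij_betw h2 {1..r} K" "\<And>k. k \<in> {1..r} \<Longrightarrow> fst (snd (h2 k)) = colb m n A k"
    using fiber_bijection[of "{1..r}" K "colb m n A" "\<lambda>z. fst (snd z)", OF _ finK col] by auto
  define w where "w k = (if k \<in> {1..r} then h1 (h2 k) else k)" for k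
  have "bij_betw (h1 \<circ> h2) {1..r} {1..r}" by (rule bij_betw_trans[OF h2(1) h1(1)])
  then have "bij_betw w {1..r} {1..r}" by (rule bij_betw_cong[THEN iffD1, rotated]) (simp add: w_def)
  then have ws: "w \<in> symgrp r"
    unfolding symgrp_def by (intro CollectI bij_imp_permutes) (auto simp: w_def)
  have "mt r (rowb m n A) (colb m n A) w i j = A $$ (i, j)" if ij: "i < ?N" "j < ?N" for i j
  proof -
    have "{k \<in> {1..r}. rowb m n A (w k) = i \<and> colb m n A k = j} = {k \<in> {1..r}. h2 k \<in> {z \<in> K. fst z = i \<and> fst (snd z) = j}}"
      using h1(2) h2(2) bij_betwE[OF h2(1)] by (auto simp: w_def)
    moreover have "bij_betw h2 {k \<in> {1..r}. h2 k \<in> {z \<in> K. fst z = i \<and> fst (snd z) = j}} {z \<in> K. fst z = i \<and> fst (snd z) = j}"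
    proof (rule bij_betw_subset[OF h2(1)])
      show "h2 ` {k \<in> {1..r}. h2 k \<in> {z \<in> K. fst z = i \<and> fst (snd z) = j}} = {z \<in> K. fst z = i \<and> fst (snd z) = j}"
        using bij_betw_imp_surj_on[OF h2(1)] by blast
    qed blast
    moreover have "{z \<in> K. fst z = i \<and> fst (snd z) = j} = {i} \<times> {j} \<times> {..<A $$ (i, j)}"
      using ij by (auto simp: K_def)
    ultimately show ?thesis unfolding mt_def by (simp add: bij_betw_same_card card_cartesian_product)
  qed
  then have "w \<in> DA m n r A" using ws by (simp add: DA_def Dset_def)
  then show ?thesis by blast
qed

lemma double_rep_shortest:
  assumes A: "A \<in> matrices m n r"
  shows "double_rep (m + n) m r (rowb m n A) (colb m n A) (\<lambda>i j. A $$ (i, j)) (shortest m n r A)"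
proof -
  note rb = row_comp_bicomps[OF A] and cb = col_comp_bicomps[OF A]
  have s: "shortest m n r A = arg_min_on (cox_length r) (Dset (m + n) r (rowb m n A) (colb m n A) (\<lambda>i j. A $$ (i, j)))"
    unfolding shortest_def double_coset_eq[OF A] DA_def ..
  note sh = shortest_incr[OF _ _ _ s]
  have 1: "Dset (m + n) r (rowb m n A) (colb m n A) (\<lambda>i j. A $$ (i, j)) \<noteq> {}"
    using DA_nonempty[OF A] by (simp add: DA_def)
  have 2: "convex_blocks r (rowb m n A)" "convex_blocks r (colb m n A)"
    using rho_convex[OF rb] rho_convex[OF cb] by (simp_all add: rowb_def colb_def)
  show ?thesis
  proof
    show "mono_blocks r (rowb m n A)" "mono_blocks r (colb m n A)"
      using rho_mono[OF rb] rho_mono[OF cb] by (simp_all add: rowb_def colb_def)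
    show "rowb m n A x < m + n \<and> colb m n A x < m + n" if "x \<in> {1..r}" for x
      using rho_bound[OF rb that] rho_bound[OF cb that] by (simp add: rowb_def colb_def)
    show "A $$ (i, j) \<le> 1" if "i < m + n" "j < m + n" "(i < m) \<noteq> (j < m)" for i j
    proof -
      have "A $$ (i, j) \<in> {0, 1}" using A that unfolding matrices_def by blast
      then show ?thesis by auto
    qed
  qed (rule sh[OF 1 2])+
qed

definition zA :: "nat \<Rightarrow> nat \<Rightarrow> nat \<Rightarrow> 'r::comm_ring_1 \<Rightarrow> nat mat \<Rightarrow> 'r hecke" where
  "zA m n r e A = zfun m r e (rowb m n A) (colb m n A) (DA m n r A)"

lemma TD_eq_zA:
  assumes f: "comm_ring_hom f" and A: "A \<in> matrices m n r"
  shows "TD m n r f A = zA m n r (- qinv_of f) A"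
proof -
  interpret double_rep "m + n" m r "rowb m n A" "colb m n A" "\<lambda>i j. A $$ (i, j)" "shortest m n r A"
    by (rule double_rep_shortest[OF A])
  note rb = row_comp_bicomps[OF A] and cb = col_comp_bicomps[OF A]
  let ?d = "shortest m n r A"
  let ?x = "xyf m r (- qinv_of f) (rowb m n A)"
  have sub: "min_right_reps r X (stab r b) \<subseteq> symgrp r" for X and b :: "nat \<Rightarrow> nat \<times> nat"
    by (auto simp: min_right_reps_def stab_symgrp)
  have mult: "hmult r f (hmult r f (hmult r f ?x (T_elt ?d)) (T_elt u)) (T_elt v) =
      hm r (q_of f) (hm r (q_of f) (hm r (q_of f) ?x (T_elt ?d)) (T_elt u)) (T_elt v)"
    if "u \<in> symgrp r" "v \<in> symgrp r" for u v
    using that ds by (simp add: hmult_eq_hm)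
  have "TD m n r f A = (\<lambda>w. \<Sum>u\<in>min_right_reps r (conj_inter ?d (stab r (refine Ev (rowb m n A))) (stab r (refine Ev (colb m n A)))) (stab r (refine Ev (colb m n A))).
      \<Sum>v\<in>min_right_reps r (conj_inter ?d (stab r (refine Od (rowb m n A))) (stab r (refine Od (colb m n A)))) (stab r (refine Od (colb m n A))).
        (- qinv_of f) ^ cox_length r v * hmult r f (hmult r f (hmult r f ?x (T_elt ?d)) (T_elt u)) (T_elt v) w)"
    using young_lstar[OF rb] young_lstar[OF cb] young_rstar[OF rb] young_rstar[OF cb] xy_elt_eq[OF rb, of f]
    by (simp add: TD_def Let_def case_prod_beta rowb_def colb_def)
  also have "\<dots> = (\<lambda>w. \<Sum>u\<in>min_right_reps r (conj_inter ?d (stab r (refine Ev (rowb m n A))) (stab r (refine Ev (colb m n A)))) (stab r (refine Ev (colb m n A))).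
      \<Sum>v\<in>min_right_reps r (conj_inter ?d (stab r (refine Od (rowb m n A))) (stab r (refine Od (colb m n A)))) (stab r (refine Od (colb m n A))).
        (- qinv_of f) ^ cox_length r v * hm r (q_of f) (hm r (q_of f) (hm r (q_of f) ?x (T_elt ?d)) (T_elt u)) (T_elt v) w)"
    using sub by (intro ext sum.cong refl arg_cong2[where f = "(*)"] fun_cong[OF mult]) blast+
  finally show ?thesis unfolding zA_def DA_def TD_eq_zfun[OF q_qinv[OF f]] .
qed

lemma zA_LL: "A \<in> matrices m n r \<Longrightarrow> zA m n r e A \<in> LL m r e (rho (row_comp m n A))"
  using zfun_Dset_LL[OF double_rep.parity[OF double_rep_shortest]]
  unfolding zA_def DA_def by (simp add: rowb_def)

lemma zA_RR: "A \<in> matrices m n r \<Longrightarrow> zA m n r e A \<in> RR m r e (rho (col_comp m n A))"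
  using zfun_Dset_RR[OF double_rep.parity[OF double_rep_shortest]]
  unfolding zA_def DA_def by (simp add: colb_def)

lemma iota_zA:
  assumes "A \<in> matrices m n r" shows "iota r (zA m n r e A) = zA m n r e (transpose_mat A)"
proof -
  note c = matrices_carrier[OF assms]
  have rc: "rowb m n (transpose_mat A) = colb m n A" "colb m n (transpose_mat A) = rowb m n A"
    by (simp_all add: rowb_def colb_def col_comp_transpose[OF c] row_comp_transpose[OF c])
  have "pinv ` DA m n r A = DA m n r (transpose_mat A)"
    unfolding DA_def Dset_inv rc using c by (auto simp: Dset_def)
  moreover have "DA m n r A \<subseteq> symgrp r" unfolding DA_def by (rule Dset_subset)
  ultimately show ?thesis unfolding zA_def by (simp add: iota_zfun rc)
qed

text \<open>With equal row and column sums, distinct matrices have disjoint double cosets, and at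
  the shortest element of its own double coset the exponent is 0. So the elements \<open>zA\<close>
  are dual to evaluation at the shortest elements.\<close>

lemma zA_at_shortest:
  assumes A: "A \<in> matrices m n r" and B: "B \<in> matrices m n r"
    and e: "row_comp m n A = row_comp m n B" "col_comp m n A = col_comp m n B"
  shows "zA m n r e A (shortest m n r B) = (if A = B then 1 else 0)"
proof -
  interpret B: double_rep "m + n" m r "rowb m n B" "colb m n B" "\<lambda>i j. B $$ (i, j)" "shortest m n r B"
    by (rule double_rep_shortest[OF B])
  have rc: "rowb m n A = rowb m n B" "colb m n A = colb m n B" by (simp_all add: rowb_def colb_def e)
  have "shortest m n r B \<in> DA m n r A \<longleftrightarrow> A = B"
  proof
    assume "shortest m n r B \<in> DA m n r A"
    then have "\<forall>i<m + n. \<forall>j<m + n. A $$ (i, j) = B $$ (i, j)"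
      using B.dD unfolding DA_def rc Dset_def by fastforce
    then show "A = B" using matrices_carrier[OF A] matrices_carrier[OF B] by (intro eq_matI) auto
  qed (use B.dD in \<open>simp add: DA_def\<close>)
  \<comment> \<open>The exponent at the representative itself is the instance u = v = id of
    \<open>oset_rep\<close>.\<close>
  moreover have "oset m r (rowb m n B) (colb m n B) (shortest m n r B) = {}"
    using B.oset_rep[of id id] B.di by (auto simp: invset_def)
  ultimately show ?thesis by (auto simp: zA_def zfun_def rc)
qed

text \<open>The matrix of intersection sizes of w is taken. Its row and column sums are the block
  sizes, and an entry at least 2 in a mixed position would provide two positions violating
  \<open>parity_ok\<close>.\<close>

lemma matrix_of_perm:
  assumes p: "p \<in> bicomps m n r" and p': "p' \<in> bicomps m n r" and w: "w \<in> symgrp r"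
    and ok: "parity_ok m r (rho p) (rho p') w"
  obtains A where "A \<in> matrices m n r" "row_comp m n A = p" "col_comp m n A = p'" "w \<in> DA m n r A"
proof -
  let ?N = "m + n"
  define A where "A = mat ?N ?N (\<lambda>(i, j). mt r (rho p) (rho p') w i j)"
  have bd: "rho p (w k) < ?N" "rho p' k < ?N" if "k \<in> {1..r}" for k
    using rho_bound[OF p, of "w k"] rho_bound[OF p' that] symgrp_range[OF w, of k] that by auto
  have row: "(\<Sum>j<?N. mt r (rho p) (rho p') w i j) = (fst p @ snd p) ! i" if i: "i < ?N" for i
  proof -
    have "(\<Sum>j<?N. mt r (rho p) (rho p') w i j) = card (\<Union>j<?N. {k \<in> {1..r}. rho p (w k) = i \<and> rho p' k = j})"
      unfolding mt_def by (subst card_UN_disjoint) auto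
    also have "(\<Union>j<?N. {k \<in> {1..r}. rho p (w k) = i \<and> rho p' k = j}) = {k \<in> {1..r}. rho p (w k) = i}"
      using bd by auto
    also have "card \<dots> = card {k \<in> {1..r}. rho p k = i}"
    proof (rule bij_betw_same_card[of w], rule bij_betwI[where g = "pinv w"])
      show "w \<in> {k \<in> {1..r}. rho p (w k) = i} \<rightarrow> {k \<in> {1..r}. rho p k = i}"
        using symgrp_range[OF w] by auto
      show "pinv w \<in> {k \<in> {1..r}. rho p k = i} \<rightarrow> {k \<in> {1..r}. rho p (w k) = i}"
        using symgrp_range[OF symgrp_inv[OF w]] symgrp_inv_app(2)[OF w] by auto
    qed (simp_all add: symgrp_inv_app[OF w])
    finally show ?thesis using card_block_rho[OF p i] by simp
  qed
  have col: "(\<Sum>i<?N. mt r (rho p) (rho p') w i j) = (fst p' @ snd p') ! j" if j: "j < ?N" for j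
  proof -
    have "(\<Sum>i<?N. mt r (rho p) (rho p') w i j) = card (\<Union>i<?N. {k \<in> {1..r}. rho p (w k) = i \<and> rho p' k = j})"
      unfolding mt_def by (subst card_UN_disjoint) auto
    also have "(\<Union>i<?N. {k \<in> {1..r}. rho p (w k) = i \<and> rho p' k = j}) = {k \<in> {1..r}. rho p' k = j}"
      using bd by auto
    finally show ?thesis using card_block_rho[OF p' j] by simp
  qed
  have rc: "row_comp m n A = p"
  proof (rule prod_eqI)
    show "fst (row_comp m n A) = fst p"
      using row bicompsD[OF p] by (intro nth_equalityI) (auto simp: row_comp_def A_def nth_append)
    show "snd (row_comp m n A) = snd p"
    proof (rule nth_equalityI)
      fix i assume "i < length (snd (row_comp m n A))"
      then have i: "i < n" by (simp add: row_comp_def)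
      then have "snd (row_comp m n A) ! i = (\<Sum>j<?N. mt r (rho p) (rho p') w (m + i) j)"
        by (auto simp: row_comp_def A_def)
      also have "\<dots> = snd p ! i" using row[of "m + i"] i bicompsD[OF p] by (simp add: nth_append)
      finally show "snd (row_comp m n A) ! i = snd p ! i" .
    qed (use bicompsD[OF p] in \<open>simp add: row_comp_def\<close>)
  qed
  have cc: "col_comp m n A = p'"
  proof (rule prod_eqI)
    show "fst (col_comp m n A) = fst p'"
      using col bicompsD[OF p'] by (intro nth_equalityI) (auto simp: col_comp_def A_def nth_append)
    show "snd (col_comp m n A) = snd p'"
    proof (rule nth_equalityI)
      fix i assume "i < length (snd (col_comp m n A))"
      then have i: "i < n" by (simp add: col_comp_def)
      then have "snd (col_comp m n A) ! i = (\<Sum>j<?N. mt r (rho p) (rho p') w j (m + i))"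
        by (auto simp: col_comp_def A_def)
      also have "\<dots> = snd p' ! i" using col[of "m + i"] i bicompsD[OF p'] by (simp add: nth_append)
      finally show "snd (col_comp m n A) ! i = snd p' ! i" .
    qed (use bicompsD[OF p'] in \<open>simp add: col_comp_def\<close>)
  qed
  have "A $$ (i, j) \<in> {0, 1}" if ij: "i < ?N" "j < ?N" "(i < m) \<noteq> (j < m)" for i j
  proof (rule ccontr)
    assume "A $$ (i, j) \<notin> {0, 1}"
    then have "2 \<le> A $$ (i, j)" by (cases "A $$ (i, j)") auto
    then have "2 \<le> card {k \<in> {1..r}. rho p (w k) = i \<and> rho p' k = j}" using ij by (simp add: A_def mt_def)
    then obtain S where S: "S \<subseteq> {k \<in> {1..r}. rho p (w k) = i \<and> rho p' k = j}" "card S = 2"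
      by (meson obtain_subset_with_card_n)
    then obtain a b where ab: "S = {a, b}" "a \<noteq> b" by (auto simp: card_2_iff)
    have "i < m \<longleftrightarrow> j < m"
    proof (cases "a < b")
      case True
      then show ?thesis using ok[unfolded parity_ok_def, rule_format, of a b] S(1) ab by auto
    next
      case False
      then show ?thesis using ok[unfolded parity_ok_def, rule_format, of b a] S(1) ab by auto
    qed
    then show False using ij by blast
  qed
  moreover have "(\<Sum>i<?N. \<Sum>j<?N. A $$ (i, j)) = r"
  proof -
    have "(\<Sum>i<?N. \<Sum>j<?N. A $$ (i, j)) = (\<Sum>i<?N. (fst p @ snd p) ! i)"
      using row by (intro sum.cong) (auto simp: A_def)
    also have "\<dots> = sum_list (fst p @ snd p)"
      using bicompsD(4)[OF p] by (metis sum_list_sum_nth lessThan_atLeast0)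
    finally show ?thesis using bicompsD(3)[OF p] by simp
  qed
  ultimately have "A \<in> matrices m n r" by (simp add: matrices_def A_def)
  moreover have "w \<in> DA m n r A"
    unfolding DA_def rowb_def colb_def rc cc Dset_def using w by (simp add: A_def)
  ultimately show ?thesis using that rc cc by blast
qed

text \<open>Either the parity condition is automatic, or \<open>1 + q\<close> is regular and kills the remaining double cosets.\<close>

lemma LR_zero:
  assumes p: "p \<in> bicomps m n r" and p': "p' \<in> bicomps m n r" and q: "q * qi = (1 :: 'r::comm_ring_1)"
    and reg: "m = 0 \<or> n = 0 \<or> r = 1 \<or> (\<forall>a::'r. (1 + q) * a = 0 \<longrightarrow> a = 0)"
    and hL: "h \<in> LL m r (- qi) (rho p)" and hR: "h \<in> RR m r (- qi) (rho p')"
    and z: "\<And>A. A \<in> matrices m n r \<Longrightarrow> row_comp m n A = p \<Longrightarrow> col_comp m n A = p' \<Longrightarrow> h (shortest m n r A) = 0"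
  shows "h = (\<lambda>w. 0)"
proof (rule LR_vanish[OF rho_convex[OF p] rho_convex[OF p'] hL hR])
  fix d assume d: "d \<in> symgrp r" "incr_blocks r (rho p) (pinv d)" "incr_blocks r (rho p') d"
  show "h d = 0"
  proof (cases "parity_ok m r (rho p) (rho p') d")
    case True
    then obtain A where A: "A \<in> matrices m n r" "row_comp m n A = p" "col_comp m n A = p'" "d \<in> DA m n r A"
      using matrix_of_perm[OF p p' d(1)] by blast
    interpret A: double_rep "m + n" m r "rowb m n A" "colb m n A" "\<lambda>i j. A $$ (i, j)" "shortest m n r A"
      by (rule double_rep_shortest[OF A(1)])
    have "d = shortest m n r A"
      by (rule double_rep_unique[OF A.dD A(4)[unfolded DA_def] A.bd A.mono(2) A.di _ A.di'])
        (use d A in \<open>simp_all add: rowb_def colb_def\<close>)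
    then show ?thesis using z A by simp
  next
    case False
    then obtain i j where ij: "1 \<le> i" "i < j" "j \<le> r" "(rho p (d i) < m) \<noteq> (rho p' i < m)"
      unfolding parity_ok_def by blast
    have b: "rho p (d i) < m + n" "rho p' i < m + n"
      using rho_bound[OF p, of "d i"] rho_bound[OF p', of i] symgrp_bounds[OF d(1), of i] ij by auto
    \<comment> \<open>One label is below m and the other is not, so m and n are positive, and two
      distinct positions give r > 1. Only the regularity of 1 + q remains among the
      alternatives.\<close>
    then have "\<not> (m = 0 \<or> n = 0 \<or> r = 1)" using ij by auto
    then have r: "\<forall>a::'r. (1 + q) * a = 0 \<longrightarrow> a = 0" using reg by blast
    show ?thesis
    proof (rule bad_pair_vanish[OF rho_mono[OF p] rho_mono[OF p'] d hL hR False])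
      \<comment> \<open>Multiplying - q^-1 a = a by q turns it into (1 + q) a = 0.\<close>
      fix a :: 'r assume a: "- qi * a = a"
      have "a = q * (qi * a)" using q by (simp add: mult.assoc[symmetric])
      also have "qi * a = - a" using a by (metis minus_mult_left minus_minus)
      finally have "q * a = - a" by (metis minus_minus mult_minus_right)
      then have "(1 + q) * a = 0" by (simp add: distrib_right)
      then show "a = 0" using r by blast
    qed
  qed
qed

subsection \<open>Endomorphisms as families of Hecke algebra elements\<close>

lemma finite_bicomps [simp]: "finite (bicomps m n r)"
proof (rule finite_subset)
  show "bicomps m n r \<subseteq> {xs. set xs \<subseteq> {..r} \<and> length xs = m} \<times> {xs. set xs \<subseteq> {..r} \<and> length xs = n}"
    unfolding bicomps_def using member_le_sum_list[where 'a = nat] by fastforce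
qed (simp add: finite_lists_length_eq)

locale schur_setup =
  fixes m n r :: nat and f :: "laurent \<Rightarrow> 'r::comm_ring_1"
  assumes f: "comm_ring_hom f"
begin

abbreviation "Q \<equiv> q_of f"
abbreviation "E \<equiv> - qinv_of f"
abbreviation "B \<equiv> bicomps m n r"
abbreviation "X p \<equiv> xyf m r E (rho p)"
abbreviation "HC \<equiv> (hecke_carrier r :: 'r hecke set)"
abbreviation "TS \<equiv> tspace m n r f"
abbreviation "SC \<equiv> schur_carrier m n r f"
abbreviation "Lp p \<equiv> LL m r E (rho p)"
abbreviation "Rp p \<equiv> RR m r E (rho p)"
abbreviation "zero_h \<equiv> (\<lambda>w. 0) :: 'r hecke"

definition zm :: "nat list \<times> nat list \<Rightarrow> nat list \<times> nat list \<Rightarrow> 'r hecke set" where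
  "zm p p' = Lp p \<inter> Rp p'"

definition fams :: "(nat list \<times> nat list \<Rightarrow> nat list \<times> nat list \<Rightarrow> 'r hecke) set" where
  "fams = {Z. \<forall>p\<in>B. \<forall>p'\<in>B. Z p p' \<in> zm p p'}"

lemmas qq = q_qinv[OF f]
lemmas xyH = xyH_eq[OF f]

text \<open>For \<open>Z = a x\<close> and \<open>t = x b\<close>, where \<open>x\<close> is the generator of the summand indexed by \<open>p\<close>, this is
  \<open>a x b = a t = Z b\<close>, hence independent of the choices.\<close>

definition star :: "nat list \<times> nat list \<Rightarrow> 'r hecke \<Rightarrow> 'r hecke \<Rightarrow> 'r hecke" where
  "star p Z t = hm r Q (SOME a. a \<in> HC \<and> Z = hm r Q a (X p)) t"

lemma Lp_obtain:
  assumes "p \<in> B" "t \<in> Lp p" obtains b where "b \<in> HC" "t = hm r Q (X p) b"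
  using assms(2) unfolding LL_eq_xyf[OF rho_convex[OF assms(1)] qq] by blast

lemma Rp_obtain:
  assumes "p \<in> B" "Z \<in> Rp p" obtains a where "a \<in> HC" "Z = hm r Q a (X p)"
  using RR_eq_xyf[OF rho_convex[OF assms(1)] qq assms(2)] by blast

lemma star_eq_right:
  assumes p: "p \<in> B" and Z: "Z \<in> Rp p" and b: "b \<in> HC"
  shows "star p Z (hm r Q (X p) b) = hm r Q Z b"
proof -
  define a where "a = (SOME a. a \<in> HC \<and> Z = hm r Q a (X p))"
  have a: "a \<in> HC" "Z = hm r Q a (X p)"
    using someI_ex[of "\<lambda>a. a \<in> HC \<and> Z = hm r Q a (X p)"] Rp_obtain[OF p Z] unfolding a_def by metis+
  have "star p Z (hm r Q (X p) b) = hm r Q a (hm r Q (X p) b)" by (simp add: star_def a_def)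
  also have "\<dots> = hm r Q (hm r Q a (X p)) b" using a b by (simp add: hm_assoc)
  finally show ?thesis using a by simp
qed

lemma star_eq_left:
  assumes p: "p \<in> B" and a: "a \<in> HC" and t: "t \<in> Lp p"
  shows "star p (hm r Q a (X p)) t = hm r Q a t"
proof -
  obtain b where b: "b \<in> HC" "t = hm r Q (X p) b" using Lp_obtain[OF p t] .
  have "hm r Q a (X p) \<in> Rp p" by (rule hm_RR[OF qq a xyf_RR])
  then show ?thesis using star_eq_right[OF p _ b(1)] a b by (simp add: hm_assoc)
qed

lemma zmD: "Z \<in> zm p p' \<Longrightarrow> Z \<in> Lp p" "Z \<in> zm p p' \<Longrightarrow> Z \<in> Rp p'" "Z \<in> zm p p' \<Longrightarrow> Z \<in> HC"
  by (auto simp: zm_def LL_carrier)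

lemma star_X: "p \<in> B \<Longrightarrow> Z \<in> Rp p \<Longrightarrow> star p Z (X p) = Z"
  using star_eq_right[of p Z "T_elt id"] by (simp add: RR_carrier)

lemma star_Lp:
  assumes "p' \<in> B" "Z \<in> zm p p'" "t \<in> Lp p'" shows "star p' Z t \<in> Lp p"
proof -
  obtain b where b: "b \<in> HC" "t = hm r Q (X p') b" using Lp_obtain[OF assms(1,3)] .
  then show ?thesis using star_eq_right[OF assms(1) zmD(2)[OF assms(2)] b(1)] hm_LL[OF qq zmD(1)[OF assms(2)] b(1)] by simp
qed

lemma star_zm:
  assumes "p' \<in> B" "Z \<in> zm p p'" "Z' \<in> zm p' p''" shows "star p' Z Z' \<in> zm p p''"
proof -
  obtain a where a: "a \<in> HC" "Z = hm r Q a (X p')" using Rp_obtain[OF assms(1) zmD(2)[OF assms(2)]] .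
  have "star p' Z Z' = hm r Q a Z'" using star_eq_left[OF assms(1) a(1) zmD(1)[OF assms(3)]] a(2) by simp
  also have "\<dots> \<in> Rp p''" by (rule hm_RR[OF qq a(1) zmD(2)[OF assms(3)]])
  finally show ?thesis using star_Lp[OF assms(1,2) zmD(1)[OF assms(3)]] by (simp add: zm_def)
qed

text \<open>With Z = a x and t = x' b, for the generators x and x' of the two intermediate summands,
  both sides are the product a Z' b.\<close>

lemma star_assoc:
  assumes "p' \<in> B" "p'' \<in> B" "Z \<in> zm p p'" "Z' \<in> zm p' p''" "t \<in> Lp p''"
  shows "star p' Z (star p'' Z' t) = star p'' (star p' Z Z') t"
proof -
  obtain b where b: "b \<in> HC" "t = hm r Q (X p'') b" using Lp_obtain[OF assms(2,5)] .
  obtain a where a: "a \<in> HC" "Z = hm r Q a (X p')" using Rp_obtain[OF assms(1) zmD(2)[OF assms(3)]] .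
  have 1: "star p'' Z' t = hm r Q Z' b" using star_eq_right[OF assms(2) zmD(2)[OF assms(4)] b(1)] b(2) by simp
  have "star p' Z (star p'' Z' t) = hm r Q a (hm r Q Z' b)"
    using star_eq_left[OF assms(1) a(1) star_Lp[OF assms(2,4,5)]] a(2) by (simp add: 1)
  moreover have "star p' Z Z' = hm r Q a Z'" using star_eq_left[OF assms(1) a(1) zmD(1)[OF assms(4)]] a(2) by simp
  moreover have "star p'' (star p' Z Z') t = hm r Q (star p' Z Z') b"
    using star_eq_right[OF assms(2) zmD(2)[OF star_zm[OF assms(1,3,4)]] b(1)] b(2) by simp
  ultimately show ?thesis using a(1) b(1) zmD(3)[OF assms(4)] by (simp add: hm_assoc)
qed

lemma star_sum_right:
  assumes "\<And>i. i \<in> I \<Longrightarrow> g i \<in> HC"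
  shows "star p Z (\<lambda>w. \<Sum>i\<in>I. c i * g i w) = (\<lambda>w. \<Sum>i\<in>I. c i * star p Z (g i) w)"
  unfolding star_def by (rule hm_sum_right) (rule assms)

lemma star_add_right:
  "t \<in> HC \<Longrightarrow> s \<in> HC \<Longrightarrow> star p Z (\<lambda>w. s w + t w) = (\<lambda>w. star p Z s w + star p Z t w)"
  unfolding star_def by (rule hm_add_right)

lemma star_zero_right [simp]: "star p Z zero_h = zero_h"
  by (simp add: star_def)

lemma star_act:
  assumes "t \<in> HC" "b \<in> HC" "p \<in> B" "Z \<in> Rp p"
  shows "star p Z (hm r Q t b) = hm r Q (star p Z t) b"
proof -
  define a where "a = (SOME a. a \<in> HC \<and> Z = hm r Q a (X p))"
  have "a \<in> HC"
    using someI_ex[of "\<lambda>a. a \<in> HC \<and> Z = hm r Q a (X p)"] Rp_obtain[OF assms(3,4)] unfolding a_def by metis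
  then show ?thesis unfolding star_def a_def[symmetric] using assms by (simp add: hm_assoc)
qed

lemma star_add_left:
  assumes "p \<in> B" "Z \<in> Rp p" "Z' \<in> Rp p" "t \<in> Lp p"
  shows "star p (\<lambda>w. Z w + Z' w) t = (\<lambda>w. star p Z t w + star p Z' t w)"
proof -
  obtain b where b: "b \<in> HC" "t = hm r Q (X p) b" using Lp_obtain[OF assms(1,4)] .
  show ?thesis unfolding b(2) star_eq_right[OF assms(1) assms(2) b(1)] star_eq_right[OF assms(1) assms(3) b(1)]
      star_eq_right[OF assms(1) RR_add[OF assms(2,3)] b(1)] by (rule hm_add_left)
qed

lemma star_scale_left:
  assumes "p \<in> B" "Z \<in> Rp p" "t \<in> Lp p"
  shows "star p (\<lambda>w. c * Z w) t = (\<lambda>w. c * star p Z t w)"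
proof -
  obtain b where b: "b \<in> HC" "t = hm r Q (X p) b" using Lp_obtain[OF assms(1,3)] .
  show ?thesis unfolding b(2) star_eq_right[OF assms(1) assms(2) b(1)]
      star_eq_right[OF assms(1) RR_scale[OF assms(2)] b(1)] by (rule hm_scale_left)
qed

lemma star_zero_left [simp]:
  assumes "p \<in> B" "t \<in> Lp p" shows "star p zero_h t = zero_h"
  using star_scale_left[OF assms(1) RR_zero assms(2), of 0] by simp

lemma zm_zero: "zero_h \<in> zm p p'" by (simp add: zm_def LL_zero RR_zero)

lemma zm_add: "Z \<in> zm p p' \<Longrightarrow> Z' \<in> zm p p' \<Longrightarrow> (\<lambda>w. Z w + Z' w) \<in> zm p p'"
  by (simp add: zm_def LL_add RR_add)

lemma zm_scale: "Z \<in> zm p p' \<Longrightarrow> (\<lambda>w. c * Z w) \<in> zm p p'"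
  by (simp add: zm_def LL_scale RR_scale)

lemma zm_sum: "(\<And>i. i \<in> I \<Longrightarrow> g i \<in> zm p p') \<Longrightarrow> (\<lambda>w. \<Sum>i\<in>I. c i * g i w) \<in> zm p p'"
  by (induction I rule: infinite_finite_induct) (auto simp: zm_zero intro!: zm_add zm_scale)

lemma star_sum_left:
  assumes "p \<in> B" "t \<in> Lp p" "\<And>i. i \<in> I \<Longrightarrow> g i \<in> Rp p"
  shows "star p (\<lambda>w. \<Sum>i\<in>I. c i * g i w) t = (\<lambda>w. \<Sum>i\<in>I. c i * star p (g i) t w)"
proof -
  obtain b where b: "b \<in> HC" "t = hm r Q (X p) b" using Lp_obtain[OF assms(1,2)] .
  have R: "(\<lambda>w. \<Sum>i\<in>I. c i * g i w) \<in> Rp p"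
    using assms(3) by (induction I rule: infinite_finite_induct) (auto simp: RR_zero intro!: RR_add RR_scale)
  have "star p (\<lambda>w. \<Sum>i\<in>I. c i * g i w) t = hm r Q (\<lambda>w. \<Sum>i\<in>I. c i * g i w) b"
    unfolding b(2) by (rule star_eq_right[OF assms(1) R b(1)])
  also have "\<dots> = (\<lambda>w. \<Sum>i\<in>I. c i * hm r Q (g i) b w)" by (rule hm_sum_left)
  also have "\<dots> = (\<lambda>w. \<Sum>i\<in>I. c i * star p (g i) t w)"
    unfolding b(2) using star_eq_right[OF assms(1) assms(3) b(1)] by simp
  finally show ?thesis .
qed

lemma iota_zm: "Z \<in> zm p p' \<Longrightarrow> iota r Z \<in> zm p' p"
  by (simp add: zm_def iota_LL iota_RR)

text \<open>With Z = a x and Z' = x b the product is a x b; its image under \<open>iota\<close> is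
  again of this form, because x is invariant.\<close>

lemma iota_star:
  assumes "p' \<in> B" "Z \<in> zm p p'" "Z' \<in> zm p' p''"
  shows "iota r (star p' Z Z') = star p' (iota r Z') (iota r Z)"
proof -
  obtain a where a: "a \<in> HC" "Z = hm r Q a (X p')" using Rp_obtain[OF assms(1) zmD(2)[OF assms(2)]] .
  obtain b where b: "b \<in> HC" "Z' = hm r Q (X p') b" using Lp_obtain[OF assms(1) zmD(1)[OF assms(3)]] .
  have 1: "iota r Z = hm r Q (X p') (iota r a)" using a by (simp add: iota_hm iota_xyf)
  have "star p' (iota r Z') (iota r Z) = hm r Q (iota r Z') (iota r a)"
    unfolding 1 by (rule star_eq_right[OF assms(1)]) (use zmD(2)[OF iota_zm[OF assms(3)]] in simp_all)
  moreover have "star p' Z Z' = hm r Q a Z'" using star_eq_left[OF assms(1) a(1) zmD(1)[OF assms(3)]] a(2) by simp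
  ultimately show ?thesis using a(1) zmD(3)[OF assms(3)] by (simp add: iota_hm)
qed

section \<open>Passing between endomorphisms and families\<close>

lemma tspace_iff: "t \<in> TS \<longleftrightarrow> (\<forall>p\<in>B. t p \<in> Lp p) \<and> (\<forall>p. p \<notin> B \<longrightarrow> t p = zero_h)"
  unfolding tspace_def by (auto simp: xyH)

lemma tspaceD: "t \<in> TS \<Longrightarrow> p \<in> B \<Longrightarrow> t p \<in> Lp p" "t \<in> TS \<Longrightarrow> p \<in> B \<Longrightarrow> t p \<in> HC"
  by (auto simp: tspace_iff LL_carrier)

lemma tinj_tspace: "p \<in> B \<Longrightarrow> t \<in> Lp p \<Longrightarrow> tinj p t \<in> TS"
  unfolding tspace_iff tinj_def by (auto simp: LL_zero)

lemma tadd_tspace: "s \<in> TS \<Longrightarrow> t \<in> TS \<Longrightarrow> tadd s t \<in> TS"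
  unfolding tspace_iff tadd_def by (auto simp: LL_add)

lemma tact_eq: "t \<in> TS \<Longrightarrow> h \<in> HC \<Longrightarrow> tact r f t h = (\<lambda>p. hm r Q (t p) h)"
  unfolding tact_def tspace_iff by (rule ext) (metis LL_carrier hmult_eq_hm zero_carrier)

lemma tact_tspace: "t \<in> TS \<Longrightarrow> h \<in> HC \<Longrightarrow> tact r f t h \<in> TS"
  by (simp add: tact_eq) (auto simp: tspace_iff hm_LL[OF qq])

lemma tzero_tspace: "(\<lambda>p w. 0) \<in> TS"
  by (simp add: tspace_iff LL_zero)

text \<open>The matrix entry of F with target p and source p', recorded as the image of the
  generator of the source summand.\<close>

definition fam :: "('r tspace \<Rightarrow> 'r tspace) \<Rightarrow> nat list \<times> nat list \<Rightarrow> nat list \<times> nat list \<Rightarrow> 'r hecke" where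
  "fam F p p' = F (tinj p' (X p')) p"

definition of_fam :: "(nat list \<times> nat list \<Rightarrow> nat list \<times> nat list \<Rightarrow> 'r hecke) \<Rightarrow> 'r tspace \<Rightarrow> 'r tspace" where
  "of_fam Z = (\<lambda>t\<in>TS. \<lambda>p w. if p \<in> B then \<Sum>p'\<in>B. star p' (Z p p') (t p') w else 0)"

lemma SC_D:
  assumes "F \<in> SC"
  shows "t \<in> TS \<Longrightarrow> F t \<in> TS" "s \<in> TS \<Longrightarrow> t \<in> TS \<Longrightarrow> F (tadd s t) = tadd (F s) (F t)"
    "t \<in> TS \<Longrightarrow> h \<in> HC \<Longrightarrow> F (tact r f t h) = tact r f (F t) h" "t \<notin> TS \<Longrightarrow> F t = undefined"
    "F \<in> extensional TS"
  using assms unfolding schur_carrier_def by (auto simp: PiE_iff extensional_def)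

lemma X_tinj: "p \<in> B \<Longrightarrow> tinj p (X p) \<in> TS"
  by (rule tinj_tspace[OF _ xyf_LL])

lemma X_RR_act:
  assumes i: "1 \<le> i" "i < r" "rho p i = rho p (Suc i)"
  shows "hm r Q (X p) (T_elt (sr i)) = hm r Q (X p) (\<lambda>w. (if rho p i < m then Q else - 1) * T_elt id w)"
proof -
  have "hm r Q (X p) (T_elt (sr i)) = Rop Q i (X p)" using i by (simp add: hm_T_sr_right)
  also have "\<dots> = (\<lambda>w. (if rho p i < m then Q else - 1) * X p w)" by (rule RR_Rop[OF qq xyf_RR i])
  finally show ?thesis by (simp add: hm_scale_right)
qed

text \<open>The image of the generator is a right eigenvector because the generator itself is one.\<close>

lemma fam_zm:
  assumes F: "F \<in> SC" and p: "p \<in> B" "p' \<in> B" shows "fam F p p' \<in> zm p p'"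
proof -
  note x = X_tinj[OF p(2)]
  have L: "fam F p p' \<in> Lp p" unfolding fam_def by (rule tspaceD(1)[OF SC_D(1)[OF F x] p(1)])
  have "fam F p p' \<in> Rp p'"
  proof (rule Rop_RR[OF qq LL_carrier[OF L]])
    fix i assume i: "1 \<le> i" "i < r" "rho p' i = rho p' (Suc i)"
    let ?c = "if rho p' i < m then Q else - 1"
    have T: "T_elt (sr i) \<in> HC" "(\<lambda>w. ?c * T_elt id w) \<in> HC" using i by simp_all
    have "tact r f (tinj p' (X p')) (T_elt (sr i)) = tact r f (tinj p' (X p')) (\<lambda>w. ?c * T_elt id w)"
      unfolding tact_eq[OF x T(1)] tact_eq[OF x T(2)] using X_RR_act[OF i] by (auto simp: tinj_def)
    then have "tact r f (F (tinj p' (X p'))) (T_elt (sr i)) p = tact r f (F (tinj p' (X p'))) (\<lambda>w. ?c * T_elt id w) p"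
      unfolding SC_D(3)[OF F x T(1), symmetric] SC_D(3)[OF F x T(2), symmetric] by simp
    then have "hm r Q (fam F p p') (T_elt (sr i)) = hm r Q (fam F p p') (\<lambda>w. ?c * T_elt id w)"
      unfolding tact_eq[OF SC_D(1)[OF F x] T(1)] tact_eq[OF SC_D(1)[OF F x] T(2)] fam_def .
    then show "Rop Q i (fam F p p') = (\<lambda>w. ?c * fam F p p' w)"
      using i LL_carrier[OF L] by (simp add: hm_T_sr_right hm_scale_right)
  qed
  then show ?thesis using L by (simp add: zm_def)
qed

lemma fam_fams: "F \<in> SC \<Longrightarrow> fam F \<in> fams"
  by (simp add: fams_def fam_zm)

lemma famsD: "Z \<in> fams \<Longrightarrow> p \<in> B \<Longrightarrow> p' \<in> B \<Longrightarrow> Z p p' \<in> zm p p'"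
  by (simp add: fams_def)

lemma SC_tinj:
  assumes F: "F \<in> SC" and p: "p \<in> B" "p' \<in> B" and t: "t \<in> Lp p'"
  shows "F (tinj p' t) p = star p' (fam F p p') t"
proof -
  obtain b where b: "b \<in> HC" "t = hm r Q (X p') b" using Lp_obtain[OF p(2) t] .
  note x = X_tinj[OF p(2)]
  have "tinj p' t = tact r f (tinj p' (X p')) b"
    unfolding tact_eq[OF x b(1)] b(2) by (auto simp: tinj_def)
  then have "F (tinj p' t) p = hm r Q (fam F p p') b"
    unfolding fam_def using SC_D(3)[OF F x b(1)] tact_eq[OF SC_D(1)[OF F x] b(1)] by simp
  then show ?thesis using star_eq_right[OF p(2) zmD(2)[OF fam_zm[OF F p]] b(1)] b(2) by simp
qed

lemma SC_zero: assumes F: "F \<in> SC" shows "F (\<lambda>p w. 0) = (\<lambda>p w. 0)"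
proof -
  have "F (tadd (\<lambda>p w. 0) (\<lambda>p w. 0)) = tadd (F (\<lambda>p w. 0)) (F (\<lambda>p w. 0))"
    by (rule SC_D(2)[OF F tzero_tspace tzero_tspace])
  then show ?thesis by (auto simp: tadd_def fun_eq_iff)
qed

lemma SC_eq_sum:
  assumes F: "F \<in> SC" and t: "t \<in> TS"
  shows "F t p w = (\<Sum>p'\<in>B. F (tinj p' (t p')) p w)"
proof -
  \<comment> \<open>Additivity of F is binary, so t is assembled from its components over growing
    index sets.\<close>
  have *: "(\<lambda>p. if p \<in> I then t p else zero_h) \<in> TS \<and>
    F (\<lambda>p. if p \<in> I then t p else zero_h) p w = (\<Sum>p'\<in>I. F (tinj p' (t p')) p w)"
    if "finite I" "I \<subseteq> B" for I
    using that
  proof (induction I)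
    case empty then show ?case using SC_zero[OF F] tzero_tspace by simp
  next
    case (insert p' I)
    let ?t = "\<lambda>p. if p \<in> I then t p else zero_h"
    have e: "(\<lambda>p. if p \<in> insert p' I then t p else zero_h) = tadd (tinj p' (t p')) ?t"
      using insert by (auto simp: tadd_def tinj_def fun_eq_iff)
    have 1: "tinj p' (t p') \<in> TS" using insert.prems by (intro tinj_tspace tspaceD(1)[OF t]) auto
    have 2: "?t \<in> TS" "F ?t p w = (\<Sum>p'\<in>I. F (tinj p' (t p')) p w)" using insert by auto
    show ?case unfolding e using tadd_tspace[OF 1 2(1)] SC_D(2)[OF F 1 2(1)] 2 insert.hyps
      by (simp add: tadd_def)
  qed
  have "(\<lambda>p. if p \<in> B then t p else zero_h) = t" using t by (auto simp: tspace_iff)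
  then show ?thesis using *[of B] by simp
qed

lemma SC_eq_of_fam: assumes F: "F \<in> SC" shows "F = of_fam (fam F)"
proof
  fix t
  show "F t = of_fam (fam F) t"
  proof (cases "t \<in> TS")
    case False then show ?thesis using SC_D(4)[OF F] by (simp add: of_fam_def)
  next
    case True
    show ?thesis
    proof (intro ext)
      fix p w
      show "F t p w = of_fam (fam F) t p w"
      proof (cases "p \<in> B")
        case p: True
        have "F t p w = (\<Sum>p'\<in>B. star p' (fam F p p') (t p') w)"
          unfolding SC_eq_sum[OF F True] by (intro sum.cong refl) (simp add: SC_tinj[OF F p] tspaceD[OF True])
        then show ?thesis using True p by (simp add: of_fam_def)
      next
        case False
        then have "F t p = zero_h" using SC_D(1)[OF F True] unfolding tspace_iff by blast
        then show ?thesis using True False by (simp add: of_fam_def)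
      qed
    qed
  qed
qed

lemma of_fam_cong: "(\<And>p p'. p \<in> B \<Longrightarrow> p' \<in> B \<Longrightarrow> Z p p' = Z' p p') \<Longrightarrow> of_fam Z = of_fam Z'"
  unfolding of_fam_def
proof (intro restrict_ext ext)
  fix t p w
  assume "\<And>p p'. p \<in> B \<Longrightarrow> p' \<in> B \<Longrightarrow> Z p p' = Z' p p'"
  then have "(\<Sum>p'\<in>B. star p' (Z p p') (t p') w) = (\<Sum>p'\<in>B. star p' (Z' p p') (t p') w)" if "p \<in> B"
    using that by (intro sum.cong) simp_all
  then show "(if p \<in> B then \<Sum>p'\<in>B. star p' (Z p p') (t p') w else 0) =
      (if p \<in> B then \<Sum>p'\<in>B. star p' (Z' p p') (t p') w else 0)" by simp
qed

lemma SC_eqI: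
  assumes "F \<in> SC" "G \<in> SC" "\<And>p p'. p \<in> B \<Longrightarrow> p' \<in> B \<Longrightarrow> fam F p p' = fam G p p'"
  shows "F = G"
  using SC_eq_of_fam[OF assms(1)] SC_eq_of_fam[OF assms(2)] of_fam_cong[of "fam F" "fam G", OF assms(3)] by simp

lemma of_fam_app: "t \<in> TS \<Longrightarrow> p \<in> B \<Longrightarrow> of_fam Z t p = (\<lambda>w. \<Sum>p'\<in>B. star p' (Z p p') (t p') w)"
  by (simp add: of_fam_def)

lemma of_fam_notin: "t \<in> TS \<Longrightarrow> p \<notin> B \<Longrightarrow> of_fam Z t p = zero_h"
  by (simp add: of_fam_def)

lemma of_fam_tspace:
  assumes Z: "Z \<in> fams" and t: "t \<in> TS" shows "of_fam Z t \<in> TS"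
  unfolding tspace_iff
proof (intro conjI ballI allI impI)
  fix p assume p: "p \<in> B"
  have "(\<lambda>w. \<Sum>p'\<in>B. 1 * star p' (Z p p') (t p') w) \<in> Lp p"
    by (intro LL_sum star_Lp famsD[OF Z p] tspaceD(1)[OF t])
  then show "of_fam Z t p \<in> Lp p" by (simp add: of_fam_app[OF t p])
qed (simp add: of_fam_notin[OF t])

lemma of_fam_SC: assumes Z: "Z \<in> fams" shows "of_fam Z \<in> SC"
  unfolding schur_carrier_def
proof (intro CollectI conjI ballI)
  show "of_fam Z \<in> TS \<rightarrow>\<^sub>E TS"
    using of_fam_tspace[OF Z] by (simp add: PiE_iff of_fam_def extensional_restrict)
next
  fix s t assume s: "s \<in> TS" and t: "t \<in> TS"
  show "of_fam Z (tadd s t) = tadd (of_fam Z s) (of_fam Z t)"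
  proof (rule ext)
    fix p
    show "of_fam Z (tadd s t) p = tadd (of_fam Z s) (of_fam Z t) p"
    proof (cases "p \<in> B")
      case True
      have "star p' (Z p p') (tadd s t p') = (\<lambda>w. star p' (Z p p') (s p') w + star p' (Z p p') (t p') w)" if "p' \<in> B" for p'
        unfolding tadd_def by (rule star_add_right) (use that tspaceD(2) s t in auto)
      then show ?thesis
        by (simp add: of_fam_app[OF tadd_tspace[OF s t] True] tadd_def[of "of_fam Z s"] of_fam_app[OF s True] of_fam_app[OF t True] sum.distrib)
    next
      case False
      then show ?thesis by (simp add: of_fam_notin[OF tadd_tspace[OF s t]] tadd_def[of "of_fam Z s"] of_fam_notin s t)
    qed
  qed
next
  fix t h assume t: "t \<in> TS" and h: "h \<in> HC"
  show "of_fam Z (tact r f t h) = tact r f (of_fam Z t) h"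
  proof (rule ext)
    fix p
    show "of_fam Z (tact r f t h) p = tact r f (of_fam Z t) h p"
    proof (cases "p \<in> B")
      case True
      have "star p' (Z p p') (tact r f t h p') = hm r Q (star p' (Z p p') (t p')) h" if "p' \<in> B" for p'
        unfolding tact_eq[OF t h] using that by (intro star_act tspaceD(2)[OF t] h zmD(2)[OF famsD[OF Z True]])
      then have "of_fam Z (tact r f t h) p = (\<lambda>w. \<Sum>p'\<in>B. 1 * hm r Q (star p' (Z p p') (t p')) h w)"
        by (simp add: of_fam_app[OF tact_tspace[OF t h] True])
      also have "\<dots> = hm r Q (\<lambda>w. \<Sum>p'\<in>B. 1 * star p' (Z p p') (t p') w) h"
        by (rule hm_sum_left[symmetric])
      finally show ?thesis
        unfolding tact_eq[OF of_fam_tspace[OF Z t] h] by (simp add: of_fam_app[OF t True])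
    next
      case False
      then show ?thesis
        unfolding tact_eq[OF of_fam_tspace[OF Z t] h] by (simp add: of_fam_notin tact_tspace t h)
    qed
  qed
qed

lemma fam_of_fam:
  assumes Z: "Z \<in> fams" and p: "p \<in> B" "p' \<in> B" shows "fam (of_fam Z) p p' = Z p p'"
proof -
  have "star p'' (Z p p'') (tinj p' (X p') p'') w = (if p'' = p' then Z p p' w else 0)" if "p'' \<in> B" for p'' w
    using star_X[OF p(2) zmD(2)[OF famsD[OF Z p]]] by (auto simp: tinj_def)
  then have "(\<Sum>p''\<in>B. star p'' (Z p p'') (tinj p' (X p') p'') w) = (\<Sum>p''\<in>B. if p'' = p' then Z p p' w else 0)" for w
    by (intro sum.cong) auto
  then show ?thesis unfolding fam_def of_fam_app[OF X_tinj[OF p(2)] p(1)] using p by simp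
qed

end

subsection \<open>The algebra structure\<close>

context schur_setup begin

abbreviation "S \<equiv> schur m n r f"

lemma S_sel [simp]:
  "carrier S = SC" "\<zero>\<^bsub>S\<^esub> = (\<lambda>t\<in>TS. \<lambda>p w. 0)" "\<one>\<^bsub>S\<^esub> = (\<lambda>t\<in>TS. t)"
  "F \<oplus>\<^bsub>S\<^esub> G = (\<lambda>t\<in>TS. tadd (F t) (G t))" "F \<otimes>\<^bsub>S\<^esub> G = schur_mult m n r f F G"
  "c \<odot>\<^bsub>S\<^esub> F = (\<lambda>t\<in>TS. \<lambda>p w. c * F t p w)"
  by (simp_all add: schur_def)

text \<open>The sign attached by the supermultiplication to the composite of entries from p'' to p'
  to p.\<close>

definition sg :: "nat list \<times> nat list \<Rightarrow> nat list \<times> nat list \<Rightarrow> nat list \<times> nat list \<Rightarrow> 'r" where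
  "sg p p' p'' = (- 1) ^ (hom_degree p p' * hom_degree p' p'')"

definition fmult where
  "fmult Z Z' p p'' = (\<lambda>w. \<Sum>p'\<in>B. sg p p' p'' * star p' (Z p p') (Z' p' p'') w)"

lemma fmult_fams: "Z \<in> fams \<Longrightarrow> Z' \<in> fams \<Longrightarrow> fmult Z Z' \<in> fams"
  unfolding fams_def fmult_def by (intro CollectI ballI zm_sum star_zm) auto

lemma TS_eqI:
  assumes "F \<in> extensional TS" "G \<in> extensional TS"
    and "\<And>t p w. t \<in> TS \<Longrightarrow> p \<in> B \<Longrightarrow> F t p w = G t p w"
    and "\<And>t p w. t \<in> TS \<Longrightarrow> p \<notin> B \<Longrightarrow> F t p w = G t p w"
  shows "F = (G :: 'r tspace \<Rightarrow> 'r tspace)"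
  using assms by (intro extensionalityI[of F TS G] ext) blast+

lemma of_fam_ext: "of_fam Z \<in> extensional TS"
  by (simp add: of_fam_def)

definition deg_fam where
  "deg_fam i Z p p' = (if hom_degree p p' = i then Z p p' else zero_h)"

lemma deg_fam_fams: "Z \<in> fams \<Longrightarrow> deg_fam i Z \<in> fams"
  by (simp add: fams_def deg_fam_def zm_zero)

lemma SC_notin: "F \<in> SC \<Longrightarrow> t \<in> TS \<Longrightarrow> p \<notin> B \<Longrightarrow> F t p = zero_h"
  using SC_D(1) unfolding tspace_iff by blast

lemma component_eq:
  assumes F: "F \<in> SC" shows "schur_component m n r f i F = of_fam (deg_fam i (fam F))"
proof (rule TS_eqI)
  fix t p and w :: "nat \<Rightarrow> nat" assume t: "t \<in> TS" and p: "p \<in> B"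
  have "(\<Sum>p'\<in>{p'\<in>B. hom_degree p p' = i}. F (tinj p' (t p')) p w) =
      (\<Sum>p'\<in>B. if hom_degree p p' = i then F (tinj p' (t p')) p w else 0)"
    by (rule sum.inter_filter) simp
  also have "\<dots> = (\<Sum>p'\<in>B. star p' (deg_fam i (fam F) p p') (t p') w)"
    by (rule sum.cong[OF refl]) (simp add: deg_fam_def SC_tinj[OF F p] tspaceD[OF t])
  finally show "schur_component m n r f i F t p w = of_fam (deg_fam i (fam F)) t p w"
    using t p by (simp add: schur_component_def of_fam_app)
next
  fix t p and w :: "nat \<Rightarrow> nat" assume t: "t \<in> TS" and p: "p \<notin> B"
  have "F (tinj p' (t p')) p w = 0" if "p' \<in> B" for p'
    using SC_notin[OF F tinj_tspace[OF that tspaceD(1)[OF t that]] p] by simp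
  then show "schur_component m n r f i F t p w = of_fam (deg_fam i (fam F)) t p w"
    using t p by (simp add: schur_component_def of_fam_notin)
qed (simp_all add: schur_component_def of_fam_ext)

lemma hom_degree_less: "hom_degree p p' < 2" by (simp add: hom_degree_def)

text \<open>Homogeneous components select matrix entries by degree, so each path from p'' over p' to
  p occurs for exactly one pair of degrees. The supermultiplication thus becomes a matrix product
  with signs.\<close>

lemma mult_eq:
  assumes F: "F \<in> SC" and G: "G \<in> SC"
  shows "schur_mult m n r f F G = of_fam (fmult (fam F) (fam G))"
proof (rule TS_eqI)
  note FF = fam_fams[OF F] and GG = fam_fams[OF G]
  fix t p and w :: "nat \<Rightarrow> nat" assume t: "t \<in> TS" and p: "p \<in> B"
  define K where "K p' p'' = star p'' (star p' (fam F p p') (fam G p' p'')) (t p'') w" for p' p''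
  have comp: "schur_component m n r f i F (schur_component m n r f j G t) p w =
      (\<Sum>p'\<in>B. \<Sum>p''\<in>B. if hom_degree p p' = i \<and> hom_degree p' p'' = j then K p' p'' else 0)" for i j
  proof -
    note Fi = deg_fam_fams[OF FF, of i] and Gj = deg_fam_fams[OF GG, of j]
    have "star p' (deg_fam i (fam F) p p') (of_fam (deg_fam j (fam G)) t p') w =
        (\<Sum>p''\<in>B. if hom_degree p p' = i \<and> hom_degree p' p'' = j then K p' p'' else 0)" if p': "p' \<in> B" for p'
    proof -
      have "star p' (deg_fam i (fam F) p p') (of_fam (deg_fam j (fam G)) t p') =
          star p' (deg_fam i (fam F) p p') (\<lambda>w. \<Sum>p''\<in>B. 1 * star p'' (deg_fam j (fam G) p' p'') (t p'') w)"
        by (simp add: of_fam_app[OF t p'])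
      also have "\<dots> = (\<lambda>w. \<Sum>p''\<in>B. 1 * star p' (deg_fam i (fam F) p p') (star p'' (deg_fam j (fam G) p' p'') (t p'')) w)"
        by (intro star_sum_right LL_carrier[OF star_Lp[OF _ famsD[OF Gj p'] tspaceD(1)[OF t]]])
      finally have "star p' (deg_fam i (fam F) p p') (of_fam (deg_fam j (fam G)) t p') w =
          (\<Sum>p''\<in>B. star p' (deg_fam i (fam F) p p') (star p'' (deg_fam j (fam G) p' p'') (t p'')) w)" by simp
      also have "\<dots> = (\<Sum>p''\<in>B. if hom_degree p p' = i \<and> hom_degree p' p'' = j then K p' p'' else 0)"
      proof (rule sum.cong[OF refl])
        fix p'' assume p'': "p'' \<in> B"
        note tp = tspaceD(1)[OF t p'']
        have "star p' (fam F p p') (star p'' (fam G p' p'') (t p'')) w = K p' p''"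
          unfolding K_def star_assoc[OF p' p'' famsD[OF FF p p'] famsD[OF GG p' p''] tp] ..
        moreover have "star p' zero_h (star p'' (deg_fam j (fam G) p' p'') (t p'')) = zero_h"
          by (rule star_zero_left[OF p' star_Lp[OF p'' famsD[OF Gj p' p''] tp]])
        ultimately show "star p' (deg_fam i (fam F) p p') (star p'' (deg_fam j (fam G) p' p'') (t p'')) w =
            (if hom_degree p p' = i \<and> hom_degree p' p'' = j then K p' p'' else 0)"
          using star_zero_left[OF p'' tp] by (cases "hom_degree p p' = i"; cases "hom_degree p' p'' = j") (simp_all add: deg_fam_def)
      qed
      finally show ?thesis .
    qed
    then show ?thesis
      unfolding component_eq[OF F] component_eq[OF G]
      by (simp add: of_fam_app[OF of_fam_tspace[OF Gj t] p])
  qed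
  have "schur_mult m n r f F G t p w = (\<Sum>i<2. \<Sum>j<2. (- 1) ^ (i * j) *
      (\<Sum>p'\<in>B. \<Sum>p''\<in>B. if hom_degree p p' = i \<and> hom_degree p' p'' = j then K p' p'' else 0))"
    using t by (simp add: schur_mult_def comp)
  also have "\<dots> = (\<Sum>p'\<in>B. \<Sum>p''\<in>B. \<Sum>i<2. \<Sum>j<2.
      (- 1) ^ (i * j) * (if hom_degree p p' = i \<and> hom_degree p' p'' = j then K p' p'' else 0))"
    by (simp add: sum_distrib_left numeral_2_eq_2 lessThan_Suc sum.distrib sum_negf sum_subtractf)
  \<comment> \<open>Both degrees are 0 or 1, so exactly one of the four terms of the double sum
    survives and carries the sign \<open>sg\<close>.\<close>
  also have "\<dots> = (\<Sum>p'\<in>B. \<Sum>p''\<in>B. sg p p' p'' * K p' p'')"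
  proof (intro sum.cong refl)
    fix p' p''
    have "hom_degree p p' = 0 \<or> hom_degree p p' = 1" "hom_degree p' p'' = 0 \<or> hom_degree p' p'' = 1"
      using hom_degree_less[of p p'] hom_degree_less[of p' p''] by linarith+
    then show "(\<Sum>i<2. \<Sum>j<2. (- 1) ^ (i * j) * (if hom_degree p p' = i \<and> hom_degree p' p'' = j then K p' p'' else 0)) =
        sg p p' p'' * K p' p''"
      by (auto simp: sg_def numeral_2_eq_2 lessThan_Suc)
  qed
  also have "\<dots> = (\<Sum>p''\<in>B. \<Sum>p'\<in>B. sg p p' p'' * K p' p'')" by (rule sum.swap)
  also have "\<dots> = (\<Sum>p''\<in>B. star p'' (fmult (fam F) (fam G) p p'') (t p'') w)"
  proof (rule sum.cong[OF refl])
    fix p'' assume p'': "p'' \<in> B"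
    have "star p'' (fmult (fam F) (fam G) p p'') (t p'') =
        (\<lambda>w. \<Sum>p'\<in>B. sg p p' p'' * star p'' (star p' (fam F p p') (fam G p' p'')) (t p'') w)"
      unfolding fmult_def
      by (rule star_sum_left[OF p'' tspaceD(1)[OF t p'']])
        (intro zmD(2)[OF star_zm[OF _ famsD[OF FF p] famsD[OF GG _ p'']]])
    then show "(\<Sum>p'\<in>B. sg p p' p'' * K p' p'') = star p'' (fmult (fam F) (fam G) p p'') (t p'') w"
      by (simp add: K_def)
  qed
  finally show "schur_mult m n r f F G t p w = of_fam (fmult (fam F) (fam G)) t p w"
    by (simp add: of_fam_app[OF t p])
next
  fix t p and w :: "nat \<Rightarrow> nat" assume t: "t \<in> TS" and p: "p \<notin> B"
  have "schur_component m n r f j G t \<in> TS" for j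
    unfolding component_eq[OF G] by (rule of_fam_tspace[OF deg_fam_fams[OF fam_fams[OF G]] t])
  then show "schur_mult m n r f F G t p w = of_fam (fmult (fam F) (fam G)) t p w"
    using t p by (simp add: schur_mult_def of_fam_notin component_eq[OF F])
qed (simp_all add: schur_mult_def of_fam_ext)

lemma mult_SC: "F \<in> SC \<Longrightarrow> G \<in> SC \<Longrightarrow> schur_mult m n r f F G \<in> SC"
  by (simp add: mult_eq of_fam_SC fmult_fams fam_fams)

lemma fam_mult:
  "F \<in> SC \<Longrightarrow> G \<in> SC \<Longrightarrow> p \<in> B \<Longrightarrow> p' \<in> B \<Longrightarrow> fam (schur_mult m n r f F G) p p' = fmult (fam F) (fam G) p p'"
  by (simp add: mult_eq fam_of_fam fmult_fams fam_fams)

lemma add_eq: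
  assumes F: "F \<in> SC" and G: "G \<in> SC"
  shows "F \<oplus>\<^bsub>S\<^esub> G = of_fam (\<lambda>p p' w. fam F p p' w + fam G p p' w)"
proof (rule TS_eqI)
  note FF = fam_fams[OF F] and GG = fam_fams[OF G]
  fix t p and w :: "nat \<Rightarrow> nat" assume t: "t \<in> TS" and p: "p \<in> B"
  have e: "F t p w = of_fam (fam F) t p w" "G t p w = of_fam (fam G) t p w"
    using SC_eq_of_fam[OF F] SC_eq_of_fam[OF G] by simp_all
  have "star p' (\<lambda>w. fam F p p' w + fam G p p' w) (t p') =
      (\<lambda>w. star p' (fam F p p') (t p') w + star p' (fam G p p') (t p') w)" if "p' \<in> B" for p'
    by (rule star_add_left[OF that zmD(2)[OF famsD[OF FF p that]] zmD(2)[OF famsD[OF GG p that]] tspaceD(1)[OF t that]])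
  then show "(F \<oplus>\<^bsub>S\<^esub> G) t p w = of_fam (\<lambda>p p' w. fam F p p' w + fam G p p' w) t p w"
    using t by (simp add: tadd_def e of_fam_app[OF t p] sum.distrib)
next
  fix t p and w :: "nat \<Rightarrow> nat" assume t: "t \<in> TS" and p: "p \<notin> B"
  show "(F \<oplus>\<^bsub>S\<^esub> G) t p w = of_fam (\<lambda>p p' w. fam F p p' w + fam G p p' w) t p w"
    using t by (simp add: tadd_def SC_notin[OF F t p] SC_notin[OF G t p] of_fam_notin[OF t p])
qed (simp_all add: of_fam_ext)

lemma smult_eq:
  assumes F: "F \<in> SC"
  shows "c \<odot>\<^bsub>S\<^esub> F = of_fam (\<lambda>p p' w. c * fam F p p' w)"
proof (rule TS_eqI)
  note FF = fam_fams[OF F]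
  fix t p and w :: "nat \<Rightarrow> nat" assume t: "t \<in> TS" and p: "p \<in> B"
  have e: "F t p w = of_fam (fam F) t p w" using SC_eq_of_fam[OF F] by simp
  have "star p' (\<lambda>w. c * fam F p p' w) (t p') = (\<lambda>w. c * star p' (fam F p p') (t p') w)" if "p' \<in> B" for p'
    by (rule star_scale_left[OF that zmD(2)[OF famsD[OF FF p that]] tspaceD(1)[OF t that]])
  then show "(c \<odot>\<^bsub>S\<^esub> F) t p w = of_fam (\<lambda>p p' w. c * fam F p p' w) t p w"
    using t by (simp add: e of_fam_app[OF t p] sum_distrib_left)
next
  fix t p and w :: "nat \<Rightarrow> nat" assume t: "t \<in> TS" and p: "p \<notin> B"
  show "(c \<odot>\<^bsub>S\<^esub> F) t p w = of_fam (\<lambda>p p' w. c * fam F p p' w) t p w"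
    using t by (simp add: SC_notin[OF F t p] of_fam_notin[OF t p])
qed (simp_all add: of_fam_ext)

lemma zero_eq: "\<zero>\<^bsub>S\<^esub> = of_fam (\<lambda>p p'. zero_h)"
proof (rule TS_eqI)
  fix t p and w :: "nat \<Rightarrow> nat" assume t: "t \<in> TS" and p: "p \<in> B"
  have "star p' zero_h (t p') w = 0" if "p' \<in> B" for p'
    using star_zero_left[OF that tspaceD(1)[OF t that]] by simp
  then show "\<zero>\<^bsub>S\<^esub> t p w = of_fam (\<lambda>p p'. zero_h) t p w"
    using t by (simp add: of_fam_app[OF t p])
qed (simp_all add: of_fam_ext of_fam_notin)

lemma X_zm: "X p \<in> zm p p"
  by (simp add: zm_def xyf_LL xyf_RR)

lemma star_X_left: "p \<in> B \<Longrightarrow> t \<in> Lp p \<Longrightarrow> star p (X p) t = t"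
  using star_eq_left[of p "T_elt id" t] by (simp add: LL_carrier)

lemma one_eq: "\<one>\<^bsub>S\<^esub> = of_fam (\<lambda>p p'. if p = p' then X p else zero_h)"
proof (rule TS_eqI)
  fix t p and w :: "nat \<Rightarrow> nat" assume t: "t \<in> TS" and p: "p \<in> B"
  have "star p' (if p = p' then X p else zero_h) (t p') w = (if p' = p then t p w else 0)" if "p' \<in> B" for p'
    using star_X_left[OF p tspaceD(1)[OF t p]] star_zero_left[OF that tspaceD(1)[OF t that]] by auto
  then have "(\<Sum>p'\<in>B. star p' (if p = p' then X p else zero_h) (t p') w) = (\<Sum>p'\<in>B. if p' = p then t p w else 0)"
    by (intro sum.cong) auto
  then show "\<one>\<^bsub>S\<^esub> t p w = of_fam (\<lambda>p p'. if p = p' then X p else zero_h) t p w"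
    using t p by (simp add: of_fam_app[OF t p])
next
  fix t p and w :: "nat \<Rightarrow> nat" assume t: "t \<in> TS" and p: "p \<notin> B"
  moreover have "t p = zero_h" using t p unfolding tspace_iff by blast
  ultimately show "\<one>\<^bsub>S\<^esub> t p w = of_fam (\<lambda>p p'. if p = p' then X p else zero_h) t p w"
    by (simp add: of_fam_notin)
qed (simp_all add: of_fam_ext)

lemma fams_ops:
  "Z \<in> fams \<Longrightarrow> Z' \<in> fams \<Longrightarrow> (\<lambda>p p' w. Z p p' w + Z' p p' w) \<in> fams"
  "Z \<in> fams \<Longrightarrow> (\<lambda>p p' w. c * Z p p' w) \<in> fams"
  "(\<lambda>p p'. zero_h) \<in> fams" "(\<lambda>p p'. if p = p' then X p else zero_h) \<in> fams"
  by (auto simp: fams_def zm_add zm_scale zm_zero X_zm)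

lemma SC_ops:
  "F \<in> SC \<Longrightarrow> G \<in> SC \<Longrightarrow> F \<oplus>\<^bsub>S\<^esub> G \<in> SC" "F \<in> SC \<Longrightarrow> c \<odot>\<^bsub>S\<^esub> F \<in> SC" "\<zero>\<^bsub>S\<^esub> \<in> SC" "\<one>\<^bsub>S\<^esub> \<in> SC"
  "F \<in> SC \<Longrightarrow> G \<in> SC \<Longrightarrow> F \<otimes>\<^bsub>S\<^esub> G \<in> SC"
proof -
  show "F \<in> SC \<Longrightarrow> G \<in> SC \<Longrightarrow> F \<oplus>\<^bsub>S\<^esub> G \<in> SC"
    unfolding add_eq by (intro of_fam_SC fams_ops fam_fams)
  show "F \<in> SC \<Longrightarrow> c \<odot>\<^bsub>S\<^esub> F \<in> SC"
    unfolding smult_eq by (intro of_fam_SC fams_ops fam_fams)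
  show "\<zero>\<^bsub>S\<^esub> \<in> SC" unfolding zero_eq by (intro of_fam_SC fams_ops)
  show "\<one>\<^bsub>S\<^esub> \<in> SC" unfolding one_eq by (intro of_fam_SC fams_ops)
qed (simp add: mult_SC)

lemma fam_ops:
  assumes "p \<in> B" "p' \<in> B"
  shows "F \<in> SC \<Longrightarrow> G \<in> SC \<Longrightarrow> fam (F \<oplus>\<^bsub>S\<^esub> G) p p' = (\<lambda>w. fam F p p' w + fam G p p' w)"
    "F \<in> SC \<Longrightarrow> fam (c \<odot>\<^bsub>S\<^esub> F) p p' = (\<lambda>w. c * fam F p p' w)"
    "fam \<zero>\<^bsub>S\<^esub> p p' = zero_h" "fam \<one>\<^bsub>S\<^esub> p p' = (if p = p' then X p else zero_h)"
    "F \<in> SC \<Longrightarrow> G \<in> SC \<Longrightarrow> fam (F \<otimes>\<^bsub>S\<^esub> G) p p' = fmult (fam F) (fam G) p p'"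
proof -
  show "F \<in> SC \<Longrightarrow> G \<in> SC \<Longrightarrow> fam (F \<oplus>\<^bsub>S\<^esub> G) p p' = (\<lambda>w. fam F p p' w + fam G p p' w)"
    unfolding add_eq by (subst fam_of_fam[OF fams_ops(1)]) (simp_all add: fam_fams assms)
  show "F \<in> SC \<Longrightarrow> fam (c \<odot>\<^bsub>S\<^esub> F) p p' = (\<lambda>w. c * fam F p p' w)"
    unfolding smult_eq by (subst fam_of_fam[OF fams_ops(2)]) (simp_all add: fam_fams assms)
  show "fam \<zero>\<^bsub>S\<^esub> p p' = zero_h" unfolding zero_eq by (subst fam_of_fam[OF fams_ops(3)]) (simp_all add: assms)
  show "fam \<one>\<^bsub>S\<^esub> p p' = (if p = p' then X p else zero_h)"
    unfolding one_eq by (subst fam_of_fam[OF fams_ops(4)]) (simp_all add: assms)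
qed (simp add: fam_mult assms)

declare S_sel(2-6) [simp del]

lemma S_abelian_group: "abelian_group S"
proof (rule abelian_groupI)
  fix F G H assume "F \<in> carrier S" "G \<in> carrier S" "H \<in> carrier S"
  then show "(F \<oplus>\<^bsub>S\<^esub> G) \<oplus>\<^bsub>S\<^esub> H = F \<oplus>\<^bsub>S\<^esub> (G \<oplus>\<^bsub>S\<^esub> H)"
    by (intro SC_eqI) (simp_all add: SC_ops fam_ops add.assoc)
next
  fix F G assume "F \<in> carrier S" "G \<in> carrier S"
  then show "F \<oplus>\<^bsub>S\<^esub> G = G \<oplus>\<^bsub>S\<^esub> F"
    by (intro SC_eqI) (simp_all add: SC_ops fam_ops add.commute)
next
  fix F assume F: "F \<in> carrier S"
  then show "\<zero>\<^bsub>S\<^esub> \<oplus>\<^bsub>S\<^esub> F = F"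
    by (intro SC_eqI) (simp_all add: SC_ops fam_ops)
  have "((- 1) \<odot>\<^bsub>S\<^esub> F) \<oplus>\<^bsub>S\<^esub> F = \<zero>\<^bsub>S\<^esub>"
    using F by (intro SC_eqI) (simp_all add: SC_ops fam_ops)
  then show "\<exists>y\<in>carrier S. y \<oplus>\<^bsub>S\<^esub> F = \<zero>\<^bsub>S\<^esub>" using F SC_ops(2)[of F "- 1"] by (intro bexI[of _ "(- 1) \<odot>\<^bsub>S\<^esub> F"]) simp_all
qed (simp_all add: SC_ops)

lemma finsum_SC:
  assumes "finite I" "\<And>i. i \<in> I \<Longrightarrow> g i \<in> SC"
  shows "(\<Oplus>\<^bsub>S\<^esub>i\<in>I. g i) \<in> SC" "p \<in> B \<Longrightarrow> p' \<in> B \<Longrightarrow> fam (\<Oplus>\<^bsub>S\<^esub>i\<in>I. g i) p p' = (\<lambda>w. \<Sum>i\<in>I. fam (g i) p p' w)"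
proof -
  interpret abelian_group S by (rule S_abelian_group)
  have *: "(\<Oplus>\<^bsub>S\<^esub>i\<in>I. g i) \<in> SC \<and> (\<forall>p\<in>B. \<forall>p'\<in>B. fam (\<Oplus>\<^bsub>S\<^esub>i\<in>I. g i) p p' = (\<lambda>w. \<Sum>i\<in>I. fam (g i) p p' w))"
    using assms
  proof (induction I)
    case empty then show ?case using SC_ops(3) by (simp add: fam_ops)
  next
    case (insert i I)
    then have "(\<Oplus>\<^bsub>S\<^esub>j\<in>insert i I. g j) = g i \<oplus>\<^bsub>S\<^esub> (\<Oplus>\<^bsub>S\<^esub>j\<in>I. g j)"
      by (intro finsum_insert) auto
    then show ?case using insert by (simp add: SC_ops fam_ops)
  qed
  show "(\<Oplus>\<^bsub>S\<^esub>i\<in>I. g i) \<in> SC" using * by blast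
  show "p \<in> B \<Longrightarrow> p' \<in> B \<Longrightarrow> fam (\<Oplus>\<^bsub>S\<^esub>i\<in>I. g i) p p' = (\<lambda>w. \<Sum>i\<in>I. fam (g i) p p' w)" using * by blast
qed

subsection \<open>The basis elements and the anti-involution\<close>

definition phi_fam :: "nat mat \<Rightarrow> nat list \<times> nat list \<Rightarrow> nat list \<times> nat list \<Rightarrow> 'r hecke" where
  "phi_fam A p p' = (if p = row_comp m n A \<and> p' = col_comp m n A then zA m n r E A else zero_h)"

lemma zA_zm: "A \<in> matrices m n r \<Longrightarrow> zA m n r E A \<in> zm (row_comp m n A) (col_comp m n A)"
  by (simp add: zm_def zA_LL zA_RR)

lemma phi_fam_fams: "A \<in> matrices m n r \<Longrightarrow> phi_fam A \<in> fams"
  unfolding fams_def phi_fam_def by (simp add: zA_zm zm_zero)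

text \<open>The description operator in \<open>phi\<close> is resolved here: the family provides an
  endomorphism with the prescribed values, and any other one has the same images of all generators,
  hence the same family.\<close>

lemma phi_eq:
  assumes A: "A \<in> matrices m n r" shows "phi m n r f A = of_fam (phi_fam A)"
  unfolding phi_def
proof (rule the_equality)
  note rb = row_comp_bicomps[OF A] and cb = col_comp_bicomps[OF A]
  let ?row = "row_comp m n A" and ?col = "col_comp m n A"
  note P = phi_fam_fams[OF A]
  have tin: "of_fam (phi_fam A) (tinj p t) = (if p = ?col then tinj ?row (star ?col (zA m n r E A) t) else (\<lambda>p w. 0))"
    if p: "p \<in> B" and t: "t \<in> Lp p" for p t
  proof (rule ext)
    fix p'
    show "of_fam (phi_fam A) (tinj p t) p' = (if p = ?col then tinj ?row (star ?col (zA m n r E A) t) else (\<lambda>p w. 0)) p'"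
    proof (cases "p' \<in> B")
      case True
      have "star p'' (phi_fam A p' p'') (tinj p t p'') w =
          (if p'' = p then (if p' = ?row \<and> p = ?col then star ?col (zA m n r E A) t w else 0) else 0)"
        if "p'' \<in> B" for p'' w
        using star_zero_left[OF p t] by (auto simp: tinj_def phi_fam_def)
      then have "of_fam (phi_fam A) (tinj p t) p' =
          (\<lambda>w. \<Sum>p''\<in>B. if p'' = p then (if p' = ?row \<and> p = ?col then star ?col (zA m n r E A) t w else 0) else 0)"
        unfolding of_fam_app[OF tinj_tspace[OF p t] True] by (intro ext sum.cong) auto
      then show ?thesis using p by (auto simp: tinj_def)
    next
      case False
      then show ?thesis using of_fam_notin[OF tinj_tspace[OF p t] False] rb by (auto simp: tinj_def)
    qed
  qed
  have xyh: "hmult r f (xy_elt r f ?col) h = hm r Q (X ?col) h" if "h \<in> HC" for h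
    using that by (simp add: xy_elt_eq[OF cb] hmult_eq_hm)
  have tdh: "hmult r f (TD m n r f A) h = hm r Q (zA m n r E A) h" if "h \<in> HC" for h
    using that zmD(3)[OF zA_zm[OF A]] by (simp add: TD_eq_zA[OF f A] hmult_eq_hm)
  show "of_fam (phi_fam A) \<in> SC \<and>
    (\<forall>h\<in>HC. of_fam (phi_fam A) (tinj ?col (hmult r f (xy_elt r f ?col) h)) = tinj ?row (hmult r f (TD m n r f A) h)) \<and>
    (\<forall>p\<in>B. p \<noteq> ?col \<longrightarrow> (\<forall>x\<in>xyH r f p. of_fam (phi_fam A) (tinj p x) = (\<lambda>p' w. 0)))"
  proof (intro conjI ballI impI)
    fix h assume h: "h \<in> HC"
    show "of_fam (phi_fam A) (tinj ?col (hmult r f (xy_elt r f ?col) h)) = tinj ?row (hmult r f (TD m n r f A) h)"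
      unfolding xyh[OF h] tdh[OF h] tin[OF cb hm_LL[OF qq xyf_LL h]]
      using star_eq_right[OF cb zmD(2)[OF zA_zm[OF A]] h] by simp
  qed (use tin xyH of_fam_SC[OF P] in auto)
  fix F assume F: "F \<in> SC \<and>
    (\<forall>h\<in>HC. F (tinj ?col (hmult r f (xy_elt r f ?col) h)) = tinj ?row (hmult r f (TD m n r f A) h)) \<and>
    (\<forall>p\<in>B. p \<noteq> ?col \<longrightarrow> (\<forall>x\<in>xyH r f p. F (tinj p x) = (\<lambda>p' w. 0)))"
  show "F = of_fam (phi_fam A)"
  proof (rule SC_eqI)
    fix p p' assume p: "p \<in> B" "p' \<in> B"
    have T: "T_elt id \<in> HC" by simp
    have "F (tinj ?col (hmult r f (xy_elt r f ?col) (T_elt id))) = tinj ?row (hmult r f (TD m n r f A) (T_elt id))"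
      using F T by blast
    then have "F (tinj ?col (X ?col)) = tinj ?row (zA m n r E A)"
      using zmD(3)[OF zA_zm[OF A]] by (simp add: xyh[OF T] tdh[OF T])
    moreover have "F (tinj p' (X p')) = (\<lambda>p' w. 0)" if "p' \<noteq> ?col"
      using F that p(2) xyf_LL[of m r E "rho p'"] unfolding xyH[OF p(2), symmetric] by blast
    ultimately have "fam F p p' = phi_fam A p p'"
      unfolding fam_def phi_fam_def by (cases "p' = ?col") (auto simp: tinj_def)
    then show "fam F p p' = fam (of_fam (phi_fam A)) p p'" using fam_of_fam[OF P p] by simp
  qed (use F of_fam_SC[OF P] in auto)
qed

lemma phi_SC: "A \<in> matrices m n r \<Longrightarrow> phi m n r f A \<in> SC"
  by (simp add: phi_eq of_fam_SC phi_fam_fams)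

lemma fam_phi: "A \<in> matrices m n r \<Longrightarrow> p \<in> B \<Longrightarrow> p' \<in> B \<Longrightarrow> fam (phi m n r f A) p p' = phi_fam A p p'"
  by (simp add: phi_eq fam_of_fam phi_fam_fams)

text \<open>The coefficient at \<open>phi\<close> of A, read off as a single Hecke coefficient at
  the shortest element of its double coset; \<open>zA_at_shortest\<close> is the duality behind
  this.\<close>

definition coord :: "('r tspace \<Rightarrow> 'r tspace) \<Rightarrow> nat mat \<Rightarrow> 'r" where
  "coord F A = fam F (row_comp m n A) (col_comp m n A) (shortest m n r A)"

lemma coord_lincomb:
  assumes fin: "finite (matrices m n r)" and B: "B' \<in> matrices m n r"
  shows "coord (\<Oplus>\<^bsub>S\<^esub>A\<in>matrices m n r. c A \<odot>\<^bsub>S\<^esub> phi m n r f A) B' = c B'"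
proof -
  note rb = row_comp_bicomps[OF B] and cb = col_comp_bicomps[OF B]
  have "coord (\<Oplus>\<^bsub>S\<^esub>A\<in>matrices m n r. c A \<odot>\<^bsub>S\<^esub> phi m n r f A) B' =
      (\<Sum>A\<in>matrices m n r. c A * phi_fam A (row_comp m n B') (col_comp m n B') (shortest m n r B'))"
    unfolding coord_def by (subst finsum_SC(2)[OF fin _ rb cb]) (simp_all add: SC_ops phi_SC fam_ops rb cb fam_phi)
  also have "\<dots> = (\<Sum>A\<in>matrices m n r. if A = B' then c A else 0)"
  proof (rule sum.cong[OF refl])
    fix A assume A: "A \<in> matrices m n r"
    show "c A * phi_fam A (row_comp m n B') (col_comp m n B') (shortest m n r B') = (if A = B' then c A else 0)"
      using zA_at_shortest[OF A B, of E] by (auto simp: phi_fam_def)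
  qed
  also have "\<dots> = c B'" using fin B by simp
  finally show ?thesis .
qed

text \<open>The difference of the two families consists of two-sided eigenvectors that vanish at the
  shortest element of every admissible double coset, so \<open>LR_zero\<close> applies to each
  entry.\<close>

lemma lincomb_coord:
  assumes reg: "m = 0 \<or> n = 0 \<or> r = 1 \<or> (\<forall>a. (1 + Q) * a = 0 \<longrightarrow> a = 0)"
    and fin: "finite (matrices m n r)" and F: "F \<in> SC"
  shows "F = (\<Oplus>\<^bsub>S\<^esub>A\<in>matrices m n r. coord F A \<odot>\<^bsub>S\<^esub> phi m n r f A)" (is "F = ?G")
proof (rule SC_eqI[OF F])
  have G: "?G \<in> SC" by (rule finsum_SC(1)[OF fin]) (simp add: SC_ops phi_SC)
  then show "?G \<in> SC" .
  fix p p' assume p: "p \<in> B" "p' \<in> B"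
  define h where "h = (\<lambda>w. fam F p p' w + (- 1) * fam ?G p p' w)"
  have hz: "h \<in> zm p p'" unfolding h_def by (intro zm_add zm_scale fam_zm F G p)
  have "h = zero_h"
  proof (rule LR_zero[OF p qq reg zmD(1)[OF hz] zmD(2)[OF hz]])
    fix A assume A: "A \<in> matrices m n r" "row_comp m n A = p" "col_comp m n A = p'"
    have "coord ?G A = coord F A" by (rule coord_lincomb[OF fin A(1)])
    then show "h (shortest m n r A) = 0" by (simp add: h_def coord_def A(2,3))
  qed
  then show "fam F p p' = fam ?G p p'" by (simp add: h_def fun_eq_iff)
qed

lemma is_basis_phi:
  assumes reg: "m = 0 \<or> n = 0 \<or> r = 1 \<or> (\<forall>a. (1 + Q) * a = 0 \<longrightarrow> a = 0)"
    and fin: "finite (matrices m n r)"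
  shows "is_basis S (matrices m n r) (phi m n r f)"
  unfolding is_basis_def
proof (intro conjI ballI)
  show "finite (matrices m n r)" by (rule fin)
  show "phi m n r f \<in> matrices m n r \<rightarrow> carrier S" by (simp add: phi_SC)
  fix F assume "F \<in> carrier S"
  then have F: "F \<in> SC" by simp
  interpret abelian_group S by (rule S_abelian_group)
  show "\<exists>!c. c \<in> extensional (matrices m n r) \<and> F = (\<Oplus>\<^bsub>S\<^esub>i\<in>matrices m n r. c i \<odot>\<^bsub>S\<^esub> phi m n r f i)"
  proof (rule ex1I[of _ "restrict (coord F) (matrices m n r)"])
    have "(\<Oplus>\<^bsub>S\<^esub>A\<in>matrices m n r. coord F A \<odot>\<^bsub>S\<^esub> phi m n r f A) =
        (\<Oplus>\<^bsub>S\<^esub>A\<in>matrices m n r. restrict (coord F) (matrices m n r) A \<odot>\<^bsub>S\<^esub> phi m n r f A)"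
      by (rule finsum_cong') (simp_all add: SC_ops phi_SC)
    then show "restrict (coord F) (matrices m n r) \<in> extensional (matrices m n r) \<and>
        F = (\<Oplus>\<^bsub>S\<^esub>A\<in>matrices m n r. restrict (coord F) (matrices m n r) A \<odot>\<^bsub>S\<^esub> phi m n r f A)"
      using lincomb_coord[OF reg fin F] by simp
    fix c assume c: "c \<in> extensional (matrices m n r) \<and> F = (\<Oplus>\<^bsub>S\<^esub>i\<in>matrices m n r. c i \<odot>\<^bsub>S\<^esub> phi m n r f i)"
    then have "coord F A = c A" if "A \<in> matrices m n r" for A using coord_lincomb[OF fin that] by simp
    then show "c = restrict (coord F) (matrices m n r)"
      using c by (intro extensionalityI[of c "matrices m n r"]) auto
  qed
qed

text \<open>Transposition of the family combined with the anti-involution of the Hecke algebra. It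
  is defined on all endomorphisms at once and not by linear extension from the
  \<open>phi\<close>.\<close>

definition tau :: "('r tspace \<Rightarrow> 'r tspace) \<Rightarrow> 'r tspace \<Rightarrow> 'r tspace" where
  "tau F = of_fam (\<lambda>p p'. iota r (fam F p' p))"

lemma iota_fams: "Z \<in> fams \<Longrightarrow> (\<lambda>p p'. iota r (Z p' p)) \<in> fams"
  by (simp add: fams_def iota_zm)

lemma tau_SC: "F \<in> SC \<Longrightarrow> tau F \<in> SC"
  unfolding tau_def by (intro of_fam_SC iota_fams fam_fams)

lemma fam_tau: "F \<in> SC \<Longrightarrow> p \<in> B \<Longrightarrow> p' \<in> B \<Longrightarrow> fam (tau F) p p' = iota r (fam F p' p)"
  unfolding tau_def by (subst fam_of_fam) (simp_all add: iota_fams fam_fams)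

lemma hom_degree_sym: "hom_degree p p' = hom_degree p' p"
  by (simp add: hom_degree_def add.commute)

text \<open>The sign of a path is unchanged when the path is reversed, because degrees are
  symmetric. Hence reversing the factors introduces no further sign.\<close>

lemma fmult_tau:
  assumes F: "F \<in> SC" and G: "G \<in> SC" and p: "p \<in> B" "p'' \<in> B"
  shows "iota r (fmult (fam F) (fam G) p'' p) = fmult (fam (tau G)) (fam (tau F)) p p''"
proof -
  have "iota r (fmult (fam F) (fam G) p'' p) =
      (\<lambda>w. \<Sum>p'\<in>B. sg p'' p' p * iota r (star p' (fam F p'' p') (fam G p' p)) w)"
    by (auto simp: iota_def fmult_def)
  also have "\<dots> = fmult (fam (tau G)) (fam (tau F)) p p''"
    unfolding fmult_def
  proof (intro ext sum.cong refl)
    fix w p' assume p': "p' \<in> B"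
    have "iota r (star p' (fam F p'' p') (fam G p' p)) = star p' (iota r (fam G p' p)) (iota r (fam F p'' p'))"
      by (rule iota_star[OF p' fam_zm[OF F p(2) p'] fam_zm[OF G p' p(1)]])
    moreover have "sg p'' p' p = sg p p' p''"
      unfolding sg_def using hom_degree_sym[of p p'] hom_degree_sym[of p' p''] by (simp add: mult.commute)
    ultimately show "sg p'' p' p * iota r (star p' (fam F p'' p') (fam G p' p)) w =
        sg p p' p'' * star p' (fam (tau G) p p') (fam (tau F) p' p'') w"
      using p p' by (simp add: fam_tau F G)
  qed
  finally show ?thesis .
qed

lemma tau_anti_involution: "algebra_anti_involution S tau"
  unfolding algebra_anti_involution_def
proof (intro conjI ballI allI)
  show "tau \<in> carrier S \<rightarrow> carrier S" by (simp add: tau_SC)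
  fix F G c assume "F \<in> carrier S" "G \<in> carrier S"
  then have FG: "F \<in> SC" "G \<in> SC" by simp_all
  show "tau (F \<oplus>\<^bsub>S\<^esub> G) = tau F \<oplus>\<^bsub>S\<^esub> tau G"
    using FG by (intro SC_eqI) (simp_all add: tau_SC SC_ops fam_ops fam_tau, auto simp: iota_def)
  show "tau (F \<otimes>\<^bsub>S\<^esub> G) = tau G \<otimes>\<^bsub>S\<^esub> tau F"
    using FG by (intro SC_eqI) (simp_all add: tau_SC SC_ops fam_ops fam_tau fmult_tau)
next
  fix F c assume "F \<in> carrier S"
  then have F: "F \<in> SC" by simp
  show "tau (c \<odot>\<^bsub>S\<^esub> F) = c \<odot>\<^bsub>S\<^esub> tau F"
    using F by (intro SC_eqI) (simp_all add: tau_SC SC_ops fam_ops fam_tau, auto simp: iota_def)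
  show "tau (tau F) = F"
    using F zmD(3)[OF fam_zm[OF F]] by (intro SC_eqI) (simp_all add: tau_SC fam_tau)
next
  show "tau \<one>\<^bsub>S\<^esub> = \<one>\<^bsub>S\<^esub>"
  proof (rule SC_eqI)
    fix p p' assume p: "p \<in> B" "p' \<in> B"
    have "iota r zero_h = zero_h" by (auto simp: iota_def)
    then show "fam (tau \<one>\<^bsub>S\<^esub>) p p' = fam \<one>\<^bsub>S\<^esub> p p'"
      using p by (simp add: fam_tau SC_ops fam_ops iota_xyf)
  qed (simp_all add: tau_SC SC_ops)
qed

lemma tau_phi:
  assumes A: "A \<in> matrices m n r" shows "tau (phi m n r f A) = phi m n r f (transpose_mat A)"
proof (rule SC_eqI)
  note At = transpose_matrices[OF A] and c = matrices_carrier[OF A]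
  fix p p' assume p: "p \<in> B" "p' \<in> B"
  have "iota r zero_h = zero_h" by (auto simp: iota_def)
  then show "fam (tau (phi m n r f A)) p p' = fam (phi m n r f (transpose_mat A)) p p'"
    using p by (simp add: fam_tau phi_SC A At fam_phi phi_fam_def iota_zA col_comp_transpose[OF c] row_comp_transpose[OF c])
qed (simp_all add: tau_SC phi_SC A transpose_matrices)

end

subsection \<open>Counting matrices\<close>

text \<open>Stars and bars, transported from lists along an enumeration of X. The truncated
  subtraction is correct for empty X as well: the binomial is 1 for k = 0 and 0 for k > 0.\<close>

lemma card_weak_compositions:
  assumes "finite X"
  shows "finite {g \<in> extensional X. sum g X = (k::nat)}"
    and "card {g \<in> extensional X. sum g X = k} = (card X + k - 1) choose k"
proof -
  obtain h where h: "bij_betw h {0..<card X} X" using ex_bij_betw_nat_finite[OF assms] by blast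
  let ?h' = "inv_into {0..<card X} h"
  let ?F = "\<lambda>g. map (g \<circ> h) [0..<card X]" and ?G = "\<lambda>l. restrict (\<lambda>x. l ! ?h' x) X"
  have h': "?h' x < card X" "h (?h' x) = x" if "x \<in> X" for x
    using bij_betw_inv_into_right[OF h that] bij_betwE[OF bij_betw_inv_into[OF h]] that by auto
  have hX: "h i \<in> X" "?h' (h i) = i" if "i < card X" for i
    using bij_betwE[OF h] bij_betw_inv_into_left[OF h] that by auto
  have sum: "sum_list (?F g) = sum g X" for g :: "'a \<Rightarrow> nat"
    using sum.reindex_bij_betw[OF h, of g] by (simp add: sum_list_distinct_conv_sum_set)
  have bij: "bij_betw ?F {g \<in> extensional X. sum g X = k} {l. length l = card X \<and> sum_list l = k}"
  proof (rule bij_betwI[where g = ?G])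
    show "?F \<in> {g \<in> extensional X. sum g X = k} \<rightarrow> {l. length l = card X \<and> sum_list l = k}"
      using sum by auto
    show GF: "?G (?F g) = g" if "g \<in> {g \<in> extensional X. sum g X = k}" for g
      using that h' by (intro extensionalityI[of _ X]) auto
    show FG: "?F (?G l) = l" if "l \<in> {l. length l = card X \<and> sum_list l = k}" for l
      using that hX by (intro nth_equalityI) auto
    show "?G \<in> {l. length l = card X \<and> sum_list l = k} \<rightarrow> {g \<in> extensional X. sum g X = k}"
    proof
      fix l assume l: "l \<in> {l. length l = card X \<and> sum_list l = k}"
      have "sum (?G l) X = sum_list (?F (?G l))" by (rule sum[symmetric])
      also have "\<dots> = k" using FG[OF l] l by simp
      finally show "?G l \<in> {g \<in> extensional X. sum g X = k}" by simp
    qed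
  qed
  have "finite {l. length l = card X \<and> sum_list l = k}"
  proof (rule finite_subset)
    show "{l. length l = card X \<and> sum_list l = k} \<subseteq> {l. set l \<subseteq> {..k} \<and> length l = card X}"
      using member_le_sum_list[where 'a = nat] by auto
  qed (simp add: finite_lists_length_eq)
  then show "finite {g \<in> extensional X. sum g X = k}" using bij_betw_finite[OF bij] by blast
  show "card {g \<in> extensional X. sum g X = k} = (card X + k - 1) choose k"
    using bij_betw_same_card[OF bij] card_length_sum_list[of "card X" k] by (simp add: add.commute)
qed

text \<open>The entries of equal parity form an arbitrary function with some sum k. The mixed
  entries are 0 or 1 and amount to the set of places carrying 1, of size r - k.\<close>

lemma matrices_bij:
  fixes m n r :: nat
  defines "Pe \<equiv> {(i, j). i < m + n \<and> j < m + n \<and> (i < m) = (j < m)}"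
    and "Po \<equiv> {(i, j). i < m + n \<and> j < m + n \<and> (i < m) \<noteq> (j < m)}"
  shows "bij_betw (\<lambda>A. (restrict (\<lambda>p. A $$ p) Pe, {p \<in> Po. A $$ p = 1})) (matrices m n r)
    (\<Union>k\<in>{..r}. {g \<in> extensional Pe. sum g Pe = k} \<times> {T. T \<subseteq> Po \<and> card T = r - k})"
    (is "bij_betw ?F _ ?U")
proof -
  have fin: "finite Pe" "finite Po"
    unfolding Pe_def Po_def by (rule finite_subset[of _ "{..<m + n} \<times> {..<m + n}"]; auto)+
  have un: "Pe \<union> Po = {..<m + n} \<times> {..<m + n}" "Pe \<inter> Po = {}" by (auto simp: Pe_def Po_def)
  have total: "(\<Sum>i<m + n. \<Sum>j<m + n. a (i, j)) = sum a Pe + sum a Po" for a :: "nat \<times> nat \<Rightarrow> nat"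
    unfolding sum.cartesian_product un(1)[symmetric] by (simp add: sum.union_disjoint fin un(2))
  let ?G = "\<lambda>(g, T). mat (m + n) (m + n) (\<lambda>p. if p \<in> Pe then g p else if p \<in> T then 1 else (0::nat))"
  show ?thesis
  proof (rule bij_betwI[where g = ?G])
    show "?F \<in> matrices m n r \<rightarrow> ?U"
    proof
      fix A assume A: "A \<in> matrices m n r"
      have t: "sum (\<lambda>p. A $$ p) Pe + sum (\<lambda>p. A $$ p) Po = r"
        using A total[of "\<lambda>p. A $$ p"] by (simp add: matrices_def)
      have "A $$ p = (if A $$ p = 1 then 1 else 0)" if pP: "p \<in> Po" for p
      proof -
        obtain i j where p: "p = (i, j)" "i < m + n" "j < m + n" "(i < m) \<noteq> (j < m)"
          using pP by (auto simp: Po_def)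
        then have "A $$ (i, j) \<in> {0, 1}" using A unfolding matrices_def by blast
        then show ?thesis by (auto simp: p(1))
      qed
      then have "sum (\<lambda>p. A $$ p) Po = sum (\<lambda>p. if A $$ p = 1 then 1 else 0) Po" by (intro sum.cong) auto
      also have "\<dots> = card {p \<in> Po. A $$ p = 1}" using fin by (simp add: sum.inter_filter[symmetric])
      finally have "card {p \<in> Po. A $$ p = 1} = r - sum (\<lambda>p. A $$ p) Pe" using t by simp
      then show "?F A \<in> ?U" using t by (intro UN_I[of "sum (\<lambda>p. A $$ p) Pe"]) auto
    qed
    show "?G \<in> ?U \<rightarrow> matrices m n r"
    proof
      fix x assume "x \<in> ?U"
      then obtain g T where x: "x = (g, T)" "sum g Pe \<le> r" "T \<subseteq> Po" "card T = r - sum g Pe" by auto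
      define a where "a p = (if p \<in> Pe then g p else if p \<in> T then 1 else (0::nat))" for p
      have Gx: "?G x = mat (m + n) (m + n) a" by (simp add: x(1) a_def[abs_def])
      have "sum a Pe = sum g Pe" by (rule sum.cong) (auto simp: a_def)
      moreover have "sum a Po = (\<Sum>p\<in>Po. if p \<in> T then 1 else 0)"
        using un by (intro sum.cong) (auto simp: a_def)
      then have "sum a Po = card T" using fin x(3) by (simp add: sum.If_cases Int_absorb1)
      ultimately have "(\<Sum>i<m + n. \<Sum>j<m + n. a (i, j)) = r" using total[of a] x by simp
      then have "(\<Sum>i<m + n. \<Sum>j<m + n. mat (m + n) (m + n) a $$ (i, j)) = r" by simp
      moreover have "a (i, j) \<in> {0, 1}" if "(i < m) \<noteq> (j < m)" for i j
        using that by (auto simp: a_def Pe_def)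
      ultimately show "?G x \<in> matrices m n r" unfolding Gx by (simp add: matrices_def)
    qed
    show "?G (?F A) = A" if A: "A \<in> matrices m n r" for A
    proof (rule eq_matI)
      fix i j assume "i < dim_row A" "j < dim_col A"
      then have ij: "i < m + n" "j < m + n" using A by (auto simp: matrices_def)
      have "(i < m) \<noteq> (j < m) \<Longrightarrow> A $$ (i, j) \<in> {0, 1}" using A ij unfolding matrices_def by blast
      then show "?G (?F A) $$ (i, j) = A $$ (i, j)" using ij by (auto simp: Pe_def Po_def)
    qed (use A in \<open>auto simp: matrices_def\<close>)
    show "?F (?G x) = x" if xU: "x \<in> ?U" for x
    proof -
      obtain k where "x \<in> {g \<in> extensional Pe. sum g Pe = k} \<times> {T. T \<subseteq> Po \<and> card T = r - k}" using xU by blast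
      then obtain g T where x: "x = (g, T)" "g \<in> extensional Pe" "T \<subseteq> Po" by (elim SigmaE) blast
      have "restrict (\<lambda>p. ?G x $$ p) Pe = g"
        using x(2) by (intro extensionalityI[of _ Pe]) (auto simp: x(1) Pe_def)
      moreover have "?G x $$ p = (if p \<in> T then 1 else 0)" if "p \<in> Po" for p
      proof (cases p)
        case (Pair i j)
        then have "p \<notin> Pe" "i < m + n" "j < m + n" using that un(2) by (auto simp: Po_def)
        then show ?thesis using Pair by (simp add: x(1))
      qed
      then have "{p \<in> Po. ?G x $$ p = 1} = {p \<in> Po. p \<in> T}"
        by (intro Collect_cong conj_cong refl) (simp split: if_splits)
      then have "{p \<in> Po. ?G x $$ p = 1} = T" using x(3) by auto
      ultimately show ?thesis by (simp add: x(1))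
    qed
  qed
qed

lemma finite_card_matrices:
  shows "finite (matrices m n r)"
    and "card (matrices m n r) = (\<Sum>k\<le>r. ((m\<^sup>2 + n\<^sup>2 + k - 1) choose k) * ((2 * m * n) choose (r - k)))"
proof -
  define Pe where "Pe = {(i, j). i < m + n \<and> j < m + n \<and> (i < m) = (j < m)}"
  define Po where "Po = {(i, j). i < m + n \<and> j < m + n \<and> (i < m) \<noteq> (j < m)}"
  have Pe: "Pe = {..<m} \<times> {..<m} \<union> {m..<m + n} \<times> {m..<m + n}" by (auto simp: Pe_def)
  have Po: "Po = {..<m} \<times> {m..<m + n} \<union> {m..<m + n} \<times> {..<m}" by (auto simp: Po_def)
  have cPe: "card Pe = m\<^sup>2 + n\<^sup>2"
    unfolding Pe by (subst card_Un_disjoint) (auto simp: power2_eq_square)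
  have cPo: "card Po = 2 * m * n"
    unfolding Po by (subst card_Un_disjoint) auto
  have fin: "finite Pe" "finite Po" unfolding Pe Po by simp_all
  let ?U = "\<lambda>k. {g \<in> extensional Pe. sum g Pe = k} \<times> {T. T \<subseteq> Po \<and> card T = r - k}"
  note bij = matrices_bij[of m n r, folded Pe_def Po_def]
  have finU: "finite (?U k)" for k
    using card_weak_compositions(1)[OF fin(1), of k] finite_subset[of "{T. T \<subseteq> Po \<and> card T = r - k}" "Pow Po"] fin(2)
    by auto
  then have "finite (\<Union>k\<in>{..r}. ?U k)" by blast
  then show "finite (matrices m n r)" using bij_betw_finite[OF bij] by blast
  have "card (matrices m n r) = card (\<Union>k\<in>{..r}. ?U k)" by (rule bij_betw_same_card[OF bij])
  also have "\<dots> = (\<Sum>k\<le>r. card (?U k))"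
    by (rule card_UN_disjoint) (use finU in auto)
  also have "\<dots> = (\<Sum>k\<le>r. ((m\<^sup>2 + n\<^sup>2 + k - 1) choose k) * ((2 * m * n) choose (r - k)))"
    using card_weak_compositions(2)[OF fin(1)] n_subsets[OF fin(2)] by (simp add: card_cartesian_product cPe cPo)
  finally show "card (matrices m n r) = (\<Sum>k\<le>r. ((m\<^sup>2 + n\<^sup>2 + k - 1) choose k) * ((2 * m * n) choose (r - k)))" .
qed

text \<open>The factor has constant coefficient 1, so it is nonzero, and Laurent polynomials over
  the integers have no zero divisors. This provides the regularity condition for the generic
  algebra.\<close>

lemma laurent_regular:
  fixes a :: laurent assumes "(1 + q_of id) * a = 0" shows "a = 0"
proof -
  have "poly_mapping.lookup (1 + q_of id) 0 = (1 :: int)"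
    by (simp add: q_of_def lookup_add lookup_one lookup_single)
  then have "1 + q_of id \<noteq> (0 :: laurent)" by (metis lookup_zero zero_neq_one)
  then show ?thesis using assms by simp
qed

subsection \<open>Base change of an algebra with a finite basis\<close>

text \<open>An f-semilinear multiplicative map g that carries a basis of A to a basis of M. The
  conclusion will be that M is the extension of scalars of A along f.\<close>

locale base_change_setup =
  fixes f :: "'c::comm_ring_1 \<Rightarrow> 'r::comm_ring_1"
    and A :: "('c, 'a, 'y) module_scheme" and M :: "('r, 'b, 'z) module_scheme"
    and g :: "'a \<Rightarrow> 'b" and I :: "'i set" and b :: "'i \<Rightarrow> 'a"
  assumes A_group: "abelian_group A"
    and A_smult: "\<And>c x. x \<in> carrier A \<Longrightarrow> c \<odot>\<^bsub>A\<^esub> x \<in> carrier A"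
    and A_mult: "\<And>x y. x \<in> carrier A \<Longrightarrow> y \<in> carrier A \<Longrightarrow> x \<otimes>\<^bsub>A\<^esub> y \<in> carrier A"
    and A_one: "\<one>\<^bsub>A\<^esub> \<in> carrier A"
    and A_basis: "is_basis A I b"
    and M_group: "abelian_group M"
    and M_smult: "\<And>c x. x \<in> carrier M \<Longrightarrow> c \<odot>\<^bsub>M\<^esub> x \<in> carrier M"
    and M_smult_add: "\<And>c d x. x \<in> carrier M \<Longrightarrow> (c + d) \<odot>\<^bsub>M\<^esub> x = c \<odot>\<^bsub>M\<^esub> x \<oplus>\<^bsub>M\<^esub> d \<odot>\<^bsub>M\<^esub> x"
    and M_add_smult: "\<And>c x y. x \<in> carrier M \<Longrightarrow> y \<in> carrier M \<Longrightarrow> c \<odot>\<^bsub>M\<^esub> (x \<oplus>\<^bsub>M\<^esub> y) = c \<odot>\<^bsub>M\<^esub> x \<oplus>\<^bsub>M\<^esub> c \<odot>\<^bsub>M\<^esub> y"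
    and M_smult_smult: "\<And>c d x. x \<in> carrier M \<Longrightarrow> c \<odot>\<^bsub>M\<^esub> (d \<odot>\<^bsub>M\<^esub> x) = (c * d) \<odot>\<^bsub>M\<^esub> x"
    and M_one_smult: "\<And>x. x \<in> carrier M \<Longrightarrow> 1 \<odot>\<^bsub>M\<^esub> x = x"
    and M_mult: "\<And>x y. x \<in> carrier M \<Longrightarrow> y \<in> carrier M \<Longrightarrow> x \<otimes>\<^bsub>M\<^esub> y \<in> carrier M"
    and M_distl: "\<And>x y z. x \<in> carrier M \<Longrightarrow> y \<in> carrier M \<Longrightarrow> z \<in> carrier M \<Longrightarrow>
      (x \<oplus>\<^bsub>M\<^esub> y) \<otimes>\<^bsub>M\<^esub> z = x \<otimes>\<^bsub>M\<^esub> z \<oplus>\<^bsub>M\<^esub> y \<otimes>\<^bsub>M\<^esub> z"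
    and M_distr: "\<And>x y z. x \<in> carrier M \<Longrightarrow> y \<in> carrier M \<Longrightarrow> z \<in> carrier M \<Longrightarrow>
      z \<otimes>\<^bsub>M\<^esub> (x \<oplus>\<^bsub>M\<^esub> y) = z \<otimes>\<^bsub>M\<^esub> x \<oplus>\<^bsub>M\<^esub> z \<otimes>\<^bsub>M\<^esub> y"
    and M_smult_mult: "\<And>c d x y. x \<in> carrier M \<Longrightarrow> y \<in> carrier M \<Longrightarrow>
      (c \<odot>\<^bsub>M\<^esub> x) \<otimes>\<^bsub>M\<^esub> (d \<odot>\<^bsub>M\<^esub> y) = (c * d) \<odot>\<^bsub>M\<^esub> (x \<otimes>\<^bsub>M\<^esub> y)"
    and g_closed: "\<And>x. x \<in> carrier A \<Longrightarrow> g x \<in> carrier M"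
    and g_add: "\<And>x y. x \<in> carrier A \<Longrightarrow> y \<in> carrier A \<Longrightarrow> g (x \<oplus>\<^bsub>A\<^esub> y) = g x \<oplus>\<^bsub>M\<^esub> g y"
    and g_smult: "\<And>c x. x \<in> carrier A \<Longrightarrow> g (c \<odot>\<^bsub>A\<^esub> x) = f c \<odot>\<^bsub>M\<^esub> g x"
    and g_mult: "\<And>x y. x \<in> carrier A \<Longrightarrow> y \<in> carrier A \<Longrightarrow> g (x \<otimes>\<^bsub>A\<^esub> y) = g x \<otimes>\<^bsub>M\<^esub> g y"
    and g_one: "g \<one>\<^bsub>A\<^esub> = \<one>\<^bsub>M\<^esub>"
    and M_basis: "is_basis M I (\<lambda>i. g (b i))"
begin

sublocale A: abelian_group A by (rule A_group)
sublocale M: abelian_group M by (rule M_group)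

abbreviation "FA \<equiv> tensor_free A :: (('a \<times> 'r) \<Rightarrow>\<^sub>0 int) monoid"
abbreviation "N \<equiv> tensor_rels f A"

lemma FA_carrier: "P \<in> carrier FA \<longleftrightarrow> Poly_Mapping.keys P \<subseteq> carrier A \<times> UNIV"
  by (simp add: tensor_free_def)

lemma FA_group: "comm_group FA"
  by (simp add: tensor_free_def abelian_free_Abelian_group)

lemma FA_mult: "P \<otimes>\<^bsub>FA\<^esub> P' = P + P'" "\<one>\<^bsub>FA\<^esub> = 0"
  by (simp_all add: tensor_free_def)

lemma FA_frag: "x \<in> carrier A \<Longrightarrow> frag_of (x, a) \<in> carrier FA"
  by (simp add: FA_carrier)

lemma FA_diff: "P \<in> carrier FA \<Longrightarrow> P' \<in> carrier FA \<Longrightarrow> P - P' \<in> carrier FA"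
  unfolding FA_carrier using keys_diff[of P P'] by (meson Un_least order_trans)

lemma FA_add: "P \<in> carrier FA \<Longrightarrow> P' \<in> carrier FA \<Longrightarrow> P + P' \<in> carrier FA"
  unfolding FA_carrier using Poly_Mapping.keys_add[of P P'] by (meson Un_least order_trans)

lemma FA_zero: "0 \<in> carrier FA"
  by (simp add: FA_carrier)

lemma FA_sum: "(\<And>i. i \<in> J \<Longrightarrow> P i \<in> carrier FA) \<Longrightarrow> (\<Sum>i\<in>J. P i) \<in> carrier FA"
  by (induction J rule: infinite_finite_induct) (auto simp: FA_zero FA_add)

lemma rels_carrier: "({frag_of (x \<oplus>\<^bsub>A\<^esub> y, a) - frag_of (x, a) - frag_of (y, a) | x y a. x \<in> carrier A \<and> y \<in> carrier A} \<union>
      {frag_of (x, a + b) - frag_of (x, a) - frag_of (x, b) | x a b. x \<in> carrier A} \<union>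
      {frag_of (c \<odot>\<^bsub>A\<^esub> x, a) - frag_of (x, f c * a) | c x a. x \<in> carrier A}) \<subseteq> carrier FA"
  by (auto intro!: FA_diff FA_frag A_smult)

lemma N_subgroup: "subgroup N FA"
  unfolding tensor_rels_def
  by (rule group.generate_is_subgroup[OF comm_group.axioms(2)[OF FA_group] rels_carrier])

lemma N_carrier: "P \<in> N \<Longrightarrow> P \<in> carrier FA"
  using subgroup.subset[OF N_subgroup] by blast

lemma N_zero: "0 \<in> N" using subgroup.one_closed[OF N_subgroup] by (simp add: FA_mult)

lemma N_add: "P \<in> N \<Longrightarrow> P' \<in> N \<Longrightarrow> P + P' \<in> N"
  using subgroup.m_closed[OF N_subgroup] by (simp add: FA_mult)

lemma N_minus: "P \<in> N \<Longrightarrow> - P \<in> N"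
  using subgroup.m_inv_closed[OF N_subgroup, of P] N_carrier[of P]
  by (simp add: tensor_free_def)

lemma N_diff: "P \<in> N \<Longrightarrow> P' \<in> N \<Longrightarrow> P - P' \<in> N"
  using N_add[of P "- P'"] N_minus by simp

lemma N_sum: "(\<And>i. i \<in> J \<Longrightarrow> P i \<in> N) \<Longrightarrow> (\<Sum>i\<in>J. P i) \<in> N"
  by (induction J rule: infinite_finite_induct) (auto simp: N_zero N_add)

lemma N_rels:
  "x \<in> carrier A \<Longrightarrow> y \<in> carrier A \<Longrightarrow> frag_of (x \<oplus>\<^bsub>A\<^esub> y, a) - frag_of (x, a) - frag_of (y, a) \<in> N"
  "x \<in> carrier A \<Longrightarrow> frag_of (x, a + a') - frag_of (x, a) - frag_of (x, a') \<in> N"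
  "x \<in> carrier A \<Longrightarrow> frag_of (c \<odot>\<^bsub>A\<^esub> x, a) - frag_of (x, f c * a) \<in> N"
  unfolding tensor_rels_def by (rule generate.incl, blast)+

lemma N_frag_zero: "x \<in> carrier A \<Longrightarrow> frag_of (x, 0) \<in> N"
  using N_minus[OF N_rels(2)[of x 0 0]] by simp

lemma N_zero_frag: "frag_of (\<zero>\<^bsub>A\<^esub>, a) \<in> N"
  using N_minus[OF N_rels(1)[of "\<zero>\<^bsub>A\<^esub>" "\<zero>\<^bsub>A\<^esub>" a]] by simp

lemma N_finsum:
  assumes "finite J" "\<And>i. i \<in> J \<Longrightarrow> x i \<in> carrier A"
  shows "frag_of (\<Oplus>\<^bsub>A\<^esub>i\<in>J. x i, a) - (\<Sum>i\<in>J. frag_of (x i, a)) \<in> N"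
  using assms
proof (induction J)
  case empty then show ?case by (simp add: N_zero_frag)
next
  case (insert i J)
  have e: "(\<Oplus>\<^bsub>A\<^esub>i\<in>insert i J. x i) = x i \<oplus>\<^bsub>A\<^esub> (\<Oplus>\<^bsub>A\<^esub>i\<in>J. x i)"
    using insert by (intro A.finsum_insert) auto
  have c: "(\<Oplus>\<^bsub>A\<^esub>i\<in>J. x i) \<in> carrier A" using insert by (intro A.finsum_closed) auto
  have "(frag_of (x i \<oplus>\<^bsub>A\<^esub> (\<Oplus>\<^bsub>A\<^esub>i\<in>J. x i), a) - frag_of (x i, a) - frag_of (\<Oplus>\<^bsub>A\<^esub>i\<in>J. x i, a)) +
      (frag_of (\<Oplus>\<^bsub>A\<^esub>i\<in>J. x i, a) - (\<Sum>i\<in>J. frag_of (x i, a))) \<in> N"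
    using insert c by (intro N_add N_rels(1)) auto
  then show ?case using insert.hyps by (simp add: e algebra_simps)
qed

lemma A_basisD: "finite I" "i \<in> I \<Longrightarrow> b i \<in> carrier A"
  "x \<in> carrier A \<Longrightarrow> \<exists>c. x = (\<Oplus>\<^bsub>A\<^esub>i\<in>I. c i \<odot>\<^bsub>A\<^esub> b i)"
  using A_basis unfolding is_basis_def by blast+

text \<open>The spanning half: modulo the bilinearity relations, a generator (x, a) is expanded by a
  basis expansion of x, and the coefficients move to the second component.\<close>

lemma reduce:
  assumes "P \<in> carrier FA"
  shows "\<exists>c. P - (\<Sum>i\<in>I. frag_of (b i, c i)) \<in> N"
proof -
  have "Poly_Mapping.keys P \<subseteq> carrier A \<times> UNIV" using assms by (simp add: FA_carrier)
  then show ?thesis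
  proof (rule free_Abelian_group_induct)
    show "\<exists>c. 0 - (\<Sum>i\<in>I. frag_of (b i, c i)) \<in> N"
    proof (rule exI[of _ "\<lambda>_. 0"])
      have "(\<Sum>i\<in>I. frag_of (b i, 0)) \<in> N"
        by (intro N_sum N_frag_zero A_basisD(2))
      then show "0 - (\<Sum>i\<in>I. frag_of (b i, 0)) \<in> N" using N_minus by simp
    qed
  next
    fix P P' :: "('a \<times> 'r) \<Rightarrow>\<^sub>0 int"
    assume "\<exists>c. P - (\<Sum>i\<in>I. frag_of (b i, c i)) \<in> N" "\<exists>c. P' - (\<Sum>i\<in>I. frag_of (b i, c i)) \<in> N"
    then obtain c c' where c: "P - (\<Sum>i\<in>I. frag_of (b i, c i)) \<in> N" "P' - (\<Sum>i\<in>I. frag_of (b i, c' i)) \<in> N" by blast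
    \<comment> \<open>The induction over the free group proceeds by differences. Writing c_i as (c_i
      - c'_i) + c'_i puts the difference of two reduced sums into reduced form by additivity in the
      second component.\<close>
    have "(\<Sum>i\<in>I. frag_of (b i, (c i - c' i) + c' i) - frag_of (b i, c i - c' i) - frag_of (b i, c' i)) \<in> N"
      by (intro N_sum N_rels(2) A_basisD(2))
    then have "(\<Sum>i\<in>I. frag_of (b i, c i)) - (\<Sum>i\<in>I. frag_of (b i, c i - c' i)) - (\<Sum>i\<in>I. frag_of (b i, c' i)) \<in> N"
      by (simp add: sum_subtractf)
    from N_add[OF N_diff[OF c] this]
    have "P - P' - (\<Sum>i\<in>I. frag_of (b i, c i - c' i)) \<in> N" by (simp add: algebra_simps)
    then show "\<exists>c. P - P' - (\<Sum>i\<in>I. frag_of (b i, c i)) \<in> N" by (intro exI[of _ "\<lambda>i. c i - c' i"])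
  next
    fix xa :: "'a \<times> 'r" assume "xa \<in> carrier A \<times> UNIV"
    then obtain x a where xa: "xa = (x, a)" "x \<in> carrier A" by (cases xa) auto
    obtain c where c: "x = (\<Oplus>\<^bsub>A\<^esub>i\<in>I. c i \<odot>\<^bsub>A\<^esub> b i)" using A_basisD(3)[OF xa(2)] by blast
    have "frag_of (x, a) - (\<Sum>i\<in>I. frag_of (c i \<odot>\<^bsub>A\<^esub> b i, a)) \<in> N"
      unfolding c by (intro N_finsum A_basisD A_smult)
    moreover have "(\<Sum>i\<in>I. frag_of (c i \<odot>\<^bsub>A\<^esub> b i, a) - frag_of (b i, f (c i) * a)) \<in> N"
      by (intro N_sum N_rels(3) A_basisD(2))
    ultimately have "frag_of (x, a) - (\<Sum>i\<in>I. frag_of (c i \<odot>\<^bsub>A\<^esub> b i, a)) +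
        (\<Sum>i\<in>I. frag_of (c i \<odot>\<^bsub>A\<^esub> b i, a) - frag_of (b i, f (c i) * a)) \<in> N" by (rule N_add)
    then have "frag_of (x, a) - (\<Sum>i\<in>I. frag_of (b i, f (c i) * a)) \<in> N" by (simp add: sum_subtractf)
    then show "\<exists>c. frag_of xa - (\<Sum>i\<in>I. frag_of (b i, c i)) \<in> N"
      unfolding xa by (intro exI[of _ "\<lambda>i. f (c i) * a"])
  qed
qed

text \<open>The additive extension of (x, a) to a g(x), taken from the universal property of the
  free abelian group. It will induce the isomorphism.\<close>

definition ev :: "(('a \<times> 'r) \<Rightarrow>\<^sub>0 int) \<Rightarrow> 'b" where
  "ev = (SOME h. h \<in> hom FA (add_monoid M) \<and> (\<forall>x\<in>carrier A. \<forall>a. h (frag_of (x, a)) = a \<odot>\<^bsub>M\<^esub> g x))"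

lemma ev:
  "P \<in> carrier FA \<Longrightarrow> ev P \<in> carrier M"
  "P \<in> carrier FA \<Longrightarrow> P' \<in> carrier FA \<Longrightarrow> ev (P + P') = ev P \<oplus>\<^bsub>M\<^esub> ev P'"
  "x \<in> carrier A \<Longrightarrow> ev (frag_of (x, a)) = a \<odot>\<^bsub>M\<^esub> g x"
proof -
  have "(\<lambda>(x, a). a \<odot>\<^bsub>M\<^esub> g x) ` (carrier A \<times> UNIV) \<subseteq> carrier (add_monoid M)"
    by (auto intro: M_smult g_closed)
  then obtain h where "h \<in> hom FA (add_monoid M)" "\<And>x. x \<in> carrier A \<times> UNIV \<Longrightarrow> h (frag_of x) = (\<lambda>(x, a). a \<odot>\<^bsub>M\<^esub> g x) x"
    unfolding tensor_free_def using comm_group.free_Abelian_group_universal[OF M.a_comm_group] by blast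
  then have "\<exists>h. h \<in> hom FA (add_monoid M) \<and> (\<forall>x\<in>carrier A. \<forall>a. h (frag_of (x, a)) = a \<odot>\<^bsub>M\<^esub> g x)" by auto
  from someI_ex[OF this] have e: "ev \<in> hom FA (add_monoid M)" "\<And>x a. x \<in> carrier A \<Longrightarrow> ev (frag_of (x, a)) = a \<odot>\<^bsub>M\<^esub> g x"
    unfolding ev_def by blast+
  show "P \<in> carrier FA \<Longrightarrow> ev P \<in> carrier M" using hom_in_carrier[OF e(1)] by simp
  show "P \<in> carrier FA \<Longrightarrow> P' \<in> carrier FA \<Longrightarrow> ev (P + P') = ev P \<oplus>\<^bsub>M\<^esub> ev P'"
    using hom_mult[OF e(1), of P P'] by (simp add: FA_mult)
  show "x \<in> carrier A \<Longrightarrow> ev (frag_of (x, a)) = a \<odot>\<^bsub>M\<^esub> g x" by (rule e(2))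
qed

lemma ev_zero: "ev 0 = \<zero>\<^bsub>M\<^esub>"
  using ev(2)[of 0 0] ev(1)[of 0] FA_zero M.add.r_cancel_one by fastforce

lemma ev_diff:
  assumes "P \<in> carrier FA" "P' \<in> carrier FA" shows "ev (P - P') = ev P \<ominus>\<^bsub>M\<^esub> ev P'"
proof -
  have "ev P = ev (P - P') \<oplus>\<^bsub>M\<^esub> ev P'" using ev(2)[of "P - P'" P'] FA_diff assms by simp
  then show ?thesis using ev(1)[OF FA_diff[OF assms]] ev(1)[OF assms(2)]
    by (simp add: M.minus_eq M.a_assoc M.r_neg)
qed

lemma ev_sum:
  assumes "finite J" "\<And>i. i \<in> J \<Longrightarrow> P i \<in> carrier FA"
  shows "ev (\<Sum>i\<in>J. P i) = (\<Oplus>\<^bsub>M\<^esub>i\<in>J. ev (P i))"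
  using assms
proof (induction J)
  case empty then show ?case by (simp add: ev_zero)
next
  case (insert i J)
  then have "(\<Oplus>\<^bsub>M\<^esub>i\<in>insert i J. ev (P i)) = ev (P i) \<oplus>\<^bsub>M\<^esub> (\<Oplus>\<^bsub>M\<^esub>i\<in>J. ev (P i))"
    by (intro M.finsum_insert) (auto simp: ev(1))
  then show ?case using insert by (simp add: ev(2) FA_sum)
qed

lemma ev_rels:
  assumes "P \<in> {frag_of (x \<oplus>\<^bsub>A\<^esub> y, a) - frag_of (x, a) - frag_of (y, a) | x y a. x \<in> carrier A \<and> y \<in> carrier A} \<union>
      {frag_of (x, a + b) - frag_of (x, a) - frag_of (x, b) | x a b. x \<in> carrier A} \<union>
      {frag_of (c \<odot>\<^bsub>A\<^esub> x, a) - frag_of (x, f c * a) | c x a. x \<in> carrier A}"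
  shows "ev P = \<zero>\<^bsub>M\<^esub>"
proof -
  have cancel: "(u \<oplus>\<^bsub>M\<^esub> v) \<ominus>\<^bsub>M\<^esub> u \<ominus>\<^bsub>M\<^esub> v = \<zero>\<^bsub>M\<^esub>" if "u \<in> carrier M" "v \<in> carrier M" for u v
    using that by (simp add: M.minus_eq M.a_assoc M.r_neg M.a_lcomm[of v])
  show ?thesis using assms
  proof (elim UnE CollectE exE conjE)
    fix x y a assume P: "P = frag_of (x \<oplus>\<^bsub>A\<^esub> y, a) - frag_of (x, a) - frag_of (y, a)" and x: "x \<in> carrier A" "y \<in> carrier A"
    show ?thesis unfolding P using x
      by (simp add: ev_diff ev(3) FA_diff FA_frag g_add g_closed M_add_smult cancel M_smult)
  next
    fix x a b assume P: "P = frag_of (x, a + b) - frag_of (x, a) - frag_of (x, b)" and x: "x \<in> carrier A"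
    show ?thesis unfolding P using x
      by (simp add: ev_diff ev(3) FA_diff FA_frag g_closed M_smult_add cancel M_smult)
  next
    fix c x a assume P: "P = frag_of (c \<odot>\<^bsub>A\<^esub> x, a) - frag_of (x, f c * a)" and x: "x \<in> carrier A"
    show ?thesis unfolding P using x
      by (simp add: ev_diff ev(3) FA_frag A_smult g_closed g_smult M_smult_smult M_smult mult.commute M.minus_eq M.r_neg)
  qed
qed

lemma ev_N: assumes "P \<in> N" shows "ev P = \<zero>\<^bsub>M\<^esub>"
  using assms unfolding tensor_rels_def
proof (induction rule: generate.induct)
  case one then show ?case by (simp add: FA_mult ev_zero)
next
  case (incl P)
  then show ?case by (rule ev_rels)
next
  case (inv P)
  then have c: "P \<in> carrier FA" by (rule subsetD[OF rels_carrier])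
  then have i: "inv\<^bsub>FA\<^esub> P = 0 - P"
    unfolding FA_carrier unfolding tensor_free_def by (subst inv_free_Abelian_group) simp_all
  show ?case unfolding i ev_diff[OF FA_zero c] ev_rels[OF inv] by (simp add: ev_zero M.minus_eq)
next
  case (eng P P')
  then have "P \<in> carrier FA" "P' \<in> carrier FA"
    using N_carrier unfolding tensor_rels_def by blast+
  then show ?case using eng by (simp add: FA_mult ev(2))
qed

lemma M_basisD: "g (b i) \<in> carrier M" if "i \<in> I" using g_closed A_basisD(2) that by simp

lemma ev_lincomb: "ev (\<Sum>i\<in>I. frag_of (b i, c i)) = (\<Oplus>\<^bsub>M\<^esub>i\<in>I. c i \<odot>\<^bsub>M\<^esub> g (b i))"
proof -
  have "ev (\<Sum>i\<in>I. frag_of (b i, c i)) = (\<Oplus>\<^bsub>M\<^esub>i\<in>I. ev (frag_of (b i, c i)))"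
    by (rule ev_sum[OF A_basisD(1)]) (simp add: FA_frag A_basisD(2))
  also have "\<dots> = (\<Oplus>\<^bsub>M\<^esub>i\<in>I. c i \<odot>\<^bsub>M\<^esub> g (b i))"
    by (rule M.finsum_cong') (simp_all add: ev(3) A_basisD(2) M_smult M_basisD)
  finally show ?thesis .
qed

text \<open>The kernel of \<open>ev\<close> consists of the relations alone: after
  \<open>reduce\<close>, vanishing of \<open>ev\<close> is a linear relation among the g(b_i), which
  are a basis. All coefficients are therefore 0, and the pairs (b_i, 0) are relations.\<close>

lemma ev_zero_N:
  assumes P: "P \<in> carrier FA" and z: "ev P = \<zero>\<^bsub>M\<^esub>" shows "P \<in> N"
proof -
  obtain c where c: "P - (\<Sum>i\<in>I. frag_of (b i, c i)) \<in> N" using reduce[OF P] by blast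
  have S: "(\<Sum>i\<in>I. frag_of (b i, c i)) \<in> carrier FA" by (intro FA_sum FA_frag A_basisD(2))
  have "ev P \<ominus>\<^bsub>M\<^esub> ev (\<Sum>i\<in>I. frag_of (b i, c i)) = \<zero>\<^bsub>M\<^esub>"
    using ev_N[OF c] ev_diff[OF P S] by simp
  then have "ev (\<Sum>i\<in>I. frag_of (b i, c i)) = \<zero>\<^bsub>M\<^esub>"
    using z ev(1)[OF S] by (simp add: M.minus_eq)
  then have e: "(\<Oplus>\<^bsub>M\<^esub>i\<in>I. c i \<odot>\<^bsub>M\<^esub> g (b i)) = \<zero>\<^bsub>M\<^esub>"
    unfolding ev_lincomb .
  have z0: "0 \<odot>\<^bsub>M\<^esub> y = \<zero>\<^bsub>M\<^esub>" if "y \<in> carrier M" for y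
    using M_smult_add[OF that, of 0 0] M_smult[OF that, of 0] M.add.r_cancel_one by fastforce
  have "\<exists>!c. c \<in> extensional I \<and> \<zero>\<^bsub>M\<^esub> = (\<Oplus>\<^bsub>M\<^esub>i\<in>I. c i \<odot>\<^bsub>M\<^esub> g (b i))"
    using M_basis M.zero_closed unfolding is_basis_def by blast
  then have unique: "c1 = c2" if "c1 \<in> extensional I" "\<zero>\<^bsub>M\<^esub> = (\<Oplus>\<^bsub>M\<^esub>i\<in>I. c1 i \<odot>\<^bsub>M\<^esub> g (b i))"
    "c2 \<in> extensional I" "\<zero>\<^bsub>M\<^esub> = (\<Oplus>\<^bsub>M\<^esub>i\<in>I. c2 i \<odot>\<^bsub>M\<^esub> g (b i))" for c1 c2
    using that by (elim ex1E) metis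
  have 1: "(\<Oplus>\<^bsub>M\<^esub>i\<in>I. restrict c I i \<odot>\<^bsub>M\<^esub> g (b i)) = (\<Oplus>\<^bsub>M\<^esub>i\<in>I. c i \<odot>\<^bsub>M\<^esub> g (b i))"
    by (rule M.finsum_cong') (simp_all add: M_smult M_basisD)
  have 2: "(\<Oplus>\<^bsub>M\<^esub>i\<in>I. restrict (\<lambda>_. 0) I i \<odot>\<^bsub>M\<^esub> g (b i)) = (\<Oplus>\<^bsub>M\<^esub>i\<in>I. \<zero>\<^bsub>M\<^esub>)"
    by (rule M.finsum_cong') (simp_all add: z0 M_basisD)
  \<comment> \<open>Uniqueness in \<open>is_basis\<close> concerns coefficient functions that are
    extensional on I, so both candidates are restricted before being compared.\<close>
  have "restrict c I = restrict (\<lambda>_. 0) I"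
    by (rule unique) (simp_all only: 1 2 e M.finsum_zero restrict_extensional)
  then have "c i = 0" if "i \<in> I" for i using that by (metis restrict_apply')
  then have "(\<Sum>i\<in>I. frag_of (b i, c i)) \<in> N" by (intro N_sum) (simp add: N_frag_zero A_basisD(2))
  from N_add[OF c this] show ?thesis by simp
qed

text \<open>Because the kernel of \<open>ev\<close> is the subgroup of relations, these fibres are
  the cosets that form the tensor product; computing with cosets becomes computing in M.\<close>

definition fib :: "'b \<Rightarrow> (('a \<times> 'r) \<Rightarrow>\<^sub>0 int) set" where
  "fib y = {P \<in> carrier FA. ev P = y}"

lemma class_eq: assumes P: "P \<in> carrier FA" shows "tensor_class f A P = fib (ev P)"
proof (rule Set.set_eqI, rule iffI)
  fix P' assume "P' \<in> tensor_class f A P"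
  then obtain k where k: "k \<in> N" "P' = k + P" by (auto simp: tensor_class_def r_coset_def FA_mult)
  then show "P' \<in> fib (ev P)" using N_carrier[OF k(1)] P by (simp add: fib_def FA_add ev ev_N)
next
  fix P' assume "P' \<in> fib (ev P)"
  then have P': "P' \<in> carrier FA" "ev P' = ev P" by (simp_all add: fib_def)
  have "P' - P \<in> N"
    using P P' by (intro ev_zero_N) (simp_all add: FA_diff ev_diff M.minus_eq M.r_neg ev(1))
  then show "P' \<in> tensor_class f A P"
    by (force simp: tensor_class_def r_coset_def FA_mult intro: bexI[of _ "P' - P"])
qed

lemma ev_surj: assumes "y \<in> carrier M" shows "\<exists>P\<in>carrier FA. ev P = y"
proof -
  obtain c where c: "y = (\<Oplus>\<^bsub>M\<^esub>i\<in>I. c i \<odot>\<^bsub>M\<^esub> g (b i))"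
    using M_basis assms unfolding is_basis_def by blast
  have "ev (\<Sum>i\<in>I. frag_of (b i, c i)) = y"
    unfolding c by (rule ev_lincomb)
  moreover have "(\<Sum>i\<in>I. frag_of (b i, c i)) \<in> carrier FA" by (intro FA_sum FA_frag A_basisD(2))
  ultimately show ?thesis by blast
qed

abbreviation "BC \<equiv> base_change f A"

lemma BC_carrier: "carrier BC = fib ` carrier M"
proof -
  have "carrier BC = tensor_class f A ` carrier FA"
    by (auto simp: base_change_def FactGroup_def RCOSETS_def tensor_class_def)
  also have "\<dots> = fib ` carrier M"
  proof (rule Set.set_eqI, rule iffI)
    fix Z assume "Z \<in> tensor_class f A ` carrier FA"
    then obtain P where "P \<in> carrier FA" "Z = tensor_class f A P" by blast
    then show "Z \<in> fib ` carrier M" using class_eq ev(1) by blast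
  next
    fix Z assume "Z \<in> fib ` carrier M"
    then obtain y where y: "y \<in> carrier M" "Z = fib y" by blast
    obtain P where "P \<in> carrier FA" "ev P = y" using ev_surj[OF y(1)] by blast
    then show "Z \<in> tensor_class f A ` carrier FA" using class_eq y(2) by blast
  qed
  finally show ?thesis .
qed

lemma fib_nonempty: "y \<in> carrier M \<Longrightarrow> fib y \<noteq> {}"
  using ev_surj by (auto simp: fib_def)

lemma BC_add:
  assumes "y \<in> carrier M" "y' \<in> carrier M" shows "fib y \<oplus>\<^bsub>BC\<^esub> fib y' = fib (y \<oplus>\<^bsub>M\<^esub> y')"
proof -
  have "fib y \<oplus>\<^bsub>BC\<^esub> fib y' = (\<Union>P\<in>fib y. \<Union>P'\<in>fib y'. {P + P'})"
    by (simp add: base_change_def FactGroup_def set_mult_def FA_mult)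
  also have "\<dots> = fib (y \<oplus>\<^bsub>M\<^esub> y')"
  proof (rule Set.set_eqI, rule iffI)
    fix Z assume "Z \<in> (\<Union>P\<in>fib y. \<Union>P'\<in>fib y'. {P + P'})"
    then show "Z \<in> fib (y \<oplus>\<^bsub>M\<^esub> y')" by (auto simp: fib_def FA_add ev(2))
  next
    fix Z assume Z: "Z \<in> fib (y \<oplus>\<^bsub>M\<^esub> y')"
    obtain P where P: "P \<in> fib y" using fib_nonempty[OF assms(1)] by blast
    have "Z - P \<in> fib y'"
      using Z P assms by (auto simp: fib_def FA_diff ev_diff M.minus_eq M.a_comm[of y y'] M.a_assoc M.r_neg)
    then show "Z \<in> (\<Union>P\<in>fib y. \<Union>P'\<in>fib y'. {P + P'})"
      using P by (intro UN_I[of P] UN_I[of "Z - P"]) auto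
  qed
  finally show ?thesis .
qed

definition tprod :: "(('a \<times> 'r) \<Rightarrow>\<^sub>0 int) \<Rightarrow> (('a \<times> 'r) \<Rightarrow>\<^sub>0 int) \<Rightarrow> ('a \<times> 'r) \<Rightarrow>\<^sub>0 int" where
  "tprod P P' = frag_extend (\<lambda>(x, a). frag_extend (\<lambda>(y, b). frag_of (x \<otimes>\<^bsub>A\<^esub> y, a * b)) P') P"

lemma M_zero_mult: "y \<in> carrier M \<Longrightarrow> \<zero>\<^bsub>M\<^esub> \<otimes>\<^bsub>M\<^esub> y = \<zero>\<^bsub>M\<^esub>"
  "y \<in> carrier M \<Longrightarrow> y \<otimes>\<^bsub>M\<^esub> \<zero>\<^bsub>M\<^esub> = \<zero>\<^bsub>M\<^esub>"
  using M_distl[of "\<zero>\<^bsub>M\<^esub>" "\<zero>\<^bsub>M\<^esub>" y] M_distr[of "\<zero>\<^bsub>M\<^esub>" "\<zero>\<^bsub>M\<^esub>" y] M_mult M.add.r_cancel_one by fastforce+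

lemma M_mult_minus:
  assumes "x \<in> carrier M" "y \<in> carrier M" "z \<in> carrier M"
  shows "(x \<ominus>\<^bsub>M\<^esub> y) \<otimes>\<^bsub>M\<^esub> z = x \<otimes>\<^bsub>M\<^esub> z \<ominus>\<^bsub>M\<^esub> y \<otimes>\<^bsub>M\<^esub> z"
    "z \<otimes>\<^bsub>M\<^esub> (x \<ominus>\<^bsub>M\<^esub> y) = z \<otimes>\<^bsub>M\<^esub> x \<ominus>\<^bsub>M\<^esub> z \<otimes>\<^bsub>M\<^esub> y"
    "c \<odot>\<^bsub>M\<^esub> (x \<ominus>\<^bsub>M\<^esub> y) = c \<odot>\<^bsub>M\<^esub> x \<ominus>\<^bsub>M\<^esub> c \<odot>\<^bsub>M\<^esub> y"
proof -
  have c: "x \<ominus>\<^bsub>M\<^esub> y \<in> carrier M" using assms by simp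
  have x: "x = (x \<ominus>\<^bsub>M\<^esub> y) \<oplus>\<^bsub>M\<^esub> y" using assms by (simp add: M.minus_eq M.a_assoc M.l_neg)
  have cancel: "u = v \<ominus>\<^bsub>M\<^esub> w" if "v = u \<oplus>\<^bsub>M\<^esub> w" "u \<in> carrier M" "w \<in> carrier M" for u v w
    using that by (simp add: M.minus_eq M.a_assoc M.r_neg)
  show "(x \<ominus>\<^bsub>M\<^esub> y) \<otimes>\<^bsub>M\<^esub> z = x \<otimes>\<^bsub>M\<^esub> z \<ominus>\<^bsub>M\<^esub> y \<otimes>\<^bsub>M\<^esub> z"
    using M_distl[OF c assms(2,3)] x M_mult c assms by (intro cancel) simp_all
  show "z \<otimes>\<^bsub>M\<^esub> (x \<ominus>\<^bsub>M\<^esub> y) = z \<otimes>\<^bsub>M\<^esub> x \<ominus>\<^bsub>M\<^esub> z \<otimes>\<^bsub>M\<^esub> y"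
    using M_distr[OF c assms(2,3)] x M_mult c assms by (intro cancel) simp_all
  show "c \<odot>\<^bsub>M\<^esub> (x \<ominus>\<^bsub>M\<^esub> y) = c \<odot>\<^bsub>M\<^esub> x \<ominus>\<^bsub>M\<^esub> c \<odot>\<^bsub>M\<^esub> y"
    using M_add_smult[OF c assms(2), of c] x M_smult c assms by (intro cancel) simp_all
qed

lemma tprod_inner:
  fixes a :: 'r
  assumes x: "x \<in> carrier A" and P: "P \<in> carrier FA"
  defines "q \<equiv> frag_extend (\<lambda>(y, d). frag_of (x \<otimes>\<^bsub>A\<^esub> y, a * d))"
  shows "q P \<in> carrier FA \<and> ev (q P) = (a \<odot>\<^bsub>M\<^esub> g x) \<otimes>\<^bsub>M\<^esub> ev P"
proof -
  have "Poly_Mapping.keys P \<subseteq> carrier A \<times> UNIV" using P by (simp add: FA_carrier)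
  then show ?thesis
  proof (rule free_Abelian_group_induct)
    show "q 0 \<in> carrier FA \<and> ev (q 0) = (a \<odot>\<^bsub>M\<^esub> g x) \<otimes>\<^bsub>M\<^esub> ev 0"
      using x by (simp add: q_def FA_zero ev_zero M_zero_mult M_smult g_closed)
  next
    fix P P' :: "('a \<times> 'r) \<Rightarrow>\<^sub>0 int"
    assume "Poly_Mapping.keys P \<subseteq> carrier A \<times> UNIV" "Poly_Mapping.keys P' \<subseteq> carrier A \<times> UNIV"
      "q P \<in> carrier FA \<and> ev (q P) = (a \<odot>\<^bsub>M\<^esub> g x) \<otimes>\<^bsub>M\<^esub> ev P"
      "q P' \<in> carrier FA \<and> ev (q P') = (a \<odot>\<^bsub>M\<^esub> g x) \<otimes>\<^bsub>M\<^esub> ev P'"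
    then show "q (P - P') \<in> carrier FA \<and> ev (q (P - P')) = (a \<odot>\<^bsub>M\<^esub> g x) \<otimes>\<^bsub>M\<^esub> ev (P - P')"
      using x by (simp add: q_def frag_extend_diff FA_diff ev_diff FA_carrier[symmetric] M_mult_minus M_smult g_closed ev(1))
  next
    fix yd :: "'a \<times> 'r" assume "yd \<in> carrier A \<times> UNIV"
    then obtain y d where yd: "yd = (y, d)" "y \<in> carrier A" by (cases yd) auto
    then show "q (frag_of yd) \<in> carrier FA \<and> ev (q (frag_of yd)) = (a \<odot>\<^bsub>M\<^esub> g x) \<otimes>\<^bsub>M\<^esub> ev (frag_of yd)"
      using x by (simp add: q_def FA_frag A_mult ev(3) g_mult M_smult_mult g_closed)
  qed
qed

lemma tprod:
  assumes P: "P \<in> carrier FA" and P': "P' \<in> carrier FA"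
  shows "tprod P P' \<in> carrier FA \<and> ev (tprod P P') = ev P \<otimes>\<^bsub>M\<^esub> ev P'"
proof -
  have "Poly_Mapping.keys P \<subseteq> carrier A \<times> UNIV" using P by (simp add: FA_carrier)
  then show ?thesis
  proof (rule free_Abelian_group_induct)
    show "tprod 0 P' \<in> carrier FA \<and> ev (tprod 0 P') = ev 0 \<otimes>\<^bsub>M\<^esub> ev P'"
      using P' by (simp add: tprod_def FA_zero ev_zero M_zero_mult ev(1))
  next
    fix P1 P2 :: "('a \<times> 'r) \<Rightarrow>\<^sub>0 int"
    assume "Poly_Mapping.keys P1 \<subseteq> carrier A \<times> UNIV" "Poly_Mapping.keys P2 \<subseteq> carrier A \<times> UNIV"
      "tprod P1 P' \<in> carrier FA \<and> ev (tprod P1 P') = ev P1 \<otimes>\<^bsub>M\<^esub> ev P'"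
      "tprod P2 P' \<in> carrier FA \<and> ev (tprod P2 P') = ev P2 \<otimes>\<^bsub>M\<^esub> ev P'"
    then show "tprod (P1 - P2) P' \<in> carrier FA \<and> ev (tprod (P1 - P2) P') = ev (P1 - P2) \<otimes>\<^bsub>M\<^esub> ev P'"
      using P' by (simp add: tprod_def frag_extend_diff FA_diff ev_diff FA_carrier[symmetric] M_mult_minus ev(1))
  next
    fix xa :: "'a \<times> 'r" assume "xa \<in> carrier A \<times> UNIV"
    then obtain x a where xa: "xa = (x, a)" "x \<in> carrier A" by (cases xa) auto
    show "tprod (frag_of xa) P' \<in> carrier FA \<and> ev (tprod (frag_of xa) P') = ev (frag_of xa) \<otimes>\<^bsub>M\<^esub> ev P'"
      using tprod_inner[OF xa(2) P', of a] by (simp add: tprod_def xa ev(3))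
  qed
qed

text \<open>Collapses the unions over representatives in \<open>base_change\<close> once the
  resulting class is known not to depend on the representatives.\<close>

lemma UN_const_class:
  assumes "X \<noteq> {}" "\<And>P. P \<in> X \<Longrightarrow> F P = Z" shows "(\<Union>P\<in>X. F P) = Z"
  using assms by auto

lemma BC_mult:
  assumes y: "y \<in> carrier M" "y' \<in> carrier M" shows "fib y \<otimes>\<^bsub>BC\<^esub> fib y' = fib (y \<otimes>\<^bsub>M\<^esub> y')"
proof -
  have "fib y \<otimes>\<^bsub>BC\<^esub> fib y' = (\<Union>P\<in>fib y. \<Union>P'\<in>fib y'. tensor_class f A (tprod P P'))"
    by (simp add: base_change_def tprod_def)
  also have "\<dots> = fib (y \<otimes>\<^bsub>M\<^esub> y')"
  proof (intro UN_const_class fib_nonempty y)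
    fix P P' assume "P \<in> fib y" "P' \<in> fib y'"
    then have "P \<in> carrier FA" "P' \<in> carrier FA" "ev P = y" "ev P' = y'" by (simp_all add: fib_def)
    then show "tensor_class f A (tprod P P') = fib (y \<otimes>\<^bsub>M\<^esub> y')"
      using tprod[of P P'] class_eq[of "tprod P P'"] by simp
  qed
  finally show ?thesis .
qed

lemma BC_smult:
  assumes y: "y \<in> carrier M" shows "c \<odot>\<^bsub>BC\<^esub> fib y = fib (c \<odot>\<^bsub>M\<^esub> y)"
proof -
  define s :: "(('a \<times> 'r) \<Rightarrow>\<^sub>0 int) \<Rightarrow> ('a \<times> 'r) \<Rightarrow>\<^sub>0 int" where "s = frag_extend (\<lambda>(x, a). frag_of (x, c * a))"
  have s: "s P \<in> carrier FA \<and> ev (s P) = c \<odot>\<^bsub>M\<^esub> ev P" if P: "P \<in> carrier FA" for P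
  proof -
    have "Poly_Mapping.keys P \<subseteq> carrier A \<times> UNIV" using P by (simp add: FA_carrier)
    then show ?thesis
    proof (rule free_Abelian_group_induct)
      have "c \<odot>\<^bsub>M\<^esub> \<zero>\<^bsub>M\<^esub> = \<zero>\<^bsub>M\<^esub>"
        using M_mult_minus(3)[of "\<zero>\<^bsub>M\<^esub>" "\<zero>\<^bsub>M\<^esub>" "\<zero>\<^bsub>M\<^esub>" c] M_smult[of "\<zero>\<^bsub>M\<^esub>" c] by (simp add: M.minus_eq M.r_neg)
      then show "s 0 \<in> carrier FA \<and> ev (s 0) = c \<odot>\<^bsub>M\<^esub> ev 0" by (simp add: s_def FA_zero ev_zero)
    next
      fix P P' :: "('a \<times> 'r) \<Rightarrow>\<^sub>0 int"
      assume "Poly_Mapping.keys P \<subseteq> carrier A \<times> UNIV" "Poly_Mapping.keys P' \<subseteq> carrier A \<times> UNIV"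
        "s P \<in> carrier FA \<and> ev (s P) = c \<odot>\<^bsub>M\<^esub> ev P" "s P' \<in> carrier FA \<and> ev (s P') = c \<odot>\<^bsub>M\<^esub> ev P'"
      then show "s (P - P') \<in> carrier FA \<and> ev (s (P - P')) = c \<odot>\<^bsub>M\<^esub> ev (P - P')"
        by (simp add: s_def frag_extend_diff FA_diff ev_diff FA_carrier[symmetric] M_mult_minus(3)[OF _ _ M.zero_closed] ev(1))
    next
      fix xa :: "'a \<times> 'r" assume "xa \<in> carrier A \<times> UNIV"
      then obtain x a where xa: "xa = (x, a)" "x \<in> carrier A" by (cases xa) auto
      then show "s (frag_of xa) \<in> carrier FA \<and> ev (s (frag_of xa)) = c \<odot>\<^bsub>M\<^esub> ev (frag_of xa)"
        by (simp add: s_def FA_frag ev(3) M_smult_smult g_closed)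
    qed
  qed
  have "c \<odot>\<^bsub>BC\<^esub> fib y = (\<Union>P\<in>fib y. tensor_class f A (s P))"
    by (simp add: base_change_def s_def)
  also have "\<dots> = fib (c \<odot>\<^bsub>M\<^esub> y)"
  proof (intro UN_const_class fib_nonempty y)
    fix P assume "P \<in> fib y"
    then have "P \<in> carrier FA" "ev P = y" by (simp_all add: fib_def)
    then show "tensor_class f A (s P) = fib (c \<odot>\<^bsub>M\<^esub> y)" using s[of P] class_eq[of "s P"] by simp
  qed
  finally show ?thesis .
qed

lemma pure_tensor_eq: "x \<in> carrier A \<Longrightarrow> pure_tensor f A x a = fib (a \<odot>\<^bsub>M\<^esub> g x)"
  by (simp add: pure_tensor_def class_eq FA_frag ev(3))

definition Phi :: "(('a \<times> 'r) \<Rightarrow>\<^sub>0 int) set \<Rightarrow> 'b" where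
  "Phi X = ev (SOME P. P \<in> X)"

lemma Phi_fib: "y \<in> carrier M \<Longrightarrow> Phi (fib y) = y"
  using fib_nonempty[of y] someI_ex[of "\<lambda>P. P \<in> fib y"] by (auto simp: Phi_def fib_def)

lemma Phi_pure: "x \<in> carrier A \<Longrightarrow> Phi (pure_tensor f A x a) = a \<odot>\<^bsub>M\<^esub> g x"
  by (simp add: pure_tensor_eq Phi_fib M_smult g_closed)

lemma algebra_iso_Phi: "algebra_iso BC M Phi"
  unfolding algebra_iso_def ring_iso_def
proof (intro conjI CollectI ballI allI ring_hom_memI)
  show "Phi X \<in> carrier M" if "X \<in> carrier BC" for X using that by (auto simp: BC_carrier Phi_fib)
  have "\<one>\<^bsub>BC\<^esub> = pure_tensor f A \<one>\<^bsub>A\<^esub> 1" by (simp add: base_change_def)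
  then show "Phi \<one>\<^bsub>BC\<^esub> = \<one>\<^bsub>M\<^esub>" using M_one_smult[OF g_closed[OF A_one]] by (simp add: Phi_pure A_one g_one)
  show "bij_betw Phi (carrier BC) (carrier M)"
    by (rule bij_betwI[where g = fib]) (auto simp: BC_carrier Phi_fib)
  fix X c assume "X \<in> carrier BC"
  then obtain y where y: "y \<in> carrier M" "X = fib y" by (auto simp: BC_carrier)
  then show "Phi (c \<odot>\<^bsub>BC\<^esub> X) = c \<odot>\<^bsub>M\<^esub> Phi X" by (simp add: BC_smult Phi_fib M_smult)
  fix Y assume "Y \<in> carrier BC"
  then obtain y' where y': "y' \<in> carrier M" "Y = fib y'" by (auto simp: BC_carrier)
  show "Phi (X \<otimes>\<^bsub>BC\<^esub> Y) = Phi X \<otimes>\<^bsub>M\<^esub> Phi Y" "Phi (X \<oplus>\<^bsub>BC\<^esub> Y) = Phi X \<oplus>\<^bsub>M\<^esub> Phi Y"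
    using y y' by (simp_all add: BC_mult BC_add Phi_fib M_mult)
qed

end

section \<open>Bases indexed by an initial segment, bilinearity and grading\<close>

lemma comm_ring_hom_id: "comm_ring_hom (id :: 'a::comm_ring_1 \<Rightarrow> 'a)"
  by unfold_locales simp_all

text \<open>Needed because \<open>has_rank\<close> asks for a basis indexed by an initial segment of
  the naturals. Uniqueness pulls back along e by extending coefficient functions from J to
  I.\<close>

lemma is_basis_reindex:
  assumes A: "abelian_group A" and smult: "\<And>c x. x \<in> carrier A \<Longrightarrow> c \<odot>\<^bsub>A\<^esub> x \<in> carrier A"
    and b: "is_basis A I b" and e: "bij_betw e J I"
  shows "is_basis A J (b \<circ> e)"
  unfolding is_basis_def
proof (intro conjI ballI)
  interpret abelian_group A by (rule A)
  have I: "finite I" "b \<in> I \<rightarrow> carrier A" using b by (auto simp: is_basis_def)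
  show "finite J" using bij_betw_finite[OF e] I by simp
  show "b \<circ> e \<in> J \<rightarrow> carrier A" using I bij_betwE[OF e] by auto
  have reindex: "(\<Oplus>\<^bsub>A\<^esub>i\<in>I. c i \<odot>\<^bsub>A\<^esub> b i) = (\<Oplus>\<^bsub>A\<^esub>j\<in>J. c (e j) \<odot>\<^bsub>A\<^esub> (b \<circ> e) j)" for c
  proof -
    have "(\<Oplus>\<^bsub>A\<^esub>i\<in>e ` J. c i \<odot>\<^bsub>A\<^esub> b i) = (\<Oplus>\<^bsub>A\<^esub>j\<in>J. c (e j) \<odot>\<^bsub>A\<^esub> b (e j))"
      using bij_betw_imp_inj_on[OF e] bij_betw_imp_surj_on[OF e] I smult by (intro finsum_reindex) auto
    then show ?thesis using bij_betw_imp_surj_on[OF e] by simp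
  qed
  fix x assume x: "x \<in> carrier A"
  have ex: "\<exists>!c. c \<in> extensional I \<and> x = (\<Oplus>\<^bsub>A\<^esub>i\<in>I. c i \<odot>\<^bsub>A\<^esub> b i)"
    using b x unfolding is_basis_def by blast
  then obtain c where c: "c \<in> extensional I" "x = (\<Oplus>\<^bsub>A\<^esub>i\<in>I. c i \<odot>\<^bsub>A\<^esub> b i)" by blast
  have eJ: "(\<Oplus>\<^bsub>A\<^esub>j\<in>J. d j \<odot>\<^bsub>A\<^esub> (b \<circ> e) j) = (\<Oplus>\<^bsub>A\<^esub>j\<in>J. d' j \<odot>\<^bsub>A\<^esub> (b \<circ> e) j)"
    if "\<And>j. j \<in> J \<Longrightarrow> d j = d' j" for d d'
  proof (rule finsum_cong')
    have "b (e j) \<in> carrier A" if "j \<in> J" for j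
      using funcset_mem[OF I(2)] bij_betwE[OF e] that by blast
    then show "(\<lambda>j. d' j \<odot>\<^bsub>A\<^esub> (b \<circ> e) j) \<in> J \<rightarrow> carrier A" by (simp add: smult)
  qed (simp_all add: that)
  show "\<exists>!d. d \<in> extensional J \<and> x = (\<Oplus>\<^bsub>A\<^esub>j\<in>J. d j \<odot>\<^bsub>A\<^esub> (b \<circ> e) j)"
  proof (rule ex1I[of _ "restrict (c \<circ> e) J"])
    show "restrict (c \<circ> e) J \<in> extensional J \<and> x = (\<Oplus>\<^bsub>A\<^esub>j\<in>J. restrict (c \<circ> e) J j \<odot>\<^bsub>A\<^esub> (b \<circ> e) j)"
      using c(2) reindex[of c] eJ[of "restrict (c \<circ> e) J" "\<lambda>j. c (e j)"] by simp
    fix d assume d: "d \<in> extensional J \<and> x = (\<Oplus>\<^bsub>A\<^esub>j\<in>J. d j \<odot>\<^bsub>A\<^esub> (b \<circ> e) j)"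
    define c' where "c' = restrict (d \<circ> inv_into J e) I"
    have c'e: "c' (e j) = d j" if "j \<in> J" for j
      using that bij_betwE[OF e] bij_betw_inv_into_left[OF e] by (simp add: c'_def)
    have "x = (\<Oplus>\<^bsub>A\<^esub>i\<in>I. c' i \<odot>\<^bsub>A\<^esub> b i)"
      using d reindex[of c'] eJ[of "\<lambda>j. c' (e j)" d, OF c'e] by simp
    moreover have "c' \<in> extensional I" by (simp add: c'_def)
    ultimately have "c' = c" using ex c by blast
    then show "d = restrict (c \<circ> e) J"
      using c'e d by (intro extensionalityI[of d J]) auto
  qed
qed

context schur_setup begin

lemma star_scale_right: "t \<in> HC \<Longrightarrow> star p Z (\<lambda>w. c * t w) = (\<lambda>w. c * star p Z t w)"
  unfolding star_def by (rule hm_scale_right)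

lemma S_distl:
  assumes F: "F \<in> SC" and G: "G \<in> SC" and H: "H \<in> SC"
  shows "(F \<oplus>\<^bsub>S\<^esub> G) \<otimes>\<^bsub>S\<^esub> H = F \<otimes>\<^bsub>S\<^esub> H \<oplus>\<^bsub>S\<^esub> G \<otimes>\<^bsub>S\<^esub> H"
proof (rule SC_eqI)
  fix p p'' assume p: "p \<in> B" "p'' \<in> B"
  have "star p' (fam (F \<oplus>\<^bsub>S\<^esub> G) p p') (fam H p' p'') =
      (\<lambda>w. star p' (fam F p p') (fam H p' p'') w + star p' (fam G p p') (fam H p' p'') w)" if p': "p' \<in> B" for p'
    unfolding fam_ops(1)[OF p(1) p' F G]
    by (rule star_add_left[OF p' zmD(2)[OF fam_zm[OF F p(1) p']] zmD(2)[OF fam_zm[OF G p(1) p']] zmD(1)[OF fam_zm[OF H p' p(2)]]])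
  then have "fmult (fam (F \<oplus>\<^bsub>S\<^esub> G)) (fam H) p p'' = (\<lambda>w. fmult (fam F) (fam H) p p'' w + fmult (fam G) (fam H) p p'' w)"
    by (simp add: fmult_def sum.distrib[symmetric] distrib_left)
  then show "fam ((F \<oplus>\<^bsub>S\<^esub> G) \<otimes>\<^bsub>S\<^esub> H) p p'' = fam (F \<otimes>\<^bsub>S\<^esub> H \<oplus>\<^bsub>S\<^esub> G \<otimes>\<^bsub>S\<^esub> H) p p''"
    using p by (simp add: SC_ops fam_ops F G H)
qed (simp_all add: SC_ops F G H)

lemma S_distr:
  assumes F: "F \<in> SC" and G: "G \<in> SC" and H: "H \<in> SC"
  shows "H \<otimes>\<^bsub>S\<^esub> (F \<oplus>\<^bsub>S\<^esub> G) = H \<otimes>\<^bsub>S\<^esub> F \<oplus>\<^bsub>S\<^esub> H \<otimes>\<^bsub>S\<^esub> G"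
proof (rule SC_eqI)
  fix p p'' assume p: "p \<in> B" "p'' \<in> B"
  have "star p' (fam H p p') (fam (F \<oplus>\<^bsub>S\<^esub> G) p' p'') =
      (\<lambda>w. star p' (fam H p p') (fam F p' p'') w + star p' (fam H p p') (fam G p' p'') w)" if p': "p' \<in> B" for p'
    unfolding fam_ops(1)[OF p' p(2) F G]
    by (rule star_add_right[OF zmD(3)[OF fam_zm[OF G p' p(2)]] zmD(3)[OF fam_zm[OF F p' p(2)]]])
  then have "fmult (fam H) (fam (F \<oplus>\<^bsub>S\<^esub> G)) p p'' = (\<lambda>w. fmult (fam H) (fam F) p p'' w + fmult (fam H) (fam G) p p'' w)"
    by (simp add: fmult_def sum.distrib[symmetric] distrib_left)
  then show "fam (H \<otimes>\<^bsub>S\<^esub> (F \<oplus>\<^bsub>S\<^esub> G)) p p'' = fam (H \<otimes>\<^bsub>S\<^esub> F \<oplus>\<^bsub>S\<^esub> H \<otimes>\<^bsub>S\<^esub> G) p p''"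
    using p by (simp add: SC_ops fam_ops F G H)
qed (simp_all add: SC_ops F G H)

lemma S_smult_mult:
  assumes F: "F \<in> SC" and G: "G \<in> SC"
  shows "(c \<odot>\<^bsub>S\<^esub> F) \<otimes>\<^bsub>S\<^esub> (d \<odot>\<^bsub>S\<^esub> G) = (c * d) \<odot>\<^bsub>S\<^esub> (F \<otimes>\<^bsub>S\<^esub> G)"
proof (rule SC_eqI)
  fix p p'' assume p: "p \<in> B" "p'' \<in> B"
  have "star p' (fam (c \<odot>\<^bsub>S\<^esub> F) p p') (fam (d \<odot>\<^bsub>S\<^esub> G) p' p'') =
      (\<lambda>w. (c * d) * star p' (fam F p p') (fam G p' p'') w)" if p': "p' \<in> B" for p'
  proof -
    note Fz = fam_zm[OF F p(1) p'] and Gz = fam_zm[OF G p' p(2)]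
    have "star p' (\<lambda>w. c * fam F p p' w) (\<lambda>w. d * fam G p' p'' w) =
        (\<lambda>w. c * star p' (fam F p p') (\<lambda>w. d * fam G p' p'' w) w)"
      by (rule star_scale_left[OF p' zmD(2)[OF Fz] zmD(1)[OF zm_scale[OF Gz]]])
    also have "star p' (fam F p p') (\<lambda>w. d * fam G p' p'' w) = (\<lambda>w. d * star p' (fam F p p') (fam G p' p'') w)"
      by (rule star_scale_right[OF zmD(3)[OF Gz]])
    finally show ?thesis using p p' by (simp add: fam_ops F G mult.assoc)
  qed
  then have "fmult (fam (c \<odot>\<^bsub>S\<^esub> F)) (fam (d \<odot>\<^bsub>S\<^esub> G)) p p'' = (\<lambda>w. (c * d) * fmult (fam F) (fam G) p p'' w)"
    by (simp add: fmult_def sum_distrib_left mult.left_commute)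
  then show "fam ((c \<odot>\<^bsub>S\<^esub> F) \<otimes>\<^bsub>S\<^esub> (d \<odot>\<^bsub>S\<^esub> G)) p p'' = fam ((c * d) \<odot>\<^bsub>S\<^esub> (F \<otimes>\<^bsub>S\<^esub> G)) p p''"
    using p by (simp add: SC_ops fam_ops F G)
qed (simp_all add: SC_ops F G)

text \<open>Testing the generators is enough, since the value of F on an element of a summand is
  \<open>star\<close> of the corresponding family entry with that element.\<close>

lemma homogeneous_iff:
  "F \<in> schur_homogeneous m n r f i \<longleftrightarrow>
    F \<in> SC \<and> (\<forall>p\<in>B. \<forall>p'\<in>B. hom_degree p p' \<noteq> i \<longrightarrow> fam F p p' = zero_h)"
proof
  assume F: "F \<in> schur_homogeneous m n r f i"
  then have "fam F p p' = zero_h" if "p \<in> B" "p' \<in> B" "hom_degree p p' \<noteq> i" for p p'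
    using that xyf_LL[of m r E "rho p'"] unfolding schur_homogeneous_def fam_def xyH[OF that(2), symmetric] by blast
  then show "F \<in> SC \<and> (\<forall>p\<in>B. \<forall>p'\<in>B. hom_degree p p' \<noteq> i \<longrightarrow> fam F p p' = zero_h)"
    using F by (auto simp: schur_homogeneous_def)
next
  assume F: "F \<in> SC \<and> (\<forall>p\<in>B. \<forall>p'\<in>B. hom_degree p p' \<noteq> i \<longrightarrow> fam F p p' = zero_h)"
  have "F (tinj p' x) p = zero_h" if "p \<in> B" "p' \<in> B" "hom_degree p p' \<noteq> i" "x \<in> xyH r f p'" for p p' x
  proof -
    have x: "x \<in> Lp p'" using that(4) xyH[OF that(2)] by simp
    have "F (tinj p' x) p = star p' zero_h x" using SC_tinj[OF conjunct1[OF F] that(1,2) x] F that by simp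
    then show ?thesis using star_zero_left[OF that(2) x] by simp
  qed
  then show "F \<in> schur_homogeneous m n r f i" using F by (simp add: schur_homogeneous_def)
qed

end

section \<open>Coefficientwise specialization of the generic algebra\<close>

locale schur_base_change = schur_setup
begin

sublocale G: schur_setup m n r "id :: laurent \<Rightarrow> laurent"
  by (rule schur_setup.intro[OF comm_ring_hom_id])

sublocale f: comm_ring_hom f by (rule f)

definition mapf :: "laurent hecke \<Rightarrow> 'a hecke" where
  "mapf h = (\<lambda>w. f (h w))"

lemma f_params: "f (q_of id) = Q" "f (- qinv_of id) = E"
  by (simp_all add: q_of_def qinv_of_def f.hom_uminus)

lemma mapf_carrier: "h \<in> hecke_carrier r \<Longrightarrow> mapf h \<in> HC"
  by (rule hecke_carrierI) (simp add: mapf_def hecke_carrierD)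

lemma mapf_LL: assumes "h \<in> G.Lp p" shows "mapf h \<in> Lp p"
proof (rule LL_I[OF mapf_carrier[OF LL_carrier[OF assms]]])
  fix i w assume i: "1 \<le> i" "i < r" "rho p i = rho p (Suc i)" "w \<in> symgrp r" "pinv w i < pinv w (Suc i)"
  show "mapf h (sr i \<circ> w) = (if rho p i < m then 1 else E) * mapf h w"
    unfolding mapf_def LLD[OF assms i] f.hom_mult f_params(2)[symmetric] by simp
qed

lemma mapf_RR: assumes "h \<in> G.Rp p" shows "mapf h \<in> Rp p"
proof (rule RR_I[OF mapf_carrier[OF RR_carrier[OF assms]]])
  fix i w assume i: "1 \<le> i" "i < r" "rho p i = rho p (Suc i)" "w \<in> symgrp r" "w i < w (Suc i)"
  show "mapf h (w \<circ> sr i) = (if rho p i < m then 1 else E) * mapf h w"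
    unfolding mapf_def RRD[OF assms i] f.hom_mult f_params(2)[symmetric] by simp
qed

lemma mapf_zfun: "mapf (zfun m r (- qinv_of id) \<rho> \<kappa> D) = zfun m r E \<rho> \<kappa> D"
  unfolding mapf_def zfun_def f_params(2)[symmetric] by (auto simp: f.hom_power)

lemma mapf_X: "mapf (G.X p) = X p"
  unfolding xyf_def by (rule mapf_zfun)

lemma mapf_zm: "Z \<in> G.zm p p' \<Longrightarrow> mapf Z \<in> zm p p'"
  by (simp add: zm_def G.zm_def mapf_LL mapf_RR)

lemma mapf_hm: "b \<in> hecke_carrier r \<Longrightarrow> mapf (hm r (q_of id) a b) = hm r Q (mapf a) (mapf b)"
  unfolding mapf_def using hm_ring_hom[OF f, of b r "q_of id" a] by (simp add: f_params)

text \<open>Write Z = a x over the Laurent polynomials. Then f(Z) = f(a) x, and \<open>star\<close>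
  over the target ring may be computed with the factor f(a), whatever factor its own choice would
  pick.\<close>

lemma mapf_star:
  assumes p': "p' \<in> B" and Z: "Z \<in> G.zm p p'" and Z': "Z' \<in> G.zm p' p''"
  shows "mapf (G.star p' Z Z') = star p' (mapf Z) (mapf Z')"
proof -
  obtain a where a: "a \<in> hecke_carrier r" "Z = hm r (q_of id) a (G.X p')"
    using G.Rp_obtain[OF p' G.zmD(2)[OF Z]] .
  have "mapf (G.star p' Z Z') = hm r Q (mapf a) (mapf Z')"
    unfolding a(2) G.star_eq_left[OF p' a(1) G.zmD(1)[OF Z']] by (rule mapf_hm[OF G.zmD(3)[OF Z']])
  also have "\<dots> = star p' (hm r Q (mapf a) (X p')) (mapf Z')"
    by (rule star_eq_left[OF p' mapf_carrier[OF a(1)] mapf_LL[OF G.zmD(1)[OF Z']], symmetric])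
  also have "hm r Q (mapf a) (X p') = mapf Z" unfolding a(2) mapf_X[symmetric] by (simp add: mapf_hm)
  finally show ?thesis .
qed

text \<open>The f-semilinear map from the generic algebra, defined entrywise on families. An
  endomorphism of the generic tensor space cannot be specialized directly, but the images of its
  generators can.\<close>

definition fstar :: "(laurent tspace \<Rightarrow> laurent tspace) \<Rightarrow> 'a tspace \<Rightarrow> 'a tspace" where
  "fstar F = of_fam (\<lambda>p p'. mapf (G.fam F p p'))"

lemma fstar_fams: "F \<in> G.SC \<Longrightarrow> (\<lambda>p p'. mapf (G.fam F p p')) \<in> fams"
  by (simp add: fams_def mapf_zm G.fam_zm)

lemma fstar_SC: "F \<in> G.SC \<Longrightarrow> fstar F \<in> SC"
  unfolding fstar_def by (rule of_fam_SC[OF fstar_fams])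

lemma fam_fstar: "F \<in> G.SC \<Longrightarrow> p \<in> B \<Longrightarrow> p' \<in> B \<Longrightarrow> fam (fstar F) p p' = mapf (G.fam F p p')"
  unfolding fstar_def by (subst fam_of_fam) (simp_all add: fstar_fams)

lemma mapf_fmult:
  assumes F: "F \<in> G.SC" and F': "F' \<in> G.SC" and p: "p \<in> B" "p'' \<in> B"
  shows "mapf (G.fmult (G.fam F) (G.fam F') p p'') = fmult (fam (fstar F)) (fam (fstar F')) p p''"
proof
  fix w
  have sg: "f (G.sg p p' p'') = sg p p' p''" for p' by (simp add: G.sg_def sg_def f.hom_power f.hom_uminus)
  have "mapf (G.fmult (G.fam F) (G.fam F') p p'') w =
      (\<Sum>p'\<in>B. sg p p' p'' * mapf (G.star p' (G.fam F p p') (G.fam F' p' p'')) w)"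
    by (simp add: mapf_def G.fmult_def f.hom_sum f.hom_mult sg)
  also have "\<dots> = fmult (fam (fstar F)) (fam (fstar F')) p p'' w"
    unfolding fmult_def
    by (intro sum.cong refl) (simp add: mapf_star[OF _ G.fam_zm[OF F p(1)] G.fam_zm[OF F' _ p(2)]] fam_fstar F F' p)
  finally show "mapf (G.fmult (G.fam F) (G.fam F') p p'') w = fmult (fam (fstar F)) (fam (fstar F')) p p'' w" .
qed

text \<open>The coefficients of T_D are 0 or powers of - q^-1, so they specialize to the
  coefficients of the same element over the target ring.\<close>

lemma fstar_phi: assumes A: "A \<in> matrices m n r" shows "fstar (phi m n r id A) = phi m n r f A"
proof (rule SC_eqI)
  fix p p' assume p: "p \<in> B" "p' \<in> B"
  have "mapf (\<lambda>w. 0) = zero_h" "mapf (zA m n r (- qinv_of id) A) = zA m n r E A"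
    by (simp add: mapf_def) (simp add: zA_def mapf_zfun)
  then show "fam (fstar (phi m n r id A)) p p' = fam (phi m n r f A) p p'"
    using p by (simp add: fam_fstar G.phi_SC A G.fam_phi fam_phi G.phi_fam_def phi_fam_def)
qed (simp_all add: fstar_SC G.phi_SC phi_SC A)

lemma fstar_homogeneous:
  assumes F: "F \<in> schur_homogeneous m n r id i"
  shows "a \<odot>\<^bsub>S\<^esub> fstar F \<in> schur_homogeneous m n r f i"
proof -
  have FS: "F \<in> G.SC" and z: "\<And>p p'. p \<in> B \<Longrightarrow> p' \<in> B \<Longrightarrow> hom_degree p p' \<noteq> i \<Longrightarrow> G.fam F p p' = (\<lambda>w. 0)"
    using F unfolding G.homogeneous_iff by blast+
  have "mapf (\<lambda>w. 0) = zero_h" by (simp add: mapf_def)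
  then show ?thesis unfolding homogeneous_iff
    using FS z by (simp add: SC_ops fstar_SC fam_ops fam_fstar)
qed

text \<open>Bases are needed on both sides: for the generic algebra the regularity condition holds
  by \<open>laurent_regular\<close>, for the target it is the hypothesis; \<open>fstar_phi\<close>
  matches the two bases.\<close>

lemma base_change:
  assumes reg: "m = 0 \<or> n = 0 \<or> r = 1 \<or> (\<forall>a. (1 + Q) * a = 0 \<longrightarrow> a = 0)"
  shows "base_change_setup f (schur_generic m n r) S fstar (matrices m n r) (phi m n r id)"
proof (rule base_change_setup.intro)
  show "abelian_group (schur_generic m n r)" by (rule G.S_abelian_group)
  show "abelian_group S" by (rule S_abelian_group)
  show "is_basis (schur_generic m n r) (matrices m n r) (phi m n r id)"
    by (rule G.is_basis_phi) (use laurent_regular finite_card_matrices in blast)+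
  have b: "is_basis S (matrices m n r) (phi m n r f)"
    by (rule is_basis_phi[OF reg finite_card_matrices(1)])
  interpret abelian_group S by (rule S_abelian_group)
  have "(\<Oplus>\<^bsub>S\<^esub>i\<in>matrices m n r. c i \<odot>\<^bsub>S\<^esub> fstar (phi m n r id i)) = (\<Oplus>\<^bsub>S\<^esub>i\<in>matrices m n r. c i \<odot>\<^bsub>S\<^esub> phi m n r f i)" for c
    by (rule finsum_cong') (simp_all add: fstar_phi SC_ops phi_SC)
  then show "is_basis S (matrices m n r) (\<lambda>i. fstar (phi m n r id i))"
    using b by (simp add: is_basis_def fstar_phi Pi_def)
next
  fix x y :: "laurent tspace \<Rightarrow> laurent tspace" and c
  assume "x \<in> carrier (schur_generic m n r)"
  then have x: "x \<in> G.SC" by simp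
  show "c \<odot>\<^bsub>schur_generic m n r\<^esub> x \<in> carrier (schur_generic m n r)" using G.SC_ops(2)[OF x] by simp
  show "fstar x \<in> carrier S" using fstar_SC[OF x] by simp
  show "fstar (c \<odot>\<^bsub>schur_generic m n r\<^esub> x) = f c \<odot>\<^bsub>S\<^esub> fstar x"
    using x by (intro SC_eqI) (simp_all add: fstar_SC SC_ops G.SC_ops fam_fstar fam_ops G.fam_ops mapf_def f.hom_mult)
  assume "y \<in> carrier (schur_generic m n r)"
  then have y: "y \<in> G.SC" by simp
  show "x \<otimes>\<^bsub>schur_generic m n r\<^esub> y \<in> carrier (schur_generic m n r)" using G.SC_ops(5)[OF x y] by simp
  show "fstar (x \<oplus>\<^bsub>schur_generic m n r\<^esub> y) = fstar x \<oplus>\<^bsub>S\<^esub> fstar y"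
    using x y by (intro SC_eqI) (simp_all add: fstar_SC SC_ops G.SC_ops fam_fstar fam_ops G.fam_ops mapf_def f.hom_add)
  show "fstar (x \<otimes>\<^bsub>schur_generic m n r\<^esub> y) = fstar x \<otimes>\<^bsub>S\<^esub> fstar y"
    using x y by (intro SC_eqI) (simp_all add: fstar_SC SC_ops G.SC_ops fam_fstar fam_ops G.fam_ops mapf_fmult)
next
  show "\<one>\<^bsub>schur_generic m n r\<^esub> \<in> carrier (schur_generic m n r)" using G.SC_ops(4) by simp
  have "mapf (\<lambda>w. 0) = zero_h" by (simp add: mapf_def)
  then show "fstar \<one>\<^bsub>schur_generic m n r\<^esub> = \<one>\<^bsub>S\<^esub>"
    by (intro SC_eqI) (simp_all add: fstar_SC SC_ops G.SC_ops fam_fstar fam_ops G.fam_ops mapf_X)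
next
  fix x y z c d assume "x \<in> carrier S"
  then have x: "x \<in> SC" by simp
  show "c \<odot>\<^bsub>S\<^esub> x \<in> carrier S" using SC_ops(2)[OF x] by simp
  show "(c + d) \<odot>\<^bsub>S\<^esub> x = c \<odot>\<^bsub>S\<^esub> x \<oplus>\<^bsub>S\<^esub> d \<odot>\<^bsub>S\<^esub> x" "c \<odot>\<^bsub>S\<^esub> (d \<odot>\<^bsub>S\<^esub> x) = (c * d) \<odot>\<^bsub>S\<^esub> x" "1 \<odot>\<^bsub>S\<^esub> x = x"
    using x by (intro SC_eqI; simp add: SC_ops fam_ops distrib_right mult.assoc)+
  assume "y \<in> carrier S"
  then have y: "y \<in> SC" by simp
  show "c \<odot>\<^bsub>S\<^esub> (x \<oplus>\<^bsub>S\<^esub> y) = c \<odot>\<^bsub>S\<^esub> x \<oplus>\<^bsub>S\<^esub> c \<odot>\<^bsub>S\<^esub> y"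
    using x y by (intro SC_eqI; simp add: SC_ops fam_ops distrib_left)
  show "x \<otimes>\<^bsub>S\<^esub> y \<in> carrier S" using SC_ops(5)[OF x y] by simp
  show "(c \<odot>\<^bsub>S\<^esub> x) \<otimes>\<^bsub>S\<^esub> (d \<odot>\<^bsub>S\<^esub> y) = (c * d) \<odot>\<^bsub>S\<^esub> (x \<otimes>\<^bsub>S\<^esub> y)" by (rule S_smult_mult[OF x y])
  assume "z \<in> carrier S"
  then have z: "z \<in> SC" by simp
  show "(x \<oplus>\<^bsub>S\<^esub> y) \<otimes>\<^bsub>S\<^esub> z = x \<otimes>\<^bsub>S\<^esub> z \<oplus>\<^bsub>S\<^esub> y \<otimes>\<^bsub>S\<^esub> z" by (rule S_distl[OF x y z])
  show "z \<otimes>\<^bsub>S\<^esub> (x \<oplus>\<^bsub>S\<^esub> y) = z \<otimes>\<^bsub>S\<^esub> x \<oplus>\<^bsub>S\<^esub> z \<otimes>\<^bsub>S\<^esub> y" by (rule S_distr[OF x y z])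
qed

end

theorem theorem5p8:
  fixes f :: "laurent \<Rightarrow> 'r::comm_ring_1" and m n r :: nat
  assumes "comm_ring_hom f"
    and "\<not> (m = 0 \<and> n = 0)"
    and "r \<ge> 1"
  shows
    "(m = 0 \<or> n = 0 \<or> r = 1 \<or> (\<forall>a. (1 + q_of f) * a = 0 \<longrightarrow> a = 0) \<longrightarrow>
        is_basis (schur m n r f) (matrices m n r) (phi m n r f) \<and>
        (\<exists>\<Phi>. algebra_iso (base_change f (schur_generic m n r)) (schur m n r f) \<Phi> \<and>
             (\<forall>i<2. \<forall>F \<in> schur_homogeneous m n r id i. \<forall>a.
                \<Phi> (pure_tensor f (schur_generic m n r) F a) \<in> schur_homogeneous m n r f i)) \<and>
        has_rank (schur m n r f) (card (matrices m n r))) \<and>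
     card (matrices m n r) =
       (\<Sum>k\<le>r. ((m\<^sup>2 + n\<^sup>2 + k - 1) choose k) * ((2 * m * n) choose (r - k))) \<and>
     (\<exists>\<tau>. algebra_anti_involution (schur m n r f) \<tau> \<and>
          (\<forall>A \<in> matrices m n r. \<tau> (phi m n r f A) = phi m n r f (transpose_mat A)))"
proof (intro conjI impI)
  interpret schur_base_change m n r f 
    by (rule schur_base_change.intro[OF schur_setup.intro[OF assms(1)]])
  show "card (matrices m n r) = (\<Sum>k\<le>r. ((m\<^sup>2 + n\<^sup>2 + k - 1) choose k) * ((2 * m * n) choose (r - k)))"
    by (rule finite_card_matrices(2))
  show "\<exists>\<tau>. algebra_anti_involution (schur m n r f) \<tau> \<and>
      (\<forall>A \<in> matrices m n r. \<tau> (phi m n r f A) = phi m n r f (transpose_mat A))"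
    using tau_anti_involution tau_phi by blast
  assume reg: "m = 0 \<or> n = 0 \<or> r = 1 \<or> (\<forall>a. (1 + q_of f) * a = 0 \<longrightarrow> a = 0)"
  show basis: "is_basis (schur m n r f) (matrices m n r) (phi m n r f)"
    by (rule is_basis_phi[OF reg finite_card_matrices(1)])
  obtain e where "bij_betw e {..<card (matrices m n r)} (matrices m n r)"
    using ex_bij_betw_nat_finite[OF finite_card_matrices(1)] by (metis lessThan_atLeast0)
  then show "has_rank (schur m n r f) (card (matrices m n r))"
    unfolding has_rank_def
    using is_basis_reindex[OF S_abelian_group _ basis] SC_ops(2) by (metis S_sel(1))
  interpret BC: base_change_setup f "schur_generic m n r" "schur m n r f" fstar "matrices m n r" "phi m n r id"
    by (rule base_change[OF reg])
  have "BC.Phi (pure_tensor f (schur_generic m n r) F a) \<in> schur_homogeneous m n r f i"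
    if "F \<in> schur_homogeneous m n r id i" for F a i
  proof -
    have "F \<in> carrier (schur_generic m n r)" using that by (simp add: G.homogeneous_iff)
    then show ?thesis using fstar_homogeneous[OF that] by (simp add: BC.Phi_pure)
  qed
  then show "\<exists>\<Phi>. algebra_iso (base_change f (schur_generic m n r)) (schur m n r f) \<Phi> \<and>
      (\<forall>i<2. \<forall>F \<in> schur_homogeneous m n r id i. \<forall>a.
        \<Phi> (pure_tensor f (schur_generic m n r) F a) \<in> schur_homogeneous m n r f i)"
    using BC.algebra_iso_Phi by blast
qed

end
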